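(* Let $P$ be a Hopf algebra over a field $k$ with a bicovariant differential calculus $(\Omega^*P,\mathrm{d})$. Then there is a spectral sequence beginning with $E_2^{n,m}=H^n_c(P;H^m_{dR}(P))$ which converges to $H^s({}^{coP}(\Omega^*P),\mathrm{d})$.
   Context: All vector spaces and tensor products are over the field $k$. A differential calculus on an algebra $A$ is a differential graded algebra $\Omega A=\bigoplus_{n\ge0}\Omega^nA$ with $\Omega^0A=A$, such that every $\omega\in\Omega^1A$ is a finite sum $\sum_ia_i\,\mathrm{d}b_i$. Its cohomology is $H^*_{dR}(A)$. "Bicovariant" is in the sense of Woronowicz. In particular each $\Omega^nP$ has a left $P$-coaction $\bar\lambda:\Omega^nP\to P\otimes\Omega^nP$ (the component in $P\otimes\Omega^nP$ of the extension of $\Delta$ to forms; on 1-forms $p\,\mathrm{d}q\mapsto p_{(1)}q_{(1)}\otimes p_{(2)}\,\mathrm{d}q_{(2)}$). It satisfies $\bar\lambda(p\,\omega)=\Delta(p)\bar\lambda(\omega)$, and $\mathrm{d}$ is a left $P$-comodule map, so $H^m_{dR}(P)$ is a left $P$-comodule with the induced coaction. For a left $P$-comodule $E$ with coaction $\rho_E$, ${}^{coP}E=\{e\in E:\rho_E(e)=1_P\otimes e\}$, so ${}^{coP}(\Omega^*P)$ is the complex of left invariant forms. Hopf cochain cohomology: for a left $P$-comodule $F$, let $D^n=P^{\otimes n+1}\otimes F$ ($n\ge0$) with the tensor product left coaction, and $$\mathrm{d}(p_0\otimes\cdots\otimes p_n\otimes f)=\sum_{i=0}^{n+1}(-1)^i\,p_0\otimes\cdots\otimes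 p_{i-1}\otimes1\otimes p_i\otimes\cdots\otimes p_n\otimes f.$$ Then $\mathrm{d}$ is $P$-covariant with $\mathrm{d}^2=0$, and $H^n_c(P;F)$ is the cohomology of the complex of coinvariants $({}^{coP}D^n,\mathrm{d})$. Spectral sequences: a spectral sequence (of degree $\ge2$) is a collection of bigraded vector spaces $E_r^{n,m}$, $r\ge2$ (zero if $n<0$ or $m<0$), with differentials $D_r:E_r^{n,m}\to E_r^{n+r,m+1-r}$, $D_r\circ D_r=0$, such that $E_{r+1}^{n,m}$ is isomorphic to the cohomology of $(E_r,D_r)$ at $(n,m)$. For fixed $(n,m)$ the $E_r^{n,m}$ stabilise for large $r$ to $E_\infty^{n,m}$. It converges to $H^*$ if $\bigoplus_iE_\infty^{i,s-i}\cong H^s$ for all $s$. *)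

theory Defs
  imports "HOL-Algebra.AbelCoset" "Jordan_Normal_Form.Missing_VectorSpace"
begin

text \<open>
  Vector spaces are \<open>vectorspace k V\<close> for a field \<open>k\<close> and a record \<open>V\<close> of type
  \<open>('k, 'v) module\<close>. Multiplication and unit of such a record are meaningful only when it is
  an algebra; elsewhere they are filled with zeros. A subspace \<open>U\<close> of \<open>V\<close> is regarded as the
  space \<open>V\<lparr>carrier := U\<rparr>\<close>.
\<close>

section \<open>Vector spaces\<close>

definition vs_iso ::
  "('k, 'z) ring_scheme \<Rightarrow> ('k, 'v) module \<Rightarrow> ('k, 'w) module \<Rightarrow> bool" where
  "vs_iso k V W \<longleftrightarrow> (\<exists>f. linear_map k V W f \<and> bij_betw f (carrier V) (carrier W))"

definition quot_module :: "('k, 'v) module \<Rightarrow> 'v set \<Rightarrow> ('k, 'v set) module" where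
  "quot_module V N =
    \<lparr>carrier = a_rcosets\<^bsub>V\<^esub> N, mult = (\<lambda>_ _. N), one = N, zero = N,
     add = set_add V,
     smult = (\<lambda>c C. \<Union>x\<in>C. N +>\<^bsub>V\<^esub> (c \<odot>\<^bsub>V\<^esub> x))\<rparr>"

definition dsum :: "'i set \<Rightarrow> ('i \<Rightarrow> ('k, 'v) module) \<Rightarrow> ('k, 'i \<Rightarrow> 'v) module" where
  "dsum I M =
    \<lparr>carrier = {f \<in> (\<Pi>\<^sub>E i\<in>I. carrier (M i)). finite {i \<in> I. f i \<noteq> \<zero>\<^bsub>M i\<^esub>}},
     mult = (\<lambda>_ _. \<lambda>i\<in>I. \<zero>\<^bsub>M i\<^esub>), one = (\<lambda>i\<in>I. \<zero>\<^bsub>M i\<^esub>), zero = (\<lambda>i\<in>I. \<zero>\<^bsub>M i\<^esub>),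
     add = (\<lambda>f g. \<lambda>i\<in>I. f i \<oplus>\<^bsub>M i\<^esub> g i),
     smult = (\<lambda>c f. \<lambda>i\<in>I. c \<odot>\<^bsub>M i\<^esub> f i)\<rparr>"

definition self_module :: "('k, 'z) ring_scheme \<Rightarrow> ('k, 'k) module" where
  "self_module k =
    \<lparr>carrier = carrier k, mult = mult k, one = \<one>\<^bsub>k\<^esub>, zero = \<zero>\<^bsub>k\<^esub>, add = add k, smult = mult k\<rparr>"

definition free_module :: "('k, 'z) ring_scheme \<Rightarrow> 'i set \<Rightarrow> ('k, 'i \<Rightarrow> 'k) module" where
  "free_module k I = dsum I (\<lambda>_. self_module k)"

definition basis_vec :: "('k, 'z) ring_scheme \<Rightarrow> 'i set \<Rightarrow> 'i \<Rightarrow> 'i \<Rightarrow> 'k" where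
  "basis_vec k I i = (\<lambda>j\<in>I. if j = i then \<one>\<^bsub>k\<^esub> else \<zero>\<^bsub>k\<^esub>)"

definition alt_sign :: "('k, 'z) ring_scheme \<Rightarrow> nat \<Rightarrow> 'k" where
  "alt_sign k n = (\<ominus>\<^bsub>k\<^esub> \<one>\<^bsub>k\<^esub>) [^]\<^bsub>k\<^esub> n"

section \<open>Tensor products\<close>

text \<open>
  \<open>tensor k [U\<^sub>1, \<dots>, U\<^sub>n] V\<close> is \<open>U\<^sub>1 \<otimes> \<dots> \<otimes> U\<^sub>n \<otimes> V\<close>, the free space on tuples modulo the
  multilinearity relations. All factors but the last share one element type; this keeps the
  type of \<open>P\<close>-fold tensor powers independent of the number of factors.
\<close>

definition tensor_keys ::
  "('k, 'u) module list \<Rightarrow> ('k, 'v) module \<Rightarrow> ('u list \<times> 'v) set" where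
  "tensor_keys Us V = {(xs, v). list_all2 (\<lambda>x U. x \<in> carrier U) xs Us \<and> v \<in> carrier V}"

definition tensor_rels ::
  "('k, 'z) ring_scheme \<Rightarrow> ('k, 'u) module list \<Rightarrow> ('k, 'v) module \<Rightarrow>
    ('u list \<times> 'v \<Rightarrow> 'k) set" where
  "tensor_rels k Us V =
    (let K = tensor_keys Us V; Fr = free_module k K; e = basis_vec k K in
      {e (xs[i := x \<oplus>\<^bsub>Us ! i\<^esub> y], v) \<ominus>\<^bsub>Fr\<^esub> (e (xs[i := x], v) \<oplus>\<^bsub>Fr\<^esub> e (xs[i := y], v)) |
         xs v i x y. (xs, v) \<in> K \<and> i < length Us \<and> x \<in> carrier (Us ! i) \<and> y \<in> carrier (Us ! i)}
    \<union> {e (xs[i := c \<odot>\<^bsub>Us ! i\<^esub> x], v) \<ominus>\<^bsub>Fr\<^esub> c \<odot>\<^bsub>Fr\<^esub> e (xs[i := x], v) |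
         xs v i c x. (xs, v) \<in> K \<and> i < length Us \<and> c \<in> carrier k \<and> x \<in> carrier (Us ! i)}
    \<union> {e (xs, v \<oplus>\<^bsub>V\<^esub> w) \<ominus>\<^bsub>Fr\<^esub> (e (xs, v) \<oplus>\<^bsub>Fr\<^esub> e (xs, w)) |
         xs v w. (xs, v) \<in> K \<and> w \<in> carrier V}
    \<union> {e (xs, c \<odot>\<^bsub>V\<^esub> v) \<ominus>\<^bsub>Fr\<^esub> c \<odot>\<^bsub>Fr\<^esub> e (xs, v) |
         xs v c. (xs, v) \<in> K \<and> c \<in> carrier k})"

definition tensor_null ::
  "('k, 'z) ring_scheme \<Rightarrow> ('k, 'u) module list \<Rightarrow> ('k, 'v) module \<Rightarrow>
    ('u list \<times> 'v \<Rightarrow> 'k) set" where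
  "tensor_null k Us V =
    LinearCombinations.module.span k (free_module k (tensor_keys Us V)) (tensor_rels k Us V)"

definition tensor ::
  "('k, 'z) ring_scheme \<Rightarrow> ('k, 'u) module list \<Rightarrow> ('k, 'v) module \<Rightarrow>
    ('k, ('u list \<times> 'v \<Rightarrow> 'k) set) module" where
  "tensor k Us V = quot_module (free_module k (tensor_keys Us V)) (tensor_null k Us V)"

definition pure ::
  "('k, 'z) ring_scheme \<Rightarrow> ('k, 'u) module list \<Rightarrow> ('k, 'v) module \<Rightarrow>
    'u list \<Rightarrow> 'v \<Rightarrow> ('u list \<times> 'v \<Rightarrow> 'k) set" where
  "pure k Us V xs v =
    tensor_null k Us V +>\<^bsub>free_module k (tensor_keys Us V)\<^esub> basis_vec k (tensor_keys Us V) (xs, v)"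

text \<open>
  The linear map \<open>U\<^sub>1 \<otimes> \<dots> \<otimes> U\<^sub>n \<otimes> V \<rightarrow> X\<close> with \<open>x\<^sub>1 \<otimes> \<dots> \<otimes> x\<^sub>n \<otimes> v \<mapsto> \<phi> [x\<^sub>1, \<dots>, x\<^sub>n] v\<close>. The
  result does not depend on the chosen representative when \<open>\<phi>\<close> is multilinear, which is the
  only case in which it is used.
\<close>

definition tensor_lift ::
  "('k, 'z) ring_scheme \<Rightarrow> ('k, 'u) module list \<Rightarrow> ('k, 'v) module \<Rightarrow> ('k, 'x) module \<Rightarrow>
    ('u list \<Rightarrow> 'v \<Rightarrow> 'x) \<Rightarrow> ('u list \<times> 'v \<Rightarrow> 'k) set \<Rightarrow> 'x" where
  "tensor_lift k Us V X \<phi> t =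
    (let u = (SOME u. u \<in> t) in
      \<Oplus>\<^bsub>X\<^esub>\<kappa>\<in>{\<kappa> \<in> tensor_keys Us V. u \<kappa> \<noteq> \<zero>\<^bsub>k\<^esub>}. u \<kappa> \<odot>\<^bsub>X\<^esub> \<phi> (fst \<kappa>) (snd \<kappa>))"

abbreviation tensor2 where "tensor2 k U V \<equiv> tensor k [U] V"

abbreviation pure2 where "pure2 k U V u v \<equiv> pure k [U] V [u] v"

abbreviation lift2 where "lift2 k U V X \<phi> \<equiv> tensor_lift k [U] V X (\<lambda>xs v. \<phi> (hd xs) v)"

definition id_tensor ::
  "('k, 'z) ring_scheme \<Rightarrow> ('k, 'u) module \<Rightarrow> ('k, 'v) module \<Rightarrow> ('k, 'w) module \<Rightarrow>
    ('v \<Rightarrow> 'w) \<Rightarrow> ('u list \<times> 'v \<Rightarrow> 'k) set \<Rightarrow> ('u list \<times> 'w \<Rightarrow> 'k) set" where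
  "id_tensor k U V W f = lift2 k U V (tensor2 k U W) (\<lambda>u v. pure2 k U W u (f v))"

definition tensor_id ::
  "('k, 'z) ring_scheme \<Rightarrow> ('k, 'u) module \<Rightarrow> ('k, 'w) module \<Rightarrow> ('k, 'v) module \<Rightarrow>
    ('u \<Rightarrow> 'w) \<Rightarrow> ('u list \<times> 'v \<Rightarrow> 'k) set \<Rightarrow> ('w list \<times> 'v \<Rightarrow> 'k) set" where
  "tensor_id k U W V f = lift2 k U V (tensor2 k W V) (\<lambda>u v. pure2 k W V (f u) v)"

text \<open>
  For graded algebras with homogeneous components \<open>A n\<close> and \<open>B n\<close>, the product
  \<open>(A n \<otimes> B n) \<times> (A m \<otimes> B m) \<rightarrow> A (n + m) \<otimes> B (n + m)\<close>, \<open>(a \<otimes> b)(a' \<otimes> b') = aa' \<otimes> bb'\<close>.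
  In all uses one of the two families is constantly \<open>P\<close>, sitting in degree zero, so no Koszul
  sign arises.
\<close>

definition tensor_mult ::
  "('k, 'z) ring_scheme \<Rightarrow> (nat \<Rightarrow> ('k, 'u) module) \<Rightarrow> (nat \<Rightarrow> ('k, 'v) module) \<Rightarrow>
    nat \<Rightarrow> nat \<Rightarrow> ('u list \<times> 'v \<Rightarrow> 'k) set \<Rightarrow> ('u list \<times> 'v \<Rightarrow> 'k) set \<Rightarrow>
    ('u list \<times> 'v \<Rightarrow> 'k) set" where
  "tensor_mult k A B n m t t' =
    (let U = A (n + m); V = B (n + m); X = tensor2 k U V in
      lift2 k (A n) (B n) X (\<lambda>a b.
        lift2 k (A m) (B m) X (\<lambda>a' b'. pure2 k U V (a \<otimes>\<^bsub>U\<^esub> a') (b \<otimes>\<^bsub>V\<^esub> b')) t') t)"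

section \<open>Comodules and Hopf algebras\<close>

locale k_algebra =
  fixes k :: "('k, 'z) ring_scheme" and A :: "('k, 'a) module"
  assumes vectorspace: "vectorspace k A"
    and ring: "ring A"
    and smult_assoc_left:
      "\<lbrakk>c \<in> carrier k; x \<in> carrier A; y \<in> carrier A\<rbrakk>
        \<Longrightarrow> (c \<odot>\<^bsub>A\<^esub> x) \<otimes>\<^bsub>A\<^esub> y = c \<odot>\<^bsub>A\<^esub> (x \<otimes>\<^bsub>A\<^esub> y)"
    and smult_assoc_right:
      "\<lbrakk>c \<in> carrier k; x \<in> carrier A; y \<in> carrier A\<rbrakk>
        \<Longrightarrow> x \<otimes>\<^bsub>A\<^esub> (c \<odot>\<^bsub>A\<^esub> y) = c \<odot>\<^bsub>A\<^esub> (x \<otimes>\<^bsub>A\<^esub> y)"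

text \<open>
  Comodules over \<open>(P, \<Delta>, \<epsilon>)\<close>. Coassociativity is stated in the triple tensor products
  \<open>tensor k [P, P] E\<close> and \<open>tensor k [E, P] P\<close>, which makes associators unnecessary.
\<close>

locale left_comodule =
  fixes k :: "('k, 'z) ring_scheme" and P :: "('k, 'p) module"
    and \<Delta> :: "'p \<Rightarrow> ('p list \<times> 'p \<Rightarrow> 'k) set" and \<epsilon> :: "'p \<Rightarrow> 'k"
    and E :: "('k, 'e) module" and \<rho> :: "'e \<Rightarrow> ('p list \<times> 'e \<Rightarrow> 'k) set"
  assumes linear: "linear_map k E (tensor2 k P E) \<rho>"
    and coassoc: "e \<in> carrier E \<Longrightarrow>
      lift2 k P E (tensor k [P, P] E)
        (\<lambda>p f. lift2 k P P (tensor k [P, P] E) (\<lambda>q r. pure k [P, P] E [q, r] f) (\<Delta> p)) (\<rho> e)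
      = lift2 k P E (tensor k [P, P] E)
        (\<lambda>p f. lift2 k P E (tensor k [P, P] E) (\<lambda>q g. pure k [P, P] E [p, q] g) (\<rho> f)) (\<rho> e)"
    and counit: "e \<in> carrier E \<Longrightarrow> lift2 k P E E (\<lambda>p f. \<epsilon> p \<odot>\<^bsub>E\<^esub> f) (\<rho> e) = e"

locale right_comodule =
  fixes k :: "('k, 'z) ring_scheme" and P :: "('k, 'p) module"
    and \<Delta> :: "'p \<Rightarrow> ('p list \<times> 'p \<Rightarrow> 'k) set" and \<epsilon> :: "'p \<Rightarrow> 'k"
    and E :: "('k, 'p) module" and \<rho> :: "'p \<Rightarrow> ('p list \<times> 'p \<Rightarrow> 'k) set"
  assumes linear: "linear_map k E (tensor2 k E P) \<rho>"
    and coassoc: "e \<in> carrier E \<Longrightarrow>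
      lift2 k E P (tensor k [E, P] P)
        (\<lambda>f p. lift2 k E P (tensor k [E, P] P) (\<lambda>g q. pure k [E, P] P [g, q] p) (\<rho> f)) (\<rho> e)
      = lift2 k E P (tensor k [E, P] P)
        (\<lambda>f p. lift2 k P P (tensor k [E, P] P) (\<lambda>q r. pure k [E, P] P [f, q] r) (\<Delta> p)) (\<rho> e)"
    and counit: "e \<in> carrier E \<Longrightarrow> lift2 k E P E (\<lambda>f p. \<epsilon> p \<odot>\<^bsub>E\<^esub> f) (\<rho> e) = e"

text \<open>
  \<open>P\<close> being a left and a right comodule over itself via \<open>\<Delta>\<close> says precisely that \<open>(P, \<Delta>, \<epsilon>)\<close> is
  a coalgebra. The antipode is not assumed to be bijective.
\<close>

locale hopf_algebra =
  fixes k :: "('k, 'z) ring_scheme" and P :: "('k, 'p) module"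
    and \<Delta> :: "'p \<Rightarrow> ('p list \<times> 'p \<Rightarrow> 'k) set" and \<epsilon> :: "'p \<Rightarrow> 'k" and S :: "'p \<Rightarrow> 'p"
  assumes algebra: "k_algebra k P"
    and left: "left_comodule k P \<Delta> \<epsilon> P \<Delta>"
    and right: "right_comodule k P \<Delta> \<epsilon> P \<Delta>"
    and comult_one: "\<Delta> \<one>\<^bsub>P\<^esub> = pure2 k P P \<one>\<^bsub>P\<^esub> \<one>\<^bsub>P\<^esub>"
    and comult_mult: "\<lbrakk>p \<in> carrier P; q \<in> carrier P\<rbrakk> \<Longrightarrow>
      \<Delta> (p \<otimes>\<^bsub>P\<^esub> q) = tensor_mult k (\<lambda>_. P) (\<lambda>_. P) 0 0 (\<Delta> p) (\<Delta> q)"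
    and counit_linear: "linear_map k P (self_module k) \<epsilon>"
    and counit_one: "\<epsilon> \<one>\<^bsub>P\<^esub> = \<one>\<^bsub>k\<^esub>"
    and counit_mult: "\<lbrakk>p \<in> carrier P; q \<in> carrier P\<rbrakk> \<Longrightarrow> \<epsilon> (p \<otimes>\<^bsub>P\<^esub> q) = \<epsilon> p \<otimes>\<^bsub>k\<^esub> \<epsilon> q"
    and antipode_linear: "linear_map k P P S"
    and antipode_left: "p \<in> carrier P \<Longrightarrow>
      lift2 k P P P (\<lambda>q r. S q \<otimes>\<^bsub>P\<^esub> r) (\<Delta> p) = \<epsilon> p \<odot>\<^bsub>P\<^esub> \<one>\<^bsub>P\<^esub>"
    and antipode_right: "p \<in> carrier P \<Longrightarrow>
      lift2 k P P P (\<lambda>q r. q \<otimes>\<^bsub>P\<^esub> S r) (\<Delta> p) = \<epsilon> p \<odot>\<^bsub>P\<^esub> \<one>\<^bsub>P\<^esub>"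

definition coinvariants ::
  "('k, 'z) ring_scheme \<Rightarrow> ('k, 'p) module \<Rightarrow> ('k, 'e) module \<Rightarrow>
    ('e \<Rightarrow> ('p list \<times> 'e \<Rightarrow> 'k) set) \<Rightarrow> ('k, 'e) module" where
  "coinvariants k P E \<rho> = E\<lparr>carrier := {e \<in> carrier E. \<rho> e = pure2 k P E \<one>\<^bsub>P\<^esub> e}\<rparr>"

section \<open>Cohomology of cochain complexes\<close>

definition cocycles ::
  "(nat \<Rightarrow> ('k, 'v) module) \<Rightarrow> (nat \<Rightarrow> 'v \<Rightarrow> 'v) \<Rightarrow> nat \<Rightarrow> ('k, 'v) module" where
  "cocycles X d n = (X n)\<lparr>carrier := {x \<in> carrier (X n). d n x = \<zero>\<^bsub>X (Suc n)\<^esub>}\<rparr>"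

definition coboundaries ::
  "(nat \<Rightarrow> ('k, 'v) module) \<Rightarrow> (nat \<Rightarrow> 'v \<Rightarrow> 'v) \<Rightarrow> nat \<Rightarrow> 'v set" where
  "coboundaries X d n = (case n of 0 \<Rightarrow> {\<zero>\<^bsub>X 0\<^esub>} | Suc m \<Rightarrow> d m ` carrier (X m))"

definition cohomology ::
  "(nat \<Rightarrow> ('k, 'v) module) \<Rightarrow> (nat \<Rightarrow> 'v \<Rightarrow> 'v) \<Rightarrow> nat \<Rightarrow> ('k, 'v set) module" where
  "cohomology X d n = quot_module (cocycles X d n) (coboundaries X d n)"

section \<open>Bicovariant differential calculi\<close>

text \<open>
  \<open>W\<close> is the total differential graded algebra and \<open>\<Omega> n\<close> the subspace of \<open>n\<close>-forms in it.
\<close>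

abbreviation forms :: "('k, 'w) module \<Rightarrow> (nat \<Rightarrow> 'w set) \<Rightarrow> nat \<Rightarrow> ('k, 'w) module" where
  "forms W \<Omega> n \<equiv> W\<lparr>carrier := \<Omega> n\<rparr>"

locale differential_calculus =
  fixes k :: "('k, 'z) ring_scheme" and A :: "('k, 'w) module"
    and W :: "('k, 'w) module" and \<Omega> :: "nat \<Rightarrow> 'w set" and d :: "'w \<Rightarrow> 'w"
  assumes algebra: "k_algebra k W"
    and subspace: "subspace k (\<Omega> n) W"
    and grading: "w \<in> carrier W \<Longrightarrow>
      \<exists>!f. f \<in> (\<Pi> n\<in>UNIV. \<Omega> n) \<and> finite {n. f n \<noteq> \<zero>\<^bsub>W\<^esub>} \<and> w = (\<Oplus>\<^bsub>W\<^esub>n\<in>{n. f n \<noteq> \<zero>\<^bsub>W\<^esub>}. f n)"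
    and one_degree: "\<one>\<^bsub>W\<^esub> \<in> \<Omega> 0"
    and mult_degree: "\<lbrakk>x \<in> \<Omega> n; y \<in> \<Omega> m\<rbrakk> \<Longrightarrow> x \<otimes>\<^bsub>W\<^esub> y \<in> \<Omega> (n + m)"
    and degree_zero: "forms W \<Omega> 0 = A"
    and d_linear: "linear_map k W W d"
    and d_degree: "x \<in> \<Omega> n \<Longrightarrow> d x \<in> \<Omega> (Suc n)"
    and d_d: "x \<in> carrier W \<Longrightarrow> d (d x) = \<zero>\<^bsub>W\<^esub>"
    and leibniz: "\<lbrakk>x \<in> \<Omega> n; y \<in> carrier W\<rbrakk> \<Longrightarrow>
      d (x \<otimes>\<^bsub>W\<^esub> y) = d x \<otimes>\<^bsub>W\<^esub> y \<oplus>\<^bsub>W\<^esub> alt_sign k n \<odot>\<^bsub>W\<^esub> (x \<otimes>\<^bsub>W\<^esub> d y)"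
    and one_forms: "\<omega> \<in> \<Omega> 1 \<Longrightarrow>
      \<exists>(N::nat) a b. a \<in> {..<N} \<rightarrow> carrier A \<and> b \<in> {..<N} \<rightarrow> carrier A \<and>
        \<omega> = (\<Oplus>\<^bsub>W\<^esub>i\<in>{..<N}. a i \<otimes>\<^bsub>W\<^esub> d (b i))"

text \<open>
  Left and right covariance with compatible coactions. The coactions
  \<open>coL n : \<Omega>\<^sup>n \<rightarrow> P \<otimes> \<Omega>\<^sup>n\<close> and \<open>coR n : \<Omega>\<^sup>n \<rightarrow> \<Omega>\<^sup>n \<otimes> P\<close> extend \<open>\<Delta>\<close>, are multiplicative and
  commute with \<open>d\<close>; hence \<open>coL 1 (p dq) = p\<^sub>1 q\<^sub>1 \<otimes> p\<^sub>2 dq\<^sub>2\<close> in Sweedler notation, and both are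
  unique if the calculus is generated by \<open>P\<close> and \<open>dP\<close>. They are data here because only the
  one-forms are required to be so generated. If \<open>\<Delta>\<close> extends to a differential graded algebra map on
  all forms, \<open>coL n\<close> and \<open>coR n\<close> are its components in \<open>P \<otimes> \<Omega>\<^sup>n\<close> and \<open>\<Omega>\<^sup>n \<otimes> P\<close>.
\<close>

locale bicovariant_calculus =
  fixes k :: "('k, 'z) ring_scheme" and P :: "('k, 'w) module"
    and \<Delta> :: "'w \<Rightarrow> ('w list \<times> 'w \<Rightarrow> 'k) set" and \<epsilon> :: "'w \<Rightarrow> 'k"
    and W :: "('k, 'w) module" and \<Omega> :: "nat \<Rightarrow> 'w set" and d :: "'w \<Rightarrow> 'w"
    and coL :: "nat \<Rightarrow> 'w \<Rightarrow> ('w list \<times> 'w \<Rightarrow> 'k) set"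
    and coR :: "nat \<Rightarrow> 'w \<Rightarrow> ('w list \<times> 'w \<Rightarrow> 'k) set"
  assumes calculus: "differential_calculus k P W \<Omega> d"
    and left: "left_comodule k P \<Delta> \<epsilon> (forms W \<Omega> n) (coL n)"
    and right: "right_comodule k P \<Delta> \<epsilon> (forms W \<Omega> n) (coR n)"
    and bicomodule: "\<omega> \<in> \<Omega> n \<Longrightarrow>
      lift2 k P (forms W \<Omega> n) (tensor k [P, forms W \<Omega> n] P)
        (\<lambda>p \<eta>. lift2 k (forms W \<Omega> n) P (tensor k [P, forms W \<Omega> n] P)
          (\<lambda>\<xi> q. pure k [P, forms W \<Omega> n] P [p, \<xi>] q) (coR n \<eta>)) (coL n \<omega>)
      = lift2 k (forms W \<Omega> n) P (tensor k [P, forms W \<Omega> n] P)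
        (\<lambda>\<eta> q. lift2 k P (forms W \<Omega> n) (tensor k [P, forms W \<Omega> n] P)
          (\<lambda>p \<xi>. pure k [P, forms W \<Omega> n] P [p, \<xi>] q) (coL n \<eta>)) (coR n \<omega>)"
    and left_zero: "p \<in> carrier P \<Longrightarrow> coL 0 p = \<Delta> p"
    and right_zero: "p \<in> carrier P \<Longrightarrow> coR 0 p = \<Delta> p"
    and left_mult: "\<lbrakk>\<omega> \<in> \<Omega> n; \<eta> \<in> \<Omega> m\<rbrakk> \<Longrightarrow>
      coL (n + m) (\<omega> \<otimes>\<^bsub>W\<^esub> \<eta>) = tensor_mult k (\<lambda>_. P) (forms W \<Omega>) n m (coL n \<omega>) (coL m \<eta>)"
    and right_mult: "\<lbrakk>\<omega> \<in> \<Omega> n; \<eta> \<in> \<Omega> m\<rbrakk> \<Longrightarrow>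
      coR (n + m) (\<omega> \<otimes>\<^bsub>W\<^esub> \<eta>) = tensor_mult k (forms W \<Omega>) (\<lambda>_. P) n m (coR n \<omega>) (coR m \<eta>)"
    and left_d: "\<omega> \<in> \<Omega> n \<Longrightarrow>
      coL (Suc n) (d \<omega>) = id_tensor k P (forms W \<Omega> n) (forms W \<Omega> (Suc n)) d (coL n \<omega>)"
    and right_d: "\<omega> \<in> \<Omega> n \<Longrightarrow>
      coR (Suc n) (d \<omega>) = tensor_id k (forms W \<Omega> n) (forms W \<Omega> (Suc n)) P d (coR n \<omega>)"

definition de_Rham ::
  "('k, 'w) module \<Rightarrow> (nat \<Rightarrow> 'w set) \<Rightarrow> ('w \<Rightarrow> 'w) \<Rightarrow> nat \<Rightarrow> ('k, 'w set) module" where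
  "de_Rham W \<Omega> d = cohomology (forms W \<Omega>) (\<lambda>_. d)"

text \<open>
  The induced coaction \<open>H\<^sup>m \<rightarrow> P \<otimes> H\<^sup>m\<close> on de Rham cohomology. For a closed form \<open>\<omega>\<close>,
  \<open>coL m \<omega>\<close> lies in the kernel of \<open>id \<otimes> d\<close>, that is, in the image of the injection
  \<open>P \<otimes> Z\<^sup>m \<rightarrow> P \<otimes> \<Omega>\<^sup>m\<close>, where \<open>Z\<^sup>m\<close> is the space of closed forms. Its preimage \<open>u\<close> is mapped to
  \<open>P \<otimes> H\<^sup>m\<close> by the projection \<open>Z\<^sup>m \<rightarrow> H\<^sup>m\<close>.
\<close>

definition de_Rham_coaction ::
  "('k, 'z) ring_scheme \<Rightarrow> ('k, 'w) module \<Rightarrow> ('k, 'w) module \<Rightarrow> (nat \<Rightarrow> 'w set) \<Rightarrow> ('w \<Rightarrow> 'w) \<Rightarrow>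
    (nat \<Rightarrow> 'w \<Rightarrow> ('w list \<times> 'w \<Rightarrow> 'k) set) \<Rightarrow> nat \<Rightarrow> 'w set \<Rightarrow>
    ('w list \<times> 'w set \<Rightarrow> 'k) set" where
  "de_Rham_coaction k P W \<Omega> d coL m c =
    (let Z = cocycles (forms W \<Omega>) (\<lambda>_. d) m; B = coboundaries (forms W \<Omega>) (\<lambda>_. d) m in
      THE t. \<exists>\<omega>\<in>c. \<exists>u\<in>carrier (tensor2 k P Z).
        id_tensor k P Z (forms W \<Omega> m) (\<lambda>z. z) u = coL m \<omega> \<and>
        t = id_tensor k P Z (de_Rham W \<Omega> d m) (\<lambda>z. B +>\<^bsub>Z\<^esub> z) u)"

definition invariant_forms ::
  "('k, 'z) ring_scheme \<Rightarrow> ('k, 'w) module \<Rightarrow> ('k, 'w) module \<Rightarrow> (nat \<Rightarrow> 'w set) \<Rightarrow>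
    (nat \<Rightarrow> 'w \<Rightarrow> ('w list \<times> 'w \<Rightarrow> 'k) set) \<Rightarrow> nat \<Rightarrow> ('k, 'w) module" where
  "invariant_forms k P W \<Omega> coL n = coinvariants k P (forms W \<Omega> n) (coL n)"

section \<open>Hopf cochain cohomology\<close>

abbreviation tensor_power ::
  "('k, 'z) ring_scheme \<Rightarrow> ('k, 'p) module \<Rightarrow> ('k, 'f) module \<Rightarrow> nat \<Rightarrow>
    ('k, ('p list \<times> 'f \<Rightarrow> 'k) set) module" where
  "tensor_power k P F n \<equiv> tensor k (replicate n P) F"

text \<open>
  The tensor product coaction \<open>P\<^sup>\<otimes>\<^sup>n \<otimes> F \<rightarrow> P \<otimes> (P\<^sup>\<otimes>\<^sup>n \<otimes> F)\<close> on pure tensors, by recursion on \<open>n\<close>: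
  if \<open>t = p\<^sub>1 \<otimes> \<dots> \<otimes> p\<^sub>n \<otimes> f\<close> has coaction \<open>\<Sum> c \<otimes> t'\<close>, then that of \<open>p \<otimes> t\<close> is
  \<open>\<Sum> a c \<otimes> (b \<otimes> t')\<close>, where \<open>\<Delta> p = \<Sum> a \<otimes> b\<close>.
\<close>

primrec codiag_pure ::
  "('k, 'z) ring_scheme \<Rightarrow> ('k, 'p) module \<Rightarrow> ('p \<Rightarrow> ('p list \<times> 'p \<Rightarrow> 'k) set) \<Rightarrow>
    ('k, 'f) module \<Rightarrow> ('f \<Rightarrow> ('p list \<times> 'f \<Rightarrow> 'k) set) \<Rightarrow> 'p list \<Rightarrow> 'f \<Rightarrow>
    ('p list \<times> ('p list \<times> 'f \<Rightarrow> 'k) set \<Rightarrow> 'k) set" where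
  "codiag_pure k P \<Delta> F \<rho> [] f =
    id_tensor k P F (tensor k [] F) (\<lambda>g. pure k [] F [] g) (\<rho> f)"
| "codiag_pure k P \<Delta> F \<rho> (p # ps) f =
    (let T = tensor_power k P F (length ps); T' = tensor_power k P F (Suc (length ps));
         X = tensor2 k P T' in
      lift2 k P P X (\<lambda>a b.
        lift2 k P T X (\<lambda>c t.
          pure2 k P T' (a \<otimes>\<^bsub>P\<^esub> c)
            (tensor_lift k (replicate (length ps) P) F T'
              (\<lambda>qs g. pure k (replicate (Suc (length ps)) P) F (b # qs) g) t))
          (codiag_pure k P \<Delta> F \<rho> ps f)) (\<Delta> p))"

definition codiag ::
  "('k, 'z) ring_scheme \<Rightarrow> ('k, 'p) module \<Rightarrow> ('p \<Rightarrow> ('p list \<times> 'p \<Rightarrow> 'k) set) \<Rightarrow>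
    ('k, 'f) module \<Rightarrow> ('f \<Rightarrow> ('p list \<times> 'f \<Rightarrow> 'k) set) \<Rightarrow> nat \<Rightarrow>
    ('p list \<times> 'f \<Rightarrow> 'k) set \<Rightarrow> ('p list \<times> ('p list \<times> 'f \<Rightarrow> 'k) set \<Rightarrow> 'k) set" where
  "codiag k P \<Delta> F \<rho> n =
    tensor_lift k (replicate n P) F (tensor2 k P (tensor_power k P F n)) (codiag_pure k P \<Delta> F \<rho>)"

definition hopf_cochains ::
  "('k, 'z) ring_scheme \<Rightarrow> ('k, 'p) module \<Rightarrow> ('p \<Rightarrow> ('p list \<times> 'p \<Rightarrow> 'k) set) \<Rightarrow>
    ('k, 'f) module \<Rightarrow> ('f \<Rightarrow> ('p list \<times> 'f \<Rightarrow> 'k) set) \<Rightarrow> nat \<Rightarrow>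
    ('k, ('p list \<times> 'f \<Rightarrow> 'k) set) module" where
  "hopf_cochains k P \<Delta> F \<rho> n =
    coinvariants k P (tensor_power k P F (n + 1)) (codiag k P \<Delta> F \<rho> (n + 1))"

definition hopf_d ::
  "('k, 'z) ring_scheme \<Rightarrow> ('k, 'p) module \<Rightarrow> ('k, 'f) module \<Rightarrow> nat \<Rightarrow>
    ('p list \<times> 'f \<Rightarrow> 'k) set \<Rightarrow> ('p list \<times> 'f \<Rightarrow> 'k) set" where
  "hopf_d k P F n =
    (let D' = tensor_power k P F (n + 2) in
      tensor_lift k (replicate (n + 1) P) F D' (\<lambda>ps f.
        \<Oplus>\<^bsub>D'\<^esub>i\<in>{0..n + 1}. alt_sign k i \<odot>\<^bsub>D'\<^esub>
          pure k (replicate (n + 2) P) F (take i ps @ \<one>\<^bsub>P\<^esub> # drop i ps) f))"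

definition hopf_cohomology ::
  "('k, 'z) ring_scheme \<Rightarrow> ('k, 'p) module \<Rightarrow> ('p \<Rightarrow> ('p list \<times> 'p \<Rightarrow> 'k) set) \<Rightarrow>
    ('k, 'f) module \<Rightarrow> ('f \<Rightarrow> ('p list \<times> 'f \<Rightarrow> 'k) set) \<Rightarrow> nat \<Rightarrow>
    ('k, ('p list \<times> 'f \<Rightarrow> 'k) set set) module" where
  "hopf_cohomology k P \<Delta> F \<rho> = cohomology (hopf_cochains k P \<Delta> F \<rho>) (hopf_d k P F)"

section \<open>Spectral sequences\<close>

definition spectral_sequence ::
  "('k, 'z) ring_scheme \<Rightarrow> (nat \<Rightarrow> int \<Rightarrow> int \<Rightarrow> ('k, 'e) module) \<Rightarrow>
    (nat \<Rightarrow> int \<Rightarrow> int \<Rightarrow> 'e \<Rightarrow> 'e) \<Rightarrow> bool" where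
  "spectral_sequence k E D \<longleftrightarrow>
    (\<forall>r\<ge>2. \<forall>n m.
      vectorspace k (E r n m) \<and>
      (n < 0 \<or> m < 0 \<longrightarrow> carrier (E r n m) = {\<zero>\<^bsub>E r n m\<^esub>}) \<and>
      linear_map k (E r n m) (E r (n + int r) (m + 1 - int r)) (D r n m) \<and>
      (\<forall>x\<in>carrier (E r n m). D r (n + int r) (m + 1 - int r) (D r n m x)
         = \<zero>\<^bsub>E r (n + int r + int r) (m + 1 - int r + 1 - int r)\<^esub>) \<and>
      vs_iso k (E (Suc r) n m)
        (quot_module
          ((E r n m)\<lparr>carrier :=
             {x \<in> carrier (E r n m). D r n m x = \<zero>\<^bsub>E r (n + int r) (m + 1 - int r)\<^esub>}\<rparr>)
          (D r (n - int r) (m - 1 + int r) ` carrier (E r (n - int r) (m - 1 + int r)))))"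

definition converges_to ::
  "('k, 'z) ring_scheme \<Rightarrow> (nat \<Rightarrow> int \<Rightarrow> int \<Rightarrow> ('k, 'e) module) \<Rightarrow>
    (nat \<Rightarrow> ('k, 'h) module) \<Rightarrow> bool" where
  "converges_to k E H \<longleftrightarrow>
    (\<exists>Einf :: int \<Rightarrow> int \<Rightarrow> ('k, 'e) module.
      (\<forall>n m. \<exists>R\<ge>2. \<forall>r\<ge>R. vs_iso k (E r n m) (Einf n m)) \<and>
      (\<forall>s. vs_iso k (dsum UNIV (\<lambda>i. Einf i (int s - i))) (H s)))"

end

theory Submission
  imports Defs
begin

text \<open>
  The double complex \<open>C n m = coinv (P\<^sup>\<otimes>\<^sup>n\<^sup>+\<^sup>1 \<otimes> \<Omega>\<^sup>m)\<close>, with the Hopf cochain differential and the de Rham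
  differential, is computed in two ways. Its columns: since \<open>P \<otimes> X\<close> with the diagonal coaction is
  isomorphic to \<open>P \<otimes> X\<close> with the coaction on \<open>P\<close> alone, there is a natural projection onto coinvariants,
  so \<open>X \<mapsto> coinv (P\<^sup>\<otimes>\<^sup>n\<^sup>+\<^sup>1 \<otimes> X)\<close> is exact, the vertical cohomology is \<open>coinv (P\<^sup>\<otimes>\<^sup>n\<^sup>+\<^sup>1 \<otimes> H\<^sup>m)\<close> and the
  second page is \<open>H\<^sub>c\<^sup>n(P; H\<^sup>m)\<close>. Its rows: multiplication of forms by \<open>P\<close> makes \<open>\<Omega>\<^sup>m\<close> a Hopf module,
  which gives a colinear contraction; so the rows resolve the left invariant forms, whose cohomology
  is therefore that of the total complex.
\<close>

section \<open>Vector spaces\<close>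

text \<open>Coinvariants are only left exact in general. The leading factor \<open>P\<close> repairs
  this: cochains of degree n carry n + 1 such factors, so one is always present. The augmentation
  column, the left invariant forms, has none, and its cohomology is the limit. The two contractions
  act at opposite ends: the projection onto coinvariants twists the leading factor by the antipode,
  the row contraction multiplies the last factor into the form. The latter need not commute with
  \<open>d\<close>, so it serves one row at a time and the rows are glued by pushing total cochains
  into column zero. Over a field, kernels and images split linearly; this makes cohomology a
  comodule and lets tensoring with \<open>P\<close> commute with it. Maps that depend on choices,
  such as the differentials of the pages, arise as linear relations shown to be graphs. Bidegrees
  are integers, with zero spaces outside the first quadrant. This absorbs the boundary cases and
  makes the filtration finite in each total degree, whence convergence. The second page is to be
  equal, not merely isomorphic, to Hopf cochain cohomology, so the complex is assembled from the
  very same records.\<close>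

lemma submoduleI:
  assumes "module k V" "U \<subseteq> carrier V" "\<zero>\<^bsub>V\<^esub> \<in> U"
    "\<And>x y. x \<in> U \<Longrightarrow> y \<in> U \<Longrightarrow> x \<oplus>\<^bsub>V\<^esub> y \<in> U"
    "\<And>c x. c \<in> carrier k \<Longrightarrow> x \<in> U \<Longrightarrow> c \<odot>\<^bsub>V\<^esub> x \<in> U"
  shows "submodule k U V"
  using assms by (simp add: submodule_def)

lemma vectorspace_self: "vectorspace k V \<Longrightarrow> module k V"
  by (simp add: vectorspace_def)

lemma subspaceI:
  assumes "vectorspace k V" "U \<subseteq> carrier V" "\<zero>\<^bsub>V\<^esub> \<in> U"
    "\<And>x y. x \<in> U \<Longrightarrow> y \<in> U \<Longrightarrow> x \<oplus>\<^bsub>V\<^esub> y \<in> U"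
    "\<And>c x. c \<in> carrier k \<Longrightarrow> x \<in> U \<Longrightarrow> c \<odot>\<^bsub>V\<^esub> x \<in> U"
  shows "subspace k U V"
  using assms by (auto simp: subspace_def vectorspace_self intro!: submoduleI)

text \<open>
  Unlike \<open>x \<ominus>\<^bsub>V\<^esub> y\<close>, this difference does not mention the carrier of \<open>V\<close>, so it is literally
  the same in \<open>V\<close> and in a subspace \<open>V\<lparr>carrier := U\<rparr>\<close>.
\<close>

definition vdiff :: "('k, 'z) ring_scheme \<Rightarrow> ('k, 'v) module \<Rightarrow> 'v \<Rightarrow> 'v \<Rightarrow> 'v" where
  "vdiff k V x y = x \<oplus>\<^bsub>V\<^esub> (\<ominus>\<^bsub>k\<^esub> \<one>\<^bsub>k\<^esub>) \<odot>\<^bsub>V\<^esub> y"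

lemma vdiff_carrier_update [simp]: "vdiff k (V\<lparr>carrier := U\<rparr>) = vdiff k V"
  by (simp add: vdiff_def fun_eq_iff)

lemma carrier_update_carrier [simp]: "V\<lparr>carrier := carrier V\<rparr> = (V :: ('k, 'v) module)"
  by simp

section \<open>Subspaces and linear maps over a field\<close>

locale ground_field =
  fixes k :: "('k, 'z) ring_scheme"
  assumes is_field: "field k"
begin

abbreviation VS :: "('k, 'v) module \<Rightarrow> bool" where "VS \<equiv> vectorspace k"

abbreviation lin :: "('k, 'v) module \<Rightarrow> ('k, 'w) module \<Rightarrow> ('v \<Rightarrow> 'w) \<Rightarrow> bool" where
  "lin \<equiv> linear_map k"

abbreviation sub :: "'v set \<Rightarrow> ('k, 'v) module \<Rightarrow> bool" where "sub \<equiv> subspace k"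

abbreviation dif :: "('k, 'v) module \<Rightarrow> 'v \<Rightarrow> 'v \<Rightarrow> 'v" where "dif \<equiv> vdiff k"

lemma k_cring: "cring k" and k_ring: "ring k"
  using is_field by (simp_all add: field_def domain_def cring_def)

lemma k_closed [simp, intro]:
  "\<zero>\<^bsub>k\<^esub> \<in> carrier k" "\<one>\<^bsub>k\<^esub> \<in> carrier k" "a \<in> carrier k \<Longrightarrow> \<ominus>\<^bsub>k\<^esub> a \<in> carrier k"
  "a \<in> carrier k \<Longrightarrow> b \<in> carrier k \<Longrightarrow> a \<oplus>\<^bsub>k\<^esub> b \<in> carrier k"
  "a \<in> carrier k \<Longrightarrow> b \<in> carrier k \<Longrightarrow> a \<otimes>\<^bsub>k\<^esub> b \<in> carrier k"
proof -
  interpret ring k by (rule k_ring)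
  show "\<zero>\<^bsub>k\<^esub> \<in> carrier k" "\<one>\<^bsub>k\<^esub> \<in> carrier k" "a \<in> carrier k \<Longrightarrow> \<ominus>\<^bsub>k\<^esub> a \<in> carrier k"
  "a \<in> carrier k \<Longrightarrow> b \<in> carrier k \<Longrightarrow> a \<oplus>\<^bsub>k\<^esub> b \<in> carrier k"
  "a \<in> carrier k \<Longrightarrow> b \<in> carrier k \<Longrightarrow> a \<otimes>\<^bsub>k\<^esub> b \<in> carrier k" by simp_all
qed

text \<open>Additive inverses enter through the scalar -1 only, in agreement with
  \<open>vdiff\<close>; for the records used here this is a computation, whereas the negative of a
  record is defined by a description that depends on its carrier.\<close>

lemma VS_I:
  assumes "\<zero>\<^bsub>V\<^esub> \<in> carrier V"
    and "\<And>x y. x \<in> carrier V \<Longrightarrow> y \<in> carrier V \<Longrightarrow> x \<oplus>\<^bsub>V\<^esub> y \<in> carrier V"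
    and "\<And>c x. c \<in> carrier k \<Longrightarrow> x \<in> carrier V \<Longrightarrow> c \<odot>\<^bsub>V\<^esub> x \<in> carrier V"
    and "\<And>x y. x \<in> carrier V \<Longrightarrow> y \<in> carrier V \<Longrightarrow> x \<oplus>\<^bsub>V\<^esub> y = y \<oplus>\<^bsub>V\<^esub> x"
    and "\<And>x y z. x \<in> carrier V \<Longrightarrow> y \<in> carrier V \<Longrightarrow> z \<in> carrier V \<Longrightarrow>
      (x \<oplus>\<^bsub>V\<^esub> y) \<oplus>\<^bsub>V\<^esub> z = x \<oplus>\<^bsub>V\<^esub> (y \<oplus>\<^bsub>V\<^esub> z)"
    and "\<And>x. x \<in> carrier V \<Longrightarrow> \<zero>\<^bsub>V\<^esub> \<oplus>\<^bsub>V\<^esub> x = x"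
    and "\<And>x. x \<in> carrier V \<Longrightarrow> (\<ominus>\<^bsub>k\<^esub> \<one>\<^bsub>k\<^esub>) \<odot>\<^bsub>V\<^esub> x \<oplus>\<^bsub>V\<^esub> x = \<zero>\<^bsub>V\<^esub>"
    and "\<And>x. x \<in> carrier V \<Longrightarrow> \<one>\<^bsub>k\<^esub> \<odot>\<^bsub>V\<^esub> x = x"
    and "\<And>a b x. a \<in> carrier k \<Longrightarrow> b \<in> carrier k \<Longrightarrow> x \<in> carrier V \<Longrightarrow>
      (a \<otimes>\<^bsub>k\<^esub> b) \<odot>\<^bsub>V\<^esub> x = a \<odot>\<^bsub>V\<^esub> (b \<odot>\<^bsub>V\<^esub> x)"
    and "\<And>a b x. a \<in> carrier k \<Longrightarrow> b \<in> carrier k \<Longrightarrow> x \<in> carrier V \<Longrightarrow>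
      (a \<oplus>\<^bsub>k\<^esub> b) \<odot>\<^bsub>V\<^esub> x = a \<odot>\<^bsub>V\<^esub> x \<oplus>\<^bsub>V\<^esub> b \<odot>\<^bsub>V\<^esub> x"
    and "\<And>a x y. a \<in> carrier k \<Longrightarrow> x \<in> carrier V \<Longrightarrow> y \<in> carrier V \<Longrightarrow>
      a \<odot>\<^bsub>V\<^esub> (x \<oplus>\<^bsub>V\<^esub> y) = a \<odot>\<^bsub>V\<^esub> x \<oplus>\<^bsub>V\<^esub> a \<odot>\<^bsub>V\<^esub> y"
  shows "VS V"
proof -
  have "abelian_group V"
  proof (rule abelian_groupI)
    show "\<exists>y\<in>carrier V. y \<oplus>\<^bsub>V\<^esub> x = \<zero>\<^bsub>V\<^esub>" if "x \<in> carrier V" for x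
      using assms(3)[OF k_closed(3)[OF k_closed(2)]] assms(7) that by blast
  qed (use assms in auto)
  then show ?thesis
    by (auto simp: vectorspace_def is_field intro!: moduleI k_cring assms)
qed

lemma vs_facts:
  assumes "VS V"
  shows vs_zero [simp]: "\<zero>\<^bsub>V\<^esub> \<in> carrier V"
    and vs_add [simp]: "x \<in> carrier V \<Longrightarrow> y \<in> carrier V \<Longrightarrow> x \<oplus>\<^bsub>V\<^esub> y \<in> carrier V"
    and vs_smult [simp]: "c \<in> carrier k \<Longrightarrow> x \<in> carrier V \<Longrightarrow> c \<odot>\<^bsub>V\<^esub> x \<in> carrier V"
    and vs_add_zero [simp]: "x \<in> carrier V \<Longrightarrow> x \<oplus>\<^bsub>V\<^esub> \<zero>\<^bsub>V\<^esub> = x" "x \<in> carrier V \<Longrightarrow> \<zero>\<^bsub>V\<^esub> \<oplus>\<^bsub>V\<^esub> x = x"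
    and vs_smult_zero [simp]: "c \<in> carrier k \<Longrightarrow> c \<odot>\<^bsub>V\<^esub> \<zero>\<^bsub>V\<^esub> = \<zero>\<^bsub>V\<^esub>" "x \<in> carrier V \<Longrightarrow> \<zero>\<^bsub>k\<^esub> \<odot>\<^bsub>V\<^esub> x = \<zero>\<^bsub>V\<^esub>"
    and vs_smult_one [simp]: "x \<in> carrier V \<Longrightarrow> \<one>\<^bsub>k\<^esub> \<odot>\<^bsub>V\<^esub> x = x"
    and vs_comm: "x \<in> carrier V \<Longrightarrow> y \<in> carrier V \<Longrightarrow> x \<oplus>\<^bsub>V\<^esub> y = y \<oplus>\<^bsub>V\<^esub> x"
    and vs_assoc: "x \<in> carrier V \<Longrightarrow> y \<in> carrier V \<Longrightarrow> z \<in> carrier V \<Longrightarrow>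
      (x \<oplus>\<^bsub>V\<^esub> y) \<oplus>\<^bsub>V\<^esub> z = x \<oplus>\<^bsub>V\<^esub> (y \<oplus>\<^bsub>V\<^esub> z)"
    and vs_lcomm: "x \<in> carrier V \<Longrightarrow> y \<in> carrier V \<Longrightarrow> z \<in> carrier V \<Longrightarrow>
      x \<oplus>\<^bsub>V\<^esub> (y \<oplus>\<^bsub>V\<^esub> z) = y \<oplus>\<^bsub>V\<^esub> (x \<oplus>\<^bsub>V\<^esub> z)"
    and vs_smult_add: "c \<in> carrier k \<Longrightarrow> x \<in> carrier V \<Longrightarrow> y \<in> carrier V \<Longrightarrow>
      c \<odot>\<^bsub>V\<^esub> (x \<oplus>\<^bsub>V\<^esub> y) = c \<odot>\<^bsub>V\<^esub> x \<oplus>\<^bsub>V\<^esub> c \<odot>\<^bsub>V\<^esub> y"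
    and vs_add_smult: "c \<in> carrier k \<Longrightarrow> e \<in> carrier k \<Longrightarrow> x \<in> carrier V \<Longrightarrow>
      (c \<oplus>\<^bsub>k\<^esub> e) \<odot>\<^bsub>V\<^esub> x = c \<odot>\<^bsub>V\<^esub> x \<oplus>\<^bsub>V\<^esub> e \<odot>\<^bsub>V\<^esub> x"
    and vs_smult_smult: "c \<in> carrier k \<Longrightarrow> e \<in> carrier k \<Longrightarrow> x \<in> carrier V \<Longrightarrow>
      (c \<otimes>\<^bsub>k\<^esub> e) \<odot>\<^bsub>V\<^esub> x = c \<odot>\<^bsub>V\<^esub> (e \<odot>\<^bsub>V\<^esub> x)"
    and vs_dif [simp]: "x \<in> carrier V \<Longrightarrow> y \<in> carrier V \<Longrightarrow> dif V x y \<in> carrier V"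
    and vs_dif_self [simp]: "x \<in> carrier V \<Longrightarrow> dif V x x = \<zero>\<^bsub>V\<^esub>"
    and vs_dif_zero [simp]: "x \<in> carrier V \<Longrightarrow> dif V x \<zero>\<^bsub>V\<^esub> = x"
    and vs_dif_add [simp]: "x \<in> carrier V \<Longrightarrow> y \<in> carrier V \<Longrightarrow> y \<oplus>\<^bsub>V\<^esub> dif V x y = x"
      "x \<in> carrier V \<Longrightarrow> y \<in> carrier V \<Longrightarrow> dif V x y \<oplus>\<^bsub>V\<^esub> y = x"
    and vs_dif_eq: "x \<in> carrier V \<Longrightarrow> y \<in> carrier V \<Longrightarrow> z \<in> carrier V \<Longrightarrow>
      dif V x y = z \<longleftrightarrow> x = y \<oplus>\<^bsub>V\<^esub> z"
proof -
  interpret V: vectorspace k V by (rule assms)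
  show "\<zero>\<^bsub>V\<^esub> \<in> carrier V"
    and "x \<in> carrier V \<Longrightarrow> y \<in> carrier V \<Longrightarrow> x \<oplus>\<^bsub>V\<^esub> y \<in> carrier V"
    and "c \<in> carrier k \<Longrightarrow> x \<in> carrier V \<Longrightarrow> c \<odot>\<^bsub>V\<^esub> x \<in> carrier V"
    and "x \<in> carrier V \<Longrightarrow> x \<oplus>\<^bsub>V\<^esub> \<zero>\<^bsub>V\<^esub> = x" "x \<in> carrier V \<Longrightarrow> \<zero>\<^bsub>V\<^esub> \<oplus>\<^bsub>V\<^esub> x = x"
    and "c \<in> carrier k \<Longrightarrow> c \<odot>\<^bsub>V\<^esub> \<zero>\<^bsub>V\<^esub> = \<zero>\<^bsub>V\<^esub>" "x \<in> carrier V \<Longrightarrow> \<zero>\<^bsub>k\<^esub> \<odot>\<^bsub>V\<^esub> x = \<zero>\<^bsub>V\<^esub>"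
    and "x \<in> carrier V \<Longrightarrow> \<one>\<^bsub>k\<^esub> \<odot>\<^bsub>V\<^esub> x = x"
    by simp_all
  show "x \<in> carrier V \<Longrightarrow> y \<in> carrier V \<Longrightarrow> x \<oplus>\<^bsub>V\<^esub> y = y \<oplus>\<^bsub>V\<^esub> x"
    and "x \<in> carrier V \<Longrightarrow> y \<in> carrier V \<Longrightarrow> z \<in> carrier V \<Longrightarrow>
      (x \<oplus>\<^bsub>V\<^esub> y) \<oplus>\<^bsub>V\<^esub> z = x \<oplus>\<^bsub>V\<^esub> (y \<oplus>\<^bsub>V\<^esub> z)"
    and "x \<in> carrier V \<Longrightarrow> y \<in> carrier V \<Longrightarrow> z \<in> carrier V \<Longrightarrow>
      x \<oplus>\<^bsub>V\<^esub> (y \<oplus>\<^bsub>V\<^esub> z) = y \<oplus>\<^bsub>V\<^esub> (x \<oplus>\<^bsub>V\<^esub> z)"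
    by (simp_all add: V.a_ac)
  show "c \<in> carrier k \<Longrightarrow> x \<in> carrier V \<Longrightarrow> y \<in> carrier V \<Longrightarrow>
      c \<odot>\<^bsub>V\<^esub> (x \<oplus>\<^bsub>V\<^esub> y) = c \<odot>\<^bsub>V\<^esub> x \<oplus>\<^bsub>V\<^esub> c \<odot>\<^bsub>V\<^esub> y"
    and "c \<in> carrier k \<Longrightarrow> e \<in> carrier k \<Longrightarrow> x \<in> carrier V \<Longrightarrow>
      (c \<oplus>\<^bsub>k\<^esub> e) \<odot>\<^bsub>V\<^esub> x = c \<odot>\<^bsub>V\<^esub> x \<oplus>\<^bsub>V\<^esub> e \<odot>\<^bsub>V\<^esub> x"
    and "c \<in> carrier k \<Longrightarrow> e \<in> carrier k \<Longrightarrow> x \<in> carrier V \<Longrightarrow>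
      (c \<otimes>\<^bsub>k\<^esub> e) \<odot>\<^bsub>V\<^esub> x = c \<odot>\<^bsub>V\<^esub> (e \<odot>\<^bsub>V\<^esub> x)"
    by (simp_all add: V.smult_r_distr V.smult_l_distr V.smult_assoc1)
  have m: "(\<ominus>\<^bsub>k\<^esub> \<one>\<^bsub>k\<^esub>) \<odot>\<^bsub>V\<^esub> x = \<ominus>\<^bsub>V\<^esub> x" if "x \<in> carrier V" for x
    using that by (simp add: V.smult_l_minus)
  have c: "x \<in> carrier V \<Longrightarrow> y \<in> carrier V \<Longrightarrow> z \<in> carrier V \<Longrightarrow>
      x \<oplus>\<^bsub>V\<^esub> y = x \<oplus>\<^bsub>V\<^esub> z \<longleftrightarrow> y = z" for x y z
    by simp
  have d: "dif V x y = x \<oplus>\<^bsub>V\<^esub> \<ominus>\<^bsub>V\<^esub> y" if "y \<in> carrier V" for x y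
    using that by (simp add: vdiff_def m)
  show "x \<in> carrier V \<Longrightarrow> y \<in> carrier V \<Longrightarrow> dif V x y \<in> carrier V"
    and "x \<in> carrier V \<Longrightarrow> dif V x x = \<zero>\<^bsub>V\<^esub>"
    and "x \<in> carrier V \<Longrightarrow> dif V x \<zero>\<^bsub>V\<^esub> = x"
    by (simp_all add: d V.r_neg)
  show 1: "x \<in> carrier V \<Longrightarrow> y \<in> carrier V \<Longrightarrow> dif V x y \<oplus>\<^bsub>V\<^esub> y = x" for x y
    by (simp add: d V.a_assoc V.l_neg)
  show 2: "x \<in> carrier V \<Longrightarrow> y \<in> carrier V \<Longrightarrow> y \<oplus>\<^bsub>V\<^esub> dif V x y = x" for x y
    using 1[of x y] V.a_comm[of y "dif V x y"] by (simp add: d)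
  show "x \<in> carrier V \<Longrightarrow> y \<in> carrier V \<Longrightarrow> z \<in> carrier V \<Longrightarrow>
      dif V x y = z \<longleftrightarrow> x = y \<oplus>\<^bsub>V\<^esub> z"
    using 2[of x y] c[of y "dif V x y" z] by (auto simp: d)
qed

lemmas vs_ac = vs_comm vs_assoc vs_lcomm

lemma sub_VS [simp]: "sub U V \<Longrightarrow> VS (V\<lparr>carrier := U\<rparr>)"
  using vectorspace.subspace_is_vs[of k V U] by (simp add: subspace_def)

lemma sub_facts:
  assumes "sub U V"
  shows sub_V: "VS V"
    and sub_zero: "\<zero>\<^bsub>V\<^esub> \<in> U"
    and sub_add: "x \<in> U \<Longrightarrow> y \<in> U \<Longrightarrow> x \<oplus>\<^bsub>V\<^esub> y \<in> U"
    and sub_smult: "c \<in> carrier k \<Longrightarrow> x \<in> U \<Longrightarrow> c \<odot>\<^bsub>V\<^esub> x \<in> U"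
    and sub_carrier: "x \<in> U \<Longrightarrow> x \<in> carrier V"
    and sub_dif: "x \<in> U \<Longrightarrow> y \<in> U \<Longrightarrow> dif V x y \<in> U"
  using assms by (auto simp: subspace_def submodule_def vdiff_def)

lemma sub_whole: "VS V \<Longrightarrow> sub (carrier V) V"
  by (rule subspaceI) auto

lemma sub_zero_space: "VS V \<Longrightarrow> sub {\<zero>\<^bsub>V\<^esub>} V"
  by (rule subspaceI) auto

lemma sub_Int:
  assumes "sub U V" "sub U' V"
  shows "sub (U \<inter> U') V"
  by (rule subspaceI) (auto simp: sub_facts[OF assms(1)] sub_facts[OF assms(2)])

lemma sub_sub:
  assumes "sub U V" "sub U' V" "U' \<subseteq> U"
  shows "sub U' (V\<lparr>carrier := U\<rparr>)"
  by (rule subspaceI) (use assms(3) in \<open>auto simp: assms(1) sub_facts(2-4)[OF assms(2)]\<close>)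

lemma linI:
  assumes "VS V" "VS W" "\<And>x. x \<in> carrier V \<Longrightarrow> f x \<in> carrier W"
    "\<And>x y. x \<in> carrier V \<Longrightarrow> y \<in> carrier V \<Longrightarrow> f (x \<oplus>\<^bsub>V\<^esub> y) = f x \<oplus>\<^bsub>W\<^esub> f y"
    "\<And>c x. c \<in> carrier k \<Longrightarrow> x \<in> carrier V \<Longrightarrow> f (c \<odot>\<^bsub>V\<^esub> x) = c \<odot>\<^bsub>W\<^esub> f x"
  shows "lin V W f"
  using assms by (auto simp: linear_map_def mod_hom_def mod_hom_axioms_def module_hom_def
      vectorspace_self)

lemma lin_facts:
  assumes "lin V W f"
  shows lin_V: "VS V" and lin_W: "VS W"
    and lin_closed: "x \<in> carrier V \<Longrightarrow> f x \<in> carrier W"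
    and lin_add: "x \<in> carrier V \<Longrightarrow> y \<in> carrier V \<Longrightarrow> f (x \<oplus>\<^bsub>V\<^esub> y) = f x \<oplus>\<^bsub>W\<^esub> f y"
    and lin_smult: "c \<in> carrier k \<Longrightarrow> x \<in> carrier V \<Longrightarrow> f (c \<odot>\<^bsub>V\<^esub> x) = c \<odot>\<^bsub>W\<^esub> f x"
    and lin_zero: "f \<zero>\<^bsub>V\<^esub> = \<zero>\<^bsub>W\<^esub>"
    and lin_dif: "x \<in> carrier V \<Longrightarrow> y \<in> carrier V \<Longrightarrow> f (dif V x y) = dif W (f x) (f y)"
proof -
  interpret linear_map k V W f by (rule assms)
  show "VS V" "VS W" by unfold_locales
  show "x \<in> carrier V \<Longrightarrow> f x \<in> carrier W"
    and "x \<in> carrier V \<Longrightarrow> y \<in> carrier V \<Longrightarrow> f (x \<oplus>\<^bsub>V\<^esub> y) = f x \<oplus>\<^bsub>W\<^esub> f y"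
    and "c \<in> carrier k \<Longrightarrow> x \<in> carrier V \<Longrightarrow> f (c \<odot>\<^bsub>V\<^esub> x) = c \<odot>\<^bsub>W\<^esub> f x"
    and "f \<zero>\<^bsub>V\<^esub> = \<zero>\<^bsub>W\<^esub>"
    by simp_all
  show "x \<in> carrier V \<Longrightarrow> y \<in> carrier V \<Longrightarrow> f (dif V x y) = dif W (f x) (f y)"
    by (simp add: vdiff_def)
qed

lemma lin_id: "VS V \<Longrightarrow> lin V V (\<lambda>x. x)"
  by (rule linI) auto

lemma lin_comp:
  assumes "lin V W f" "lin U V g"
  shows "lin U W (\<lambda>x. f (g x))"
  by (rule linI) (simp_all add: lin_facts[OF assms(1)] lin_facts[OF assms(2)])

lemma lin_const_zero: "VS V \<Longrightarrow> VS W \<Longrightarrow> lin V W (\<lambda>x. \<zero>\<^bsub>W\<^esub>)"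
  by (rule linI) simp_all

lemma lin_addf:
  assumes "lin V W f" "lin V W g"
  shows "lin V W (\<lambda>x. f x \<oplus>\<^bsub>W\<^esub> g x)"
  by (rule linI) (simp_all add: lin_facts[OF assms(1)] lin_facts[OF assms(2)] vs_ac vs_smult_add)

lemma k_mcomm: "a \<in> carrier k \<Longrightarrow> b \<in> carrier k \<Longrightarrow> a \<otimes>\<^bsub>k\<^esub> b = b \<otimes>\<^bsub>k\<^esub> a"
  using k_cring cring.cring_simprules(14) by metis

lemma vs_smult_comm:
  "VS V \<Longrightarrow> a \<in> carrier k \<Longrightarrow> b \<in> carrier k \<Longrightarrow> x \<in> carrier V \<Longrightarrow>
    a \<odot>\<^bsub>V\<^esub> (b \<odot>\<^bsub>V\<^esub> x) = b \<odot>\<^bsub>V\<^esub> (a \<odot>\<^bsub>V\<^esub> x)"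
  by (metis k_mcomm vs_smult_smult)

lemma lin_smultf:
  assumes "c \<in> carrier k" "lin V W f"
  shows "lin V W (\<lambda>x. c \<odot>\<^bsub>W\<^esub> f x)"
  by (rule linI)
    (simp_all add: assms(1) lin_facts[OF assms(2)] vs_smult_add vs_smult_comm[of W c])

lemma lin_diff: "lin V W f \<Longrightarrow> lin V W g \<Longrightarrow> lin V W (\<lambda>x. dif W (f x) (g x))"
  unfolding vdiff_def by (intro lin_addf lin_smultf k_closed)

lemma lin_restrict:
  assumes "lin V W f" "sub U V"
  shows "lin (V\<lparr>carrier := U\<rparr>) W f"
  by (rule linI) (simp_all add: lin_facts[OF assms(1)] sub_facts[OF assms(2)] assms(2))

lemma lin_corestrict:
  assumes "lin V W f" "sub U W" "\<And>x. x \<in> carrier V \<Longrightarrow> f x \<in> U"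
  shows "lin V (W\<lparr>carrier := U\<rparr>) f"
  by (rule linI) (simp_all add: lin_facts[OF assms(1)] assms(2,3))

lemma lin_extend:
  assumes "lin V (W\<lparr>carrier := U\<rparr>) f" "sub U W"
  shows "lin V W f"
proof -
  note l = lin_facts[OF assms(1), simplified]
  show ?thesis by (rule linI) (simp_all add: l sub_facts[OF assms(2)])
qed

lemma lin_cong: "lin V W f \<Longrightarrow> (\<And>x. x \<in> carrier V \<Longrightarrow> f x = g x) \<Longrightarrow> lin V W g"
proof (rule linI)
  assume f: "lin V W f" and g: "\<And>x. x \<in> carrier V \<Longrightarrow> f x = g x"
  note l [simp] = lin_facts[OF f]
  show "VS V" "VS W" by simp_all
  show "g x \<in> carrier W" if "x \<in> carrier V" for x using that l(3)[of x] g[of x] by simp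
  show "g (x \<oplus>\<^bsub>V\<^esub> y) = g x \<oplus>\<^bsub>W\<^esub> g y" if "x \<in> carrier V" "y \<in> carrier V" for x y
    using that l(4)[of x y] g[of "x \<oplus>\<^bsub>V\<^esub> y"] g[of x] g[of y] vs_add[of V x y] by simp
  show "g (c \<odot>\<^bsub>V\<^esub> x) = c \<odot>\<^bsub>W\<^esub> g x" if "c \<in> carrier k" "x \<in> carrier V" for c x
    using that l(5)[of c x] g[of "c \<odot>\<^bsub>V\<^esub> x"] g[of x] vs_smult[of V c x] by simp
qed

text \<open>Every element of \<open>V\<close> is some \<open>\<pi> u\<close>, and the two equations
  hold upstairs. This serves maps out of quotients: lifts from tensor products and the coaction on
  cohomology.\<close>

lemma lin_factor:
  assumes "lin U V \<pi>" "carrier V \<subseteq> \<pi> ` carrier U" "lin U W (\<lambda>x. g (\<pi> x))"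
  shows "lin V W g"
proof (rule linI)
  show "VS V" "VS W" using assms lin_facts by blast+
  note f = lin_facts[OF assms(1)] lin_facts[OF assms(3)]
  fix x assume "x \<in> carrier V"
  then obtain u where u: "u \<in> carrier U" "x = \<pi> u" using assms(2) by auto
  then show "g x \<in> carrier W" by (simp add: f)
  show "g (c \<odot>\<^bsub>V\<^esub> x) = c \<odot>\<^bsub>W\<^esub> g x" if "c \<in> carrier k" for c
    using u(2) lin_smult[OF assms(1) that u(1)] lin_smult[OF assms(3) that u(1)] by simp
  fix y assume "y \<in> carrier V"
  then obtain v where v: "v \<in> carrier U" "y = \<pi> v" using assms(2) by auto
  show "g (x \<oplus>\<^bsub>V\<^esub> y) = g x \<oplus>\<^bsub>W\<^esub> g y"
    using u(2) v(2) lin_add[OF assms(1) u(1) v(1)] lin_add[OF assms(3) u(1) v(1)] by simp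
qed

lemma sub_image: "lin V W f \<Longrightarrow> sub U V \<Longrightarrow> sub (f ` U) W"
proof -
  assume f: "lin V W f" and U: "sub U V"
  note l = lin_facts[OF f] and s = sub_facts[OF U]
  show "sub (f ` U) W"
  proof (rule subspaceI)
    show "\<zero>\<^bsub>W\<^esub> \<in> f ` U" using l(6) s(2) by (metis imageI)
    show "x \<oplus>\<^bsub>W\<^esub> y \<in> f ` U" if xy: "x \<in> f ` U" "y \<in> f ` U" for x y
    proof -
      obtain u v where "u \<in> U" "v \<in> U" "x = f u" "y = f v" using xy by auto
      then show ?thesis using l(4)[of u v] s(3)[of u v] s(5) by (metis imageI)
    qed
    show "c \<odot>\<^bsub>W\<^esub> x \<in> f ` U" if c: "c \<in> carrier k" "x \<in> f ` U" for c x
    proof -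
      obtain u where "u \<in> U" "x = f u" using c by auto
      then show ?thesis using c l(5)[of c u] s(4)[of c u] s(5) by (metis imageI)
    qed
  qed (use l s in auto)
qed

lemma sub_range: "lin V W f \<Longrightarrow> sub (f ` carrier V) W"
  by (meson sub_image sub_whole lin_V)

lemma sub_vimage:
  assumes "lin V W f" "sub U W"
  shows "sub {x \<in> carrier V. f x \<in> U} V"
  by (rule subspaceI) (auto simp: lin_facts[OF assms(1)] sub_facts(2-4)[OF assms(2)])

lemma sub_kernel: "lin V W f \<Longrightarrow> sub {x \<in> carrier V. f x = \<zero>\<^bsub>W\<^esub>} V"
  using sub_vimage[of V W f "{\<zero>\<^bsub>W\<^esub>}"] by (simp add: sub_zero_space lin_W)

section \<open>Linear relations, complements and linear splittings\<close>

text \<open>Two values related to the same x differ by a value related to x - x = 0, hence agree.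
  Diagram chases thereby yield linear maps without fixing the choices made along the way.\<close>

lemma linear_relation:
  assumes V: "VS V" and W: "VS W"
    and total: "\<And>x. x \<in> carrier V \<Longrightarrow> \<exists>y\<in>carrier W. R x y"
    and add: "\<And>x y x' y'. x \<in> carrier V \<Longrightarrow> x' \<in> carrier V \<Longrightarrow> y \<in> carrier W \<Longrightarrow> y' \<in> carrier W \<Longrightarrow>
      R x y \<Longrightarrow> R x' y' \<Longrightarrow> R (x \<oplus>\<^bsub>V\<^esub> x') (y \<oplus>\<^bsub>W\<^esub> y')"
    and smult: "\<And>c x y. c \<in> carrier k \<Longrightarrow> x \<in> carrier V \<Longrightarrow> y \<in> carrier W \<Longrightarrow> R x y \<Longrightarrow>
      R (c \<odot>\<^bsub>V\<^esub> x) (c \<odot>\<^bsub>W\<^esub> y)"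
    and zero: "\<And>y. y \<in> carrier W \<Longrightarrow> R \<zero>\<^bsub>V\<^esub> y \<Longrightarrow> y = \<zero>\<^bsub>W\<^esub>"
  shows "\<exists>f. lin V W f \<and> (\<forall>x\<in>carrier V. \<forall>y\<in>carrier W. R x y \<longleftrightarrow> y = f x)"
proof -
  have uniq: "y = y'" if "x \<in> carrier V" "y \<in> carrier W" "y' \<in> carrier W" "R x y" "R x y'" for x y y'
  proof -
    have "R (dif V x x) (dif W y y')"
      unfolding vdiff_def using that V W by (intro add smult) auto
    then have "dif W y y' = \<zero>\<^bsub>W\<^esub>" using zero that V W by auto
    then show ?thesis using that W by (simp add: vs_dif_eq)
  qed
  obtain f where f: "\<And>x. x \<in> carrier V \<Longrightarrow> f x \<in> carrier W \<and> R x (f x)"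
    using total by metis
  have "lin V W f"
  proof (rule linI)
    fix x y assume xy: "x \<in> carrier V" "y \<in> carrier V"
    show "f (x \<oplus>\<^bsub>V\<^esub> y) = f x \<oplus>\<^bsub>W\<^esub> f y"
      by (rule uniq[of "x \<oplus>\<^bsub>V\<^esub> y"]) (use V W f add xy in auto)
  next
    fix c x assume cx: "c \<in> carrier k" "x \<in> carrier V"
    show "f (c \<odot>\<^bsub>V\<^esub> x) = c \<odot>\<^bsub>W\<^esub> f x"
      by (rule uniq[of "c \<odot>\<^bsub>V\<^esub> x"]) (use V W f smult cx in auto)
  qed (use V W f in auto)
  then show ?thesis using f uniq by blast
qed

text \<open>Zorn's lemma for the subspaces that meet \<open>U\<close> only in zero. A maximal one
  must span \<open>V\<close> together with \<open>U\<close>, for otherwise a missing vector could be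
  adjoined to it.\<close>

lemma complement_exists:
  assumes U: "sub U V"
  shows "\<exists>C. sub C V \<and> U \<inter> C = {\<zero>\<^bsub>V\<^esub>} \<and> (\<forall>v\<in>carrier V. \<exists>u\<in>U. \<exists>c\<in>C. v = u \<oplus>\<^bsub>V\<^esub> c)"
proof -
  have V: "VS V" by (rule sub_V[OF U])
  define S where "S = {C. sub C V \<and> U \<inter> C = {\<zero>\<^bsub>V\<^esub>}}"
  have S0: "{\<zero>\<^bsub>V\<^esub>} \<in> S" by (auto simp: S_def sub_zero_space V sub_zero U)
  have chain: "\<Union>\<C> \<in> S" if \<C>: "\<C> \<in> chains S" "\<C> \<noteq> {}" for \<C>
  proof -
    have cS: "sub C V" "U \<inter> C = {\<zero>\<^bsub>V\<^esub>}" if "C \<in> \<C>" for C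
      using \<C> that by (auto simp: chains_def S_def)
    have "sub (\<Union>\<C>) V"
    proof (rule subspaceI[OF V])
      show "\<Union>\<C> \<subseteq> carrier V" using sub_carrier[OF cS(1)] by auto
      show "\<zero>\<^bsub>V\<^esub> \<in> \<Union>\<C>" using sub_zero[OF cS(1)] \<C>(2) by auto
      show "c \<odot>\<^bsub>V\<^esub> x \<in> \<Union>\<C>" if "c \<in> carrier k" "x \<in> \<Union>\<C>" for c x
        using that sub_smult[OF cS(1)] by auto
      fix x y assume "x \<in> \<Union>\<C>" "y \<in> \<Union>\<C>"
      then obtain A B where A: "A \<in> \<C>" "B \<in> \<C>" "x \<in> A" "y \<in> B" by auto
      then consider "A \<subseteq> B" | "B \<subseteq> A" using \<C> by (auto simp: chains_def chain_subset_def)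
      then show "x \<oplus>\<^bsub>V\<^esub> y \<in> \<Union>\<C>"
        by cases (use A sub_add[OF cS(1)[OF A(1)]] sub_add[OF cS(1)[OF A(2)]] in blast)+
    qed
    moreover have "U \<inter> \<Union>\<C> = {\<zero>\<^bsub>V\<^esub>}" using cS(2) \<C>(2) by blast
    ultimately show ?thesis by (simp add: S_def)
  qed
  have "\<exists>M\<in>S. \<forall>X\<in>S. M \<subseteq> X \<longrightarrow> X = M"
  proof (rule Zorn_Lemma2, intro ballI)
    fix \<C> assume "\<C> \<in> chains S"
    \<comment> \<open>The empty chain is bounded by the zero space, every other chain by its
      union.\<close>
    then show "\<exists>U\<in>S. \<forall>X\<in>\<C>. X \<subseteq> U"
      using chain S0 by (cases "\<C> = {}") blast+
  qed
  then obtain M where M: "sub M V" "U \<inter> M = {\<zero>\<^bsub>V\<^esub>}" and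
    max: "\<And>X. sub X V \<Longrightarrow> U \<inter> X = {\<zero>\<^bsub>V\<^esub>} \<Longrightarrow> M \<subseteq> X \<Longrightarrow> X = M"
    by (auto simp: S_def)
  have "\<exists>u\<in>U. \<exists>c\<in>M. v = u \<oplus>\<^bsub>V\<^esub> c" if v: "v \<in> carrier V" for v
  proof (rule ccontr)
    assume nex: "\<not> ?thesis"
    \<comment> \<open>The span of \<open>M\<close> and v. It is shown to meet \<open>U\<close> only
      in zero, so maximality forces v into \<open>M\<close>.\<close>
    define M' where "M' = {m \<oplus>\<^bsub>V\<^esub> a \<odot>\<^bsub>V\<^esub> v | m a. m \<in> M \<and> a \<in> carrier k}"
    note s [simp] = sub_facts[OF M(1)] sub_facts[OF U] and v [simp]
    have M'I: "m \<oplus>\<^bsub>V\<^esub> a \<odot>\<^bsub>V\<^esub> v \<in> M'" if "m \<in> M" "a \<in> carrier k" for m a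
      using that by (auto simp: M'_def)
    have vM': "v \<in> M'" using M'I[of "\<zero>\<^bsub>V\<^esub>" "\<one>\<^bsub>k\<^esub>"] by simp
    have MM': "m \<in> M'" if "m \<in> M" for m using M'I[of m "\<zero>\<^bsub>k\<^esub>"] that by simp
    have M': "sub M' V"
    proof (rule subspaceI[OF V])
      show "M' \<subseteq> carrier V" by (auto simp: M'_def)
      show "\<zero>\<^bsub>V\<^esub> \<in> M'" by (rule MM') simp
      fix x assume "x \<in> M'"
      then obtain m a where x: "x = m \<oplus>\<^bsub>V\<^esub> a \<odot>\<^bsub>V\<^esub> v" "m \<in> M" "a \<in> carrier k" by (auto simp: M'_def)
      show "c \<odot>\<^bsub>V\<^esub> x \<in> M'" if c: "c \<in> carrier k" for c
        using M'I[of "c \<odot>\<^bsub>V\<^esub> m" "c \<otimes>\<^bsub>k\<^esub> a"] x c by (simp add: vs_smult_add vs_smult_smult)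
      fix y assume "y \<in> M'"
      then obtain n b where y: "y = n \<oplus>\<^bsub>V\<^esub> b \<odot>\<^bsub>V\<^esub> v" "n \<in> M" "b \<in> carrier k" by (auto simp: M'_def)
      show "x \<oplus>\<^bsub>V\<^esub> y \<in> M'"
        using M'I[of "m \<oplus>\<^bsub>V\<^esub> n" "a \<oplus>\<^bsub>k\<^esub> b"] x y by (simp add: vs_add_smult vs_ac)
    qed
    have "x = \<zero>\<^bsub>V\<^esub>" if xU: "x \<in> U" and xM: "x \<in> M'" for x
    proof -
      from xM obtain m a where x: "x = m \<oplus>\<^bsub>V\<^esub> a \<odot>\<^bsub>V\<^esub> v" "m \<in> M" "a \<in> carrier k" by (auto simp: M'_def)
      show ?thesis
      proof (cases "a = \<zero>\<^bsub>k\<^esub>")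
        case True
        then have "x = m" using x v V s by simp
        then show ?thesis using M(2) xU x by auto
      next
        case False
        interpret K: field k by (rule is_field)
        \<comment> \<open>A nonzero coefficient of v could be inverted: v would be the sum of a
          multiple of x in \<open>U\<close> and a multiple of m in \<open>M\<close>, against
          \<open>nex\<close>.\<close>
        define b where "b = inv\<^bsub>k\<^esub> a"
        have b: "b \<in> carrier k" "b \<otimes>\<^bsub>k\<^esub> a = \<one>\<^bsub>k\<^esub>"
          using False x(3) K.field_Units by (auto simp: b_def)
        have xV: "x \<in> carrier V" using xU by simp
        have "dif V x m = a \<odot>\<^bsub>V\<^esub> v" using x xV by (subst vs_dif_eq) simp_all
        then have "b \<odot>\<^bsub>V\<^esub> dif V x m = b \<odot>\<^bsub>V\<^esub> (a \<odot>\<^bsub>V\<^esub> v)"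
          by simp
        also have "b \<odot>\<^bsub>V\<^esub> (a \<odot>\<^bsub>V\<^esub> v) = v"
          using b(2) vs_smult_smult[OF V b(1) x(3) v] by simp
        finally have "b \<odot>\<^bsub>V\<^esub> dif V x m = v" .
        moreover have "b \<odot>\<^bsub>V\<^esub> dif V x m = b \<odot>\<^bsub>V\<^esub> x \<oplus>\<^bsub>V\<^esub> b \<odot>\<^bsub>V\<^esub> ((\<ominus>\<^bsub>k\<^esub> \<one>\<^bsub>k\<^esub>) \<odot>\<^bsub>V\<^esub> m)"
          using b x xV by (simp add: vdiff_def vs_smult_add)
        moreover have "b \<odot>\<^bsub>V\<^esub> x \<in> U" "b \<odot>\<^bsub>V\<^esub> ((\<ominus>\<^bsub>k\<^esub> \<one>\<^bsub>k\<^esub>) \<odot>\<^bsub>V\<^esub> m) \<in> M"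
          using b xU x by simp_all
        ultimately show ?thesis using nex by metis
      qed
    qed
    then have "U \<inter> M' = {\<zero>\<^bsub>V\<^esub>}" using sub_zero[OF M'] sub_zero[OF U] by auto
    then have "M' = M" using max M' MM' by blast
    then have "v \<in> M" using vM' by simp
    moreover have "v = \<zero>\<^bsub>V\<^esub> \<oplus>\<^bsub>V\<^esub> v" by simp
    ultimately show False using nex sub_zero[OF U] by metis
  qed
  then show ?thesis using M by blast
qed

text \<open>With complements \<open>C\<close> of the kernel and \<open>E\<close> of the range,
  \<open>f\<close> maps \<open>C\<close> bijectively onto the range; \<open>g\<close> inverts this
  bijection and vanishes on \<open>E\<close>. It stands in for a section when \<open>f\<close> is
  not surjective.\<close>

lemma generalized_inverse:
  assumes f: "lin V W f"
  shows "\<exists>g. lin W V g \<and> (\<forall>v\<in>carrier V. f (g (f v)) = f v)"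
proof -
  note l [simp] = lin_facts[OF f]
  obtain C where C: "sub C V" "{x \<in> carrier V. f x = \<zero>\<^bsub>W\<^esub>} \<inter> C = {\<zero>\<^bsub>V\<^esub>}"
    "\<forall>v\<in>carrier V. \<exists>u\<in>{x \<in> carrier V. f x = \<zero>\<^bsub>W\<^esub>}. \<exists>c\<in>C. v = u \<oplus>\<^bsub>V\<^esub> c"
    using complement_exists[OF sub_kernel[OF f]] by blast
  obtain E where E: "sub E W" "f ` carrier V \<inter> E = {\<zero>\<^bsub>W\<^esub>}"
    "\<forall>w\<in>carrier W. \<exists>u\<in>f ` carrier V. \<exists>c\<in>E. w = u \<oplus>\<^bsub>W\<^esub> c"
    using complement_exists[OF sub_range[OF f]] by blast
  note s [simp] = sub_facts[OF C(1)] sub_facts[OF E(1)]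
  \<comment> \<open>The graph of \<open>g\<close>: c is the point of \<open>C\<close> over the range
    component of w.\<close>
  define R where "R w c \<longleftrightarrow> c \<in> C \<and> (\<exists>e\<in>E. w = f c \<oplus>\<^bsub>W\<^esub> e)" for w c
  have "\<exists>g. lin W V g \<and> (\<forall>x\<in>carrier W. \<forall>y\<in>carrier V. R x y \<longleftrightarrow> y = g x)"
  proof (rule linear_relation)
    show "VS W" "VS V" by (fact l)+
    show "\<exists>y\<in>carrier V. R w y" if w: "w \<in> carrier W" for w
    proof -
      from E(3) w obtain v e where v: "v \<in> carrier V" "e \<in> E" "w = f v \<oplus>\<^bsub>W\<^esub> e" by auto
      moreover from C(3) v(1) obtain u c where u: "u \<in> carrier V" "f u = \<zero>\<^bsub>W\<^esub>" "c \<in> C" "v = u \<oplus>\<^bsub>V\<^esub> c"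
        by auto
      moreover have "f v = f c" using u by simp
      ultimately show ?thesis by (auto simp: R_def intro!: bexI[of _ c])
    qed
    show "R (x \<oplus>\<^bsub>W\<^esub> x') (y \<oplus>\<^bsub>V\<^esub> y')" if "R x y" "R x' y'" for x x' y y'
    proof -
      from that obtain e e' where e: "e \<in> E" "e' \<in> E" "x = f y \<oplus>\<^bsub>W\<^esub> e" "x' = f y' \<oplus>\<^bsub>W\<^esub> e'" "y \<in> C" "y' \<in> C"
        by (auto simp: R_def)
      then have "x \<oplus>\<^bsub>W\<^esub> x' = f (y \<oplus>\<^bsub>V\<^esub> y') \<oplus>\<^bsub>W\<^esub> (e \<oplus>\<^bsub>W\<^esub> e')" by (simp add: vs_ac)
      then show ?thesis using e by (auto simp: R_def)
    qed
    show "R (c \<odot>\<^bsub>W\<^esub> x) (c \<odot>\<^bsub>V\<^esub> y)" if c: "c \<in> carrier k" and "R x y" for c x y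
    proof -
      from that obtain e where e: "e \<in> E" "x = f y \<oplus>\<^bsub>W\<^esub> e" "y \<in> C" by (auto simp: R_def)
      then have "c \<odot>\<^bsub>W\<^esub> x = f (c \<odot>\<^bsub>V\<^esub> y) \<oplus>\<^bsub>W\<^esub> (c \<odot>\<^bsub>W\<^esub> e)" using c by (simp add: vs_smult_add)
      then show ?thesis using e c by (auto simp: R_def)
    qed
    show "y = \<zero>\<^bsub>V\<^esub>" if "R \<zero>\<^bsub>W\<^esub> y" for y
    proof -
      from that obtain e where e: "e \<in> E" "\<zero>\<^bsub>W\<^esub> = f y \<oplus>\<^bsub>W\<^esub> e" "y \<in> C" by (auto simp: R_def)
      have "f y = dif W \<zero>\<^bsub>W\<^esub> e"
        using e vs_dif_eq[of W "\<zero>\<^bsub>W\<^esub>" e "f y"] vs_comm[of W "f y" e] by simp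
      moreover have "dif W \<zero>\<^bsub>W\<^esub> e \<in> E" using e(1) by simp
      ultimately have "f y \<in> E" by (simp only:)
      moreover have yV: "y \<in> carrier V" using e(3) by simp
      ultimately have "f y \<in> f ` carrier V \<inter> E" by (intro IntI imageI)
      then have "f y = \<zero>\<^bsub>W\<^esub>" unfolding E(2) by simp
      then have "y \<in> {x \<in> carrier V. f x = \<zero>\<^bsub>W\<^esub>} \<inter> C" using e(3) yV by simp
      then show ?thesis unfolding C(2) by simp
    qed
  qed
  then obtain g where g: "lin W V g" "\<And>x y. x \<in> carrier W \<Longrightarrow> y \<in> carrier V \<Longrightarrow> R x y \<longleftrightarrow> y = g x"
    by blast
  have "f (g (f v)) = f v" if v: "v \<in> carrier V" for v
  proof -
    have fv: "f v \<in> carrier W" using v by simp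
    have gc: "g (f v) \<in> carrier V" using lin_closed[OF g(1) fv] .
    have fgc: "f (g (f v)) \<in> carrier W" using gc by simp
    have "R (f v) (g (f v))" using g(2)[OF fv gc] by simp
    then obtain e where e: "e \<in> E" "f v = f (g (f v)) \<oplus>\<^bsub>W\<^esub> e" by (auto simp: R_def)
    have eW: "e \<in> carrier W" by (rule sub_carrier[OF E(1) e(1)])
    have "f (dif V v (g (f v))) = e"
      using e(2) lin_dif[OF f v gc] vs_dif_eq[OF l(2) fv fgc eW] by simp
    moreover have "dif V v (g (f v)) \<in> carrier V" using gc v by simp
    ultimately have "e \<in> f ` carrier V \<inter> E" using e(1) by (metis IntI imageI)
    then have "e = \<zero>\<^bsub>W\<^esub>" using E(2) by simp
    then show ?thesis using e(2) vs_add_zero(1)[OF l(2) fgc] by simp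
  qed
  then show ?thesis using g by blast
qed

lemma linear_section:
  assumes "lin V W f" "carrier W \<subseteq> f ` carrier V"
  obtains g where "lin W V g" "\<And>w. w \<in> carrier W \<Longrightarrow> f (g w) = w"
proof -
  obtain g where g: "lin W V g" "\<forall>v\<in>carrier V. f (g (f v)) = f v"
    using generalized_inverse[OF assms(1)] by blast
  have "f (g w) = w" if "w \<in> carrier W" for w
  proof -
    obtain v where "v \<in> carrier V" "w = f v" using assms(2) \<open>w \<in> carrier W\<close> by blast
    then show ?thesis using g(2) by simp
  qed
  then show ?thesis using g(1) that by blast
qed

section \<open>Quotient spaces\<close>

lemma coset_iff:
  assumes N: "sub N V" and x: "x \<in> carrier V"
  shows "y \<in> N +>\<^bsub>V\<^esub> x \<longleftrightarrow> (\<exists>n\<in>N. y = n \<oplus>\<^bsub>V\<^esub> x)"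
  by (auto simp: a_r_coset_def')

lemma coset_eq_iff:
  assumes N: "sub N V" and x: "x \<in> carrier V" and y: "y \<in> carrier V"
  shows "N +>\<^bsub>V\<^esub> x = N +>\<^bsub>V\<^esub> y \<longleftrightarrow> dif V x y \<in> N"
proof
  note s [simp] = sub_facts[OF N]
  assume "N +>\<^bsub>V\<^esub> x = N +>\<^bsub>V\<^esub> y"
  moreover have "x \<in> N +>\<^bsub>V\<^esub> x" using coset_iff[OF N x, of x] x by (auto intro!: bexI[of _ "\<zero>\<^bsub>V\<^esub>"])
  ultimately obtain n where n: "n \<in> N" "x = n \<oplus>\<^bsub>V\<^esub> y" using coset_iff[OF N y] by auto
  then have "dif V x y = n" using x y by (simp add: vs_dif_eq vs_comm)
  then show "dif V x y \<in> N" using n by simp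
next
  note s [simp] = sub_facts[OF N]
  assume a: "dif V x y \<in> N"
  show "N +>\<^bsub>V\<^esub> x = N +>\<^bsub>V\<^esub> y"
  proof (rule Set.set_eqI)
    fix z
    have "\<exists>n'\<in>N. n \<oplus>\<^bsub>V\<^esub> x = n' \<oplus>\<^bsub>V\<^esub> y" if "n \<in> N" for n
      using that a x y
      by (intro bexI[of _ "n \<oplus>\<^bsub>V\<^esub> dif V x y"]) (auto simp: vs_assoc)
    moreover have "\<exists>n'\<in>N. n \<oplus>\<^bsub>V\<^esub> y = n' \<oplus>\<^bsub>V\<^esub> x" if n: "n \<in> N" for n
    proof (intro bexI[of _ "dif V n (dif V x y)"])
      show "dif V n (dif V x y) \<in> N" using a n by simp
      define d where "d = dif V x y"
      have d: "d \<in> carrier V" "x = d \<oplus>\<^bsub>V\<^esub> y" using x y by (simp_all add: d_def)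
      have "dif V n d \<oplus>\<^bsub>V\<^esub> x = dif V n d \<oplus>\<^bsub>V\<^esub> (d \<oplus>\<^bsub>V\<^esub> y)" using d(2) by simp
      also have "\<dots> = (dif V n d \<oplus>\<^bsub>V\<^esub> d) \<oplus>\<^bsub>V\<^esub> y" using d(1) y n by (subst vs_assoc) simp_all
      also have "\<dots> = n \<oplus>\<^bsub>V\<^esub> y" using d(1) y n by simp
      finally show "n \<oplus>\<^bsub>V\<^esub> y = dif V n (dif V x y) \<oplus>\<^bsub>V\<^esub> x" by (simp add: d_def)
    qed
    ultimately show "z \<in> N +>\<^bsub>V\<^esub> x \<longleftrightarrow> z \<in> N +>\<^bsub>V\<^esub> y"
      by (auto simp: coset_iff[OF N x] coset_iff[OF N y])
  qed
qed

lemma quot_carrier: "carrier (quot_module V N) = (\<lambda>x. N +>\<^bsub>V\<^esub> x) ` carrier V"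
  by (auto simp: quot_module_def A_RCOSETS_def')

lemma quot_zero: "\<zero>\<^bsub>quot_module V N\<^esub> = N"
  by (simp add: quot_module_def)

lemma coset_self: "sub N V \<Longrightarrow> x \<in> carrier V \<Longrightarrow> x \<in> N +>\<^bsub>V\<^esub> x"
  using coset_iff[of N V x x] sub_zero[of N V] sub_V[of N V] by (auto intro!: bexI[of _ "\<zero>\<^bsub>V\<^esub>"])

lemma coset_zero: "sub N V \<Longrightarrow> N +>\<^bsub>V\<^esub> \<zero>\<^bsub>V\<^esub> = N"
proof -
  assume N: "sub N V"
  note s [simp] = sub_facts[OF N]
  show ?thesis
  proof (rule Set.set_eqI)
    fix z
    show "z \<in> N +>\<^bsub>V\<^esub> \<zero>\<^bsub>V\<^esub> \<longleftrightarrow> z \<in> N"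
      using coset_iff[OF N, of "\<zero>\<^bsub>V\<^esub>" z] by auto
  qed
qed

lemma coset_add:
  assumes N: "sub N V" and x: "x \<in> carrier V" and y: "y \<in> carrier V"
  shows "(N +>\<^bsub>V\<^esub> x) \<oplus>\<^bsub>quot_module V N\<^esub> (N +>\<^bsub>V\<^esub> y) = N +>\<^bsub>V\<^esub> (x \<oplus>\<^bsub>V\<^esub> y)"
proof -
  note s [simp] = sub_facts[OF N]
  have "(N +>\<^bsub>V\<^esub> x) \<oplus>\<^bsub>quot_module V N\<^esub> (N +>\<^bsub>V\<^esub> y) =
    {u \<oplus>\<^bsub>V\<^esub> v | u v. u \<in> N +>\<^bsub>V\<^esub> x \<and> v \<in> N +>\<^bsub>V\<^esub> y}"
    by (auto simp: quot_module_def set_add_def')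
  also have "\<dots> = N +>\<^bsub>V\<^esub> (x \<oplus>\<^bsub>V\<^esub> y)"
  proof (intro equalityI subsetI)
    fix z assume "z \<in> {u \<oplus>\<^bsub>V\<^esub> v | u v. u \<in> N +>\<^bsub>V\<^esub> x \<and> v \<in> N +>\<^bsub>V\<^esub> y}"
    then obtain n n' where "n \<in> N" "n' \<in> N" "z = (n \<oplus>\<^bsub>V\<^esub> x) \<oplus>\<^bsub>V\<^esub> (n' \<oplus>\<^bsub>V\<^esub> y)"
      by (auto simp: coset_iff[OF N x] coset_iff[OF N y])
    then show "z \<in> N +>\<^bsub>V\<^esub> (x \<oplus>\<^bsub>V\<^esub> y)"
      using x y by (subst coset_iff[OF N]) (auto simp: vs_ac intro!: bexI[of _ "n \<oplus>\<^bsub>V\<^esub> n'"])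
  next
    fix z assume "z \<in> N +>\<^bsub>V\<^esub> (x \<oplus>\<^bsub>V\<^esub> y)"
    then obtain n where n: "n \<in> N" "z = n \<oplus>\<^bsub>V\<^esub> (x \<oplus>\<^bsub>V\<^esub> y)"
      using x y by (subst (asm) coset_iff[OF N]) auto
    then have "z = (n \<oplus>\<^bsub>V\<^esub> x) \<oplus>\<^bsub>V\<^esub> y" using x y by (simp add: vs_assoc)
    moreover have "n \<oplus>\<^bsub>V\<^esub> x \<in> N +>\<^bsub>V\<^esub> x" using n by (auto simp: coset_iff[OF N x])
    ultimately show "z \<in> {u \<oplus>\<^bsub>V\<^esub> v | u v. u \<in> N +>\<^bsub>V\<^esub> x \<and> v \<in> N +>\<^bsub>V\<^esub> y}"
      using coset_self[OF N y] by blast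
  qed
  finally show ?thesis .
qed

text \<open>For every y in the coset of x the difference c y - c x lies in \<open>N\<close>, so the
  union that defines scalar multiplication is a nonempty union of one and the same coset. This also
  gives the right value for c = 0.\<close>

lemma coset_smult:
  assumes N: "sub N V" and x: "x \<in> carrier V" and c: "c \<in> carrier k"
  shows "c \<odot>\<^bsub>quot_module V N\<^esub> (N +>\<^bsub>V\<^esub> x) = N +>\<^bsub>V\<^esub> (c \<odot>\<^bsub>V\<^esub> x)"
proof -
  note s [simp] = sub_facts[OF N]
  have "N +>\<^bsub>V\<^esub> (c \<odot>\<^bsub>V\<^esub> y) = N +>\<^bsub>V\<^esub> (c \<odot>\<^bsub>V\<^esub> x)" if y: "y \<in> N +>\<^bsub>V\<^esub> x" for y
  proof -
    obtain n where n: "n \<in> N" "y = n \<oplus>\<^bsub>V\<^esub> x" using y by (auto simp: coset_iff[OF N x])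
    have "dif V (c \<odot>\<^bsub>V\<^esub> y) (c \<odot>\<^bsub>V\<^esub> x) = c \<odot>\<^bsub>V\<^esub> n"
      using n x c by (subst vs_dif_eq) (auto simp: vs_smult_add vs_comm)
    then show ?thesis using n x c by (subst coset_eq_iff[OF N]) auto
  qed
  then have "(\<Union>y\<in>N +>\<^bsub>V\<^esub> x. N +>\<^bsub>V\<^esub> (c \<odot>\<^bsub>V\<^esub> y)) = (\<Union>y\<in>N +>\<^bsub>V\<^esub> x. N +>\<^bsub>V\<^esub> (c \<odot>\<^bsub>V\<^esub> x))"
    by (rule SUP_cong[OF refl])
  moreover have "N +>\<^bsub>V\<^esub> x \<noteq> {}" using coset_self[OF N x] by blast
  ultimately show ?thesis by (simp add: quot_module_def)
qed

lemma quot_VS: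
  assumes N: "sub N V"
  shows "VS (quot_module V N)"
proof -
  note s [simp] = sub_facts[OF N]
  note c = coset_add[OF N] coset_smult[OF N] coset_zero[OF N, symmetric]
  let ?Q = "quot_module V N"
  have obt: "\<exists>x. x \<in> carrier V \<and> X = N +>\<^bsub>V\<^esub> x" if "X \<in> carrier ?Q" for X
    using that by (auto simp: quot_carrier)
  have cl: "N +>\<^bsub>V\<^esub> x \<in> carrier ?Q" if "x \<in> carrier V" for x
    using that by (simp add: quot_carrier)
  show ?thesis
  proof (rule VS_I)
    show "\<zero>\<^bsub>?Q\<^esub> \<in> carrier ?Q" using cl[of "\<zero>\<^bsub>V\<^esub>"] by (simp add: quot_zero coset_zero[OF N])
    fix X assume "X \<in> carrier ?Q"
    then obtain x where x: "x \<in> carrier V" "X = N +>\<^bsub>V\<^esub> x" using obt by blast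
    have "(\<ominus>\<^bsub>k\<^esub> \<one>\<^bsub>k\<^esub>) \<odot>\<^bsub>V\<^esub> x \<oplus>\<^bsub>V\<^esub> x = \<zero>\<^bsub>V\<^esub>"
      using vs_dif_self[of V x] x by (simp add: vdiff_def vs_comm)
    then show "(\<ominus>\<^bsub>k\<^esub> \<one>\<^bsub>k\<^esub>) \<odot>\<^bsub>?Q\<^esub> X \<oplus>\<^bsub>?Q\<^esub> X = \<zero>\<^bsub>?Q\<^esub>"
      using x by (simp add: c(1,2) coset_zero[OF N] quot_zero)
    show "\<zero>\<^bsub>?Q\<^esub> \<oplus>\<^bsub>?Q\<^esub> X = X"
      using c(1)[of "\<zero>\<^bsub>V\<^esub>" x] x by (simp add: coset_zero[OF N] quot_zero)
    show "\<one>\<^bsub>k\<^esub> \<odot>\<^bsub>?Q\<^esub> X = X" using x by (simp add: c(2))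
    show "a \<odot>\<^bsub>?Q\<^esub> X \<in> carrier ?Q" if "a \<in> carrier k" for a using x that by (simp add: c(2) cl)
    show "(a \<otimes>\<^bsub>k\<^esub> b) \<odot>\<^bsub>?Q\<^esub> X = a \<odot>\<^bsub>?Q\<^esub> (b \<odot>\<^bsub>?Q\<^esub> X)"
      "(a \<oplus>\<^bsub>k\<^esub> b) \<odot>\<^bsub>?Q\<^esub> X = a \<odot>\<^bsub>?Q\<^esub> X \<oplus>\<^bsub>?Q\<^esub> b \<odot>\<^bsub>?Q\<^esub> X"
      if "a \<in> carrier k" "b \<in> carrier k" for a b
      using x that by (simp_all add: c(1,2) vs_smult_smult vs_add_smult)
    fix Y assume "Y \<in> carrier ?Q"
    then obtain y where y: "y \<in> carrier V" "Y = N +>\<^bsub>V\<^esub> y" using obt by blast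
    show "X \<oplus>\<^bsub>?Q\<^esub> Y \<in> carrier ?Q" using x y by (simp add: c(1) cl)
    show "X \<oplus>\<^bsub>?Q\<^esub> Y = Y \<oplus>\<^bsub>?Q\<^esub> X" using x y by (simp add: c(1) vs_comm)
    show "a \<odot>\<^bsub>?Q\<^esub> (X \<oplus>\<^bsub>?Q\<^esub> Y) = a \<odot>\<^bsub>?Q\<^esub> X \<oplus>\<^bsub>?Q\<^esub> a \<odot>\<^bsub>?Q\<^esub> Y" if "a \<in> carrier k" for a
      using x y that by (simp add: c(1,2) vs_smult_add)
    fix Z assume "Z \<in> carrier ?Q"
    then obtain z where z: "z \<in> carrier V" "Z = N +>\<^bsub>V\<^esub> z" using obt by blast
    show "X \<oplus>\<^bsub>?Q\<^esub> Y \<oplus>\<^bsub>?Q\<^esub> Z = X \<oplus>\<^bsub>?Q\<^esub> (Y \<oplus>\<^bsub>?Q\<^esub> Z)" using x y z by (simp add: c(1) vs_assoc)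
  qed
qed

lemma lin_quot: "sub N V \<Longrightarrow> lin V (quot_module V N) (\<lambda>x. N +>\<^bsub>V\<^esub> x)"
  by (rule linI) (simp_all add: quot_VS sub_V coset_add coset_smult quot_carrier)

lemma coset_eq_zero:
  "sub N V \<Longrightarrow> x \<in> carrier V \<Longrightarrow> N +>\<^bsub>V\<^esub> x = N \<longleftrightarrow> x \<in> N"
  using coset_eq_iff[of N V x "\<zero>\<^bsub>V\<^esub>"] by (simp add: coset_zero sub_V)

end

context ground_field
begin

section \<open>Isomorphisms, direct sums and finite filtrations\<close>

lemma lin_bij:
  assumes f: "lin V W f" and inj: "\<And>x. x \<in> carrier V \<Longrightarrow> f x = \<zero>\<^bsub>W\<^esub> \<Longrightarrow> x = \<zero>\<^bsub>V\<^esub>"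
    and surj: "\<And>y. y \<in> carrier W \<Longrightarrow> \<exists>x\<in>carrier V. f x = y"
  shows "bij_betw f (carrier V) (carrier W)"
proof (rule bij_betw_imageI)
  note l = lin_facts[OF f]
  show "inj_on f (carrier V)"
  proof (rule inj_onI)
    fix x y assume a: "x \<in> carrier V" "y \<in> carrier V" "f x = f y"
    then have "dif V x y = \<zero>\<^bsub>V\<^esub>" using l by (intro inj) auto
    then show "x = y" using a l by (simp add: vs_dif_eq)
  qed
  show "f ` carrier V = carrier W" using l surj by force
qed

lemma vs_isoI:
  assumes "lin V W f" "\<And>x. x \<in> carrier V \<Longrightarrow> f x = \<zero>\<^bsub>W\<^esub> \<Longrightarrow> x = \<zero>\<^bsub>V\<^esub>"
    "\<And>y. y \<in> carrier W \<Longrightarrow> \<exists>x\<in>carrier V. f x = y"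
  shows "vs_iso k V W"
  using lin_bij[OF assms] assms(1) by (auto simp: vs_iso_def)

lemma vs_iso_refl: "VS V \<Longrightarrow> vs_iso k V V"
  by (rule vs_isoI[where f = "\<lambda>x. x"]) (auto intro: lin_id)

lemma dsum_VS:
  assumes V: "\<And>i. i \<in> I \<Longrightarrow> VS (V i)"
  shows "VS (dsum I V)"
proof (rule VS_I)
  have fin: "finite {i \<in> I. f i \<oplus>\<^bsub>V i\<^esub> g i \<noteq> \<zero>\<^bsub>V i\<^esub>}"
    if "finite {i \<in> I. f i \<noteq> \<zero>\<^bsub>V i\<^esub>}" "finite {i \<in> I. g i \<noteq> \<zero>\<^bsub>V i\<^esub>}" for f g
    by (rule finite_subset[OF _ finite_UnI[OF that]]) (use V in auto)
  have fin': "finite {i \<in> I. c \<odot>\<^bsub>V i\<^esub> g i \<noteq> \<zero>\<^bsub>V i\<^esub>}"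
    if "finite {i \<in> I. g i \<noteq> \<zero>\<^bsub>V i\<^esub>}" "c \<in> carrier k" for c g
    by (rule finite_subset[OF _ that(1)]) (use V that in auto)
  show "\<zero>\<^bsub>dsum I V\<^esub> \<in> carrier (dsum I V)" using V by (simp add: dsum_def cong: conj_cong)
  fix x assume x: "x \<in> carrier (dsum I V)"
  then have x1: "x \<in> (\<Pi>\<^sub>E i\<in>I. carrier (V i))" "finite {i \<in> I. x i \<noteq> \<zero>\<^bsub>V i\<^esub>}" by (auto simp: dsum_def)
  then have x2: "x i \<in> carrier (V i)" if "i \<in> I" for i using that by auto
  have ext: "(\<lambda>i\<in>I. h i) = x" if "\<And>i. i \<in> I \<Longrightarrow> h i = x i" for h
    using restrict_ext[of I h x] that PiE_restrict[OF x1(1)] by simp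
  have "(\<lambda>i\<in>I. \<zero>\<^bsub>V i\<^esub> \<oplus>\<^bsub>V i\<^esub> x i) = x" by (rule ext) (simp add: x2 V)
  then show "\<zero>\<^bsub>dsum I V\<^esub> \<oplus>\<^bsub>dsum I V\<^esub> x = x"
    by (simp add: dsum_def restrict_def cong: if_cong)
  show "(\<ominus>\<^bsub>k\<^esub> \<one>\<^bsub>k\<^esub>) \<odot>\<^bsub>dsum I V\<^esub> x \<oplus>\<^bsub>dsum I V\<^esub> x = \<zero>\<^bsub>dsum I V\<^esub>"
    using x2 V vs_dif_self[OF V] by (auto simp: dsum_def restrict_def fun_eq_iff vdiff_def vs_comm[OF V])
  have "(\<lambda>i\<in>I. \<one>\<^bsub>k\<^esub> \<odot>\<^bsub>V i\<^esub> x i) = x" by (rule ext) (simp add: x2 V)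
  then show "\<one>\<^bsub>k\<^esub> \<odot>\<^bsub>dsum I V\<^esub> x = x"
    by (simp add: dsum_def)
  show "c \<odot>\<^bsub>dsum I V\<^esub> x \<in> carrier (dsum I V)" if "c \<in> carrier k" for c
    using x1 x2 V that fin'[OF x1(2) that] by (auto simp: dsum_def cong: conj_cong)
  show "(a \<otimes>\<^bsub>k\<^esub> b) \<odot>\<^bsub>dsum I V\<^esub> x = a \<odot>\<^bsub>dsum I V\<^esub> (b \<odot>\<^bsub>dsum I V\<^esub> x)"
    "(a \<oplus>\<^bsub>k\<^esub> b) \<odot>\<^bsub>dsum I V\<^esub> x = a \<odot>\<^bsub>dsum I V\<^esub> x \<oplus>\<^bsub>dsum I V\<^esub> b \<odot>\<^bsub>dsum I V\<^esub> x"
    if "a \<in> carrier k" "b \<in> carrier k" for a b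
    using x2 V that by (auto simp: dsum_def restrict_def fun_eq_iff vs_smult_smult vs_add_smult)
  fix y assume y: "y \<in> carrier (dsum I V)"
  then have y1: "y \<in> (\<Pi>\<^sub>E i\<in>I. carrier (V i))" "finite {i \<in> I. y i \<noteq> \<zero>\<^bsub>V i\<^esub>}" by (auto simp: dsum_def)
  then have y2: "y i \<in> carrier (V i)" if "i \<in> I" for i using that by auto
  show "x \<oplus>\<^bsub>dsum I V\<^esub> y \<in> carrier (dsum I V)"
    using x2 y2 V fin[OF x1(2) y1(2)] by (auto simp: dsum_def cong: conj_cong)
  show "x \<oplus>\<^bsub>dsum I V\<^esub> y = y \<oplus>\<^bsub>dsum I V\<^esub> x"
    using x2 y2 V by (auto simp: dsum_def restrict_def fun_eq_iff vs_comm)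
  show "a \<odot>\<^bsub>dsum I V\<^esub> (x \<oplus>\<^bsub>dsum I V\<^esub> y) = a \<odot>\<^bsub>dsum I V\<^esub> x \<oplus>\<^bsub>dsum I V\<^esub> a \<odot>\<^bsub>dsum I V\<^esub> y"
    if "a \<in> carrier k" for a
    using x2 y2 V that by (auto simp: dsum_def restrict_def fun_eq_iff vs_smult_add)
  fix z assume z: "z \<in> carrier (dsum I V)"
  then have z2: "z i \<in> carrier (V i)" if "i \<in> I" for i using that by (auto simp: dsum_def)
  show "x \<oplus>\<^bsub>dsum I V\<^esub> y \<oplus>\<^bsub>dsum I V\<^esub> z = x \<oplus>\<^bsub>dsum I V\<^esub> (y \<oplus>\<^bsub>dsum I V\<^esub> z)"
    using x2 y2 z2 V by (auto simp: dsum_def restrict_def fun_eq_iff vs_assoc)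
qed

lemma lin_dsum_proj: "(\<And>i. i \<in> I \<Longrightarrow> VS (V i)) \<Longrightarrow> i \<in> I \<Longrightarrow> lin (dsum I V) (V i) (\<lambda>f. f i)"
  by (rule linI, erule dsum_VS) (auto simp: dsum_def)

text \<open>\<open>K1\<close> and \<open>K2\<close> have the same image in V/B, and
  \<open>K1\<close> meets \<open>B\<close> only in zero. The isomorphism sends x to the class of any
  y in \<open>K2\<close> with x - y in \<open>B\<close>. It compares a page with the cohomology of
  the preceding one when both are cut out of a fixed space.\<close>

lemma subspace_iso:
  assumes s: "sub K1 V" "sub K2 V" "sub B V"
    and 12: "\<And>x. x \<in> K1 \<Longrightarrow> \<exists>y\<in>K2. dif V x y \<in> B"
    and 21: "\<And>y. y \<in> K2 \<Longrightarrow> \<exists>x\<in>K1. dif V x y \<in> B"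
    and 0: "K1 \<inter> B \<subseteq> {\<zero>\<^bsub>V\<^esub>}"
  shows "vs_iso k (V\<lparr>carrier := K1\<rparr>) (quot_module (V\<lparr>carrier := K2\<rparr>) (K2 \<inter> B))"
proof -
  define N where "N = K2 \<inter> B"
  let ?U = "V\<lparr>carrier := K1\<rparr>" and ?W = "V\<lparr>carrier := K2\<rparr>"
  let ?Q = "quot_module ?W N"
  note f [simp] = sub_facts[OF s(1)] sub_facts[OF s(2)] sub_facts[OF s(3)]
  have N: "sub N ?W" unfolding N_def by (intro sub_sub sub_Int s) auto
  note q [simp] = lin_facts[OF lin_quot[OF N], simplified]
  define R where "R e c \<longleftrightarrow> (\<exists>x\<in>K2. c = N +>\<^bsub>?W\<^esub> x \<and> dif V e x \<in> B)" for e c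
  have "\<exists>f. lin ?U ?Q f \<and> (\<forall>x\<in>carrier ?U. \<forall>y\<in>carrier ?Q. R x y \<longleftrightarrow> y = f x)"
  proof (rule linear_relation)
    show "VS ?U" using s by simp
    show "VS ?Q" by (rule q)
    show "\<exists>y\<in>carrier ?Q. R x y" if "x \<in> carrier ?U" for x
      using 12[of x] that q(3) by (auto simp: R_def)
  next
    fix x y x' y' assume x: "x \<in> carrier ?U" "x' \<in> carrier ?U" and "R x y" "R x' y'"
    then obtain u u' where u: "u \<in> K2" "y = N +>\<^bsub>?W\<^esub> u" "dif V x u \<in> B"
      "u' \<in> K2" "y' = N +>\<^bsub>?W\<^esub> u'" "dif V x' u' \<in> B" by (auto simp: R_def)
    have "dif V (x \<oplus>\<^bsub>V\<^esub> x') (u \<oplus>\<^bsub>V\<^esub> u') = dif V x u \<oplus>\<^bsub>V\<^esub> dif V x' u'"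
      using x u by (simp add: vdiff_def vs_smult_add vs_ac)
    then have "dif V (x \<oplus>\<^bsub>V\<^esub> x') (u \<oplus>\<^bsub>V\<^esub> u') \<in> B" using u by simp
    then show "R (x \<oplus>\<^bsub>?U\<^esub> x') (y \<oplus>\<^bsub>?Q\<^esub> y')"
      unfolding R_def using u by (intro bexI[of _ "u \<oplus>\<^bsub>V\<^esub> u'"] conjI) simp_all
  next
    fix c x y assume x: "x \<in> carrier ?U" and c: "c \<in> carrier k" and "R x y"
    then obtain u where u: "u \<in> K2" "y = N +>\<^bsub>?W\<^esub> u" "dif V x u \<in> B" by (auto simp: R_def)
    have "dif V (c \<odot>\<^bsub>V\<^esub> x) (c \<odot>\<^bsub>V\<^esub> u) = c \<odot>\<^bsub>V\<^esub> dif V x u"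
      using x u c by (simp add: vdiff_def vs_smult_add vs_smult_comm[of V c])
    then have "dif V (c \<odot>\<^bsub>V\<^esub> x) (c \<odot>\<^bsub>V\<^esub> u) \<in> B" using u c by simp
    then show "R (c \<odot>\<^bsub>?U\<^esub> x) (c \<odot>\<^bsub>?Q\<^esub> y)"
      unfolding R_def using u c by (intro bexI[of _ "c \<odot>\<^bsub>V\<^esub> u"] conjI) simp_all
  next
    fix y assume "R \<zero>\<^bsub>?U\<^esub> y"
    then obtain u where u: "u \<in> K2" "y = N +>\<^bsub>?W\<^esub> u" "dif V \<zero>\<^bsub>V\<^esub> u \<in> B" by (auto simp: R_def)
    have "dif V \<zero>\<^bsub>V\<^esub> (dif V \<zero>\<^bsub>V\<^esub> u) = u" using u f by (simp add: vs_dif_eq)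
    moreover have "dif V \<zero>\<^bsub>V\<^esub> (dif V \<zero>\<^bsub>V\<^esub> u) \<in> B" using u(3) by simp
    ultimately have "u \<in> N" using u(1) by (simp add: N_def)
    then show "y = \<zero>\<^bsub>?Q\<^esub>" using u coset_eq_zero[OF N, of u] by (simp add: quot_zero)
  qed
  then obtain g where g: "lin ?U ?Q g" "\<And>x y. x \<in> K1 \<Longrightarrow> y \<in> carrier ?Q \<Longrightarrow> R x y \<longleftrightarrow> y = g x"
    by auto
  have "vs_iso k ?U ?Q"
  proof (rule vs_isoI[OF g(1)])
    fix x assume x: "x \<in> carrier ?U" "g x = \<zero>\<^bsub>?Q\<^esub>"
    then have "R x \<zero>\<^bsub>?Q\<^esub>" using g(2)[of x "\<zero>\<^bsub>?Q\<^esub>"] by simp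
    then obtain u where u: "u \<in> K2" "N = N +>\<^bsub>?W\<^esub> u" "dif V x u \<in> B" by (auto simp: R_def quot_zero)
    then have "u \<in> B" using coset_eq_zero[OF N, of u] by (auto simp: N_def)
    then have "dif V x u \<oplus>\<^bsub>V\<^esub> u \<in> B" using u(3) by (intro sub_add[OF s(3)])
    then have "x \<in> B" using u x by simp
    then show "x = \<zero>\<^bsub>?U\<^esub>" using x 0 by auto
  next
    fix y assume "y \<in> carrier ?Q"
    then obtain u where u: "u \<in> K2" "y = N +>\<^bsub>?W\<^esub> u" by (auto simp: quot_carrier)
    then obtain x where "x \<in> K1" "dif V x u \<in> B" using 21 by blast
    then show "\<exists>x\<in>carrier ?U. g x = y" using g(2)[of x y] u by (auto simp: R_def)
  qed
  then show ?thesis by (simp add: N_def)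
qed

text \<open>A chosen copy of Z/B inside \<open>V\<close>. Unlike the quotient, it stays in the
  element type of \<open>V\<close>.\<close>

definition compl :: "('k, 'v) module \<Rightarrow> 'v set \<Rightarrow> 'v set \<Rightarrow> 'v set" where
  "compl V Z B = (SOME C. sub C V \<and> C \<subseteq> Z \<and> C \<inter> B \<subseteq> {\<zero>\<^bsub>V\<^esub>} \<and> (\<forall>z\<in>Z. \<exists>b\<in>B. \<exists>c\<in>C. z = b \<oplus>\<^bsub>V\<^esub> c))"

lemma compl_facts:
  assumes Z: "sub Z V" and B: "sub B V" and BZ: "B \<subseteq> Z"
  shows compl_sub: "sub (compl V Z B) V" and compl_subset: "compl V Z B \<subseteq> Z"
    and compl_Int: "compl V Z B \<inter> B \<subseteq> {\<zero>\<^bsub>V\<^esub>}"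
    and compl_sum: "z \<in> Z \<Longrightarrow> \<exists>b\<in>B. \<exists>c\<in>compl V Z B. z = b \<oplus>\<^bsub>V\<^esub> c"
proof -
  obtain C where C: "sub C (V\<lparr>carrier := Z\<rparr>)" "B \<inter> C = {\<zero>\<^bsub>V\<^esub>}"
    "\<forall>v\<in>Z. \<exists>u\<in>B. \<exists>c\<in>C. v = u \<oplus>\<^bsub>V\<^esub> c"
    using complement_exists[OF sub_sub[OF Z B BZ]] by auto
  have "sub C V"
    by (rule subspaceI) (use sub_facts[OF C(1), simplified] sub_facts[OF Z] in auto)
  moreover have "C \<subseteq> Z" using sub_facts[OF C(1)] by auto
  ultimately have "\<exists>C. sub C V \<and> C \<subseteq> Z \<and> C \<inter> B \<subseteq> {\<zero>\<^bsub>V\<^esub>} \<and> (\<forall>z\<in>Z. \<exists>b\<in>B. \<exists>c\<in>C. z = b \<oplus>\<^bsub>V\<^esub> c)"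
    using C by blast
  from someI_ex[OF this, folded compl_def]
  show "sub (compl V Z B) V" "compl V Z B \<subseteq> Z" "compl V Z B \<inter> B \<subseteq> {\<zero>\<^bsub>V\<^esub>}"
    "z \<in> Z \<Longrightarrow> \<exists>b\<in>B. \<exists>c\<in>compl V Z B. z = b \<oplus>\<^bsub>V\<^esub> c" by blast+
qed

text \<open>A finite filtration of a vector space splits. \<open>G n\<close> maps \<open>V n\<close>
  onto a complement of \<open>L (n + 1)\<close> in \<open>L n\<close>, and the isomorphism is the
  sum of the \<open>G n\<close>; only the indices from 0 to s contribute.\<close>

lemma dsum_iso_filtered:
  fixes G :: "int \<Rightarrow> 'v \<Rightarrow> 'h" and s :: nat
  assumes H: "VS H" and V: "\<And>n. VS (V n)"
    and V0: "\<And>n. n < 0 \<or> n > int s \<Longrightarrow> carrier (V n) = {\<zero>\<^bsub>V n\<^esub>}"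
    and G: "\<And>n. lin (V n) H (G n)"
    and L: "\<And>n. sub (L n) H" and Ldec: "\<And>n. L (n + 1) \<subseteq> L n"
    and L0: "L 0 = carrier H" and Ls: "L (int s + 1) \<subseteq> {\<zero>\<^bsub>H\<^esub>}"
    and GL: "\<And>n e. e \<in> carrier (V n) \<Longrightarrow> G n e \<in> L n"
    and ex: "\<And>n h. h \<in> L n \<Longrightarrow> \<exists>e\<in>carrier (V n). \<exists>h'\<in>L (n + 1). h = G n e \<oplus>\<^bsub>H\<^esub> h'"
    and uniq: "\<And>n e h. e \<in> carrier (V n) \<Longrightarrow> h \<in> L (n + 1) \<Longrightarrow> G n e \<oplus>\<^bsub>H\<^esub> h = \<zero>\<^bsub>H\<^esub> \<Longrightarrow> e = \<zero>\<^bsub>V n\<^esub>"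
  shows "vs_iso k (dsum UNIV V) H"
proof -
  let ?D = "dsum UNIV V"
  \<comment> \<open>\<open>S j\<close> sums the top j pieces, of indices s - j + 1 to s. Counting
    down from s keeps its values in \<open>L (s + 1 - j)\<close>, which is what the next step
    needs.\<close>
  define S where "S = rec_nat (\<lambda>f. \<zero>\<^bsub>H\<^esub>) (\<lambda>j g f. G (int s - int j) (f (int s - int j)) \<oplus>\<^bsub>H\<^esub> g f)"
  have S0: "S 0 f = \<zero>\<^bsub>H\<^esub>" and SS: "S (Suc j) f = G (int s - int j) (f (int s - int j)) \<oplus>\<^bsub>H\<^esub> S j f" for j f
    by (simp_all add: S_def)
  have DV: "f n \<in> carrier (V n)" if "f \<in> carrier ?D" for f n using that by (auto simp: dsum_def)
  have Slin: "lin ?D H (S j)" for j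
  proof (induction j)
    case 0
    show ?case by (rule lin_cong[OF lin_const_zero]) (auto simp: S0 dsum_VS V H)
  next
    case (Suc j)
    have "lin ?D H (\<lambda>f. G (int s - int j) (f (int s - int j)) \<oplus>\<^bsub>H\<^esub> S j f)"
      by (intro lin_addf Suc lin_comp[OF G] lin_dsum_proj) (auto simp: V)
    then show ?case by (rule lin_cong) (simp add: SS)
  qed
  have SL: "S j f \<in> L (int s + 1 - int j)" if "f \<in> carrier ?D" for j f
  proof (induction j)
    case 0 show ?case using sub_zero[OF L] by (simp add: S0)
  next
    case (Suc j)
    have "S j f \<in> L (int s - int j)" using Suc Ldec[of "int s - int j"] by (auto simp: algebra_simps)
    then show ?case using GL[OF DV[OF that, of "int s - int j"]] sub_add[OF L] by (simp add: SS)
  qed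
  \<comment> \<open>In \<open>S (Suc j) f\<close> the new summand has the lowest index and the rest
    lies one filtration step deeper, so \<open>uniq\<close> kills the new component first.\<close>
  have Sinj: "\<forall>i. int s - int j < i \<and> i \<le> int s \<longrightarrow> f i = \<zero>\<^bsub>V i\<^esub>"
    if "f \<in> carrier ?D" "S j f = \<zero>\<^bsub>H\<^esub>" for j f
    using that(2)
  proof (induction j)
    case 0
    show ?case by auto
  next
    case (Suc j)
    have "f (int s - int j) = \<zero>\<^bsub>V (int s - int j)\<^esub>"
      by (rule uniq[OF DV[OF that(1)] SL[OF that(1), of j, unfolded diff_add_eq[symmetric]]])
        (use Suc.prems in \<open>simp add: SS\<close>)
    moreover from this have "S j f = \<zero>\<^bsub>H\<^esub>"
      using Suc.prems lin_closed[OF Slin that(1)] H by (simp add: SS lin_zero[OF G])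
    then have "\<forall>i. int s - int j < i \<and> i \<le> int s \<longrightarrow> f i = \<zero>\<^bsub>V i\<^esub>" by (rule Suc.IH)
    ultimately show ?case
      by (intro allI impI, rename_tac i, case_tac "i = int s - int j") auto
  qed
  have Ssurj: "\<exists>f\<in>carrier ?D. (\<forall>i. \<not> (int s - int j < i \<and> i \<le> int s) \<longrightarrow> f i = \<zero>\<^bsub>V i\<^esub>) \<and> S j f = h"
    if "h \<in> L (int s + 1 - int j)" for j h
    using that
  proof (induction j arbitrary: h)
    case 0
    then have "h = \<zero>\<^bsub>H\<^esub>" using Ls by auto
    moreover have "(\<lambda>i. \<zero>\<^bsub>V i\<^esub>) \<in> carrier ?D" using V by (simp add: dsum_def PiE_UNIV_domain)
    ultimately show ?case by (intro bexI[of _ "\<lambda>i. \<zero>\<^bsub>V i\<^esub>"]) (simp_all add: S0)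
  next
    case (Suc j)
    let ?n = "int s - int j"
    obtain e h' where e: "e \<in> carrier (V ?n)" "h' \<in> L (?n + 1)" "h = G ?n e \<oplus>\<^bsub>H\<^esub> h'"
      using ex[of h ?n] Suc.prems by auto
    then obtain f where f: "f \<in> carrier ?D" "\<forall>i. \<not> (?n < i \<and> i \<le> int s) \<longrightarrow> f i = \<zero>\<^bsub>V i\<^esub>" "S j f = h'"
      using Suc.IH[of h'] by (auto simp: algebra_simps)
    \<comment> \<open>\<open>S j\<close> reads only indices above \<open>?n\<close>, so setting the
      entry at \<open>?n\<close> leaves it unchanged.\<close>
    define f' where "f' = f(?n := e)"
    have "{i. f' i \<noteq> \<zero>\<^bsub>V i\<^esub>} \<subseteq> insert ?n {i. f i \<noteq> \<zero>\<^bsub>V i\<^esub>}" by (auto simp: f'_def)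
    then have "finite {i. f' i \<noteq> \<zero>\<^bsub>V i\<^esub>}"
      using f(1) finite_subset by (fastforce simp: dsum_def)
    then have f': "f' \<in> carrier ?D"
      using f(1) e(1) by (auto simp: dsum_def f'_def)
    have "S i f' = S i f" if "i \<le> j" for i
      using that by (induction i) (auto simp: S0 SS f'_def)
    then have "S (Suc j) f' = h" using f e by (simp add: SS f'_def)
    moreover have "\<forall>i. \<not> (int s - int (Suc j) < i \<and> i \<le> int s) \<longrightarrow> f' i = \<zero>\<^bsub>V i\<^esub>"
      using f(2) by (auto simp: f'_def)
    ultimately show ?case using f' by blast
  qed
  show ?thesis
  proof (rule vs_isoI[OF Slin[of "Suc s"]])
    fix f assume f: "f \<in> carrier ?D" "S (Suc s) f = \<zero>\<^bsub>H\<^esub>"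
    have "f i = \<zero>\<^bsub>V i\<^esub>" for i
    proof (cases "0 \<le> i \<and> i \<le> int s")
      case True then show ?thesis using Sinj[OF f] by auto
    next
      case False then show ?thesis using V0[of i] DV[OF f(1), of i] by auto
    qed
    then show "f = \<zero>\<^bsub>?D\<^esub>" by (auto simp: dsum_def)
  next
    fix h assume "h \<in> carrier H"
    then show "\<exists>f\<in>carrier ?D. S (Suc s) f = h" using Ssurj[of h "Suc s"] L0 by auto
  qed
qed

end

section \<open>The spectral sequence of a filtered complex\<close>

text \<open>
  A complex \<open>(X, D)\<close> graded by \<open>T\<close> and filtered by \<open>F\<close>. In the classical notation,
  \<open>A n r s\<close> is \<open>Z\<^sub>r\<close> in filtration degree \<open>n\<close> and total degree \<open>s\<close>, and \<open>\<phi>\<close> presents a given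
  second page \<open>M\<close>. All later pages are realised as subspaces of \<open>M\<close>, complementary to the
  boundaries \<open>Bb r\<close> inside the cycles \<open>Zb r\<close>; this keeps the pages in one type.
\<close>

locale filtered_complex = ground_field k for k :: "('k, 'z) ring_scheme" +
  fixes X :: "('k, 'x) module" and D :: "'x \<Rightarrow> 'x" and T F :: "int \<Rightarrow> 'x set"
    and M :: "int \<Rightarrow> int \<Rightarrow> ('k, 'e) module" and \<phi> :: "int \<Rightarrow> int \<Rightarrow> 'x \<Rightarrow> 'e"
    and A :: "int \<Rightarrow> int \<Rightarrow> int \<Rightarrow> 'x set"
    and H :: "nat \<Rightarrow> ('k, 'h) module" and cl :: "nat \<Rightarrow> 'x \<Rightarrow> 'h"
  defines "A \<equiv> \<lambda>n r s. {y \<in> T s \<inter> F n. D y \<in> F (n + r)}"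
  assumes D_lin: "lin X X D" and D_D: "x \<in> carrier X \<Longrightarrow> D (D x) = \<zero>\<^bsub>X\<^esub>"
    and T_sub: "sub (T s) X"
    and T_D: "x \<in> T s \<Longrightarrow> D x \<in> T (s + 1)"
    and F_sub: "sub (F n) X" and F_dec: "n \<le> n' \<Longrightarrow> F n' \<subseteq> F n"
    and F_whole: "n \<le> 0 \<Longrightarrow> F n = carrier X"
    and F_high: "x \<in> T s \<Longrightarrow> x \<in> F n \<Longrightarrow> s < n \<Longrightarrow> x = \<zero>\<^bsub>X\<^esub>"
    and phi_lin: "lin (X\<lparr>carrier := A n 2 (n + m)\<rparr>) (M n m) (\<phi> n m)"
    and phi_surj: "carrier (M n m) \<subseteq> \<phi> n m ` A n 2 (n + m)"
    and phi_ker: "y \<in> A n 2 (n + m) \<Longrightarrow>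
      \<phi> n m y = \<zero>\<^bsub>M n m\<^esub> \<longleftrightarrow> (\<exists>z\<in>A (n - 1) 1 (n + m - 1). dif X y (D z) \<in> F (n + 1))"
    and cl_lin: "lin (X\<lparr>carrier := {y \<in> T (int j). D y = \<zero>\<^bsub>X\<^esub>}\<rparr>) (H j) (cl j)"
    and cl_surj: "carrier (H j) \<subseteq> cl j ` {y \<in> T (int j). D y = \<zero>\<^bsub>X\<^esub>}"
    and cl_ker: "y \<in> T (int j) \<Longrightarrow> D y = \<zero>\<^bsub>X\<^esub> \<Longrightarrow>
      cl j y = \<zero>\<^bsub>H j\<^esub> \<longleftrightarrow> (\<exists>z\<in>T (int j - 1). y = D z)"
begin

section \<open>Cycles and boundaries in a filtered complex\<close>

lemma X_VS: "VS X" by (rule lin_V[OF D_lin])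

lemma M_VS: "VS (M n m)" by (rule lin_W[OF phi_lin])

lemma H_VS: "VS (H s)" by (rule lin_W[OF cl_lin])

lemma A_iff: "y \<in> A n r s \<longleftrightarrow> y \<in> T s \<and> y \<in> F n \<and> D y \<in> F (n + r)"
  by (simp add: A_def)

lemma TX: "x \<in> T s \<Longrightarrow> x \<in> carrier X" by (rule sub_carrier[OF T_sub])

lemma AX: "x \<in> A n r s \<Longrightarrow> x \<in> carrier X" by (auto simp: A_iff TX)

lemma DX: "x \<in> carrier X \<Longrightarrow> D x \<in> carrier X" by (rule lin_closed[OF D_lin])

lemma F_zero [simp]: "\<zero>\<^bsub>X\<^esub> \<in> F n" by (rule sub_zero[OF F_sub])

lemma A_sub: "sub (A n r s) X"
  by (rule subspaceI[OF X_VS])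
    (auto simp: A_iff TX lin_zero[OF D_lin] lin_add[OF D_lin] lin_smult[OF D_lin]
      sub_zero[OF T_sub] sub_zero[OF F_sub] sub_add[OF T_sub] sub_add[OF F_sub]
      sub_smult[OF T_sub] sub_smult[OF F_sub])

lemma F_le: "x \<in> F n' \<Longrightarrow> n \<le> n' \<Longrightarrow> x \<in> F n" using F_dec by blast

lemma A_le: "y \<in> A n' r' s \<Longrightarrow> n \<le> n' \<Longrightarrow> n + r \<le> n' + r' \<Longrightarrow> y \<in> A n r s"
  by (auto simp: A_iff intro: F_le)

lemma A_D: "z \<in> A n r s \<Longrightarrow> n' \<le> n + r \<Longrightarrow> s' = s + 1 \<Longrightarrow> D z \<in> A n' r' s'"
  using D_D[OF AX, of z n r s] F_zero by (auto simp: A_iff T_D intro: F_le)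

lemma phi_facts:
  assumes s: "s = n + m"
  shows phi_closed: "y \<in> A n 2 s \<Longrightarrow> \<phi> n m y \<in> carrier (M n m)"
    and phi_add: "y \<in> A n 2 s \<Longrightarrow> z \<in> A n 2 s \<Longrightarrow> \<phi> n m (y \<oplus>\<^bsub>X\<^esub> z) = \<phi> n m y \<oplus>\<^bsub>M n m\<^esub> \<phi> n m z"
    and phi_smult: "c \<in> carrier k \<Longrightarrow> y \<in> A n 2 s \<Longrightarrow> \<phi> n m (c \<odot>\<^bsub>X\<^esub> y) = c \<odot>\<^bsub>M n m\<^esub> \<phi> n m y"
    and phi_dif: "y \<in> A n 2 s \<Longrightarrow> z \<in> A n 2 s \<Longrightarrow> \<phi> n m (dif X y z) = dif (M n m) (\<phi> n m y) (\<phi> n m z)"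
  using lin_facts[OF phi_lin[of n m], simplified] s by auto

text \<open>The witness in the description of the kernel of \<open>\<phi>\<close> is z = 0.\<close>

lemma phi_F:
  assumes "y \<in> A n 2 s" "s = n + m" "y \<in> F (n + 1)"
  shows "\<phi> n m y = \<zero>\<^bsub>M n m\<^esub>"
proof -
  have "\<zero>\<^bsub>X\<^esub> \<in> A (n - 1) 1 (n + m - 1)" by (rule sub_zero[OF A_sub])
  moreover have "dif X y (D \<zero>\<^bsub>X\<^esub>) = y" using AX[OF assms(1)] X_VS by (simp add: lin_zero[OF D_lin])
  ultimately show ?thesis using assms phi_ker[of y n m] by metis
qed

text \<open>Here z itself is the witness, the difference D z - D z being zero. These are the
  boundaries of the first page, which \<open>M\<close> has already divided out.\<close>

lemma phi_D:
  assumes "z \<in> A (n - 1) 1 (s - 1)" "s = n + m"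
  shows "\<phi> n m (D z) = \<zero>\<^bsub>M n m\<^esub>"
proof -
  have "D z \<in> A n 2 (n + m)" using A_D[OF assms(1), of n "n + m" 2] assms(2) by simp
  moreover have "dif X (D z) (D z) \<in> F (n + 1)"
    using DX[OF AX[OF assms(1)]] X_VS F_zero by simp
  ultimately show ?thesis using phi_ker[of "D z" n m] assms by auto
qed

lemma T_dif: "x \<in> T s \<Longrightarrow> y \<in> T s \<Longrightarrow> dif X x y \<in> T s" by (rule sub_dif[OF T_sub])

lemma D_dif: "x \<in> carrier X \<Longrightarrow> y \<in> carrier X \<Longrightarrow> D (dif X x y) = dif X (D x) (D y)"
  by (rule lin_dif[OF D_lin])

definition Zb where "Zb r n m = \<phi> n m ` A n r (n + m)"

text \<open>The classical boundaries divided out on page r: they come from filtration degree n - r +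
  1, that is, from a jump of at most r - 1, because page r has absorbed the differentials of the
  earlier pages only.\<close>

definition Bb where "Bb r n m = \<phi> n m ` D ` A (n - r + 1) (r - 1) (n + m - 1)"

lemma Bb_iff: "b \<in> Bb r n m \<longleftrightarrow> (\<exists>z\<in>A (n - r + 1) (r - 1) (n + m - 1). b = \<phi> n m (D z))"
  by (auto simp: Bb_def)

lemma Zb_iff: "e \<in> Zb r n m \<longleftrightarrow> (\<exists>y\<in>A n r (n + m). e = \<phi> n m y)"
  by (auto simp: Zb_def)

lemma A2: "y \<in> A n r s \<Longrightarrow> 2 \<le> r \<Longrightarrow> y \<in> A n 2 s"
  by (rule A_le) auto

lemma Zb_sub: "2 \<le> r \<Longrightarrow> sub (Zb r n m) (M n m)"
  unfolding Zb_def by (rule sub_image[OF phi_lin], rule sub_sub[OF A_sub A_sub]) (auto intro: A2)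

lemma DA: "z \<in> A (n - r + 1) (r - 1) (n + m - 1) \<Longrightarrow> D z \<in> A n r' (n + m)"
  by (erule A_D) auto

lemma Bb_sub: "sub (Bb r n m) (M n m)"
  unfolding Bb_def
proof (rule sub_image[OF phi_lin], rule sub_sub[OF A_sub])
  show "sub (D ` A (n - r + 1) (r - 1) (n + m - 1)) X" by (rule sub_image[OF D_lin A_sub])
qed (auto intro: DA)

lemma Zb_2: "Zb 2 n m = carrier (M n m)"
  using phi_surj phi_closed unfolding Zb_def by blast

text \<open>\<open>Bb 2\<close> comes from \<open>A (n - 1) 1\<close>, exactly the elements whose
  differentials \<open>phi_D\<close> annihilates.\<close>

lemma Bb_2: "Bb 2 n m = {\<zero>\<^bsub>M n m\<^esub>}"
proof -
  have "b = \<zero>\<^bsub>M n m\<^esub>" if "b \<in> Bb 2 n m" for b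
    using that phi_D[of _ n "n + m" m] by (auto simp: Bb_iff)
  then show ?thesis using sub_zero[OF Bb_sub] by blast
qed

text \<open>Boundaries are permanent cycles since D D = 0; hence r and r' are independent.\<close>

lemma Bb_Zb: "2 \<le> r' \<Longrightarrow> Bb r n m \<subseteq> Zb r' n m"
  unfolding Bb_def Zb_def by (auto intro: DA)

lemma Bb_Suc: "Bb r n m \<subseteq> Bb (r + 1) n m"
proof
  fix b assume "b \<in> Bb r n m"
  then obtain z where "z \<in> A (n - r + 1) (r - 1) (n + m - 1)" "b = \<phi> n m (D z)" by (auto simp: Bb_iff)
  moreover from this(1) have "z \<in> A (n - (r + 1) + 1) (r + 1 - 1) (n + m - 1)" by (rule A_le) auto
  ultimately show "b \<in> Bb (r + 1) n m" unfolding Bb_iff by blast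
qed

lemma Zb_Suc: "Zb (r + 1) n m \<subseteq> Zb r n m"
  unfolding Zb_def by (intro image_mono subsetI) (erule A_le, auto)

text \<open>This makes the differential of page r single-valued. If the class of y is that of D z,
  then y - D z - D w lies one filtration step deeper for some w and has the same differential as y;
  it exhibits the class of D y as a boundary.\<close>

lemma boundary_wd:
  assumes y: "y \<in> A n r (n + m)" and r: "2 \<le> r" and b: "\<phi> n m y \<in> Bb r n m"
  shows "\<phi> (n + r) (m + 1 - r) (D y) \<in> Bb r (n + r) (m + 1 - r)"
proof -
  obtain z where z: "z \<in> A (n - r + 1) (r - 1) (n + m - 1)" "\<phi> n m y = \<phi> n m (D z)"
    using b by (auto simp: Bb_iff)
  have y2: "y \<in> A n 2 (n + m)" by (rule A2[OF y r])
  have "\<phi> n m (dif X y (D z)) = \<zero>\<^bsub>M n m\<^esub>"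
    using phi_dif[OF refl y2 DA[OF z(1)]] z(2) M_VS phi_closed[OF refl y2] by simp
  then obtain w where w: "w \<in> A (n - 1) 1 (n + m - 1)" "dif X (dif X y (D z)) (D w) \<in> F (n + 1)"
    using phi_ker[OF sub_dif[OF A_sub y2 DA[OF z(1)]]] by auto
  define y' where "y' = dif X (dif X y (D z)) (D w)"
  have c: "y \<in> carrier X" "z \<in> carrier X" "w \<in> carrier X" "D z \<in> carrier X" "D w \<in> carrier X" "D y \<in> carrier X"
    using y z w by (auto intro: AX DX)
  have "D y' = D y" using c X_VS by (simp add: y'_def D_dif D_D)
  moreover have "y' \<in> T (n + m)"
    unfolding y'_def using y DA[OF z(1)] A_D[OF w(1), of n "n + m" 2]
    by (intro T_dif) (auto simp: A_iff)
  ultimately have "y' \<in> A ((n + r) - r + 1) (r - 1) ((n + r) + (m + 1 - r) - 1)"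
    using w(2) y by (auto simp: A_iff y'_def[symmetric])
  then show ?thesis unfolding Bb_iff using \<open>D y' = D y\<close> by metis
qed

text \<open>If the class of D y is that of D z, then D y agrees with D (z + w) modulo F (n + r + 1),
  where z and w lie in F (n + 1). Hence y - (z + w) is a cycle for page r + 1, and it has the same
  class as y.\<close>

lemma boundary_Zb:
  assumes y: "y \<in> A n r (n + m)" and r: "2 \<le> r"
  shows "\<phi> (n + r) (m + 1 - r) (D y) \<in> Bb r (n + r) (m + 1 - r) \<Longrightarrow> \<phi> n m y \<in> Zb (r + 1) n m"
proof -
  let ?n = "n + r" and ?m = "m + 1 - r"
  assume "\<phi> ?n ?m (D y) \<in> Bb r ?n ?m"
  then obtain z where z: "z \<in> A (?n - r + 1) (r - 1) (?n + ?m - 1)" "\<phi> ?n ?m (D y) = \<phi> ?n ?m (D z)"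
    by (auto simp: Bb_iff)
  have z1: "z \<in> A (n + 1) (r - 1) (n + m)" using z(1) by simp
  have Dy: "D y \<in> A ?n 2 (?n + ?m)" using A_D[OF y, of ?n "?n + ?m" 2] by simp
  have Dz: "D z \<in> A ?n 2 (?n + ?m)" by (rule DA[OF z(1)])
  have "\<phi> ?n ?m (dif X (D y) (D z)) = \<zero>\<^bsub>M ?n ?m\<^esub>"
    using phi_dif[OF refl Dy Dz] z(2) M_VS phi_closed[OF refl Dy] by simp
  then obtain w where w: "w \<in> A (?n - 1) 1 (?n + ?m - 1)" "dif X (dif X (D y) (D z)) (D w) \<in> F (?n + 1)"
    using phi_ker[OF sub_dif[OF A_sub Dy Dz]] by auto
  have c: "y \<in> carrier X" "z \<in> carrier X" "w \<in> carrier X" "D z \<in> carrier X" "D w \<in> carrier X" "D y \<in> carrier X"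
    using y z w by (auto intro: AX DX)
  define v where "v = z \<oplus>\<^bsub>X\<^esub> w"
  \<comment> \<open>The kernel of \<open>\<phi>\<close> supplies w in filtration degree n + r - 1,
    which is at least n + 1 because r is at least 2.\<close>
  have w1: "w \<in> F (n + 1)" "w \<in> T (n + m)" "D w \<in> F (n + r)" using w(1) r by (auto simp: A_iff intro: F_le)
  have v: "v \<in> F (n + 1)" "v \<in> T (n + m)" "D v \<in> F (n + r)"
    using w1 z1 c by (auto simp: v_def A_iff lin_add[OF D_lin] intro!: sub_add[OF F_sub] sub_add[OF T_sub])
  have vA: "v \<in> A n r (n + m)" using v by (auto simp: A_iff intro: F_le)
  have vc: "v \<in> carrier X" using v TX by blast
  have "D (dif X y v) = dif X (dif X (D y) (D z)) (D w)"
    using c vc X_VS by (subst D_dif) (auto simp: v_def lin_add[OF D_lin] vdiff_def vs_smult_add vs_assoc)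
  then have yv: "dif X y v \<in> A n (r + 1) (n + m)"
    using w(2) sub_dif[OF A_sub y vA] by (auto simp: A_iff add.assoc)
  have "\<phi> n m (dif X y v) = \<phi> n m y"
    using phi_dif[OF refl A2[OF y r] A2[OF vA r]] phi_F[OF A2[OF vA r] refl v(1)] M_VS phi_closed[OF refl A2[OF y r]]
    by simp
  then show ?thesis using yv unfolding Zb_iff by metis
qed

text \<open>D y lies in F (n + r + 1), one step deeper than page r requires, and there
  \<open>\<phi>\<close> vanishes.\<close>

lemma Zb_boundary:
  assumes y: "y \<in> A n (r + 1) (n + m)"
  shows "\<phi> (n + r) (m + 1 - r) (D y) = \<zero>\<^bsub>M (n + r) (m + 1 - r)\<^esub>"
  by (rule phi_F[where s = "n + m + 1"]) (use A_D[OF y, of "n + r" "n + m + 1" 2] y in \<open>auto simp: A_iff add.assoc\<close>)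

section \<open>The pages and their differentials\<close>

definition K where "K r n m = compl (M n m) (Zb r n m) (Bb r n m)"

lemma K_facts:
  assumes "2 \<le> r"
  shows K_sub: "sub (K r n m) (M n m)" and K_Zb: "K r n m \<subseteq> Zb r n m"
    and K_Int: "K r n m \<inter> Bb r n m \<subseteq> {\<zero>\<^bsub>M n m\<^esub>}"
    and K_sum: "z \<in> Zb r n m \<Longrightarrow> \<exists>b\<in>Bb r n m. \<exists>c\<in>K r n m. z = b \<oplus>\<^bsub>M n m\<^esub> c"
  unfolding K_def using compl_facts[OF Zb_sub[OF assms, of n m] Bb_sub Bb_Zb[OF assms]] by blast+

text \<open>The graph of the page differential: lift e to a cycle y, apply \<open>D\<close>, and
  reduce the class modulo boundaries to the chosen complement.\<close>

definition Erel where
  "Erel r n m e e' \<longleftrightarrow> (\<exists>y\<in>A n r (n + m). \<phi> n m y = e \<and>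
    dif (M (n + r) (m + 1 - r)) (\<phi> (n + r) (m + 1 - r) (D y)) e' \<in> Bb r (n + r) (m + 1 - r))"

definition E where "E r n m = (M n m)\<lparr>carrier := K (int r) n m\<rparr>"

text \<open>\<open>Erel\<close> is total because cycles decompose into boundary and complement, and
  it relates zero only to zero by \<open>boundary_wd\<close>.\<close>

lemma differential_exists:
  assumes r: "2 \<le> r"
  shows "\<exists>f. lin ((M n m)\<lparr>carrier := K r n m\<rparr>) ((M (n + r) (m + 1 - r))\<lparr>carrier := K r (n + r) (m + 1 - r)\<rparr>) f
    \<and> (\<forall>x\<in>K r n m. \<forall>y\<in>K r (n + r) (m + 1 - r). Erel r n m x y \<longleftrightarrow> y = f x)"
proof -
  let ?n = "n + r" and ?m = "m + 1 - r"
  let ?M = "M n m" and ?M' = "M ?n ?m"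
  note s [simp] = sub_facts[OF K_sub[OF r, of n m]] sub_facts[OF K_sub[OF r, of ?n ?m]] sub_facts[OF Bb_sub[of r ?n ?m]]
  have Dy: "D y \<in> A ?n 2 (?n + ?m)" if "y \<in> A n r (n + m)" for y using A_D[OF that, of ?n "?n + ?m" 2] by simp
  have p: "\<phi> ?n ?m (D y) \<in> carrier ?M'" if "y \<in> A n r (n + m)" for y using phi_closed[OF refl Dy[OF that]] .
  have "\<exists>f. lin (?M\<lparr>carrier := K r n m\<rparr>) (?M'\<lparr>carrier := K r ?n ?m\<rparr>) f
    \<and> (\<forall>x\<in>carrier (?M\<lparr>carrier := K r n m\<rparr>). \<forall>y\<in>carrier (?M'\<lparr>carrier := K r ?n ?m\<rparr>). Erel r n m x y \<longleftrightarrow> y = f x)"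
  proof (rule linear_relation; (unfold module.simps ring.simps partial_object.simps)?)
    show "VS (?M\<lparr>carrier := K r n m\<rparr>)" "VS (?M'\<lparr>carrier := K r ?n ?m\<rparr>)" using K_sub[OF r] by simp_all
  next
    fix x assume "x \<in> carrier (?M\<lparr>carrier := K r n m\<rparr>)"
    then have "x \<in> Zb r n m" using K_Zb[OF r] by auto
    then obtain y where y: "y \<in> A n r (n + m)" "x = \<phi> n m y" by (auto simp: Zb_iff)
    have "\<phi> ?n ?m (D y) \<in> Zb r ?n ?m" unfolding Zb_def by (intro imageI A_D[OF y(1)]) simp_all
    from K_sum[OF r this] obtain b c where
      b: "b \<in> Bb r ?n ?m" "c \<in> K r ?n ?m" "\<phi> ?n ?m (D y) = b \<oplus>\<^bsub>?M'\<^esub> c" by blast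
    then have "dif ?M' (\<phi> ?n ?m (D y)) c = b" by (simp add: vs_dif_eq vs_comm)
    then have "Erel r n m x c" unfolding Erel_def using y b(1) by (intro bexI[of _ y] conjI) simp_all
    then show "\<exists>c\<in>carrier (?M'\<lparr>carrier := K r ?n ?m\<rparr>). Erel r n m x c" using b(2) by auto
  next
    fix x y x' y' assume c: "y \<in> carrier (?M'\<lparr>carrier := K r ?n ?m\<rparr>)" "y' \<in> carrier (?M'\<lparr>carrier := K r ?n ?m\<rparr>)"
      and "Erel r n m x y" "Erel r n m x' y'"
    then obtain u u' where u: "u \<in> A n r (n + m)" "\<phi> n m u = x" "dif ?M' (\<phi> ?n ?m (D u)) y \<in> Bb r ?n ?m"
      "u' \<in> A n r (n + m)" "\<phi> n m u' = x'" "dif ?M' (\<phi> ?n ?m (D u')) y' \<in> Bb r ?n ?m"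
      by (auto simp: Erel_def)
    have "\<phi> ?n ?m (D (u \<oplus>\<^bsub>X\<^esub> u')) = \<phi> ?n ?m (D u) \<oplus>\<^bsub>?M'\<^esub> \<phi> ?n ?m (D u')"
      using lin_add[OF D_lin AX[OF u(1)] AX[OF u(4)]] phi_add[OF refl Dy[OF u(1)] Dy[OF u(4)]] by simp
    then have "dif ?M' (\<phi> ?n ?m (D (u \<oplus>\<^bsub>X\<^esub> u'))) (y \<oplus>\<^bsub>?M'\<^esub> y') =
      dif ?M' (\<phi> ?n ?m (D u)) y \<oplus>\<^bsub>?M'\<^esub> dif ?M' (\<phi> ?n ?m (D u')) y'"
      using u c p[OF u(1)] p[OF u(4)] M_VS
      by (simp add: vdiff_def vs_smult_add vs_ac)
    then have "dif ?M' (\<phi> ?n ?m (D (u \<oplus>\<^bsub>X\<^esub> u'))) (y \<oplus>\<^bsub>?M'\<^esub> y') \<in> Bb r ?n ?m" using u by simp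
    moreover have "\<phi> n m (u \<oplus>\<^bsub>X\<^esub> u') = x \<oplus>\<^bsub>?M\<^esub> x'" using u r by (simp add: phi_add[OF refl] A2)
    ultimately show "Erel r n m (x \<oplus>\<^bsub>?M\<lparr>carrier := K r n m\<rparr>\<^esub> x') (y \<oplus>\<^bsub>?M'\<lparr>carrier := K r ?n ?m\<rparr>\<^esub> y')"
      using sub_add[OF A_sub u(1) u(4)] by (auto simp: Erel_def)
  next
    fix c x y assume c: "y \<in> carrier (?M'\<lparr>carrier := K r ?n ?m\<rparr>)" "c \<in> carrier k" and "Erel r n m x y"
    then obtain u where u: "u \<in> A n r (n + m)" "\<phi> n m u = x" "dif ?M' (\<phi> ?n ?m (D u)) y \<in> Bb r ?n ?m"
      by (auto simp: Erel_def)
    have "\<phi> ?n ?m (D (c \<odot>\<^bsub>X\<^esub> u)) = c \<odot>\<^bsub>?M'\<^esub> \<phi> ?n ?m (D u)"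
      using lin_smult[OF D_lin c(2) AX[OF u(1)]] phi_smult[OF refl c(2) Dy[OF u(1)]] by simp
    then have "dif ?M' (\<phi> ?n ?m (D (c \<odot>\<^bsub>X\<^esub> u))) (c \<odot>\<^bsub>?M'\<^esub> y) = c \<odot>\<^bsub>?M'\<^esub> dif ?M' (\<phi> ?n ?m (D u)) y"
      using u c p[OF u(1)] M_VS
      by (simp add: vdiff_def vs_smult_add vs_smult_comm[of _ c])
    then have "dif ?M' (\<phi> ?n ?m (D (c \<odot>\<^bsub>X\<^esub> u))) (c \<odot>\<^bsub>?M'\<^esub> y) \<in> Bb r ?n ?m" using u c by simp
    moreover have "\<phi> n m (c \<odot>\<^bsub>X\<^esub> u) = c \<odot>\<^bsub>?M\<^esub> x" using u r c by (simp add: phi_smult[OF refl] A2)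
    ultimately show "Erel r n m (c \<odot>\<^bsub>?M\<lparr>carrier := K r n m\<rparr>\<^esub> x) (c \<odot>\<^bsub>?M'\<lparr>carrier := K r ?n ?m\<rparr>\<^esub> y)"
      using sub_smult[OF A_sub c(2) u(1)] by (auto simp: Erel_def)
  next
    fix y assume y: "y \<in> carrier (?M'\<lparr>carrier := K r ?n ?m\<rparr>)" and "Erel r n m \<zero>\<^bsub>?M\<lparr>carrier := K r n m\<rparr>\<^esub> y"
    then obtain u where u: "u \<in> A n r (n + m)" "\<phi> n m u = \<zero>\<^bsub>?M\<^esub>" "dif ?M' (\<phi> ?n ?m (D u)) y \<in> Bb r ?n ?m"
      by (auto simp: Erel_def)
    have "\<phi> ?n ?m (D u) \<in> Bb r ?n ?m" using boundary_wd[OF u(1) r] u(2) sub_zero[OF Bb_sub] by simp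
    \<comment> \<open>As a difference of two boundaries the value y is a boundary; it also lies in
      the complement, hence is zero.\<close>
    then have "dif ?M' (\<phi> ?n ?m (D u)) (dif ?M' (\<phi> ?n ?m (D u)) y) \<in> Bb r ?n ?m" using u by simp
    moreover have "dif ?M' (\<phi> ?n ?m (D u)) (dif ?M' (\<phi> ?n ?m (D u)) y) = y"
      using y p[OF u(1)] by (subst vs_dif_eq) simp_all
    ultimately show "y = \<zero>\<^bsub>?M'\<lparr>carrier := K r ?n ?m\<rparr>\<^esub>" using K_Int[OF r, of ?n ?m] y by auto
  qed
  then show ?thesis by simp
qed

definition Dr where
  "Dr r n m = (SOME f. lin ((M n m)\<lparr>carrier := K r n m\<rparr>) ((M (n + r) (m + 1 - r))\<lparr>carrier := K r (n + r) (m + 1 - r)\<rparr>) f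
    \<and> (\<forall>x\<in>K r n m. \<forall>y\<in>K r (n + r) (m + 1 - r). Erel r n m x y \<longleftrightarrow> y = f x))"

lemma Dr_facts:
  assumes "2 \<le> r"
  shows Dr_lin: "lin ((M n m)\<lparr>carrier := K r n m\<rparr>) ((M (n + r) (m + 1 - r))\<lparr>carrier := K r (n + r) (m + 1 - r)\<rparr>) (Dr r n m)"
    and Dr_iff: "x \<in> K r n m \<Longrightarrow> y \<in> K r (n + r) (m + 1 - r) \<Longrightarrow> y = Dr r n m x \<longleftrightarrow> Erel r n m x y"
  using someI_ex[OF differential_exists[OF assms, of n m]] unfolding Dr_def[symmetric] by blast+

lemma Dr_closed: "2 \<le> r \<Longrightarrow> x \<in> K r n m \<Longrightarrow> Dr r n m x \<in> K r (n + r) (m + 1 - r)"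
  using lin_closed[OF Dr_lin, of r x n m] by simp

text \<open>A vanishing value says that the class of D y is a boundary, and by
  \<open>boundary_Zb\<close> such a class comes from a cycle of the next page.\<close>

lemma Dr_kernel:
  assumes r: "2 \<le> r"
  shows "{x \<in> K r n m. Dr r n m x = \<zero>\<^bsub>M (n + r) (m + 1 - r)\<^esub>} = K r n m \<inter> Zb (r + 1) n m"
proof (intro equalityI subsetI)
  let ?n = "n + r" and ?m = "m + 1 - r"
  note z = sub_zero[OF K_sub[OF r, of ?n ?m]]
  have p: "\<phi> ?n ?m (D y) \<in> carrier (M ?n ?m)" if "y \<in> A n r (n + m)" for y
    using phi_closed[OF refl, of "D y"] A_D[OF that, of ?n "?n + ?m" 2] by simp
  fix x
  { assume "x \<in> {x \<in> K r n m. Dr r n m x = \<zero>\<^bsub>M ?n ?m\<^esub>}"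
    then have x: "x \<in> K r n m" "Erel r n m x \<zero>\<^bsub>M ?n ?m\<^esub>" using Dr_iff[OF r _ z, of x] by auto
    then obtain y where y: "y \<in> A n r (n + m)" "\<phi> n m y = x" "\<phi> ?n ?m (D y) \<in> Bb r ?n ?m"
      using M_VS p by (auto simp: Erel_def)
    then show "x \<in> K r n m \<inter> Zb (r + 1) n m" using boundary_Zb[OF y(1) r] x by auto }
  { assume "x \<in> K r n m \<inter> Zb (r + 1) n m"
    then obtain y where y: "x \<in> K r n m" "y \<in> A n (r + 1) (n + m)" "x = \<phi> n m y" by (auto simp: Zb_iff)
    have y': "y \<in> A n r (n + m)" by (rule A_le[OF y(2)]) auto
    have "dif (M ?n ?m) (\<phi> ?n ?m (D y)) \<zero>\<^bsub>M ?n ?m\<^esub> \<in> Bb r ?n ?m"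
      using Zb_boundary[OF y(2)] M_VS sub_zero[OF Bb_sub[of r ?n ?m]] by simp
    then have "Erel r n m x \<zero>\<^bsub>M ?n ?m\<^esub>" using y(3) y' unfolding Erel_def by (intro bexI[of _ y] conjI) simp_all
    then show "x \<in> {x \<in> K r n m. Dr r n m x = \<zero>\<^bsub>M ?n ?m\<^esub>}" using Dr_iff[OF r y(1) z] y by auto }
qed

text \<open>A boundary of page r + 1 is the class of D z with z in \<open>A n r\<close>. The class
  of z need not lie in the complement, but subtracting a boundary D w moves it there without
  changing D z.\<close>

lemma Dr_image:
  assumes r: "2 \<le> r"
  shows "Dr r n m ` K r n m = K r (n + r) (m + 1 - r) \<inter> Bb (r + 1) (n + r) (m + 1 - r)"
proof (intro equalityI subsetI)
  let ?n = "n + r" and ?m = "m + 1 - r"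
  have p: "\<phi> ?n ?m (D y) \<in> carrier (M ?n ?m)" if "y \<in> A n r (n + m)" for y
    using phi_closed[OF refl, of "D y"] A_D[OF that, of ?n "?n + ?m" 2] by simp
  fix e
  { assume "e \<in> Dr r n m ` K r n m"
    then obtain x where x: "x \<in> K r n m" "e = Dr r n m x" by auto
    then have e: "e \<in> K r ?n ?m" using Dr_closed[OF r] by simp
    then obtain y where y: "y \<in> A n r (n + m)" "dif (M ?n ?m) (\<phi> ?n ?m (D y)) e \<in> Bb r ?n ?m"
      using x Dr_iff[OF r x(1) e] by (auto simp: Erel_def)
    have "\<phi> ?n ?m (D y) \<in> Bb (r + 1) ?n ?m" unfolding Bb_iff using y(1) by (intro bexI[of _ y]) auto
    then have "dif (M ?n ?m) (\<phi> ?n ?m (D y)) (dif (M ?n ?m) (\<phi> ?n ?m (D y)) e) \<in> Bb (r + 1) ?n ?m"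
      using subsetD[OF Bb_Suc y(2)] by (rule sub_dif[OF Bb_sub])
    moreover have "dif (M ?n ?m) (\<phi> ?n ?m (D y)) (dif (M ?n ?m) (\<phi> ?n ?m (D y)) e) = e"
      using sub_carrier[OF K_sub[OF r] e] p[OF y(1)] M_VS by (subst vs_dif_eq) auto
    ultimately show "e \<in> K r ?n ?m \<inter> Bb (r + 1) ?n ?m" using e by simp }
  { assume e: "e \<in> K r ?n ?m \<inter> Bb (r + 1) ?n ?m"
    then obtain z where z: "z \<in> A n r (n + m)" "e = \<phi> ?n ?m (D z)" by (auto simp: Bb_iff)
    then have "\<phi> n m z \<in> Zb r n m" by (auto simp: Zb_iff)
    from K_sum[OF r this] obtain b x where
      b: "b \<in> Bb r n m" "x \<in> K r n m" "\<phi> n m z = b \<oplus>\<^bsub>M n m\<^esub> x" by blast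
    then obtain w where w: "w \<in> A (n - r + 1) (r - 1) (n + m - 1)" "b = \<phi> n m (D w)" by (auto simp: Bb_iff)
    have wz: "dif X z (D w) \<in> A n r (n + m)" by (rule sub_dif[OF A_sub z(1) DA[OF w(1)]])
    have "\<phi> n m (dif X z (D w)) = dif (M n m) (b \<oplus>\<^bsub>M n m\<^esub> x) b"
      using phi_dif[OF refl A2[OF z(1) r] DA[OF w(1)]] b w by simp
    also have "\<dots> = x" using b sub_carrier[OF K_sub[OF r]] sub_carrier[OF Bb_sub] M_VS by (subst vs_dif_eq) auto
    finally have "\<phi> n m (dif X z (D w)) = x" .
    moreover have "D (dif X z (D w)) = D z" using AX[OF z(1)] AX[OF w(1)] X_VS by (simp add: D_dif DX D_D)
    moreover have "dif (M ?n ?m) e e \<in> Bb r ?n ?m"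
      using e sub_carrier[OF K_sub[OF r]] M_VS sub_zero[OF Bb_sub] by simp
    ultimately have "Erel r n m x e" unfolding Erel_def using wz z(2) by metis
    then show "e \<in> Dr r n m ` K r n m" using Dr_iff[OF r b(2)] e b(2) by auto }
qed

text \<open>For n < 0 the step F (n + 1) is still the whole space. For m < 0 the total degree n + m
  is below the filtration degree n, where only zero is left.\<close>

lemma M_zero: "n < 0 \<or> m < 0 \<Longrightarrow> carrier (M n m) = {\<zero>\<^bsub>M n m\<^esub>}"
proof -
  assume nm: "n < 0 \<or> m < 0"
  have "\<phi> n m y = \<zero>\<^bsub>M n m\<^esub>" if y: "y \<in> A n 2 (n + m)" for y
  proof (rule phi_F[OF y refl])
    show "y \<in> F (n + 1)"
    proof (cases "n < 0")
      case True
      then show ?thesis using AX[OF y] by (simp add: F_whole)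
    next
      case False
      then have "y = \<zero>\<^bsub>X\<^esub>" using nm F_high[of y "n + m" n] y by (auto simp: A_iff)
      then show ?thesis using F_zero by simp
    qed
  qed
  then show ?thesis using phi_surj[of n m] M_VS by force
qed

lemma zero_subspace:
  assumes "n < 0 \<or> m < 0" "sub U (M n m)"
  shows "U = {\<zero>\<^bsub>M n m\<^esub>}"
proof
  show "U \<subseteq> {\<zero>\<^bsub>M n m\<^esub>}" using sub_carrier[OF assms(2)] unfolding M_zero[OF assms(1)] by (rule subsetI)
  show "{\<zero>\<^bsub>M n m\<^esub>} \<subseteq> U" using sub_zero[OF assms(2)] by simp
qed

text \<open>The boundaries of page 2 are zero and its cycles are everything, so the complement is
  all of \<open>M\<close>. This is why the second page equals \<open>M\<close> on the nose.\<close>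

lemma K_2: "K 2 n m = carrier (M n m)"
proof -
  have "x \<in> K 2 n m" if x: "x \<in> carrier (M n m)" for x
  proof -
    obtain b c where "b \<in> Bb 2 n m" "c \<in> K 2 n m" "x = b \<oplus>\<^bsub>M n m\<^esub> c"
      using K_sum[of 2 x n m] x by (auto simp: Zb_2)
    then show ?thesis using sub_carrier[OF K_sub, of 2 c n m] M_VS by (simp add: Bb_2)
  qed
  then show ?thesis using sub_carrier[OF K_sub, of 2 _ n m] by auto
qed

lemma E_2: "E 2 n m = M n m"
  by (simp add: E_def K_2)

text \<open>Both sides represent the classical quotient of \<open>Zb (r + 1)\<close> by
  \<open>Bb (r + 1)\<close>: one as the complement chosen on page r + 1, the other cut down to the
  complement chosen on page r.\<close>

lemma page_iso:
  assumes r: "2 \<le> r"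
  shows "vs_iso k ((M n m)\<lparr>carrier := K (r + 1) n m\<rparr>)
    (quot_module ((M n m)\<lparr>carrier := K r n m \<inter> Zb (r + 1) n m\<rparr>) (K r n m \<inter> Bb (r + 1) n m))"
proof -
  have r1: "2 \<le> r + 1" using r by simp
  note f [simp] = sub_facts[OF K_sub[OF r, of n m]] sub_facts[OF K_sub[OF r1, of n m]]
    sub_facts[OF Bb_sub[of "r + 1" n m]] sub_facts[OF Bb_sub[of r n m]] sub_facts[OF Zb_sub[OF r1, of n m]]
  have "vs_iso k ((M n m)\<lparr>carrier := K (r + 1) n m\<rparr>)
    (quot_module ((M n m)\<lparr>carrier := K r n m \<inter> Zb (r + 1) n m\<rparr>) ((K r n m \<inter> Zb (r + 1) n m) \<inter> Bb (r + 1) n m))"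
  proof (rule subspace_iso)
    show "sub (K (r + 1) n m) (M n m)" "sub (Bb (r + 1) n m) (M n m)" by (intro K_sub Bb_sub r1)+
    show "sub (K r n m \<inter> Zb (r + 1) n m) (M n m)" by (intro sub_Int K_sub Zb_sub r r1)
    show "K (r + 1) n m \<inter> Bb (r + 1) n m \<subseteq> {\<zero>\<^bsub>M n m\<^esub>}" by (rule K_Int[OF r1])
  next
    fix x assume x: "x \<in> K (r + 1) n m"
    then have xZ: "x \<in> Zb (r + 1) n m" using K_Zb[OF r1] by auto
    from K_sum[OF r subsetD[OF Zb_Suc this]] obtain b c where
      b: "b \<in> Bb r n m" "c \<in> K r n m" "x = b \<oplus>\<^bsub>M n m\<^esub> c" by blast
    have d: "dif (M n m) x b = c" "dif (M n m) x c = b" using b by (simp_all add: vs_dif_eq vs_comm)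
    have "b \<in> Zb (r + 1) n m" by (rule subsetD[OF Bb_Zb[OF r1] b(1)])
    then have "dif (M n m) x b \<in> Zb (r + 1) n m" by (rule sub_dif[OF Zb_sub[OF r1] xZ])
    then have "c \<in> Zb (r + 1) n m" by (simp only: d)
    then show "\<exists>y\<in>K r n m \<inter> Zb (r + 1) n m. dif (M n m) x y \<in> Bb (r + 1) n m"
      using b d(2) subsetD[OF Bb_Suc b(1)] by (intro bexI[of _ c]) simp_all
  next
    fix y assume y: "y \<in> K r n m \<inter> Zb (r + 1) n m"
    then have "y \<in> Zb (r + 1) n m" by simp
    from K_sum[OF r1 this] obtain b c where
      b: "b \<in> Bb (r + 1) n m" "c \<in> K (r + 1) n m" "y = b \<oplus>\<^bsub>M n m\<^esub> c" by blast
    have "c = y \<oplus>\<^bsub>M n m\<^esub> dif (M n m) \<zero>\<^bsub>M n m\<^esub> b"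
      using b vs_assoc[of "M n m" c b "dif (M n m) \<zero>\<^bsub>M n m\<^esub> b"] by (simp add: vs_comm[of "M n m" b c])
    then have "dif (M n m) c y = dif (M n m) \<zero>\<^bsub>M n m\<^esub> b"
      using b by (subst vs_dif_eq) simp_all
    moreover have "dif (M n m) \<zero>\<^bsub>M n m\<^esub> b \<in> Bb (r + 1) n m" using b(1) by simp
    ultimately have "dif (M n m) c y \<in> Bb (r + 1) n m" by simp
    then show "\<exists>x\<in>K (r + 1) n m. dif (M n m) x y \<in> Bb (r + 1) n m" using b by blast
  qed
  moreover have "(K r n m \<inter> Zb (r + 1) n m) \<inter> Bb (r + 1) n m = K r n m \<inter> Bb (r + 1) n m"
    using Bb_Zb[OF r1] by blast
  ultimately show ?thesis by simp
qed

theorem spectral: "spectral_sequence k E (\<lambda>r. Dr (int r))"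
  unfolding spectral_sequence_def
proof (intro allI impI conjI)
  fix r :: nat and n m :: int assume "2 \<le> r"
  then have r: "2 \<le> int r" by simp
  show "VS (E r n m)" by (simp add: E_def K_sub[OF r])
  show "carrier (E r n m) = {\<zero>\<^bsub>E r n m\<^esub>}" if "n < 0 \<or> m < 0"
    using zero_subspace[OF that K_sub[OF r, of n m]] by (simp add: E_def)
  show "lin (E r n m) (E r (n + int r) (m + 1 - int r)) (Dr (int r) n m)"
    unfolding E_def by (rule Dr_lin[OF r])
  show "\<forall>x\<in>carrier (E r n m). Dr (int r) (n + int r) (m + 1 - int r) (Dr (int r) n m x)
      = \<zero>\<^bsub>E r (n + int r + int r) (m + 1 - int r + 1 - int r)\<^esub>"
  proof
    fix x assume x: "x \<in> carrier (E r n m)"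
    \<comment> \<open>A value of the differential is a boundary of page r + 1, hence a permanent
      cycle, hence in the kernel of the next differential.\<close>
    have "Dr (int r) n m x \<in> K (int r) (n + int r) (m + 1 - int r) \<inter> Bb (int r + 1) (n + int r) (m + 1 - int r)"
      using Dr_image[OF r, of n m] x by (auto simp: E_def)
    then have "Dr (int r) n m x \<in> K (int r) (n + int r) (m + 1 - int r) \<inter> Zb (int r + 1) (n + int r) (m + 1 - int r)"
      using Bb_Zb[of "int r + 1" "int r + 1"] r by force
    then show "Dr (int r) (n + int r) (m + 1 - int r) (Dr (int r) n m x)
      = \<zero>\<^bsub>E r (n + int r + int r) (m + 1 - int r + 1 - int r)\<^esub>"
      unfolding Dr_kernel[OF r, symmetric] by (simp add: E_def)
  qed
  have "Dr (int r) (n - int r) (m - 1 + int r) ` K (int r) (n - int r) (m - 1 + int r)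
    = K (int r) n m \<inter> Bb (int r + 1) n m"
    using Dr_image[OF r, of "n - int r" "m - 1 + int r"] by simp
  then show "vs_iso k (E (Suc r) n m)
        (quot_module
          ((E r n m)\<lparr>carrier :=
             {x \<in> carrier (E r n m). Dr (int r) n m x = \<zero>\<^bsub>E r (n + int r) (m + 1 - int r)\<^esub>}\<rparr>)
          (Dr (int r) (n - int r) (m - 1 + int r) ` carrier (E r (n - int r) (m - 1 + int r))))"
    using page_iso[OF r, of n m] Dr_kernel[OF r, of n m] by (simp add: E_def add.commute)
qed

section \<open>The limit page and convergence\<close>

definition Zc where "Zc n s = {y \<in> T s \<inter> F n. D y = \<zero>\<^bsub>X\<^esub>}"

definition Zi where "Zi n m = \<phi> n m ` Zc n (n + m)"

text \<open>In the limit the preimage z of a boundary may start in any filtration degree.\<close>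

definition Bi where "Bi n m = \<phi> n m ` D ` {z \<in> T (n + m - 1). D z \<in> F n}"

definition Ki where "Ki n m = compl (M n m) (Zi n m) (Bi n m)"

text \<open>For r at least m + 2, D y has filtration degree n + r above its total degree n + m + 1
  and must vanish. For r at least n + 1, boundaries start in filtration degree n - r + 1, which is
  not positive and so imposes no condition.\<close>

lemma stable:
  assumes r: "2 \<le> r" "m + 2 \<le> r" "n + 1 \<le> r"
  shows "Zb r n m = Zi n m" "Bb r n m = Bi n m" "K r n m = Ki n m"
proof -
  have "A n r (n + m) = Zc n (n + m)"
  proof (rule Set.set_eqI)
    fix y
    have "D y = \<zero>\<^bsub>X\<^esub>" if "y \<in> T (n + m)" "D y \<in> F (n + r)"
      using F_high[OF T_D[OF that(1)] that(2)] r by simp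
    then show "y \<in> A n r (n + m) \<longleftrightarrow> y \<in> Zc n (n + m)"
      by (cases "D y = \<zero>\<^bsub>X\<^esub>") (simp_all add: A_iff Zc_def, blast)
  qed
  then show 1: "Zb r n m = Zi n m" by (simp add: Zb_def Zi_def)
  have "A (n - r + 1) (r - 1) (n + m - 1) = {z \<in> T (n + m - 1). D z \<in> F n}"
  proof (rule Set.set_eqI)
    fix z
    have "F (n - r + 1) = carrier X" using r by (intro F_whole) simp
    then show "z \<in> A (n - r + 1) (r - 1) (n + m - 1) \<longleftrightarrow> z \<in> {z \<in> T (n + m - 1). D z \<in> F n}"
      using TX[of z "n + m - 1"] by (cases "z \<in> T (n + m - 1)") (simp_all add: A_iff)
  qed
  then show 2: "Bb r n m = Bi n m" by (simp add: Bb_def Bi_def)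
  show "K r n m = Ki n m" by (simp add: K_def Ki_def 1 2)
qed

lemma stable_r: "\<exists>r\<ge>2. m + 2 \<le> r \<and> n + 1 \<le> (r :: int)"
  by (rule exI[of _ "max 2 (max (m + 2) (n + 1))"]) auto

lemma Ki_facts:
  shows Ki_sub: "sub (Ki n m) (M n m)" and Ki_Zi: "Ki n m \<subseteq> Zi n m"
    and Ki_Int: "Ki n m \<inter> Bi n m \<subseteq> {\<zero>\<^bsub>M n m\<^esub>}"
    and Ki_sum: "z \<in> Zi n m \<Longrightarrow> \<exists>b\<in>Bi n m. \<exists>c\<in>Ki n m. z = b \<oplus>\<^bsub>M n m\<^esub> c"
proof -
  obtain r where r: "r \<ge> 2" "m + 2 \<le> r" "n + 1 \<le> r" using stable_r by blast
  from K_facts[OF r(1), where n = n and m = m, unfolded stable[OF r]]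
  show "sub (Ki n m) (M n m)" "Ki n m \<subseteq> Zi n m" "Ki n m \<inter> Bi n m \<subseteq> {\<zero>\<^bsub>M n m\<^esub>}"
    "z \<in> Zi n m \<Longrightarrow> \<exists>b\<in>Bi n m. \<exists>c\<in>Ki n m. z = b \<oplus>\<^bsub>M n m\<^esub> c" by blast+
qed

lemma Zc_sub: "sub (Zc n s) X"
proof -
  have "Zc n s = T s \<inter> F n \<inter> {y \<in> carrier X. D y = \<zero>\<^bsub>X\<^esub>}" by (auto simp: Zc_def TX)
  then show ?thesis using sub_Int[OF sub_Int[OF T_sub F_sub] sub_kernel[OF D_lin]] by simp
qed

lemma Zc_A: "y \<in> Zc n s \<Longrightarrow> y \<in> A n r s"
  using F_zero by (auto simp: Zc_def A_iff)

lemma Zi_sub: "sub (Zi n m) (M n m)"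
proof -
  obtain r where r: "r \<ge> 2" "m + 2 \<le> r" "n + 1 \<le> r" using stable_r by blast
  from Zb_sub[OF r(1), of n m] show ?thesis unfolding stable(1)[OF r] .
qed

text \<open>The cohomology in degree s is filtered by the images \<open>L n\<close> of the cocycles
  in F n. Representing limit classes linearly by cocycles identifies \<open>Ki n\<close> with the
  n-th graded piece, and the filtration splits.\<close>

lemma converges_degree:
  fixes s :: nat
  shows "vs_iso k (dsum UNIV (\<lambda>n. (M n (int s - n))\<lparr>carrier := Ki n (int s - n)\<rparr>)) (H s)"
proof -
  let ?s = "int s"
  define Kn where "Kn n = (M n (?s - n))\<lparr>carrier := Ki n (?s - n)\<rparr>" for n
  define f where "f n = \<phi> n (?s - n)" for n
  have fcl: "lin (X\<lparr>carrier := Zc n ?s\<rparr>) ((M n (?s - n))\<lparr>carrier := Zi n (?s - n)\<rparr>) (f n)" for n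
  proof (rule lin_corestrict)
    have "lin ((X\<lparr>carrier := A n 2 (n + (?s - n))\<rparr>)\<lparr>carrier := Zc n ?s\<rparr>) (M n (?s - n)) (f n)"
      unfolding f_def by (rule lin_restrict[OF phi_lin], rule sub_sub[OF A_sub Zc_sub]) (auto intro: Zc_A)
    then show "lin (X\<lparr>carrier := Zc n ?s\<rparr>) (M n (?s - n)) (f n)" by simp
    show "sub (Zi n (?s - n)) (M n (?s - n))" by (rule Zi_sub)
  qed (auto simp: Zi_def f_def)
  \<comment> \<open>A linear choice of representing cocycles; with it the maps \<open>G n\<close>
    are linear.\<close>
  have "\<exists>g. lin ((M n (?s - n))\<lparr>carrier := Zi n (?s - n)\<rparr>) (X\<lparr>carrier := Zc n ?s\<rparr>) g \<and>
    (\<forall>e\<in>Zi n (?s - n). f n (g e) = e)" for n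
    by (rule linear_section[OF fcl[of n]]) (auto simp: Zi_def f_def)
  then obtain g where g: "\<And>n. lin ((M n (?s - n))\<lparr>carrier := Zi n (?s - n)\<rparr>) (X\<lparr>carrier := Zc n ?s\<rparr>) (g n)"
    "\<And>n e. e \<in> Zi n (?s - n) \<Longrightarrow> f n (g n e) = e" by metis
  define L where "L n = cl s ` Zc n ?s" for n
  define G where "G n e = cl s (g n e)" for n e
  let ?C = "{y \<in> T ?s. D y = \<zero>\<^bsub>X\<^esub>}"
  have Zc0: "Zc 0 ?s = ?C" by (auto simp: Zc_def F_whole TX)
  have C_sub: "sub ?C X" using Zc_sub[of 0 ?s] by (simp only: Zc0)
  have ZcC: "Zc n ?s \<subseteq> ?C" for n by (auto simp: Zc_def)
  have gZ: "g n e \<in> Zc n ?s" if "e \<in> Zi n (?s - n)" for n e using lin_closed[OF g(1)] that by simp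
  have gK: "g n e \<in> Zc n ?s" "f n (g n e) = e" if "e \<in> Ki n (?s - n)" for n e
    using gZ g(2) Ki_Zi that by blast+
  have ZX: "y \<in> Zc n ?s \<Longrightarrow> y \<in> carrier X" for y n by (rule sub_carrier[OF Zc_sub])
  have fF: "f n y = \<zero>\<^bsub>M n (?s - n)\<^esub>" if "y \<in> Zc (n + 1) ?s" for n y
  proof -
    have "y \<in> Zc n ?s" using that by (auto simp: Zc_def intro: F_le)
    then show ?thesis unfolding f_def using phi_F[OF Zc_A, of y n ?s "?s - n"] that by (simp add: Zc_def)
  qed
  note cla = lin_add[OF cl_lin[of s], simplified]
  have "vs_iso k (dsum UNIV Kn) (H s)"
  proof (rule dsum_iso_filtered[where G = G and L = L and s = s])
    show "VS (H s)" by (rule H_VS)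
    show "VS (Kn n)" for n by (simp add: Kn_def Ki_sub)
    show "carrier (Kn n) = {\<zero>\<^bsub>Kn n\<^esub>}" if "n < 0 \<or> n > int s" for n
      using zero_subspace[OF _ Ki_sub[of n "?s - n"]] that by (simp add: Kn_def)
    show "lin (Kn n) (H s) (G n)" for n
      unfolding G_def
    proof (rule lin_comp[where V = "X\<lparr>carrier := Zc n ?s\<rparr>"])
      have "lin ((X\<lparr>carrier := ?C\<rparr>)\<lparr>carrier := Zc n ?s\<rparr>) (H s) (cl s)"
        by (rule lin_restrict[OF cl_lin], rule sub_sub[OF C_sub Zc_sub ZcC])
      then show "lin (X\<lparr>carrier := Zc n ?s\<rparr>) (H s) (cl s)" by simp
      have "lin (((M n (?s - n))\<lparr>carrier := Zi n (?s - n)\<rparr>)\<lparr>carrier := Ki n (?s - n)\<rparr>) (X\<lparr>carrier := Zc n ?s\<rparr>) (g n)"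
        by (rule lin_restrict[OF g(1)], rule sub_sub[OF Zi_sub Ki_sub Ki_Zi])
      then show "lin (Kn n) (X\<lparr>carrier := Zc n ?s\<rparr>) (g n)" by (simp add: Kn_def)
    qed
    have L_sub: "sub (L n) (H s)" for n
      unfolding L_def by (rule sub_image[OF cl_lin sub_sub[OF C_sub Zc_sub ZcC]])
    then show "sub (L n) (H s)" for n .
    show "L (n + 1) \<subseteq> L n" for n unfolding L_def Zc_def using F_dec[of n "n + 1"] by auto
    show "L 0 = carrier (H s)" unfolding L_def Zc0 using cl_surj[of s] lin_closed[OF cl_lin[of s]] by auto
    have "y = \<zero>\<^bsub>X\<^esub>" if "y \<in> Zc (?s + 1) ?s" for y using F_high that by (auto simp: Zc_def)
    then show "L (?s + 1) \<subseteq> {\<zero>\<^bsub>H s\<^esub>}" unfolding L_def using lin_zero[OF cl_lin[of s]] by auto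
    show "G n e \<in> L n" if "e \<in> carrier (Kn n)" for n e using gK that by (auto simp: Kn_def G_def L_def)
  next
    \<comment> \<open>Existence: remove from y a boundary D z and the representative of the
      component in \<open>Ki\<close>. What remains has class zero, so subtracting one more boundary
      D w carries it into F (n + 1).\<close>
    fix n h assume "h \<in> L n"
    then obtain y where y: "y \<in> Zc n ?s" "h = cl s y" by (auto simp: L_def)
    then have "f n y \<in> Zi n (?s - n)" by (auto simp: Zi_def f_def)
    from Ki_sum[OF this] obtain b e where
      b: "b \<in> Bi n (?s - n)" "e \<in> Ki n (?s - n)" "f n y = b \<oplus>\<^bsub>M n (?s - n)\<^esub> e" by blast
    then obtain z where z: "z \<in> T (?s - 1)" "D z \<in> F n" "b = f n (D z)" by (auto simp: Bi_def f_def)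
    have Dz: "D z \<in> Zc n ?s" using z T_D[OF z(1)] D_D[OF TX[OF z(1)]] by (simp add: Zc_def)
    note e = gK[OF b(2)]
    define u where "u = D z \<oplus>\<^bsub>X\<^esub> g n e"
    have u: "u \<in> Zc n ?s" unfolding u_def using sub_add[OF Zc_sub Dz e(1)] .
    have "f n u = f n y" unfolding u_def using lin_add[OF fcl[of n]] Dz e b z by simp
    then have "f n (dif X y u) = \<zero>\<^bsub>M n (?s - n)\<^esub>"
      using lin_dif[OF fcl[of n]] y u M_VS lin_closed[OF phi_lin[of n "?s - n"], of y] Zc_A[of y n ?s 2] by (simp add: f_def)
    moreover have d: "dif X y u \<in> Zc n ?s" by (rule sub_dif[OF Zc_sub y(1) u])
    ultimately obtain w where w: "w \<in> A (n - 1) 1 (?s - 1)" "dif X (dif X y u) (D w) \<in> F (n + 1)"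
      using phi_ker[of "dif X y u" n "?s - n"] Zc_A[OF d] by (auto simp: f_def)
    have Dw: "D w \<in> ?C" using w(1) T_D[of w "?s - 1"] D_D[OF AX[OF w(1)]] by (simp add: A_iff)
    define y' where "y' = dif X (dif X y u) (D w)"
    have y'C: "y' \<in> ?C" unfolding y'_def by (rule sub_dif[OF C_sub subsetD[OF ZcC d] Dw])
    then have y': "y' \<in> Zc (n + 1) ?s" using w(2) by (auto simp: Zc_def y'_def)
    have "y = (D z \<oplus>\<^bsub>X\<^esub> g n e) \<oplus>\<^bsub>X\<^esub> (D w \<oplus>\<^bsub>X\<^esub> y')"
      using ZX[OF y(1)] ZX[OF u] ZX[OF d] sub_carrier[OF C_sub Dw] X_VS by (simp add: y'_def u_def[symmetric])
    also have "cl s \<dots> = (cl s (D z) \<oplus>\<^bsub>H s\<^esub> cl s (g n e)) \<oplus>\<^bsub>H s\<^esub> (cl s (D w) \<oplus>\<^bsub>H s\<^esub> cl s y')"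
    proof -
      have c: "D z \<in> ?C" "g n e \<in> ?C" by (rule subsetD[OF ZcC Dz], rule subsetD[OF ZcC e(1)])
      moreover have "D z \<oplus>\<^bsub>X\<^esub> g n e \<in> ?C" "D w \<oplus>\<^bsub>X\<^esub> y' \<in> ?C"
        by (rule sub_add[OF C_sub c], rule sub_add[OF C_sub Dw y'C])
      ultimately show ?thesis using Dw y'C by (simp add: cla)
    qed
    also have "cl s (D z) = \<zero>\<^bsub>H s\<^esub>" using cl_ker[of "D z" s] Dz z(1) by (auto simp: Zc_def)
    also have "cl s (D w) = \<zero>\<^bsub>H s\<^esub>" using cl_ker[of "D w" s] Dw w(1) by (auto simp: A_iff)
    also have "(\<zero>\<^bsub>H s\<^esub> \<oplus>\<^bsub>H s\<^esub> cl s (g n e)) \<oplus>\<^bsub>H s\<^esub> (\<zero>\<^bsub>H s\<^esub> \<oplus>\<^bsub>H s\<^esub> cl s y') = G n e \<oplus>\<^bsub>H s\<^esub> cl s y'"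
    proof -
      have "cl s (g n e) \<in> carrier (H s)" "cl s y' \<in> carrier (H s)"
        using e(1) y'C ZcC[of n] lin_closed[OF cl_lin[of s]] by auto
      then show ?thesis by (simp add: G_def H_VS)
    qed
    finally have "h = G n e \<oplus>\<^bsub>H s\<^esub> cl s y'" using y(2) by simp
    then show "\<exists>e\<in>carrier (Kn n). \<exists>h'\<in>L (n + 1). h = G n e \<oplus>\<^bsub>H s\<^esub> h'"
      using y' b(2) by (auto simp: Kn_def L_def)
  next
    \<comment> \<open>Uniqueness: if the representative of e plus a deeper cocycle y equals D z,
      then \<open>\<phi>\<close> sends D z to e, so e lies both in \<open>Bi\<close> and in its
      complement.\<close>
    fix n e h assume "e \<in> carrier (Kn n)" "h \<in> L (n + 1)" and 0: "G n e \<oplus>\<^bsub>H s\<^esub> h = \<zero>\<^bsub>H s\<^esub>"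
    then have eK: "e \<in> Ki n (?s - n)" and "\<exists>y\<in>Zc (n + 1) ?s. h = cl s y" by (auto simp: Kn_def L_def)
    then obtain y where y: "y \<in> Zc (n + 1) ?s" "h = cl s y" by blast
    note e = gK[OF eK]
    have yn: "y \<in> Zc n ?s" using y(1) by (auto simp: Zc_def intro: F_le)
    have ey: "g n e \<oplus>\<^bsub>X\<^esub> y \<in> Zc n ?s" by (rule sub_add[OF Zc_sub e(1) yn])
    have "cl s (g n e \<oplus>\<^bsub>X\<^esub> y) = \<zero>\<^bsub>H s\<^esub>"
      using cla[of "g n e" y] e(1) yn ZcC 0 y(2) by (auto simp: G_def Zc_def)
    then obtain z where z: "z \<in> T (?s - 1)" "g n e \<oplus>\<^bsub>X\<^esub> y = D z" using cl_ker[of "g n e \<oplus>\<^bsub>X\<^esub> y" s] ey by (auto simp: Zc_def)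
    have "f n (D z) = e \<oplus>\<^bsub>M n (?s - n)\<^esub> \<zero>\<^bsub>M n (?s - n)\<^esub>"
      using lin_add[OF fcl[of n], of "g n e" y] e yn fF[OF y(1)] z(2) by simp
    then have "f n (D z) = e" using sub_carrier[OF Ki_sub eK] M_VS by simp
    moreover have "D z \<in> F n" using ey z(2) by (auto simp: Zc_def)
    ultimately have "e \<in> Bi n (?s - n)" using z(1) unfolding Bi_def f_def by auto
    then show "e = \<zero>\<^bsub>Kn n\<^esub>" using Ki_Int eK by (auto simp: Kn_def)
  qed
  then show ?thesis unfolding Kn_def .
qed

theorem converges: "converges_to k E H"
  unfolding converges_to_def
proof (intro exI[of _ "\<lambda>n m. (M n m)\<lparr>carrier := Ki n m\<rparr>"] conjI allI)
  fix n m
  show "\<exists>R\<ge>2. \<forall>r\<ge>R. vs_iso k (E r n m) ((M n m)\<lparr>carrier := Ki n m\<rparr>)"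
  proof (intro exI[of _ "max 2 (max (nat (m + 2)) (nat (n + 1)))"] conjI allI impI)
    fix r :: nat assume "max 2 (max (nat (m + 2)) (nat (n + 1))) \<le> r"
    then have "2 \<le> int r" "m + 2 \<le> int r" "n + 1 \<le> int r" by auto
    then show "vs_iso k (E r n m) ((M n m)\<lparr>carrier := Ki n m\<rparr>)"
      unfolding E_def stable(3)[OF \<open>2 \<le> int r\<close> \<open>m + 2 \<le> int r\<close> \<open>n + 1 \<le> int r\<close>]
      by (intro vs_iso_refl sub_VS Ki_sub)
  qed simp
  show "vs_iso k (dsum UNIV (\<lambda>i. (M i (int s - i))\<lparr>carrier := Ki i (int s - i)\<rparr>)) (H s)" for s
    by (rule converges_degree)
qed

end

section \<open>Double complexes\<close>

text \<open>The full product over all bidegrees, with plain functions and no finiteness condition.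
  For a first quadrant double complex each total degree has only finitely many nonzero entries, so
  the product loses nothing there.\<close>

definition total_space :: "(int \<Rightarrow> int \<Rightarrow> ('k, 'c) module) \<Rightarrow> ('k, int \<Rightarrow> int \<Rightarrow> 'c) module" where
  "total_space C =
    \<lparr>carrier = {f. \<forall>i j. f i j \<in> carrier (C i j)},
     mult = (\<lambda>_ _ i j. \<zero>\<^bsub>C i j\<^esub>), one = (\<lambda>i j. \<zero>\<^bsub>C i j\<^esub>), zero = (\<lambda>i j. \<zero>\<^bsub>C i j\<^esub>),
     add = (\<lambda>f g i j. f i j \<oplus>\<^bsub>C i j\<^esub> g i j), smult = (\<lambda>c f i j. c \<odot>\<^bsub>C i j\<^esub> f i j)\<rparr>"

lemma total_space_simps [simp]:
  "f \<in> carrier (total_space C) \<longleftrightarrow> (\<forall>i j. f i j \<in> carrier (C i j))"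
  "\<zero>\<^bsub>total_space C\<^esub> = (\<lambda>i j. \<zero>\<^bsub>C i j\<^esub>)"
  "f \<oplus>\<^bsub>total_space C\<^esub> g = (\<lambda>i j. f i j \<oplus>\<^bsub>C i j\<^esub> g i j)"
  "c \<odot>\<^bsub>total_space C\<^esub> f = (\<lambda>i j. c \<odot>\<^bsub>C i j\<^esub> f i j)"
  "vdiff k (total_space C) f g = (\<lambda>i j. vdiff k (C i j) (f i j) (g i j))"
  by (simp_all add: total_space_def vdiff_def)

lemma (in ground_field) vs_dif_sum:
  "VS V \<Longrightarrow> x \<in> carrier V \<Longrightarrow> y \<in> carrier V \<Longrightarrow> z \<in> carrier V \<Longrightarrow>
    dif V x (y \<oplus>\<^bsub>V\<^esub> z) = dif V (dif V x y) z"
  by (simp add: vdiff_def vs_smult_add vs_assoc)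

text \<open>
  A double complex with anticommuting differentials whose rows are exact except in column zero,
  where the kernel is \<open>I\<close>. The vertical cohomology is presented by \<open>V\<close> and \<open>p\<close>.
\<close>

locale double_complex = ground_field k for k :: "('k, 'z) ring_scheme" +
  fixes C :: "int \<Rightarrow> int \<Rightarrow> ('k, 'c) module" and dh dv :: "int \<Rightarrow> int \<Rightarrow> 'c \<Rightarrow> 'c"
    and V :: "int \<Rightarrow> int \<Rightarrow> ('k, 'v) module" and \<delta> :: "int \<Rightarrow> int \<Rightarrow> 'v \<Rightarrow> 'v"
    and p :: "int \<Rightarrow> int \<Rightarrow> 'c \<Rightarrow> 'v"
    and I :: "nat \<Rightarrow> ('k, 'i) module" and dI :: "nat \<Rightarrow> 'i \<Rightarrow> 'i" and \<iota> :: "nat \<Rightarrow> 'i \<Rightarrow> 'c"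
  assumes dh_lin: "lin (C i j) (C (i + 1) j) (dh i j)"
    and dv_lin: "lin (C i j) (C i (j + 1)) (dv i j)"
    and C_neg: "i < 0 \<or> j < 0 \<Longrightarrow> carrier (C i j) = {\<zero>\<^bsub>C i j\<^esub>}"
    and dh_dh: "x \<in> carrier (C i j) \<Longrightarrow> dh (i + 1) j (dh i j x) = \<zero>\<^bsub>C (i + 1 + 1) j\<^esub>"
    and dv_dv: "x \<in> carrier (C i j) \<Longrightarrow> dv i (j + 1) (dv i j x) = \<zero>\<^bsub>C i (j + 1 + 1)\<^esub>"
    and anticommute: "x \<in> carrier (C i j) \<Longrightarrow>
      dh i (j + 1) (dv i j x) \<oplus>\<^bsub>C (i + 1) (j + 1)\<^esub> dv (i + 1) j (dh i j x) = \<zero>\<^bsub>C (i + 1) (j + 1)\<^esub>"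
    and delta_lin: "lin (V i j) (V (i + 1) j) (\<delta> i j)"
    and p_lin: "lin ((C i j)\<lparr>carrier := {x \<in> carrier (C i j). dv i j x = \<zero>\<^bsub>C i (j + 1)\<^esub>}\<rparr>) (V i j) (p i j)"
    and p_surj: "carrier (V i j) \<subseteq> p i j ` {x \<in> carrier (C i j). dv i j x = \<zero>\<^bsub>C i (j + 1)\<^esub>}"
    and p_ker: "x \<in> carrier (C i j) \<Longrightarrow> dv i j x = \<zero>\<^bsub>C i (j + 1)\<^esub> \<Longrightarrow>
      p i j x = \<zero>\<^bsub>V i j\<^esub> \<longleftrightarrow> (\<exists>w\<in>carrier (C i (j - 1)). x = dv i (j - 1) w)"
    and p_dh: "x \<in> carrier (C i j) \<Longrightarrow> dv i j x = \<zero>\<^bsub>C i (j + 1)\<^esub> \<Longrightarrow>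
      p (i + 1) j (dh i j x) = \<delta> i j (p i j x)"
    and exact: "x \<in> carrier (C i j) \<Longrightarrow> 1 \<le> i \<Longrightarrow> dh i j x = \<zero>\<^bsub>C (i + 1) j\<^esub> \<Longrightarrow>
      \<exists>y\<in>carrier (C (i - 1) j). x = dh (i - 1) j y"
    and dI_lin: "lin (I n) (I (Suc n)) (dI n)"
    and iota_lin: "lin (I n) (C 0 (int n)) (\<iota> n)"
    and iota_inj: "w \<in> carrier (I n) \<Longrightarrow> \<iota> n w = \<zero>\<^bsub>C 0 (int n)\<^esub> \<Longrightarrow> w = \<zero>\<^bsub>I n\<^esub>"
    and iota_image: "x \<in> carrier (C 0 (int n)) \<Longrightarrow>
      dh 0 (int n) x = \<zero>\<^bsub>C 1 (int n)\<^esub> \<longleftrightarrow> (\<exists>w\<in>carrier (I n). x = \<iota> n w)"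
    and iota_dI: "w \<in> carrier (I n) \<Longrightarrow> dv 0 (int n) (\<iota> n w) = \<iota> (Suc n) (dI n w)"
begin

section \<open>The total complex and its filtration by columns\<close>

lemma C_VS [simp]: "VS (C i j)" by (rule lin_V[OF dh_lin])

lemma dh_lin': "lin (C (i - 1) j) (C i j) (dh (i - 1) j)" using dh_lin[of "i - 1" j] by simp

lemma dv_lin': "lin (C i (j - 1)) (C i j) (dv i (j - 1))" using dv_lin[of i "j - 1"] by simp

lemma dh_closed [simp]: "x \<in> carrier (C (i - 1) j) \<Longrightarrow> dh (i - 1) j x \<in> carrier (C i j)"
  by (rule lin_closed[OF dh_lin'])

lemma dv_closed [simp]: "x \<in> carrier (C i (j - 1)) \<Longrightarrow> dv i (j - 1) x \<in> carrier (C i j)"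
  by (rule lin_closed[OF dv_lin'])

lemma dh_zero [simp]: "dh (i - 1) j \<zero>\<^bsub>C (i - 1) j\<^esub> = \<zero>\<^bsub>C i j\<^esub>" by (rule lin_zero[OF dh_lin'])

lemma dv_zero [simp]: "dv i (j - 1) \<zero>\<^bsub>C i (j - 1)\<^esub> = \<zero>\<^bsub>C i j\<^esub>" by (rule lin_zero[OF dv_lin'])

abbreviation X where "X \<equiv> total_space C"

lemma X_VS: "VS X"
proof (rule VS_I)
  fix x assume "x \<in> carrier X"
  then show "(\<ominus>\<^bsub>k\<^esub> \<one>\<^bsub>k\<^esub>) \<odot>\<^bsub>X\<^esub> x \<oplus>\<^bsub>X\<^esub> x = \<zero>\<^bsub>X\<^esub>"
    using vs_dif_self[OF C_VS] by (simp add: vdiff_def fun_eq_iff vs_comm[OF C_VS])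
qed (simp_all add: fun_eq_iff vs_ac[OF C_VS] vs_smult_add vs_add_smult vs_smult_smult)

definition D where "D f = (\<lambda>i j. dh (i - 1) j (f (i - 1) j) \<oplus>\<^bsub>C i j\<^esub> dv i (j - 1) (f i (j - 1)))"

definition T :: "int \<Rightarrow> (int \<Rightarrow> int \<Rightarrow> 'c) set" where
  "T s = {f \<in> carrier X. \<forall>i j. i + j \<noteq> s \<longrightarrow> f i j = \<zero>\<^bsub>C i j\<^esub>}"

definition F :: "int \<Rightarrow> (int \<Rightarrow> int \<Rightarrow> 'c) set" where
  "F n = {f \<in> carrier X. \<forall>i j. i < n \<longrightarrow> f i j = \<zero>\<^bsub>C i j\<^esub>}"

definition sng :: "int \<Rightarrow> int \<Rightarrow> 'c \<Rightarrow> int \<Rightarrow> int \<Rightarrow> 'c" where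
  "sng n m x = (\<lambda>i j. if i = n \<and> j = m then x else \<zero>\<^bsub>C i j\<^esub>)"

lemma sng_T: "x \<in> carrier (C n m) \<Longrightarrow> n + m = s \<Longrightarrow> sng n m x \<in> T s"
  by (auto simp: sng_def T_def)

lemma D_lin: "lin X X D"
proof (rule linI[OF X_VS X_VS])
  show "D x \<in> carrier X" if "x \<in> carrier X" for x using that by (simp add: D_def)
  show "D (x \<oplus>\<^bsub>X\<^esub> y) = D x \<oplus>\<^bsub>X\<^esub> D y" if "x \<in> carrier X" "y \<in> carrier X" for x y
    using that by (simp add: D_def fun_eq_iff lin_add[OF dh_lin'] lin_add[OF dv_lin'] vs_ac[OF C_VS])
  show "D (c \<odot>\<^bsub>X\<^esub> x) = c \<odot>\<^bsub>X\<^esub> D x" if "c \<in> carrier k" "x \<in> carrier X" for c x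
    using that by (simp add: D_def fun_eq_iff lin_smult[OF dh_lin'] lin_smult[OF dv_lin'] vs_smult_add)
qed

lemma D_D:
  assumes f: "f \<in> carrier X"
  shows "D (D f) = \<zero>\<^bsub>X\<^esub>"
proof -
  have c: "f i j \<in> carrier (C i j)" for i j using f by simp
  have "D (D f) i j = \<zero>\<^bsub>C i j\<^esub>" for i j
  proof -
    have h: "dh (i - 1) j (dh (i - 1 - 1) j (f (i - 1 - 1) j)) = \<zero>\<^bsub>C i j\<^esub>"
      using dh_dh[OF c, of "i - 1 - 1" j] by simp
    have v: "dv i (j - 1) (dv i (j - 1 - 1) (f i (j - 1 - 1))) = \<zero>\<^bsub>C i j\<^esub>"
      using dv_dv[OF c, of i "j - 1 - 1"] by simp
    have hv: "dh (i - 1) j (dv (i - 1) (j - 1) (f (i - 1) (j - 1))) \<oplus>\<^bsub>C i j\<^esub>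
        dv i (j - 1) (dh (i - 1) (j - 1) (f (i - 1) (j - 1))) = \<zero>\<^bsub>C i j\<^esub>"
      using anticommute[OF c, of "i - 1" "j - 1"] by simp
    show ?thesis
      unfolding D_def
      by (simp only: lin_add[OF dh_lin'[of i j] dh_closed[OF c] dv_closed[OF c]]
          lin_add[OF dv_lin'[of i j] dh_closed[OF c] dv_closed[OF c]] h v
          vs_add_zero[OF C_VS dv_closed[OF dh_closed[OF c]]] vs_add_zero[OF C_VS dh_closed[OF dv_closed[OF c]]] hv)
  qed
  then show ?thesis by (simp add: fun_eq_iff)
qed

lemma T_sub: "sub (T s) X"
  by (rule subspaceI[OF X_VS]) (auto simp: T_def)

lemma F_sub: "sub (F n) X"
  by (rule subspaceI[OF X_VS]) (auto simp: F_def)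

lemma T_X: "x \<in> T s \<Longrightarrow> x \<in> carrier X" by (simp add: T_def)

lemma T_D: "x \<in> T s \<Longrightarrow> D x \<in> T (s + 1)"
  by (auto simp: T_def D_def)

lemma zero_if: "x \<in> carrier X \<Longrightarrow> i < 0 \<or> j < 0 \<Longrightarrow> x i j = \<zero>\<^bsub>C i j\<^esub>"
  using C_neg[of i j] by auto

lemma T_neg: "s < 0 \<Longrightarrow> T s = {\<zero>\<^bsub>X\<^esub>}"
proof (intro equalityI subsetI)
  fix x assume s: "s < 0" and x: "x \<in> T s"
  have "x i j = \<zero>\<^bsub>C i j\<^esub>" for i j
  proof (cases "i + j = s")
    case True
    then have "i < 0 \<or> j < 0" using s by linarith
    then show ?thesis by (rule zero_if[OF T_X[OF x]])
  next
    case False then show ?thesis using x by (simp add: T_def)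
  qed
  then show "x \<in> {\<zero>\<^bsub>X\<^esub>}" by (simp add: fun_eq_iff)
qed (use sub_zero[OF T_sub] in simp)

text \<open>A nonzero entry would need i at least n > s = i + j, hence j < 0.\<close>

lemma F_high: "x \<in> T s \<Longrightarrow> x \<in> F n \<Longrightarrow> s < n \<Longrightarrow> x = \<zero>\<^bsub>X\<^esub>"
proof -
  assume x: "x \<in> T s" "x \<in> F n" and s: "s < n"
  have "x i j = \<zero>\<^bsub>C i j\<^esub>" for i j
  proof (cases "i < n \<or> i + j \<noteq> s")
    case True then show ?thesis using x by (auto simp: T_def F_def)
  next
    case False
    then have "j < 0" using s by linarith
    then show ?thesis using zero_if[OF T_X[OF x(1)]] by simp
  qed
  then show ?thesis by (simp add: fun_eq_iff)
qed

section \<open>The second page: horizontal cohomology of vertical cohomology\<close>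

abbreviation Ker where "Ker i j \<equiv> (V i j)\<lparr>carrier := {v \<in> carrier (V i j). \<delta> i j v = \<zero>\<^bsub>V (i + 1) j\<^esub>}\<rparr>"

abbreviation Img where "Img i j \<equiv> \<delta> (i - 1) j ` carrier (V (i - 1) j)"

abbreviation M where "M i j \<equiv> quot_module (Ker i j) (Img i j)"

text \<open>Only the leading entry of y, in column i, is read: its vertical class is taken, and then
  the horizontal class of that.\<close>

definition \<phi> where "\<phi> i j y = Img i j +>\<^bsub>Ker i j\<^esub> p i j (y i j)"

abbreviation A where "A n r s \<equiv> {y \<in> T s \<inter> F n. D y \<in> F (n + r)}"

lemma V_VS [simp]: "VS (V i j)" by (rule lin_V[OF delta_lin])

lemma delta_lin': "lin (V (i - 1) j) (V i j) (\<delta> (i - 1) j)" using delta_lin[of "i - 1" j] by simp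

lemma p_closed: "x \<in> carrier (C i j) \<Longrightarrow> dv i j x = \<zero>\<^bsub>C i (j + 1)\<^esub> \<Longrightarrow> p i j x \<in> carrier (V i j)"
  using lin_closed[OF p_lin, of x i j] by simp

lemma p_dh': "x \<in> carrier (C (i - 1) j) \<Longrightarrow> dv (i - 1) j x = \<zero>\<^bsub>C (i - 1) (j + 1)\<^esub> \<Longrightarrow>
    p i j (dh (i - 1) j x) = \<delta> (i - 1) j (p (i - 1) j x)"
  using p_dh[of x "i - 1" j] by simp

lemma p_add: "x \<in> carrier (C i j) \<Longrightarrow> dv i j x = \<zero>\<^bsub>C i (j + 1)\<^esub> \<Longrightarrow>
    y \<in> carrier (C i j) \<Longrightarrow> dv i j y = \<zero>\<^bsub>C i (j + 1)\<^esub> \<Longrightarrow> p i j (x \<oplus>\<^bsub>C i j\<^esub> y) = p i j x \<oplus>\<^bsub>V i j\<^esub> p i j y"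
  using lin_add[OF p_lin, of x i j y] by simp

lemma p_dif: "x \<in> carrier (C i j) \<Longrightarrow> dv i j x = \<zero>\<^bsub>C i (j + 1)\<^esub> \<Longrightarrow>
    y \<in> carrier (C i j) \<Longrightarrow> dv i j y = \<zero>\<^bsub>C i (j + 1)\<^esub> \<Longrightarrow> p i j (dif (C i j) x y) = dif (V i j) (p i j x) (p i j y)"
  using lin_dif[OF p_lin, of x i j y] by simp

lemma dv_dv': "w \<in> carrier (C i (j - 1)) \<Longrightarrow> dv i j (dv i (j - 1) w) = \<zero>\<^bsub>C i (j + 1)\<^esub>"
  using dv_dv[of w i "j - 1"] by simp

lemma p_dv: "w \<in> carrier (C i (j - 1)) \<Longrightarrow> p i j (dv i (j - 1) w) = \<zero>\<^bsub>V i j\<^esub>"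
  using p_ker[of "dv i (j - 1) w" i j] dv_dv' by auto

lemma dv_dh: "u \<in> carrier (C i j) \<Longrightarrow> dv i j u = \<zero>\<^bsub>C i (j + 1)\<^esub> \<Longrightarrow> dv (i + 1) j (dh i j u) = \<zero>\<^bsub>C (i + 1) (j + 1)\<^esub>"
  using anticommute[of u i j] lin_zero[OF dh_lin, of i "j + 1"] lin_closed[OF dv_lin lin_closed[OF dh_lin]]
  by simp

lemma p_dif_preimage:
  assumes x: "x \<in> carrier (C i j)" "dv i j x = \<zero>\<^bsub>C i (j + 1)\<^esub>" and y: "y \<in> carrier (C i j)" "dv i j y = \<zero>\<^bsub>C i (j + 1)\<^esub>"
    and e: "p i j x = p i j y"
  shows "\<exists>w\<in>carrier (C i (j - 1)). x = y \<oplus>\<^bsub>C i j\<^esub> dv i (j - 1) w"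
proof -
  have "dv i j (dif (C i j) x y) = \<zero>\<^bsub>C i (j + 1)\<^esub>" using lin_dif[OF dv_lin x(1) y(1)] x(2) y(2) by simp
  moreover have "p i j (dif (C i j) x y) = \<zero>\<^bsub>V i j\<^esub>" using p_dif[OF x y] e p_closed[OF y] by simp
  ultimately obtain w where "w \<in> carrier (C i (j - 1))" "dif (C i j) x y = dv i (j - 1) w"
    using p_ker[of "dif (C i j) x y" i j] x y by auto
  then show ?thesis using x y by (intro bexI[of _ w]) (simp_all add: vs_dif_eq)
qed

text \<open>Inherited from \<open>dh\<close>, since every class is some p x and \<open>p\<close>
  intertwines \<open>dh\<close> with \<open>\<delta>\<close>.\<close>

lemma delta_delta:
  assumes v: "v \<in> carrier (V i j)"
  shows "\<delta> (i + 1) j (\<delta> i j v) = \<zero>\<^bsub>V (i + 1 + 1) j\<^esub>"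
proof -
  obtain x where x: "x \<in> carrier (C i j)" "dv i j x = \<zero>\<^bsub>C i (j + 1)\<^esub>" "v = p i j x" using p_surj[of i j] v by blast
  have "\<delta> (i + 1) j (\<delta> i j v) = p (i + 1 + 1) j (dh (i + 1) j (dh i j x))"
    unfolding x(3) p_dh[OF x(1,2), symmetric] by (rule p_dh[OF lin_closed[OF dh_lin x(1)] dv_dh[OF x(1,2)], symmetric])
  then show ?thesis unfolding dh_dh[OF x(1)] using lin_zero[OF p_lin] by simp
qed

lemma Ker_sub: "sub {v \<in> carrier (V i j). \<delta> i j v = \<zero>\<^bsub>V (i + 1) j\<^esub>} (V i j)"
  by (rule sub_kernel[OF delta_lin])

lemma Img_sub: "sub (Img i j) (Ker i j)"
  by (rule sub_sub[OF Ker_sub sub_range[OF delta_lin']])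
    (use delta_delta[of _ "i - 1" j] lin_closed[OF delta_lin'] in auto)

text \<open>Column n - 1 of y is zero, so in column n the only contribution to D y is
  vertical.\<close>

lemma A_dv:
  assumes y: "y \<in> A n r s" and r: "1 \<le> r"
  shows "y n m \<in> carrier (C n m)" "dv n m (y n m) = \<zero>\<^bsub>C n (m + 1)\<^esub>"
proof -
  show c: "y n m \<in> carrier (C n m)" using y by (auto simp: T_def)
  have "D y n (m + 1) = \<zero>\<^bsub>C n (m + 1)\<^esub>" using y r by (auto simp: F_def)
  moreover have "y (n - 1) (m + 1) = \<zero>\<^bsub>C (n - 1) (m + 1)\<^esub>" using y by (auto simp: F_def)
  ultimately show "dv n m (y n m) = \<zero>\<^bsub>C n (m + 1)\<^esub>" using lin_closed[OF dv_lin c] by (simp add: D_def)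
qed

text \<open>At position (n + 1, m) the vanishing of D y says that the horizontal differential of the
  leading entry is a vertical coboundary up to sign, so it dies in vertical cohomology.\<close>

lemma A_delta:
  assumes y: "y \<in> A n 2 s"
  shows "p n m (y n m) \<in> carrier (V n m)" "\<delta> n m (p n m (y n m)) = \<zero>\<^bsub>V (n + 1) m\<^esub>"
proof -
  note a = A_dv[OF y, of m, simplified]
  show "p n m (y n m) \<in> carrier (V n m)" by (rule p_closed[OF a])
  let ?w = "y (n + 1) (m - 1)"
  have w: "?w \<in> carrier (C (n + 1) (m - 1))" using y by (auto simp: T_def)
  have "D y (n + 1) m = \<zero>\<^bsub>C (n + 1) m\<^esub>" using y by (auto simp: F_def)
  then have "dh n m (y n m) \<oplus>\<^bsub>C (n + 1) m\<^esub> dv (n + 1) (m - 1) ?w = \<zero>\<^bsub>C (n + 1) m\<^esub>" by (simp add: D_def)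
  then have "p (n + 1) m (dh n m (y n m)) \<oplus>\<^bsub>V (n + 1) m\<^esub> p (n + 1) m (dv (n + 1) (m - 1) ?w) = \<zero>\<^bsub>V (n + 1) m\<^esub>"
    using p_add[OF lin_closed[OF dh_lin a(1)] dv_dh[OF a] dv_closed[OF w] dv_dv'[OF w]] lin_zero[OF p_lin[of "n + 1" m]] by simp
  then show "\<delta> n m (p n m (y n m)) = \<zero>\<^bsub>V (n + 1) m\<^esub>"
    unfolding p_dv[OF w] p_dh[OF a, symmetric]
    using p_closed[OF lin_closed[OF dh_lin a(1)] dv_dh[OF a]] by simp
qed

lemma A_sub: "sub (A n r s) X"
  by (rule subspaceI[OF X_VS])
    (auto simp: T_def lin_zero[OF D_lin, simplified] lin_add[OF D_lin, simplified] lin_smult[OF D_lin, simplified] F_def)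

lemma eval_lin: "lin X (C n m) (\<lambda>y. y n m)"
  by (rule linI[OF X_VS C_VS]) simp_all

lemma phi_lin: "lin (X\<lparr>carrier := A n 2 (n + m)\<rparr>) (M n m) (\<phi> n m)"
proof -
  have e: "lin (X\<lparr>carrier := A n 2 (n + m)\<rparr>) (C n m) (\<lambda>y. y n m)" by (rule lin_restrict[OF eval_lin A_sub])
  have "lin (X\<lparr>carrier := A n 2 (n + m)\<rparr>) ((C n m)\<lparr>carrier := {x \<in> carrier (C n m). dv n m x = \<zero>\<^bsub>C n (m + 1)\<^esub>}\<rparr>) (\<lambda>y. y n m)"
  proof (rule lin_corestrict[OF e sub_kernel[OF dv_lin]])
    fix y assume "y \<in> carrier (X\<lparr>carrier := A n 2 (n + m)\<rparr>)"
    then have y: "y \<in> A n 2 (n + m)" by simp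
    show "y n m \<in> {x \<in> carrier (C n m). dv n m x = \<zero>\<^bsub>C n (m + 1)\<^esub>}" using A_dv[OF y] by simp
  qed
  note l = lin_comp[OF p_lin this]
  have "lin (X\<lparr>carrier := A n 2 (n + m)\<rparr>) (Ker n m) (\<lambda>y. p n m (y n m))"
  proof (rule lin_corestrict[OF l Ker_sub])
    fix y assume "y \<in> carrier (X\<lparr>carrier := A n 2 (n + m)\<rparr>)"
    then have y: "y \<in> A n 2 (n + m)" by simp
    show "p n m (y n m) \<in> {v \<in> carrier (V n m). \<delta> n m v = \<zero>\<^bsub>V (n + 1) m\<^esub>}" using A_delta[OF y] by simp
  qed
  from lin_comp[OF lin_quot[OF Img_sub] this] show ?thesis unfolding \<phi>_def[abs_def] .
qed

text \<open>A \<open>\<delta>\<close>-closed class is the class of some x with dh x = dv w. The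
  zigzag consisting of x and, in the next column, -w has its total differential in F (n +
  2).\<close>

lemma phi_surj: "carrier (M n m) \<subseteq> \<phi> n m ` A n 2 (n + m)"
proof
  fix c assume "c \<in> carrier (M n m)"
  then obtain v where v: "v \<in> carrier (V n m)" "\<delta> n m v = \<zero>\<^bsub>V (n + 1) m\<^esub>" "c = Img n m +>\<^bsub>Ker n m\<^esub> v"
    unfolding quot_carrier by auto
  obtain x where x: "x \<in> carrier (C n m)" "dv n m x = \<zero>\<^bsub>C n (m + 1)\<^esub>" "v = p n m x" using p_surj[of n m] v(1) by blast
  have "p (n + 1) m (dh n m x) = \<zero>\<^bsub>V (n + 1) m\<^esub>" using p_dh[OF x(1,2)] v x by simp
  then obtain w where w: "w \<in> carrier (C (n + 1) (m - 1))" "dh n m x = dv (n + 1) (m - 1) w"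
    using p_ker[OF lin_closed[OF dh_lin x(1)] dv_dh[OF x(1,2)]] by blast
  \<comment> \<open>The second entry of the zigzag carries a minus sign, so that the two
    contributions at (n + 1, m) cancel.\<close>
  let ?w = "dif (C (n + 1) (m - 1)) \<zero>\<^bsub>C (n + 1) (m - 1)\<^esub> w"
  let ?y = "\<lambda>i j. if i = n \<and> j = m then x else if i = n + 1 \<and> j = m - 1 then ?w else \<zero>\<^bsub>C i j\<^esub>"
  have wc: "?w \<in> carrier (C (n + 1) (m - 1))" using w by simp
  have y: "?y \<in> carrier X" using x(1) wc by auto
  have dw: "dh n m x \<oplus>\<^bsub>C (n + 1) m\<^esub> dv (n + 1) (m - 1) ?w = \<zero>\<^bsub>C (n + 1) m\<^esub>"
    using lin_dif[OF dv_lin'[of "n + 1" m], of "\<zero>\<^bsub>C (n + 1) (m - 1)\<^esub>" w] w dv_closed[OF w(1)] by simp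
  have "D ?y i j = \<zero>\<^bsub>C i j\<^esub>" if i: "i < n + 2" for i j
  proof -
    consider "i < n" | "i = n" | "i = n + 1" using i by arith
    then show ?thesis
    proof cases
      case 1 then show ?thesis by (simp add: D_def)
    next
      case 2 then show ?thesis using x(2) by (cases "j = m + 1") (auto simp: D_def)
    next
      case 3 then show ?thesis using dw dh_zero[of "n + 1" j] by (cases "j = m") (auto simp: D_def)
    qed
  qed
  then have a: "?y \<in> A n 2 (n + m)" using y lin_closed[OF D_lin y] by (auto simp: T_def F_def)
  have e: "c = \<phi> n m ?y" by (simp add: \<phi>_def v(3) x(3))
  show "c \<in> \<phi> n m ` A n 2 (n + m)" using imageI[OF a, of "\<phi> n m"] unfolding e[symmetric] .
qed

text \<open>A class in the image of \<open>\<delta>\<close> means that the leading entry is dh u +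
  dv w with u vertically closed. The entries u and w form the cochain z whose total differential has
  the same leading entry; conversely such a z can be read off.\<close>

lemma phi_ker:
  assumes y: "y \<in> A n 2 (n + m)"
  shows "\<phi> n m y = \<zero>\<^bsub>M n m\<^esub> \<longleftrightarrow> (\<exists>z\<in>A (n - 1) 1 (n + m - 1). dif X y (D z) \<in> F (n + 1))"
proof -
  note a = A_dv[OF y, of m, simplified]
  have yT: "y \<in> T (n + m)" and yF: "y \<in> F n" and yX: "y \<in> carrier X" using y T_X by auto
  have "\<phi> n m y = \<zero>\<^bsub>M n m\<^esub> \<longleftrightarrow> p n m (y n m) \<in> Img n m"
    unfolding \<phi>_def quot_zero by (rule coset_eq_zero[OF Img_sub]) (use A_delta[OF y] in simp)
  also have "\<dots> \<longleftrightarrow> (\<exists>z\<in>A (n - 1) 1 (n + m - 1). dif X y (D z) \<in> F (n + 1))"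
  proof
    assume "p n m (y n m) \<in> Img n m"
    then obtain v where v: "v \<in> carrier (V (n - 1) m)" "p n m (y n m) = \<delta> (n - 1) m v" by blast
    obtain u where u: "u \<in> carrier (C (n - 1) m)" "dv (n - 1) m u = \<zero>\<^bsub>C (n - 1) (m + 1)\<^esub>" "v = p (n - 1) m u"
      using p_surj[of "n - 1" m] v(1) by blast
    have "dv n m (dh (n - 1) m u) = \<zero>\<^bsub>C n (m + 1)\<^esub>" using dv_dh[OF u(1,2)] by simp
    moreover have "p n m (y n m) = p n m (dh (n - 1) m u)" using v(2) u(3) p_dh'[OF u(1,2)] by simp
    ultimately obtain w where w: "w \<in> carrier (C n (m - 1))" "y n m = dh (n - 1) m u \<oplus>\<^bsub>C n m\<^esub> dv n (m - 1) w"
      using p_dif_preimage[OF a dh_closed[OF u(1)]] by blast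
    \<comment> \<open>Total degree n + m - 1: u starts one column to the left, and as it is
      vertically closed, D z already lies in F n.\<close>
    let ?z = "\<lambda>i j. if i = n - 1 \<and> j = m then u else if i = n \<and> j = m - 1 then w else \<zero>\<^bsub>C i j\<^esub>"
    have zX: "?z \<in> carrier X" using u w by auto
    have zT: "?z \<in> T (n + m - 1)" using zX by (auto simp: T_def)
    have Dz: "D ?z \<in> T (n + m)" using T_D[OF zT] by simp
    have "D ?z i j = \<zero>\<^bsub>C i j\<^esub>" if "i < n" for i j
    proof (cases "i = n - 1")
      case True then show ?thesis using u(2) dh_zero[of "n - 1" j] by (cases "j = m + 1") (auto simp: D_def)
    next
      case False then show ?thesis using that by (simp add: D_def)
    qed
    then have DF: "D ?z \<in> F n" using lin_closed[OF D_lin zX] by (simp add: F_def)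
    have "dif X y (D ?z) i j = \<zero>\<^bsub>C i j\<^esub>" if i: "i < n + 1" for i j
    proof -
      consider "i + j \<noteq> n + m" | "i < n" | "i = n" "j = m" using i by linarith
      then show ?thesis
      proof cases
        case 1 then show ?thesis using yT Dz by (auto simp: T_def)
      next
        case 2 then show ?thesis using yF DF by (auto simp: F_def)
      next
        case 3
        have "D ?z n m = y n m" unfolding w(2) by (simp add: D_def)
        then show ?thesis using 3 a(1) by simp
      qed
    qed
    then have "dif X y (D ?z) \<in> F (n + 1)" using vs_dif[OF X_VS yX lin_closed[OF D_lin zX]] by (simp add: F_def)
    moreover have "?z \<in> A (n - 1) 1 (n + m - 1)" using zT zX DF by (auto simp: F_def)
    ultimately show "\<exists>z\<in>A (n - 1) 1 (n + m - 1). dif X y (D z) \<in> F (n + 1)" by blast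
  next
    assume "\<exists>z\<in>A (n - 1) 1 (n + m - 1). dif X y (D z) \<in> F (n + 1)"
    then obtain z where z: "z \<in> A (n - 1) 1 (n + m - 1)" and F: "dif X y (D z) \<in> F (n + 1)" by blast
    note b = A_dv[OF z, of m, simplified]
    let ?w = "z n (m - 1)"
    have w: "?w \<in> carrier (C n (m - 1))" using z by (auto simp: T_def)
    have Dc: "D z n m = dh (n - 1) m (z (n - 1) m) \<oplus>\<^bsub>C n m\<^esub> dv n (m - 1) ?w" by (simp add: D_def)
    have "dif (C n m) (y n m) (D z n m) = \<zero>\<^bsub>C n m\<^esub>" using F by (auto simp: F_def)
    then have e: "y n m = dh (n - 1) m (z (n - 1) m) \<oplus>\<^bsub>C n m\<^esub> dv n (m - 1) ?w"
      using a(1) b(1) w unfolding Dc by (subst (asm) vs_dif_eq) simp_all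
    have "dv n m (dh (n - 1) m (z (n - 1) m)) = \<zero>\<^bsub>C n (m + 1)\<^esub>" using dv_dh[OF b] by simp
    then have "p n m (y n m) = \<delta> (n - 1) m (p (n - 1) m (z (n - 1) m)) \<oplus>\<^bsub>V n m\<^esub> \<zero>\<^bsub>V n m\<^esub>"
      unfolding e using p_add[OF dh_closed[OF b(1)] _ dv_closed[OF w] dv_dv'[OF w]] p_dv[OF w] p_dh'[OF b] by simp
    then show "p n m (y n m) \<in> Img n m" using p_closed[OF b] lin_closed[OF delta_lin' p_closed[OF b]] by simp
  qed
  finally show ?thesis .
qed

text \<open>
  As the rows are exact, a cochain whose differential is supported in column zero can be pushed
  into column zero by removing its rightmost column, one at a time.
\<close>

lemma first_column:
  assumes "y \<in> T s" "\<And>i j. int N < i \<Longrightarrow> y i j = \<zero>\<^bsub>C i j\<^esub>" "\<And>i j. 0 < i \<Longrightarrow> D y i j = \<zero>\<^bsub>C i j\<^esub>"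
  shows "\<exists>z\<in>T (s - 1). \<forall>i j. 0 < i \<longrightarrow> dif X y (D z) i j = \<zero>\<^bsub>C i j\<^esub>"
  using assms
proof (induction N arbitrary: y)
  case 0
  have "dif X y (D \<zero>\<^bsub>X\<^esub>) = y" unfolding lin_zero[OF D_lin] by (rule vs_dif_zero[OF X_VS T_X[OF 0(1)]])
  then show ?case using 0(2) sub_zero[OF T_sub, of "s - 1"] by (intro bexI[of _ "\<zero>\<^bsub>X\<^esub>"]) simp_all
next
  case (Suc N)
  let ?m = "s - int N - 1"
  let ?x = "y (int N + 1) ?m"
  have x: "?x \<in> carrier (C (int N + 1) ?m)" using T_X[OF Suc.prems(1)] by simp
  \<comment> \<open>Beyond the rightmost column only the horizontal differential contributes, so the
    last entry is \<open>dh\<close>-closed and exactness of its row applies.\<close>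
  have "D y (int N + 1 + 1) ?m = dh (int N + 1) ?m ?x"
  proof -
    have *: "D y (i + 1) j = dh i j (y i j)" if "y (i + 1) (j - 1) = \<zero>\<^bsub>C (i + 1) (j - 1)\<^esub>" for i j
      using that lin_closed[OF dh_lin[of i j]] T_X[OF Suc.prems(1)] by (simp add: D_def)
    show ?thesis by (rule *, rule Suc.prems(2)) simp
  qed
  then obtain u where u: "u \<in> carrier (C (int N) ?m)" "?x = dh (int N) ?m u"
    using exact[OF x] Suc.prems(3)[of "int N + 1 + 1" ?m] by auto
  \<comment> \<open>Its total differential cancels column N + 1 and otherwise touches only column
    N.\<close>
  let ?z = "sng (int N) ?m u"
  have z: "?z \<in> T (s - 1)" by (rule sng_T[OF u(1)]) simp
  have Dz: "D ?z \<in> T s" using T_D[OF z] by simp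
  let ?y = "dif X y (D ?z)"
  have yT: "?y \<in> T s" by (rule sub_dif[OF T_sub Suc.prems(1) Dz])
  have h: "?y i j = \<zero>\<^bsub>C i j\<^esub>" if i: "int N < i" for i j
  proof -
    consider "i + j \<noteq> s" | "int N + 1 < i" | "i = int N + 1" "j = ?m" using i by linarith
    then show ?thesis
    proof cases
      case 1 then show ?thesis using yT unfolding T_def by blast
    next
      case 2 then show ?thesis using Suc.prems(2)[of i j] by (simp add: D_def sng_def)
    next
      case 3 then show ?thesis using u x by (simp add: D_def sng_def)
    qed
  qed
  have yX: "y \<in> carrier X" and DX: "D ?z \<in> carrier X" by (rule T_X[OF Suc.prems(1)], rule T_X[OF Dz])
  have "D ?y = D y" unfolding lin_dif[OF D_lin yX DX] D_D[OF T_X[OF z]] by (rule vs_dif_zero[OF X_VS lin_closed[OF D_lin yX]])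
  then obtain z' where z': "z' \<in> T (s - 1)" "\<forall>i j. 0 < i \<longrightarrow> dif X ?y (D z') i j = \<zero>\<^bsub>C i j\<^esub>"
    using Suc.IH[OF yT h] Suc.prems(3) by auto
  have "dif X y (D (?z \<oplus>\<^bsub>X\<^esub> z')) = dif X ?y (D z')"
    unfolding lin_add[OF D_lin T_X[OF z] T_X[OF z'(1)]]
    by (rule vs_dif_sum[OF X_VS yX DX lin_closed[OF D_lin T_X[OF z'(1)]]])
  then show ?case using z'(2) sub_add[OF T_sub z z'(1)] by (intro bexI[of _ "?z \<oplus>\<^bsub>X\<^esub> z'"]) simp_all
qed

text \<open>In total degree s all entries in columns beyond s have negative row index and vanish, so
  the induction may start at \<open>nat s\<close>.\<close>

lemma first_column':
  assumes y: "y \<in> T s" and D: "\<And>i j. 0 < i \<Longrightarrow> D y i j = \<zero>\<^bsub>C i j\<^esub>"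
  shows "\<exists>z\<in>T (s - 1). dif X y (D z) = sng 0 s (dif X y (D z) 0 s)"
proof -
  have h: "y i j = \<zero>\<^bsub>C i j\<^esub>" if i: "int (nat s) < i" for i j
  proof (cases "i + j = s")
    case True
    then have "j < 0" using i by linarith
    then show ?thesis using zero_if[OF T_X[OF y]] by simp
  next
    case False then show ?thesis using y by (auto simp: T_def)
  qed
  obtain z where z: "z \<in> T (s - 1)" "\<forall>i j. 0 < i \<longrightarrow> dif X y (D z) i j = \<zero>\<^bsub>C i j\<^esub>" using first_column[OF y h D] by blast
  let ?y = "dif X y (D z)"
  have yT: "?y \<in> T s" using sub_dif[OF T_sub y T_D[OF z(1), simplified]] .
  have "?y i j = sng 0 s (?y 0 s) i j" for i j
  proof -
    consider "i + j \<noteq> s" | "0 < i" | "i < 0" | "i = 0" "j = s" by linarith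
    then show ?thesis
    proof cases
      case 1
      have "?y i j = \<zero>\<^bsub>C i j\<^esub>" using yT 1 unfolding T_def by blast
      then show ?thesis using 1 by (auto simp: sng_def)
    next
      case 2
      have "?y i j = \<zero>\<^bsub>C i j\<^esub>" using z(2) 2 by blast
      then show ?thesis using 2 by (auto simp: sng_def)
    next
      case 3
      have "?y i j = \<zero>\<^bsub>C i j\<^esub>" using zero_if[OF T_X[OF yT]] 3 by blast
      then show ?thesis using 3 by (auto simp: sng_def)
    next
      case 4 then show ?thesis by (simp add: sng_def)
    qed
  qed
  then have "?y = sng 0 s (?y 0 s)" by (intro ext)
  then show ?thesis using z(1) by (rule bexI)
qed

section \<open>The total cohomology as the cohomology of the augmentation\<close>

definition emb where "emb n w = sng 0 (int n) (\<iota> n w)"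

lemma emb_lin: "lin (I n) X (emb n)"
  by (rule linI[OF lin_V[OF iota_lin] X_VS])
    (auto simp: emb_def sng_def fun_eq_iff lin_closed[OF iota_lin] lin_add[OF iota_lin] lin_smult[OF iota_lin])

lemma emb_T: "w \<in> carrier (I n) \<Longrightarrow> emb n w \<in> T (int n)"
  unfolding emb_def by (rule sng_T[OF lin_closed[OF iota_lin]]) simp_all

lemma emb_inj: "w \<in> carrier (I n) \<Longrightarrow> emb n w = \<zero>\<^bsub>X\<^esub> \<Longrightarrow> w = \<zero>\<^bsub>I n\<^esub>"
proof (rule iota_inj)
  assume e: "emb n w = \<zero>\<^bsub>X\<^esub>"
  have "emb n w 0 (int n) = \<zero>\<^bsub>X\<^esub> 0 (int n)" by (simp only: e)
  then show "\<iota> n w = \<zero>\<^bsub>C 0 (int n)\<^esub>" by (simp add: emb_def sng_def)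
qed

lemma D_sng:
  assumes x: "x \<in> carrier (C 0 s)"
  shows "D (sng 0 s x) 1 s = dh 0 s x" "D (sng 0 s x) 0 (s + 1) = dv 0 s x"
  using lin_closed[OF dh_lin x] lin_closed[OF dv_lin x] dh_zero[of 0 "s + 1"] dv_zero[of 1 s]
  by (simp_all add: D_def sng_def)

text \<open>The horizontal differential kills the image of \<open>\<iota>\<close>, so only the
  vertical part survives, and that is \<open>dI\<close>.\<close>

lemma D_emb:
  assumes w: "w \<in> carrier (I n)"
  shows "D (emb n w) = emb (Suc n) (dI n w)"
proof -
  let ?x = "\<iota> n w"
  have x: "?x \<in> carrier (C 0 (int n))" by (rule lin_closed[OF iota_lin w])
  have h: "dh 0 (int n) ?x = \<zero>\<^bsub>C 1 (int n)\<^esub>" using iota_image[OF x] w by blast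
  note d = D_sng[OF x, unfolded h iota_dI[OF w]]
  have "D (emb n w) i j = emb (Suc n) (dI n w) i j" for i j
  proof -
    consider "i = 1" "j = int n" | "i = 0" "j = int n + 1" | "\<not> (i = 1 \<and> j = int n)" "\<not> (i = 0 \<and> j = int n + 1)" by blast
    then show ?thesis
    proof cases
      case 1 then show ?thesis using d by (simp add: emb_def sng_def)
    next
      case 2 then show ?thesis using d by (simp add: emb_def) (simp add: sng_def)
    next
      case 3
      then have "sng 0 (int n) ?x (i - 1) j = \<zero>\<^bsub>C (i - 1) j\<^esub>" "sng 0 (int n) ?x i (j - 1) = \<zero>\<^bsub>C i (j - 1)\<^esub>"
        by (auto simp: sng_def)
      then have "D (emb n w) i j = \<zero>\<^bsub>C i j\<^esub>" by (simp add: D_def emb_def)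
      then show ?thesis using 3(2) by (auto simp: emb_def sng_def)
    qed
  qed
  then show ?thesis by (intro ext)
qed

lemma column_emb:
  assumes x: "sng 0 (int n) x \<in> carrier X" and D: "D (sng 0 (int n) x) 1 (int n) = \<zero>\<^bsub>C 1 (int n)\<^esub>"
  shows "\<exists>w\<in>carrier (I n). sng 0 (int n) x = emb n w"
proof -
  have "sng 0 (int n) x 0 (int n) \<in> carrier (C 0 (int n))" using x by simp
  then have c: "x \<in> carrier (C 0 (int n))" by (simp add: sng_def)
  then show ?thesis using iota_image[OF c] D unfolding D_sng(1)[OF c] emb_def by blast
qed

text \<open>If D z sits in column zero, then z itself can be pushed into column zero without
  changing D z. There it is \<open>emb u\<close> for some u, and injectivity of \<open>emb\<close>
  turns the equation into w = dI u.\<close>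

lemma emb_boundary:
  assumes w: "w \<in> carrier (I n)"
  shows "(\<exists>z\<in>T (int n - 1). emb n w = D z) \<longleftrightarrow> w \<in> coboundaries I dI n"
proof
  assume "\<exists>z\<in>T (int n - 1). emb n w = D z"
  then obtain z where z: "z \<in> T (int n - 1)" "emb n w = D z" by blast
  show "w \<in> coboundaries I dI n"
  proof (cases n)
    \<comment> \<open>There is nothing but zero in total degree -1, matching the convention for
      coboundaries in degree 0.\<close>
    case 0
    then have "z = \<zero>\<^bsub>X\<^esub>" using z(1) T_neg[of "int n - 1"] by simp
    then have "emb n w = \<zero>\<^bsub>X\<^esub>" using z(2) lin_zero[OF D_lin] by simp
    then show ?thesis using emb_inj[OF w] 0 by (simp add: coboundaries_def)
  next
    case (Suc m)
    have zT: "z \<in> T (int m)" using z(1) Suc by simp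
    have "D z i j = \<zero>\<^bsub>C i j\<^esub>" if "0 < i" for i j
      using that unfolding z(2)[symmetric] by (simp add: emb_def sng_def)
    from first_column'[OF zT this] obtain z' where z': "z' \<in> T (int m - 1)"
      and e: "dif X z (D z') = sng 0 (int m) (dif X z (D z') 0 (int m))" by blast
    let ?y = "dif X z (D z')"
    have X: "z \<in> carrier X" "D z' \<in> carrier X" by (rule T_X[OF zT], rule lin_closed[OF D_lin T_X[OF z'(1)]])
    have Dy: "D ?y = emb n w"
      unfolding lin_dif[OF D_lin X] D_D[OF T_X[OF z'(1)]] z(2) by (rule vs_dif_zero[OF X_VS lin_closed[OF D_lin X(1)]])
    have "\<exists>u\<in>carrier (I m). sng 0 (int m) (?y 0 (int m)) = emb m u"
    proof (rule column_emb)
      show "sng 0 (int m) (?y 0 (int m)) \<in> carrier X" unfolding e[symmetric] by (rule vs_dif[OF X_VS X])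
      show "D (sng 0 (int m) (?y 0 (int m))) 1 (int m) = \<zero>\<^bsub>C 1 (int m)\<^esub>"
        unfolding e[symmetric] Dy by (simp add: emb_def sng_def)
    qed
    then obtain u where u: "u \<in> carrier (I m)" "?y = emb m u" unfolding e[symmetric] by blast
    have d: "dI m u \<in> carrier (I n)" using lin_closed[OF dI_lin u(1)] Suc by simp
    have "emb n (dif (I n) w (dI m u)) = dif X (emb n w) (emb n (dI m u))" by (rule lin_dif[OF emb_lin w d])
    also have "emb n (dI m u) = emb n w" using D_emb[OF u(1)] Dy u(2) Suc by simp
    also have "dif X (emb n w) (emb n w) = \<zero>\<^bsub>X\<^esub>" by (rule vs_dif_self[OF X_VS lin_closed[OF emb_lin w]])
    finally have "dif (I n) w (dI m u) = \<zero>\<^bsub>I n\<^esub>" by (rule emb_inj[rotated]) (rule vs_dif[OF lin_V[OF dI_lin] w d])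
    then have "w = dI m u \<oplus>\<^bsub>I n\<^esub> \<zero>\<^bsub>I n\<^esub>" using vs_dif_eq[OF lin_V[OF dI_lin] w d vs_zero[OF lin_V[OF dI_lin]]] by simp
    then have "w = dI m u" using vs_add_zero(1)[OF lin_V[OF dI_lin] d] by simp
    then show ?thesis using u(1) Suc by (simp add: coboundaries_def)
  qed
next
  assume b: "w \<in> coboundaries I dI n"
  show "\<exists>z\<in>T (int n - 1). emb n w = D z"
  proof (cases n)
    case 0
    then have "emb n w = D \<zero>\<^bsub>X\<^esub>" using b lin_zero[OF emb_lin] lin_zero[OF D_lin] by (simp add: coboundaries_def)
    then show ?thesis using sub_zero[OF T_sub] by blast
  next
    case (Suc m)
    then obtain u where u: "u \<in> carrier (I m)" "w = dI m u" using b by (auto simp: coboundaries_def)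
    have "emb n w = D (emb m u)" using D_emb[OF u(1)] u(2) Suc by simp
    moreover have "emb m u \<in> T (int n - 1)" using emb_T[OF u(1)] Suc by simp
    ultimately show ?thesis by blast
  qed
qed

text \<open>\<open>emb\<close> is injective and carries \<open>dI\<close> to \<open>D\<close>, so D
  D = 0 pulls back.\<close>

lemma dI_dI: "w \<in> carrier (I n) \<Longrightarrow> dI (Suc n) (dI n w) = \<zero>\<^bsub>I (Suc (Suc n))\<^esub>"
  using emb_inj[OF lin_closed[OF dI_lin lin_closed[OF dI_lin]]] D_emb lin_closed[OF dI_lin] D_D[OF lin_closed[OF emb_lin]]
  by metis

abbreviation Z where "Z n \<equiv> {w \<in> carrier (I n). dI n w = \<zero>\<^bsub>I (Suc n)\<^esub>}"

lemma B_sub: "sub (coboundaries I dI n) ((I n)\<lparr>carrier := Z n\<rparr>)"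
proof (cases n)
  case 0
  show ?thesis unfolding 0 coboundaries_def
    using sub_zero_space[OF sub_VS[OF sub_kernel[OF dI_lin[of 0]]]] by simp
next
  case (Suc m)
  show ?thesis unfolding Suc coboundaries_def nat.case
    by (rule sub_sub[OF sub_kernel[OF dI_lin] sub_range[OF dI_lin]]) (use dI_dI lin_closed[OF dI_lin] in auto)
qed

text \<open>A total cocycle is related to the class of a column-zero cocycle cohomologous to it: the
  inverse of the map induced by \<open>emb\<close>, before it is known to be a map.\<close>

definition edge :: "nat \<Rightarrow> (int \<Rightarrow> int \<Rightarrow> 'c) \<Rightarrow> 'i set \<Rightarrow> bool" where
  "edge n y h \<longleftrightarrow> (\<exists>z\<in>T (int n - 1). \<exists>w\<in>Z n. y = D z \<oplus>\<^bsub>X\<^esub> emb n w \<and> h = coboundaries I dI n +>\<^bsub>(I n)\<lparr>carrier := Z n\<rparr>\<^esub> w)"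

lemma edge_exists:
  assumes y: "y \<in> T (int n)" "D y = \<zero>\<^bsub>X\<^esub>"
  shows "\<exists>z\<in>T (int n - 1). \<exists>w\<in>Z n. y = D z \<oplus>\<^bsub>X\<^esub> emb n w"
proof -
  obtain z where z: "z \<in> T (int n - 1)" and e: "dif X y (D z) = sng 0 (int n) (dif X y (D z) 0 (int n))"
    using first_column'[OF y(1)] y(2) by auto
  let ?y = "dif X y (D z)"
  have X: "y \<in> carrier X" "D z \<in> carrier X" by (rule T_X[OF y(1)], rule lin_closed[OF D_lin T_X[OF z]])
  have Dy: "D ?y = \<zero>\<^bsub>X\<^esub>"
    unfolding lin_dif[OF D_lin X] D_D[OF T_X[OF z]] y(2) by (rule vs_dif_self[OF X_VS vs_zero[OF X_VS]])
  have "\<exists>w\<in>carrier (I n). sng 0 (int n) (?y 0 (int n)) = emb n w"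
  proof (rule column_emb)
    show "sng 0 (int n) (?y 0 (int n)) \<in> carrier X" unfolding e[symmetric] by (rule vs_dif[OF X_VS X])
    show "D (sng 0 (int n) (?y 0 (int n))) 1 (int n) = \<zero>\<^bsub>C 1 (int n)\<^esub>" unfolding e[symmetric] Dy by simp
  qed
  then obtain w where w: "w \<in> carrier (I n)" "?y = emb n w" unfolding e[symmetric] by blast
  have "emb (Suc n) (dI n w) = \<zero>\<^bsub>X\<^esub>" using D_emb[OF w(1)] Dy w(2) by simp
  then have "dI n w = \<zero>\<^bsub>I (Suc n)\<^esub>" by (rule emb_inj[OF lin_closed[OF dI_lin w(1)]])
  moreover have "y = D z \<oplus>\<^bsub>X\<^esub> emb n w" unfolding w(2)[symmetric] by (rule vs_dif_add(1)[OF X_VS X, symmetric])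
  ultimately show ?thesis using z w(1) by blast
qed

text \<open>y and \<open>emb n w\<close> differ by a boundary, so \<open>emb_boundary\<close>
  decides for both. This gives single-valuedness of \<open>edge\<close> and later the kernel of
  \<open>cl\<close>.\<close>

lemma edge_zero:
  assumes z: "z \<in> T (int n - 1)" and w: "w \<in> Z n" and e: "y = D z \<oplus>\<^bsub>X\<^esub> emb n w"
  shows "(\<exists>z\<in>T (int n - 1). y = D z) \<longleftrightarrow> w \<in> coboundaries I dI n"
proof -
  have wI: "w \<in> carrier (I n)" using w by simp
  have X: "D z \<in> carrier X" "emb n w \<in> carrier X" by (rule lin_closed[OF D_lin T_X[OF z]], rule lin_closed[OF emb_lin wI])
  have "(\<exists>z\<in>T (int n - 1). y = D z) \<longleftrightarrow> (\<exists>z\<in>T (int n - 1). emb n w = D z)"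
  proof
    assume "\<exists>z\<in>T (int n - 1). y = D z"
    then obtain z' where z': "z' \<in> T (int n - 1)" "y = D z'" by blast
    have "dif X (D z') (D z) = emb n w"
      using vs_dif_eq[OF X_VS lin_closed[OF D_lin T_X[OF z'(1)]] X] e z'(2) by simp
    then have "emb n w = D (dif X z' z)" using lin_dif[OF D_lin T_X[OF z'(1)] T_X[OF z]] by simp
    then show "\<exists>z\<in>T (int n - 1). emb n w = D z" using sub_dif[OF T_sub z'(1) z] by blast
  next
    assume "\<exists>z\<in>T (int n - 1). emb n w = D z"
    then obtain z' where z': "z' \<in> T (int n - 1)" "emb n w = D z'" by blast
    have "y = D (z \<oplus>\<^bsub>X\<^esub> z')" unfolding e z'(2) by (rule lin_add[OF D_lin T_X[OF z] T_X[OF z'(1)], symmetric])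
    then show "\<exists>z\<in>T (int n - 1). y = D z" using sub_add[OF T_sub z z'(1)] by blast
  qed
  also have "\<dots> \<longleftrightarrow> w \<in> coboundaries I dI n" by (rule emb_boundary[OF wI])
  finally show ?thesis .
qed

lemma edge_map_exists:
  "\<exists>cl. lin (X\<lparr>carrier := {y \<in> T (int n). D y = \<zero>\<^bsub>X\<^esub>}\<rparr>) (cohomology I dI n) cl \<and>
    (\<forall>y\<in>{y \<in> T (int n). D y = \<zero>\<^bsub>X\<^esub>}. \<forall>h\<in>carrier (cohomology I dI n). edge n y h \<longleftrightarrow> h = cl y)"
proof -
  let ?I = "(I n)\<lparr>carrier := Z n\<rparr>" and ?B = "coboundaries I dI n"
  let ?X = "X\<lparr>carrier := {y \<in> T (int n). D y = \<zero>\<^bsub>X\<^esub>}\<rparr>"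
  have H: "cohomology I dI n = quot_module ?I ?B" by (simp add: cohomology_def cocycles_def)
  have Zs: "sub (Z n) (I n)" by (rule sub_kernel[OF dI_lin])
  have Ks: "sub {y \<in> T (int n). D y = \<zero>\<^bsub>X\<^esub>} X"
  proof -
    have "{y \<in> T (int n). D y = \<zero>\<^bsub>X\<^esub>} = T (int n) \<inter> {y \<in> carrier X. D y = \<zero>\<^bsub>X\<^esub>}" using T_X by blast
    then show ?thesis using sub_Int[OF T_sub sub_kernel[OF D_lin]] by simp
  qed
  have q: "lin ?I (quot_module ?I ?B) (\<lambda>w. ?B +>\<^bsub>?I\<^esub> w)" by (rule lin_quot[OF B_sub])
  note DXl = lin_add[OF D_lin T_X T_X] and el = lin_restrict[OF emb_lin Zs]
  have "\<exists>f. lin ?X (quot_module ?I ?B) f \<and> (\<forall>y\<in>carrier ?X. \<forall>h\<in>carrier (quot_module ?I ?B). edge n y h \<longleftrightarrow> h = f y)"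
  proof (rule linear_relation[OF sub_VS[OF Ks] quot_VS[OF B_sub]])
    fix y assume "y \<in> carrier ?X"
    then show "\<exists>h\<in>carrier (quot_module ?I ?B). edge n y h"
      using edge_exists[of y n] unfolding edge_def quot_carrier by fastforce
  next
    fix y h y' h' assume "edge n y h" "edge n y' h'"
    then obtain z w z' w' where a: "z \<in> T (int n - 1)" "w \<in> Z n" "y = D z \<oplus>\<^bsub>X\<^esub> emb n w" "h = ?B +>\<^bsub>?I\<^esub> w"
      and b: "z' \<in> T (int n - 1)" "w' \<in> Z n" "y' = D z' \<oplus>\<^bsub>X\<^esub> emb n w'" "h' = ?B +>\<^bsub>?I\<^esub> w'" unfolding edge_def by blast
    have X: "D z \<in> carrier X" "D z' \<in> carrier X" by (rule lin_closed[OF D_lin T_X[OF a(1)]], rule lin_closed[OF D_lin T_X[OF b(1)]])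
    have E: "emb n w \<in> carrier X" "emb n w' \<in> carrier X" using lin_closed[OF el] a(2) b(2) by (simp_all del: total_space_simps)
    have "y \<oplus>\<^bsub>X\<^esub> y' = D (z \<oplus>\<^bsub>X\<^esub> z') \<oplus>\<^bsub>X\<^esub> emb n (w \<oplus>\<^bsub>I n\<^esub> w')"
    proof -
      have "emb n (w \<oplus>\<^bsub>I n\<^esub> w') = emb n w \<oplus>\<^bsub>X\<^esub> emb n w'" by (rule lin_add[OF emb_lin]) (use a(2) b(2) in simp_all)
      then show ?thesis
        unfolding a(3) b(3) lin_add[OF D_lin T_X[OF a(1)] T_X[OF b(1)]]
        by (simp only: vs_ac[OF X_VS] vs_add[OF X_VS] X E)
    qed
    moreover have "h \<oplus>\<^bsub>quot_module ?I ?B\<^esub> h' = ?B +>\<^bsub>?I\<^esub> (w \<oplus>\<^bsub>I n\<^esub> w')"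
      unfolding a(4) b(4) using coset_add[OF B_sub, of w n w'] a(2) b(2) by simp
    ultimately show "edge n (y \<oplus>\<^bsub>?X\<^esub> y') (h \<oplus>\<^bsub>quot_module ?I ?B\<^esub> h')"
      unfolding edge_def using sub_add[OF T_sub a(1) b(1)] sub_add[OF Zs a(2) b(2)]
      by (intro bexI[of _ "z \<oplus>\<^bsub>X\<^esub> z'"] bexI[of _ "w \<oplus>\<^bsub>I n\<^esub> w'"]) simp_all
  next
    fix c y h assume c: "c \<in> carrier k" and "edge n y h"
    then obtain z w where a: "z \<in> T (int n - 1)" "w \<in> Z n" "y = D z \<oplus>\<^bsub>X\<^esub> emb n w" "h = ?B +>\<^bsub>?I\<^esub> w"
      unfolding edge_def by blast
    have wI: "w \<in> carrier (I n)" using a(2) by simp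
    have X: "D z \<in> carrier X" "emb n w \<in> carrier X" by (rule lin_closed[OF D_lin T_X[OF a(1)]], rule lin_closed[OF emb_lin wI])
    have "c \<odot>\<^bsub>X\<^esub> y = D (c \<odot>\<^bsub>X\<^esub> z) \<oplus>\<^bsub>X\<^esub> emb n (c \<odot>\<^bsub>I n\<^esub> w)"
      unfolding a(3) lin_smult[OF D_lin c T_X[OF a(1)]] lin_smult[OF emb_lin c wI] by (rule vs_smult_add[OF X_VS c X])
    moreover have "c \<odot>\<^bsub>quot_module ?I ?B\<^esub> h = ?B +>\<^bsub>?I\<^esub> (c \<odot>\<^bsub>I n\<^esub> w)"
      unfolding a(4) using coset_smult[OF B_sub, of w n c] a(2) c by simp
    ultimately show "edge n (c \<odot>\<^bsub>?X\<^esub> y) (c \<odot>\<^bsub>quot_module ?I ?B\<^esub> h)"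
      unfolding edge_def using sub_smult[OF T_sub c a(1)] sub_smult[OF Zs c a(2)]
      by (intro bexI[of _ "c \<odot>\<^bsub>X\<^esub> z"] bexI[of _ "c \<odot>\<^bsub>I n\<^esub> w"]) simp_all
  next
    fix h assume "edge n \<zero>\<^bsub>?X\<^esub> h"
    then obtain z w where a: "z \<in> T (int n - 1)" "w \<in> Z n" "\<zero>\<^bsub>X\<^esub> = D z \<oplus>\<^bsub>X\<^esub> emb n w" "h = ?B +>\<^bsub>?I\<^esub> w"
      unfolding edge_def by auto
    have "\<exists>z\<in>T (int n - 1). \<zero>\<^bsub>X\<^esub> = D z" using sub_zero[OF T_sub] lin_zero[OF D_lin] by metis
    then have "w \<in> ?B" using edge_zero[OF a(1,2,3)] by blast
    then show "h = \<zero>\<^bsub>quot_module ?I ?B\<^esub>" unfolding a(4) quot_zero using coset_eq_zero[OF B_sub, of w n] a(2) by simp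
  qed
  then show ?thesis unfolding H by simp
qed

definition cl where "cl n = (SOME cl. lin (X\<lparr>carrier := {y \<in> T (int n). D y = \<zero>\<^bsub>X\<^esub>}\<rparr>) (cohomology I dI n) cl \<and>
    (\<forall>y\<in>{y \<in> T (int n). D y = \<zero>\<^bsub>X\<^esub>}. \<forall>h\<in>carrier (cohomology I dI n). edge n y h \<longleftrightarrow> h = cl y))"

lemma cl_lin: "lin (X\<lparr>carrier := {y \<in> T (int n). D y = \<zero>\<^bsub>X\<^esub>}\<rparr>) (cohomology I dI n) (cl n)"
  and cl_edge: "y \<in> T (int n) \<Longrightarrow> D y = \<zero>\<^bsub>X\<^esub> \<Longrightarrow> h \<in> carrier (cohomology I dI n) \<Longrightarrow> edge n y h \<longleftrightarrow> h = cl n y"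
  using someI_ex[OF edge_map_exists[of n]] unfolding cl_def[symmetric] by simp_all

lemma H_carrier: "carrier (cohomology I dI n) = (\<lambda>w. coboundaries I dI n +>\<^bsub>(I n)\<lparr>carrier := Z n\<rparr>\<^esub> w) ` Z n"
  by (simp add: cohomology_def cocycles_def quot_carrier)

lemma cl_surj: "carrier (cohomology I dI n) \<subseteq> cl n ` {y \<in> T (int n). D y = \<zero>\<^bsub>X\<^esub>}"
proof
  fix h assume h: "h \<in> carrier (cohomology I dI n)"
  then obtain w where w: "w \<in> Z n" "h = coboundaries I dI n +>\<^bsub>(I n)\<lparr>carrier := Z n\<rparr>\<^esub> w" unfolding H_carrier by blast
  have wI: "w \<in> carrier (I n)" using w by simp
  have e: "emb n w \<in> T (int n)" "D (emb n w) = \<zero>\<^bsub>X\<^esub>"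
    by (rule emb_T[OF wI]) (use D_emb[OF wI] w(1) lin_zero[OF emb_lin] in simp)
  have "emb n w = D \<zero>\<^bsub>X\<^esub> \<oplus>\<^bsub>X\<^esub> emb n w"
    unfolding lin_zero[OF D_lin] by (rule vs_add_zero(2)[OF X_VS T_X[OF e(1)], symmetric])
  then have "edge n (emb n w) h" unfolding edge_def using sub_zero[OF T_sub] w by blast
  then have "h = cl n (emb n w)" using cl_edge[OF e h] by blast
  then show "h \<in> cl n ` {y \<in> T (int n). D y = \<zero>\<^bsub>X\<^esub>}" using e by blast
qed

lemma cl_ker:
  assumes y: "y \<in> T (int n)" "D y = \<zero>\<^bsub>X\<^esub>"
  shows "cl n y = \<zero>\<^bsub>cohomology I dI n\<^esub> \<longleftrightarrow> (\<exists>z\<in>T (int n - 1). y = D z)"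
proof -
  obtain z w where zw: "z \<in> T (int n - 1)" "w \<in> Z n" "y = D z \<oplus>\<^bsub>X\<^esub> emb n w" using edge_exists[OF y] by blast
  let ?h = "coboundaries I dI n +>\<^bsub>(I n)\<lparr>carrier := Z n\<rparr>\<^esub> w"
  have "edge n y ?h" unfolding edge_def using zw by blast
  then have "cl n y = ?h" using cl_edge[OF y, of ?h] zw(2) unfolding H_carrier by blast
  then have "cl n y = \<zero>\<^bsub>cohomology I dI n\<^esub> \<longleftrightarrow> w \<in> coboundaries I dI n"
    using coset_eq_zero[OF B_sub, of w n] zw(2) by (simp add: cohomology_def cocycles_def quot_zero)
  then show ?thesis using edge_zero[OF zw] by blast
qed

lemma filtered: "filtered_complex k X D T F M \<phi> (cohomology I dI) cl"
proof (intro filtered_complex.intro ground_field_axioms, rule filtered_complex_axioms.intro)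
  show "F n' \<subseteq> F n" if "n \<le> n'" for n n' using that by (auto simp: F_def)
  show "F n = carrier X" if "n \<le> 0" for n using that zero_if by (auto simp: F_def)
qed (rule D_lin, erule D_D, rule T_sub, erule T_D, rule F_sub, erule (2) F_high, rule phi_lin,
    rule phi_surj, erule phi_ker, rule cl_lin, rule cl_surj, erule (1) cl_ker)

theorem spectral:
  "\<exists>E D. spectral_sequence k E D \<and> (\<forall>i j. E 2 i j = M i j) \<and> converges_to k E (cohomology I dI)"
proof -
  \<comment> \<open>\<open>A\<close> is a defined parameter of the locale; its defining equation
    holds by reflexivity.\<close>
  interpret S: filtered_complex k X D T F M \<phi> "\<lambda>n r s. A n r s" "cohomology I dI" cl
    by (rule filtered) (rule reflexive)
  have "\<forall>i j. S.E 2 i j = M i j" by (intro allI) (rule S.E_2)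
  then show ?thesis by (intro exI[of _ S.E] exI[of _ "\<lambda>r. S.Dr (int r)"] conjI) (rule S.spectral, assumption, rule S.converges)
qed

end

section \<open>Tensor products\<close>

context ground_field
begin

section \<open>Free vector spaces and linear extension\<close>

lemma lin_finsum:
  assumes f: "lin V W f" and g: "\<And>i. i \<in> S \<Longrightarrow> g i \<in> carrier V" and S: "finite S"
  shows "(\<Oplus>\<^bsub>V\<^esub>i\<in>S. g i) \<in> carrier V \<and> f (\<Oplus>\<^bsub>V\<^esub>i\<in>S. g i) = (\<Oplus>\<^bsub>W\<^esub>i\<in>S. f (g i))"
proof -
  interpret V: vectorspace k V by (rule lin_V[OF f])
  interpret W: vectorspace k W by (rule lin_W[OF f])
  from S g show ?thesis
  proof (induction S)
    case empty
    show ?case by (simp add: lin_zero[OF f])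
  next
    case (insert i S)
    then have c: "g i \<in> carrier V" "g \<in> S \<rightarrow> carrier V" "f (g i) \<in> carrier W" "(\<lambda>i. f (g i)) \<in> S \<rightarrow> carrier W"
      by (auto simp: lin_closed[OF f])
    have "(\<Oplus>\<^bsub>V\<^esub>i\<in>insert i S. g i) = g i \<oplus>\<^bsub>V\<^esub> (\<Oplus>\<^bsub>V\<^esub>i\<in>S. g i)"
      by (rule V.finsum_insert) (use insert.hyps c in auto)
    moreover have "(\<Oplus>\<^bsub>W\<^esub>i\<in>insert i S. f (g i)) = f (g i) \<oplus>\<^bsub>W\<^esub> (\<Oplus>\<^bsub>W\<^esub>i\<in>S. f (g i))"
      by (rule W.finsum_insert) (use insert.hyps c in auto)
    ultimately show ?case using insert.IH insert.prems c by (simp add: lin_add[OF f])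
  qed
qed

text \<open>The tensor relations are written with \<open>\<ominus>\<close>, the rest of the
  development with \<open>dif\<close>.\<close>

lemma vs_minus: "VS V \<Longrightarrow> x \<in> carrier V \<Longrightarrow> y \<in> carrier V \<Longrightarrow> x \<ominus>\<^bsub>V\<^esub> y = dif V x y"
proof -
  assume "VS V" and xy: "x \<in> carrier V" "y \<in> carrier V"
  then interpret V: vectorspace k V by simp
  show ?thesis using xy by (simp add: vdiff_def V.minus_eq V.smult_l_minus)
qed

lemma self_VS: "VS (self_module k)"
proof -
  interpret K: field k by (rule is_field)
  show ?thesis
    by (rule VS_I) (simp_all add: self_module_def K.m_assoc K.l_distr K.r_distr K.a_ac K.l_minus K.r_neg K.l_neg)
qed

lemma self_simps [simp]:
  "carrier (self_module k) = carrier k" "\<zero>\<^bsub>self_module k\<^esub> = \<zero>\<^bsub>k\<^esub>"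
  "x \<odot>\<^bsub>self_module k\<^esub> y = x \<otimes>\<^bsub>k\<^esub> y" "x \<oplus>\<^bsub>self_module k\<^esub> y = x \<oplus>\<^bsub>k\<^esub> y"
  by (simp_all add: self_module_def)

lemma free_VS: "VS (free_module k I)"
  unfolding free_module_def by (rule dsum_VS) (rule self_VS)

lemma free_simps:
  "u \<in> carrier (free_module k I) \<longleftrightarrow> u \<in> (I \<rightarrow>\<^sub>E carrier k) \<and> finite {i \<in> I. u i \<noteq> \<zero>\<^bsub>k\<^esub>}"
  "u \<oplus>\<^bsub>free_module k I\<^esub> v = (\<lambda>i\<in>I. u i \<oplus>\<^bsub>k\<^esub> v i)"
  "c \<odot>\<^bsub>free_module k I\<^esub> u = (\<lambda>i\<in>I. c \<otimes>\<^bsub>k\<^esub> u i)"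
  "\<zero>\<^bsub>free_module k I\<^esub> = (\<lambda>i\<in>I. \<zero>\<^bsub>k\<^esub>)"
  by (simp_all add: free_module_def dsum_def)

lemma basis_closed: "basis_vec k I i \<in> carrier (free_module k I)"
proof -
  have "finite {j \<in> I. basis_vec k I i j \<noteq> \<zero>\<^bsub>k\<^esub>}"
    by (rule finite_subset[of _ "{i}"]) (auto simp: basis_vec_def)
  then show ?thesis by (auto simp: free_simps basis_vec_def)
qed

text \<open>Induction on a finite set containing the support: setting one coefficient to zero splits
  off one term.\<close>

lemma free_induct:
  assumes u: "u \<in> carrier (free_module k I)"
    and zero: "Q \<zero>\<^bsub>free_module k I\<^esub>"
    and step: "\<And>c i v. c \<in> carrier k \<Longrightarrow> i \<in> I \<Longrightarrow> v \<in> carrier (free_module k I) \<Longrightarrow> Q v \<Longrightarrow>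
      Q (c \<odot>\<^bsub>free_module k I\<^esub> basis_vec k I i \<oplus>\<^bsub>free_module k I\<^esub> v)"
  shows "Q u"
proof -
  interpret K: field k by (rule is_field)
  have "Q u" if "finite S" "u \<in> carrier (free_module k I)" "{i \<in> I. u i \<noteq> \<zero>\<^bsub>k\<^esub>} \<subseteq> S" for S u
    using that
  proof (induction S arbitrary: u)
    case empty
    then have "u = \<zero>\<^bsub>free_module k I\<^esub>" by (auto simp: free_simps fun_eq_iff PiE_def extensional_def restrict_def)
    then show ?case using zero by simp
  next
    case (insert i S)
    show ?case
    proof (cases "i \<in> I")
      case False
      then show ?thesis using insert by (intro insert.IH) auto
    next
      case True
      define v where "v = u(i := \<zero>\<^bsub>k\<^esub>)"
      have uc: "u j \<in> carrier k" if "j \<in> I" for j using insert.prems(1) that by (auto simp: free_simps)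
      have "{j \<in> I. v j \<noteq> \<zero>\<^bsub>k\<^esub>} \<subseteq> {j \<in> I. u j \<noteq> \<zero>\<^bsub>k\<^esub>}" by (auto simp: v_def)
      moreover have "finite {j \<in> I. u j \<noteq> \<zero>\<^bsub>k\<^esub>}" using insert.prems(1) by (simp add: free_simps)
      ultimately have "finite {j \<in> I. v j \<noteq> \<zero>\<^bsub>k\<^esub>}" by (rule finite_subset)
      then have v: "v \<in> carrier (free_module k I)"
        using insert.prems(1) True by (auto simp: free_simps v_def PiE_def extensional_def)
      have "Q v" by (rule insert.IH[OF v]) (use insert.prems(2) in \<open>auto simp: v_def\<close>)
      then have "Q (u i \<odot>\<^bsub>free_module k I\<^esub> basis_vec k I i \<oplus>\<^bsub>free_module k I\<^esub> v)"
        by (rule step[OF uc[OF True] True v])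
      moreover have "u i \<odot>\<^bsub>free_module k I\<^esub> basis_vec k I i \<oplus>\<^bsub>free_module k I\<^esub> v = u"
      proof
        fix j
        show "(u i \<odot>\<^bsub>free_module k I\<^esub> basis_vec k I i \<oplus>\<^bsub>free_module k I\<^esub> v) j = u j"
        proof (cases "j \<in> I")
          case True
          then show ?thesis using uc[OF \<open>i \<in> I\<close>] uc[OF True] by (simp add: free_simps basis_vec_def v_def)
        next
          case False
          then have "u j = undefined" using insert.prems(1) by (auto simp: free_simps PiE_def extensional_def)
          then show ?thesis using False by (simp add: free_simps)
        qed
      qed
      ultimately show ?thesis by simp
    qed
  qed
  moreover have "finite {i \<in> I. u i \<noteq> \<zero>\<^bsub>k\<^esub>}" using u by (simp add: free_simps)
  ultimately show ?thesis using u by blast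
qed

definition free_lift :: "'i set \<Rightarrow> ('k, 'x) module \<Rightarrow> ('i \<Rightarrow> 'x) \<Rightarrow> ('i \<Rightarrow> 'k) \<Rightarrow> 'x" where
  "free_lift I X \<phi> u = (\<Oplus>\<^bsub>X\<^esub>i\<in>{i \<in> I. u i \<noteq> \<zero>\<^bsub>k\<^esub>}. u i \<odot>\<^bsub>X\<^esub> \<phi> i)"

text \<open>Additivity needs a common index set, since the supports of u, v and u + v
  differ.\<close>

lemma free_lift_superset:
  assumes X: "VS X" and \<phi>: "\<And>i. i \<in> I \<Longrightarrow> \<phi> i \<in> carrier X" and u: "u \<in> I \<rightarrow> carrier k"
    and S: "finite S" "{i \<in> I. u i \<noteq> \<zero>\<^bsub>k\<^esub>} \<subseteq> S" "S \<subseteq> I"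
  shows "free_lift I X \<phi> u = (\<Oplus>\<^bsub>X\<^esub>i\<in>S. u i \<odot>\<^bsub>X\<^esub> \<phi> i)"
proof -
  interpret X: vectorspace k X by (rule X)
  show ?thesis
    unfolding free_lift_def
  proof (rule X.add.finprod_mono_neutral_cong_left[OF S(1,2)])
    show "u i \<odot>\<^bsub>X\<^esub> \<phi> i = \<zero>\<^bsub>X\<^esub>" if "i \<in> S - {i \<in> I. u i \<noteq> \<zero>\<^bsub>k\<^esub>}" for i
    proof -
      have "i \<in> I" "u i = \<zero>\<^bsub>k\<^esub>" using that S(3) by auto
      then show ?thesis using \<phi>[of i] by simp
    qed
    show "(\<lambda>i. u i \<odot>\<^bsub>X\<^esub> \<phi> i) \<in> S \<rightarrow> carrier X"
    proof
      fix i assume "i \<in> S"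
      then have "i \<in> I" using S(3) by auto
      then show "u i \<odot>\<^bsub>X\<^esub> \<phi> i \<in> carrier X" using \<phi>[of i] funcset_mem[OF u] by simp
    qed
  qed simp
qed

lemma free_lift_lin:
  assumes X: "VS X" and \<phi>: "\<And>i. i \<in> I \<Longrightarrow> \<phi> i \<in> carrier X"
  shows "lin (free_module k I) X (free_lift I X \<phi>)"
proof (rule linI)
  interpret X: vectorspace k X by (rule X)
  show "VS X" "VS (free_module k I)" by (rule X, rule free_VS)
  let ?s = "\<lambda>u. {i \<in> I. u i \<noteq> \<zero>\<^bsub>k\<^esub>}"
  fix u assume u: "u \<in> carrier (free_module k I)"
  have u': "u \<in> I \<rightarrow> carrier k" "finite (?s u)" using u by (auto simp: free_simps)
  have up: "u i \<odot>\<^bsub>X\<^esub> \<phi> i \<in> carrier X" if "i \<in> I" for i using u' \<phi> that by (auto simp: X)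
  show "free_lift I X \<phi> u \<in> carrier X" unfolding free_lift_def by (rule X.finsum_closed) (auto simp: up)
  show "free_lift I X \<phi> (c \<odot>\<^bsub>free_module k I\<^esub> u) = c \<odot>\<^bsub>X\<^esub> free_lift I X \<phi> u" if c: "c \<in> carrier k" for c
  proof -
    interpret K: field k by (rule is_field)
    have uI: "u i \<in> carrier k" if "i \<in> I" for i using u'(1) that by auto
    have "free_lift I X \<phi> (c \<odot>\<^bsub>free_module k I\<^esub> u) = (\<Oplus>\<^bsub>X\<^esub>i\<in>?s u. (c \<odot>\<^bsub>free_module k I\<^esub> u) i \<odot>\<^bsub>X\<^esub> \<phi> i)"
      by (rule free_lift_superset[OF X \<phi>]) (use u' c uI in \<open>auto simp: free_simps\<close>)
    also have "\<dots> = (\<Oplus>\<^bsub>X\<^esub>i\<in>?s u. c \<odot>\<^bsub>X\<^esub> (u i \<odot>\<^bsub>X\<^esub> \<phi> i))"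
      by (rule X.finsum_cong') (use up uI c \<phi> in \<open>auto simp: free_simps X vs_smult_smult\<close>)
    also have "\<dots> = c \<odot>\<^bsub>X\<^esub> free_lift I X \<phi> u"
      unfolding free_lift_def
      by (rule conjunct2[OF lin_finsum[OF lin_smultf[OF c lin_id[OF X]]], symmetric]) (use u' up in auto)
    finally show ?thesis .
  qed
  fix v assume v: "v \<in> carrier (free_module k I)"
  have v': "v \<in> I \<rightarrow> carrier k" "finite (?s v)" using v by (auto simp: free_simps)
  have vp: "v i \<odot>\<^bsub>X\<^esub> \<phi> i \<in> carrier X" if "i \<in> I" for i using v' \<phi> that by (auto simp: X)
  define T where "T = ?s u \<union> ?s v"
  have T: "finite T" "T \<subseteq> I" "?s u \<subseteq> T" "?s v \<subseteq> T" using u' v' by (auto simp: T_def)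
  have uI: "u i \<in> carrier k" "v i \<in> carrier k" if "i \<in> I" for i using u'(1) v'(1) that by auto
  have sT: "?s (u \<oplus>\<^bsub>free_module k I\<^esub> v) \<subseteq> T"
  proof -
    interpret K: field k by (rule is_field)
    show ?thesis by (auto simp: free_simps T_def)
  qed
  have "free_lift I X \<phi> (u \<oplus>\<^bsub>free_module k I\<^esub> v) = (\<Oplus>\<^bsub>X\<^esub>i\<in>T. (u \<oplus>\<^bsub>free_module k I\<^esub> v) i \<odot>\<^bsub>X\<^esub> \<phi> i)"
    by (rule free_lift_superset[OF X \<phi> _ T(1) sT T(2)]) (use uI in \<open>auto simp: free_simps\<close>)
  also have "\<dots> = (\<Oplus>\<^bsub>X\<^esub>i\<in>T. u i \<odot>\<^bsub>X\<^esub> \<phi> i \<oplus>\<^bsub>X\<^esub> v i \<odot>\<^bsub>X\<^esub> \<phi> i)"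
  proof (rule X.finsum_cong')
    show "(\<lambda>i. u i \<odot>\<^bsub>X\<^esub> \<phi> i \<oplus>\<^bsub>X\<^esub> v i \<odot>\<^bsub>X\<^esub> \<phi> i) \<in> T \<rightarrow> carrier X" using up vp T(2) by auto
    show "(u \<oplus>\<^bsub>free_module k I\<^esub> v) i \<odot>\<^bsub>X\<^esub> \<phi> i = u i \<odot>\<^bsub>X\<^esub> \<phi> i \<oplus>\<^bsub>X\<^esub> v i \<odot>\<^bsub>X\<^esub> \<phi> i" if "i \<in> T" for i
      using subsetD[OF T(2) that] uI[of i] \<phi>[of i] by (simp add: free_simps X vs_add_smult)
  qed simp
  also have "\<dots> = (\<Oplus>\<^bsub>X\<^esub>i\<in>T. u i \<odot>\<^bsub>X\<^esub> \<phi> i) \<oplus>\<^bsub>X\<^esub> (\<Oplus>\<^bsub>X\<^esub>i\<in>T. v i \<odot>\<^bsub>X\<^esub> \<phi> i)"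
    by (rule X.finsum_addf) (use up vp T(2) in auto)
  also have "\<dots> = free_lift I X \<phi> u \<oplus>\<^bsub>X\<^esub> free_lift I X \<phi> v"
    using free_lift_superset[OF X \<phi> u'(1) T(1,3,2)] free_lift_superset[OF X \<phi> v'(1) T(1,4,2)] by simp
  finally show "free_lift I X \<phi> (u \<oplus>\<^bsub>free_module k I\<^esub> v) = free_lift I X \<phi> u \<oplus>\<^bsub>X\<^esub> free_lift I X \<phi> v" .
qed

lemma free_lift_basis:
  assumes X: "VS X" and \<phi>: "\<And>i. i \<in> I \<Longrightarrow> \<phi> i \<in> carrier X" and i: "i \<in> I"
  shows "free_lift I X \<phi> (basis_vec k I i) = \<phi> i"
proof -
  interpret X: vectorspace k X by (rule X)
  have "free_lift I X \<phi> (basis_vec k I i) = (\<Oplus>\<^bsub>X\<^esub>j\<in>{i}. basis_vec k I i j \<odot>\<^bsub>X\<^esub> \<phi> j)"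
    by (rule free_lift_superset[OF X \<phi>]) (use i in \<open>auto simp: basis_vec_def\<close>)
  also have "\<dots> = \<phi> i" using i \<phi>[OF i] by (simp add: basis_vec_def X)
  finally show ?thesis .
qed

section \<open>Multilinear maps and the universal property\<close>

definition VSs :: "('k, 'u) module list \<Rightarrow> bool" where "VSs Us \<longleftrightarrow> (\<forall>U\<in>set Us. VS U)"

text \<open>Linearity in a list argument is phrased with list update, the form in which it occurs in
  \<open>tensor_rels\<close>, so that each relation is matched directly.\<close>

definition mlin ::
  "('k, 'u) module list \<Rightarrow> ('k, 'v) module \<Rightarrow> ('k, 'x) module \<Rightarrow> ('u list \<Rightarrow> 'v \<Rightarrow> 'x) \<Rightarrow> bool" where
  "mlin Us V X \<phi> \<longleftrightarrow> VS X \<and>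
    (\<forall>xs v. (xs, v) \<in> tensor_keys Us V \<longrightarrow>
      lin V X (\<phi> xs) \<and> (\<forall>i<length Us. lin (Us ! i) X (\<lambda>x. \<phi> (xs[i := x]) v)))"

lemma keys_Nil [simp]: "(xs, v) \<in> tensor_keys [] V \<longleftrightarrow> xs = [] \<and> v \<in> carrier V"
  by (auto simp: tensor_keys_def)

lemma keys_Cons [simp]:
  "(xs, v) \<in> tensor_keys (U # Us) V \<longleftrightarrow> (\<exists>y ys. xs = y # ys \<and> y \<in> carrier U \<and> (ys, v) \<in> tensor_keys Us V)"
  by (auto simp: tensor_keys_def list_all2_Cons2)

lemma keys_update:
  assumes "(xs, v) \<in> tensor_keys Us V" "i < length Us" "x \<in> carrier (Us ! i)"
  shows "(xs[i := x], v) \<in> tensor_keys Us V"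
  using list_all2_update_cong[of "\<lambda>x U. x \<in> carrier U" xs Us x "Us ! i" i] assms
  by (auto simp: tensor_keys_def)

lemma keys_facts:
  assumes "(xs, v) \<in> tensor_keys Us V"
  shows "length xs = length Us" "v \<in> carrier V" "i < length Us \<Longrightarrow> xs ! i \<in> carrier (Us ! i)"
    "w \<in> carrier V \<Longrightarrow> (xs, w) \<in> tensor_keys Us V"
  using assms by (auto simp: tensor_keys_def list_all2_conv_all_nth)

lemma mlin_closed:
  assumes "mlin Us V X \<phi>" "(xs, v) \<in> tensor_keys Us V"
  shows "\<phi> xs v \<in> carrier X"
proof -
  have "lin V X (\<phi> xs)" using assms by (simp add: mlin_def)
  then show ?thesis by (rule lin_closed) (rule keys_facts(2)[OF assms(2)])
qed

lemma mlin_Nil: "lin V X (\<phi> []) \<Longrightarrow> mlin [] V X \<phi>"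
  by (simp add: mlin_def lin_W)

text \<open>The recursive form of multilinearity, suited to maps defined by recursion on the number
  of factors.\<close>

lemma mlin_Cons:
  assumes "VS X" "\<And>y. y \<in> carrier U \<Longrightarrow> mlin Us V X (\<lambda>ys. \<phi> (y # ys))"
    and "\<And>ys v. (ys, v) \<in> tensor_keys Us V \<Longrightarrow> lin U X (\<lambda>y. \<phi> (y # ys) v)"
  shows "mlin (U # Us) V X \<phi>"
  unfolding mlin_def
proof (intro conjI allI impI)
  fix xs v i assume "(xs, v) \<in> tensor_keys (U # Us) V"
  then obtain y ys where y: "xs = y # ys" "y \<in> carrier U" "(ys, v) \<in> tensor_keys Us V" by auto
  note m = assms(2)[OF y(2), unfolded mlin_def, THEN conjunct2, rule_format, OF y(3)]
  show "lin V X (\<phi> xs)" using m y(1) by simp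
  assume i: "i < length (U # Us)"
  show "lin ((U # Us) ! i) X (\<lambda>x. \<phi> (xs[i := x]) v)"
  proof (cases i)
    case 0
    then show ?thesis using assms(3)[OF y(3)] y(1) by simp
  next
    case (Suc j)
    then show ?thesis using m i y(1) by simp
  qed
qed (rule assms(1))

lemma mlin_ConsD:
  assumes "mlin (U # Us) V X \<phi>"
  shows "y \<in> carrier U \<Longrightarrow> mlin Us V X (\<lambda>ys. \<phi> (y # ys))"
    and "(ys, v) \<in> tensor_keys Us V \<Longrightarrow> VS U \<Longrightarrow> lin U X (\<lambda>y. \<phi> (y # ys) v)"
proof -
  assume y: "y \<in> carrier U"
  show "mlin Us V X (\<lambda>ys. \<phi> (y # ys))"
    unfolding mlin_def
  proof (intro conjI allI impI)
    show "VS X" using assms by (simp add: mlin_def)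
    fix ys v i assume ys: "(ys, v) \<in> tensor_keys Us V"
    then have "(y # ys, v) \<in> tensor_keys (U # Us) V" using y by simp
    note m = assms[unfolded mlin_def, THEN conjunct2, rule_format, OF this]
    show "lin V X (\<phi> (y # ys))" using m by simp
    show "lin (Us ! i) X (\<lambda>x. \<phi> (y # ys[i := x]) v)" if "i < length Us"
      using conjunct2[OF m, rule_format, of "Suc i"] that by simp
  qed
next
  assume ys: "(ys, v) \<in> tensor_keys Us V" and U: "VS U"
  then have "(\<zero>\<^bsub>U\<^esub> # ys, v) \<in> tensor_keys (U # Us) V" by simp
  from assms[unfolded mlin_def, THEN conjunct2, rule_format, OF this]
  show "lin U X (\<lambda>y. \<phi> (y # ys) v)" by (auto dest!: spec[of _ 0])
qed

context
  fixes Us :: "('k, 'u) module list" and V :: "('k, 'v) module"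
  assumes Us: "VSs Us" and V: "VS V"
begin

lemma Us_nth: "i < length Us \<Longrightarrow> VS (Us ! i)" using Us by (simp add: VSs_def)

lemma rels_carrier: "tensor_rels k Us V \<subseteq> carrier (free_module k (tensor_keys Us V))"
proof -
  interpret F: vectorspace k "free_module k (tensor_keys Us V)" by (rule free_VS)
  show ?thesis
    unfolding tensor_rels_def Let_def by (auto intro!: F.minus_closed F.a_closed F.smult_closed basis_closed)
qed

lemma null_sub: "sub (tensor_null k Us V) (free_module k (tensor_keys Us V))"
proof -
  interpret F: vectorspace k "free_module k (tensor_keys Us V)" by (rule free_VS)
  show ?thesis
    unfolding tensor_null_def subspace_def using F.span_is_submodule[OF rels_carrier] free_VS by simp
qed

lemma tensor_VS: "VS (tensor k Us V)"
  unfolding tensor_def by (rule quot_VS[OF null_sub])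

lemma pure_closed: "pure k Us V xs v \<in> carrier (tensor k Us V)"
  unfolding tensor_def pure_def quot_carrier by (intro imageI basis_closed)

text \<open>The kernel of f is a submodule containing the relations, so it contains their
  span.\<close>

lemma null_kernel:
  assumes f: "lin (free_module k (tensor_keys Us V)) X f" and r: "\<And>u. u \<in> tensor_rels k Us V \<Longrightarrow> f u = \<zero>\<^bsub>X\<^esub>"
    and u: "u \<in> tensor_null k Us V"
  shows "f u = \<zero>\<^bsub>X\<^esub>"
proof -
  let ?F = "free_module k (tensor_keys Us V)"
  interpret F: vectorspace k ?F by (rule free_VS)
  let ?N = "{u \<in> carrier ?F. f u = \<zero>\<^bsub>X\<^esub>}"
  have "submodule k ?N ?F" using sub_kernel[OF f] by (simp add: subspace_def)
  moreover have "tensor_rels k Us V \<subseteq> ?N" using rels_carrier r by auto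
  ultimately have "F.span (tensor_rels k Us V) \<subseteq> ?N" by (intro F.span_is_subset)
  then show ?thesis using u unfolding tensor_null_def by auto
qed

lemma mlin_rels:
  assumes m: "mlin Us V X \<phi>" and u: "u \<in> tensor_rels k Us V"
  shows "free_lift (tensor_keys Us V) X (\<lambda>\<kappa>. \<phi> (fst \<kappa>) (snd \<kappa>)) u = \<zero>\<^bsub>X\<^esub>"
proof -
  let ?K = "tensor_keys Us V"
  let ?F = "free_module k ?K" and ?e = "basis_vec k ?K" and ?f = "free_lift ?K X (\<lambda>\<kappa>. \<phi> (fst \<kappa>) (snd \<kappa>))"
  have X: "VS X" using m by (simp add: mlin_def)
  have \<phi>: "\<phi> (fst \<kappa>) (snd \<kappa>) \<in> carrier X" if "\<kappa> \<in> ?K" for \<kappa>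
    using mlin_closed[OF m] that by (cases \<kappa>) auto
  have fl: "lin ?F X ?f" by (rule free_lift_lin[OF X \<phi>])
  have fe: "?f (?e (xs, v)) = \<phi> xs v" if "(xs, v) \<in> ?K" for xs v
    using free_lift_basis[OF X \<phi> that] by simp
  note b = basis_closed[of ?K]
  have fm: "?f (x \<ominus>\<^bsub>?F\<^esub> y) = \<zero>\<^bsub>X\<^esub>" if "x \<in> carrier ?F" "y \<in> carrier ?F" "?f x = ?f y" for x y
    using that lin_closed[OF fl that(2)] X by (simp add: vs_minus[OF free_VS] lin_dif[OF fl])
  have mV: "lin V X (\<phi> xs)" if "(xs, v) \<in> ?K" for xs v using m that by (auto simp: mlin_def)
  have mU: "lin (Us ! i) X (\<lambda>x. \<phi> (xs[i := x]) v)" if "(xs, v) \<in> ?K" "i < length Us" for xs v i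
    using m that by (auto simp: mlin_def)
  note fv = free_VS[of ?K]
  from u consider
    (1) xs v i x y where "(xs, v) \<in> ?K" "i < length Us" "x \<in> carrier (Us ! i)" "y \<in> carrier (Us ! i)"
      "u = ?e (xs[i := x \<oplus>\<^bsub>Us ! i\<^esub> y], v) \<ominus>\<^bsub>?F\<^esub> (?e (xs[i := x], v) \<oplus>\<^bsub>?F\<^esub> ?e (xs[i := y], v))"
  | (2) xs v i c x where "(xs, v) \<in> ?K" "i < length Us" "c \<in> carrier k" "x \<in> carrier (Us ! i)"
      "u = ?e (xs[i := c \<odot>\<^bsub>Us ! i\<^esub> x], v) \<ominus>\<^bsub>?F\<^esub> c \<odot>\<^bsub>?F\<^esub> ?e (xs[i := x], v)"
  | (3) xs v w where "(xs, v) \<in> ?K" "w \<in> carrier V"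
      "u = ?e (xs, v \<oplus>\<^bsub>V\<^esub> w) \<ominus>\<^bsub>?F\<^esub> (?e (xs, v) \<oplus>\<^bsub>?F\<^esub> ?e (xs, w))"
  | (4) xs v c where "(xs, v) \<in> ?K" "c \<in> carrier k"
      "u = ?e (xs, c \<odot>\<^bsub>V\<^esub> v) \<ominus>\<^bsub>?F\<^esub> c \<odot>\<^bsub>?F\<^esub> ?e (xs, v)"
    unfolding tensor_rels_def Let_def by blast
  then show ?thesis
  proof cases
    case 1
    note k = keys_update[OF 1(1,2)]
    have s: "x \<oplus>\<^bsub>Us ! i\<^esub> y \<in> carrier (Us ! i)" using 1 Us_nth by simp
    show ?thesis unfolding 1(5)
      by (rule fm) (use b fv k[OF s] k[OF 1(3)] k[OF 1(4)] lin_add[OF mU[OF 1(1,2)] 1(3,4)] in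
        \<open>simp_all add: lin_add[OF fl] fe\<close>)
  next
    case 2
    note k = keys_update[OF 2(1,2)]
    have s: "c \<odot>\<^bsub>Us ! i\<^esub> x \<in> carrier (Us ! i)" using 2 Us_nth by simp
    show ?thesis unfolding 2(5)
      by (rule fm) (use b fv k[OF s] k[OF 2(4)] 2(3) lin_smult[OF mU[OF 2(1,2)] 2(3,4)] in
        \<open>simp_all add: lin_smult[OF fl] fe\<close>)
  next
    case 3
    have v: "v \<in> carrier V" by (rule keys_facts(2)[OF 3(1)])
    have k: "(xs, v \<oplus>\<^bsub>V\<^esub> w) \<in> ?K" "(xs, w) \<in> ?K"
      using keys_facts(4)[OF 3(1)] v 3(2) V by simp_all
    show ?thesis unfolding 3(3)
      by (rule fm) (use b fv k 3(1) lin_add[OF mV[OF 3(1)] v 3(2)] in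
        \<open>simp_all add: lin_add[OF fl] fe\<close>)
  next
    case 4
    have v: "v \<in> carrier V" by (rule keys_facts(2)[OF 4(1)])
    have k: "(xs, c \<odot>\<^bsub>V\<^esub> v) \<in> ?K" using keys_facts(4)[OF 4(1)] v 4(2) V by simp
    show ?thesis unfolding 4(3)
      by (rule fm) (use b fv k 4(1,2) lin_smult[OF mV[OF 4(1)] 4(2) v] in
        \<open>simp_all add: lin_smult[OF fl] fe\<close>)
  qed
qed

text \<open>The representative chosen in \<open>tensor_lift\<close> differs from u by a null
  element, on which the linear extension of a multilinear map vanishes.\<close>

lemma tensor_lift_coset:
  assumes m: "mlin Us V X \<phi>" and u: "u \<in> carrier (free_module k (tensor_keys Us V))"
  shows "tensor_lift k Us V X \<phi> (tensor_null k Us V +>\<^bsub>free_module k (tensor_keys Us V)\<^esub> u) =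
    free_lift (tensor_keys Us V) X (\<lambda>\<kappa>. \<phi> (fst \<kappa>) (snd \<kappa>)) u"
proof -
  let ?K = "tensor_keys Us V"
  let ?F = "free_module k ?K" and ?f = "free_lift ?K X (\<lambda>\<kappa>. \<phi> (fst \<kappa>) (snd \<kappa>))"
  let ?t = "tensor_null k Us V +>\<^bsub>?F\<^esub> u"
  have X: "VS X" using m by (simp add: mlin_def)
  have \<phi>: "\<phi> (fst \<kappa>) (snd \<kappa>) \<in> carrier X" if "\<kappa> \<in> ?K" for \<kappa>
    using mlin_closed[OF m] that by (cases \<kappa>) auto
  have fl: "lin ?F X ?f" by (rule free_lift_lin[OF X \<phi>])
  have "u \<in> ?t" by (rule coset_self[OF null_sub u])
  then have "(SOME u. u \<in> ?t) \<in> ?t" by (rule someI[where P = "\<lambda>u. u \<in> ?t"])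
  then obtain n where n: "n \<in> tensor_null k Us V" "(SOME u. u \<in> ?t) = n \<oplus>\<^bsub>?F\<^esub> u"
    using coset_iff[OF null_sub u] by blast
  have "tensor_lift k Us V X \<phi> ?t = ?f (SOME u. u \<in> ?t)"
    by (simp add: tensor_lift_def free_lift_def Let_def)
  also have "\<dots> = ?f n \<oplus>\<^bsub>X\<^esub> ?f u"
    unfolding n(2) by (rule lin_add[OF fl sub_carrier[OF null_sub n(1)] u])
  also have "?f n = \<zero>\<^bsub>X\<^esub>" by (rule null_kernel[OF fl mlin_rels[OF m] n(1)])
  finally show ?thesis using lin_closed[OF fl u] X by simp
qed

lemma lift_lin:
  assumes m: "mlin Us V X \<phi>"
  shows "lin (tensor k Us V) X (tensor_lift k Us V X \<phi>)"
proof -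
  let ?K = "tensor_keys Us V"
  let ?F = "free_module k ?K" and ?f = "free_lift ?K X (\<lambda>\<kappa>. \<phi> (fst \<kappa>) (snd \<kappa>))"
  have X: "VS X" using m by (simp add: mlin_def)
  have \<phi>: "\<phi> (fst \<kappa>) (snd \<kappa>) \<in> carrier X" if "\<kappa> \<in> ?K" for \<kappa>
    using mlin_closed[OF m] that by (cases \<kappa>) auto
  show ?thesis
    unfolding tensor_def
  proof (rule lin_factor[OF lin_quot[OF null_sub]])
    show "lin ?F X (\<lambda>u. tensor_lift k Us V X \<phi> (tensor_null k Us V +>\<^bsub>?F\<^esub> u))"
      by (rule lin_cong[OF free_lift_lin[OF X \<phi>]]) (simp_all add: tensor_lift_coset[OF m])
  qed (simp add: quot_carrier)
qed

lemma lift_pure: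
  assumes m: "mlin Us V X \<phi>" and k: "(xs, v) \<in> tensor_keys Us V"
  shows "tensor_lift k Us V X \<phi> (pure k Us V xs v) = \<phi> xs v"
proof -
  have X: "VS X" using m by (simp add: mlin_def)
  have \<phi>: "\<phi> (fst \<kappa>) (snd \<kappa>) \<in> carrier X" if "\<kappa> \<in> tensor_keys Us V" for \<kappa>
    using mlin_closed[OF m] that by (cases \<kappa>) auto
  show ?thesis
    unfolding pure_def tensor_lift_coset[OF m basis_closed] using free_lift_basis[OF X \<phi> k] by simp
qed

lemma tensor_induct:
  assumes t: "t \<in> carrier (tensor k Us V)" and zero: "Q \<zero>\<^bsub>tensor k Us V\<^esub>"
    and step: "\<And>c xs v t. c \<in> carrier k \<Longrightarrow> (xs, v) \<in> tensor_keys Us V \<Longrightarrow> t \<in> carrier (tensor k Us V) \<Longrightarrow> Q t \<Longrightarrow>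
      Q (c \<odot>\<^bsub>tensor k Us V\<^esub> pure k Us V xs v \<oplus>\<^bsub>tensor k Us V\<^esub> t)"
  shows "Q t"
proof -
  let ?K = "tensor_keys Us V" and ?N = "tensor_null k Us V"
  let ?F = "free_module k ?K"
  note q = lin_facts[OF lin_quot[OF null_sub], folded tensor_def]
  obtain u where u: "u \<in> carrier ?F" "t = ?N +>\<^bsub>?F\<^esub> u"
    using t by (auto simp: tensor_def quot_carrier)
  have "Q (?N +>\<^bsub>?F\<^esub> u)"
    using u(1)
  proof (rule free_induct)
    show "Q (?N +>\<^bsub>?F\<^esub> \<zero>\<^bsub>?F\<^esub>)" using zero by (simp only: q(6))
    fix c \<kappa> v assume a: "c \<in> carrier k" "\<kappa> \<in> ?K" "v \<in> carrier ?F" "Q (?N +>\<^bsub>?F\<^esub> v)"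
    obtain xs w where x: "\<kappa> = (xs, w)" by (cases \<kappa>)
    have "?N +>\<^bsub>?F\<^esub> (c \<odot>\<^bsub>?F\<^esub> basis_vec k ?K \<kappa> \<oplus>\<^bsub>?F\<^esub> v) =
      c \<odot>\<^bsub>tensor k Us V\<^esub> pure k Us V xs w \<oplus>\<^bsub>tensor k Us V\<^esub> (?N +>\<^bsub>?F\<^esub> v)"
      unfolding pure_def x using a(1,3) basis_closed[of ?K "(xs, w)"] free_VS[of ?K] by (simp add: q(4,5))
    then show "Q (?N +>\<^bsub>?F\<^esub> (c \<odot>\<^bsub>?F\<^esub> basis_vec k ?K \<kappa> \<oplus>\<^bsub>?F\<^esub> v))"
      using step[OF a(1) _ q(3)[OF a(3)] a(4), of xs w] a(2) x by simp
  qed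
  then show ?thesis using u(2) by simp
qed

lemma tensor_ext:
  assumes f: "lin (tensor k Us V) X f" and g: "lin (tensor k Us V) X g"
    and e: "\<And>xs v. (xs, v) \<in> tensor_keys Us V \<Longrightarrow> f (pure k Us V xs v) = g (pure k Us V xs v)"
    and t: "t \<in> carrier (tensor k Us V)"
  shows "f t = g t"
  using t
proof (rule tensor_induct)
  show "f \<zero>\<^bsub>tensor k Us V\<^esub> = g \<zero>\<^bsub>tensor k Us V\<^esub>" by (simp add: lin_zero[OF f] lin_zero[OF g])
qed (simp add: lin_add[OF f] lin_add[OF g] lin_smult[OF f] lin_smult[OF g] e pure_closed tensor_VS)

lemma pure_mlin: "mlin Us V (tensor k Us V) (pure k Us V)"
proof -
  let ?K = "tensor_keys Us V" and ?N = "tensor_null k Us V" and ?T = "tensor k Us V"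
  let ?F = "free_module k ?K" and ?e = "basis_vec k ?K"
  interpret F: vectorspace k ?F by (rule free_VS)
  note q = lin_facts[OF lin_quot[OF null_sub], folded tensor_def]
  have rel: "?N +>\<^bsub>?F\<^esub> x = ?N +>\<^bsub>?F\<^esub> y" if "x \<ominus>\<^bsub>?F\<^esub> y \<in> tensor_rels k Us V" "x \<in> carrier ?F" "y \<in> carrier ?F" for x y
  proof -
    have "x \<ominus>\<^bsub>?F\<^esub> y \<in> ?N" unfolding tensor_null_def by (rule subsetD[OF F.in_own_span[OF rels_carrier] that(1)])
    then show ?thesis using coset_eq_iff[OF null_sub that(2,3)] vs_minus[OF free_VS that(2,3)] by simp
  qed
  note b = basis_closed[of ?K]
  show ?thesis
    unfolding mlin_def
  proof (intro conjI allI impI)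
    show "VS ?T" by (rule tensor_VS)
    fix xs v i assume k: "(xs, v) \<in> ?K"
    show "lin V ?T (pure k Us V xs)"
    proof (rule linI[OF V tensor_VS pure_closed])
      fix x y assume xy: "x \<in> carrier V" "y \<in> carrier V"
      have "?e (xs, x \<oplus>\<^bsub>V\<^esub> y) \<ominus>\<^bsub>?F\<^esub> (?e (xs, x) \<oplus>\<^bsub>?F\<^esub> ?e (xs, y)) \<in> tensor_rels k Us V"
        unfolding tensor_rels_def Let_def using keys_facts(4)[OF k xy(1)] xy(2) by blast
      from rel[OF this] show "pure k Us V xs (x \<oplus>\<^bsub>V\<^esub> y) = pure k Us V xs x \<oplus>\<^bsub>?T\<^esub> pure k Us V xs y"
        unfolding pure_def by (simp add: b q(4) free_VS)
    next
      fix c x assume c: "c \<in> carrier k" "x \<in> carrier V"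
      have "?e (xs, c \<odot>\<^bsub>V\<^esub> x) \<ominus>\<^bsub>?F\<^esub> c \<odot>\<^bsub>?F\<^esub> ?e (xs, x) \<in> tensor_rels k Us V"
        unfolding tensor_rels_def Let_def using keys_facts(4)[OF k c(2)] c(1) by blast
      from rel[OF this] show "pure k Us V xs (c \<odot>\<^bsub>V\<^esub> x) = c \<odot>\<^bsub>?T\<^esub> pure k Us V xs x"
        unfolding pure_def by (simp add: b q(5) free_VS c)
    qed
    assume i: "i < length Us"
    show "lin (Us ! i) ?T (\<lambda>x. pure k Us V (xs[i := x]) v)"
    proof (rule linI[OF Us_nth[OF i] tensor_VS pure_closed])
      fix x y assume xy: "x \<in> carrier (Us ! i)" "y \<in> carrier (Us ! i)"
      have "?e (xs[i := x \<oplus>\<^bsub>Us ! i\<^esub> y], v) \<ominus>\<^bsub>?F\<^esub> (?e (xs[i := x], v) \<oplus>\<^bsub>?F\<^esub> ?e (xs[i := y], v)) \<in> tensor_rels k Us V"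
        unfolding tensor_rels_def Let_def using k i xy by blast
      from rel[OF this] show "pure k Us V (xs[i := x \<oplus>\<^bsub>Us ! i\<^esub> y]) v = pure k Us V (xs[i := x]) v \<oplus>\<^bsub>?T\<^esub> pure k Us V (xs[i := y]) v"
        unfolding pure_def by (simp add: b q(4) free_VS)
    next
      fix c x assume c: "c \<in> carrier k" "x \<in> carrier (Us ! i)"
      have "?e (xs[i := c \<odot>\<^bsub>Us ! i\<^esub> x], v) \<ominus>\<^bsub>?F\<^esub> c \<odot>\<^bsub>?F\<^esub> ?e (xs[i := x], v) \<in> tensor_rels k Us V"
        unfolding tensor_rels_def Let_def using k i c by blast
      from rel[OF this] show "pure k Us V (xs[i := c \<odot>\<^bsub>Us ! i\<^esub> x]) v = c \<odot>\<^bsub>?T\<^esub> pure k Us V (xs[i := x]) v"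
        unfolding pure_def by (simp add: b q(5) free_VS c)
    qed
  qed
qed

text \<open>Both sides run over the same chosen representative and evaluate the maps on
  \<open>tensor_keys\<close> only. This permits rewriting under a Sweedler sum.\<close>

lemma lift_cong:
  assumes m: "mlin Us V X \<phi>" and e: "\<And>xs v. (xs, v) \<in> tensor_keys Us V \<Longrightarrow> \<phi> xs v = \<psi> xs v"
    and t: "t \<in> carrier (tensor k Us V)"
  shows "tensor_lift k Us V X \<phi> t = tensor_lift k Us V X \<psi> t"
proof -
  let ?K = "tensor_keys Us V"
  let ?F = "free_module k ?K"
  have X: "VS X" using m by (simp add: mlin_def)
  interpret X: vectorspace k X by (rule X)
  obtain u where u: "u \<in> carrier ?F" "t = tensor_null k Us V +>\<^bsub>?F\<^esub> u"
    using t by (auto simp: tensor_def quot_carrier)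
  define w where "w = (SOME u. u \<in> t)"
  have "u \<in> t" unfolding u(2) by (rule coset_self[OF null_sub u(1)])
  then have "w \<in> t" unfolding w_def by (rule someI[where P = "\<lambda>u. u \<in> t"])
  then obtain n where n: "n \<in> tensor_null k Us V" "w = n \<oplus>\<^bsub>?F\<^esub> u"
    using coset_iff[OF null_sub u(1)] u(2) by blast
  have "w \<in> carrier ?F" unfolding n(2) by (rule vs_add[OF free_VS sub_carrier[OF null_sub n(1)] u(1)])
  then have w: "w \<in> ?K \<rightarrow> carrier k" by (auto simp: free_simps)
  have "(\<Oplus>\<^bsub>X\<^esub>\<kappa>\<in>{\<kappa> \<in> ?K. w \<kappa> \<noteq> \<zero>\<^bsub>k\<^esub>}. w \<kappa> \<odot>\<^bsub>X\<^esub> \<psi> (fst \<kappa>) (snd \<kappa>)) =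
    (\<Oplus>\<^bsub>X\<^esub>\<kappa>\<in>{\<kappa> \<in> ?K. w \<kappa> \<noteq> \<zero>\<^bsub>k\<^esub>}. w \<kappa> \<odot>\<^bsub>X\<^esub> \<phi> (fst \<kappa>) (snd \<kappa>))"
  proof (rule X.finsum_cong')
    have "w \<kappa> \<odot>\<^bsub>X\<^esub> \<phi> (fst \<kappa>) (snd \<kappa>) \<in> carrier X" if "\<kappa> \<in> ?K" for \<kappa>
      using mlin_closed[OF m, of "fst \<kappa>" "snd \<kappa>"] funcset_mem[OF w that] that X by simp
    then show "(\<lambda>\<kappa>. w \<kappa> \<odot>\<^bsub>X\<^esub> \<phi> (fst \<kappa>) (snd \<kappa>)) \<in> {\<kappa> \<in> ?K. w \<kappa> \<noteq> \<zero>\<^bsub>k\<^esub>} \<rightarrow> carrier X" by blast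
    show "w \<kappa> \<odot>\<^bsub>X\<^esub> \<psi> (fst \<kappa>) (snd \<kappa>) = w \<kappa> \<odot>\<^bsub>X\<^esub> \<phi> (fst \<kappa>) (snd \<kappa>)"
      if "\<kappa> \<in> {\<kappa> \<in> ?K. w \<kappa> \<noteq> \<zero>\<^bsub>k\<^esub>}" for \<kappa>
      using that e[of "fst \<kappa>" "snd \<kappa>"] by simp
  qed simp
  then show ?thesis by (simp add: tensor_lift_def Let_def w_def)
qed

end

end

context ground_field
begin

lemma VSs_Nil [simp]: "VSs []" and VSs_Cons [simp]: "VSs (U # Us) \<longleftrightarrow> VS U \<and> VSs Us"
  by (simp_all add: VSs_def)

lemma VSs_replicate: "VS U \<Longrightarrow> VSs (replicate n U)"
  by (simp add: VSs_def)

lemma mlin_comp: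
  assumes g: "lin X Y g" and m: "mlin Us V X \<phi>"
  shows "mlin Us V Y (\<lambda>xs v. g (\<phi> xs v))"
  unfolding mlin_def
proof (intro conjI allI impI)
  show "VS Y" by (rule lin_W[OF g])
  fix xs v i assume k: "(xs, v) \<in> tensor_keys Us V"
  note m' = m[unfolded mlin_def, THEN conjunct2, rule_format, OF k]
  show "lin V Y (\<lambda>v. g (\<phi> xs v))" by (rule lin_comp[OF g conjunct1[OF m']])
  show "lin (Us ! i) Y (\<lambda>x. g (\<phi> (xs[i := x]) v))" if "i < length Us"
    using conjunct2[OF m'] that lin_comp[OF g] by blast
qed

lemma mlin_cong:
  assumes m: "mlin Us V X \<phi>" and e: "\<And>xs v. (xs, v) \<in> tensor_keys Us V \<Longrightarrow> \<phi> xs v = \<psi> xs v"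
  shows "mlin Us V X \<psi>"
  unfolding mlin_def
proof (intro conjI allI impI)
  show "VS X" using m by (simp add: mlin_def)
  fix xs v i assume k: "(xs, v) \<in> tensor_keys Us V"
  note m' = m[unfolded mlin_def, THEN conjunct2, rule_format, OF k]
  show "lin V X (\<psi> xs)" by (rule lin_cong[OF conjunct1[OF m']]) (rule e[OF keys_facts(4)[OF k]])
  assume i: "i < length Us"
  show "lin (Us ! i) X (\<lambda>x. \<psi> (xs[i := x]) v)"
    by (rule lin_cong[OF conjunct2[OF m', rule_format, OF i]]) (rule e[OF keys_update[OF k i]])
qed

lemma lift_comp:
  assumes Us: "VSs Us" and V: "VS V" and g: "lin X Y g" and m: "mlin Us V X \<phi>" and t: "t \<in> carrier (tensor k Us V)"
  shows "g (tensor_lift k Us V X \<phi> t) = tensor_lift k Us V Y (\<lambda>xs v. g (\<phi> xs v)) t"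
  by (rule tensor_ext[OF Us V lin_comp[OF g lift_lin[OF Us V m]] lift_lin[OF Us V mlin_comp[OF g m]] _ t])
    (simp add: lift_pure[OF Us V m] lift_pure[OF Us V mlin_comp[OF g m]])

text \<open>By induction on the tensor t, because on a pure tensor the lift is just
  \<open>\<phi> y xs v\<close>. It makes nested Sweedler sums linear in the variables of the outer
  sum.\<close>

lemma lift_param:
  assumes Us: "VSs Us" and V: "VS V" and Y: "VS Y" and t: "t \<in> carrier (tensor k Us V)"
    and m: "\<And>y. y \<in> carrier Y \<Longrightarrow> mlin Us V X (\<phi> y)"
    and l: "\<And>xs v. (xs, v) \<in> tensor_keys Us V \<Longrightarrow> lin Y X (\<lambda>y. \<phi> y xs v)"
  shows "lin Y X (\<lambda>y. tensor_lift k Us V X (\<phi> y) t)"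
proof -
  have X: "VS X" using m[of "\<zero>\<^bsub>Y\<^esub>"] Y by (simp add: mlin_def)
  note L = lift_lin[OF Us V m]
  from t show ?thesis
  proof (rule tensor_induct[OF Us V])
    show "lin Y X (\<lambda>y. tensor_lift k Us V X (\<phi> y) \<zero>\<^bsub>tensor k Us V\<^esub>)"
      by (rule lin_cong[OF lin_const_zero[OF Y X]]) (simp add: lin_zero[OF L])
    fix c xs v t assume a: "c \<in> carrier k" "(xs, v) \<in> tensor_keys Us V" "t \<in> carrier (tensor k Us V)"
      "lin Y X (\<lambda>y. tensor_lift k Us V X (\<phi> y) t)"
    show "lin Y X (\<lambda>y. tensor_lift k Us V X (\<phi> y) (c \<odot>\<^bsub>tensor k Us V\<^esub> pure k Us V xs v \<oplus>\<^bsub>tensor k Us V\<^esub> t))"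
      by (rule lin_cong[OF lin_addf[OF lin_smultf[OF a(1) l[OF a(2)]] a(4)]])
        (simp add: lin_add[OF L] lin_smult[OF L] lift_pure[OF Us V m a(2)] a tensor_VS[OF Us V] pure_closed[OF Us V])
  qed
qed

section \<open>Bilinear maps and Sweedler notation\<close>

definition bilin ::
  "('k, 'a) module \<Rightarrow> ('k, 'b) module \<Rightarrow> ('k, 'x) module \<Rightarrow> ('a \<Rightarrow> 'b \<Rightarrow> 'x) \<Rightarrow> bool" where
  "bilin A B X \<phi> \<longleftrightarrow> VS A \<and> VS B \<and> VS X \<and>
    (\<forall>b\<in>carrier B. lin A X (\<lambda>a. \<phi> a b)) \<and> (\<forall>a\<in>carrier A. lin B X (\<lambda>b. \<phi> a b))"

abbreviation T2 :: "('k, 'a) module \<Rightarrow> ('k, 'b) module \<Rightarrow> ('k, ('a list \<times> 'b \<Rightarrow> 'k) set) module" where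
  "T2 A B \<equiv> tensor k [A] B"

definition tp :: "('k, 'a) module \<Rightarrow> ('k, 'b) module \<Rightarrow> 'a \<Rightarrow> 'b \<Rightarrow> ('a list \<times> 'b \<Rightarrow> 'k) set" where
  "tp A B a b = pure k [A] B [a] b"

text \<open>
  \<open>bd A B X \<phi> t\<close> should be read as Sweedler notation: for \<open>t = \<Sum> a \<otimes> b\<close> it is \<open>\<Sum> \<phi> a b\<close>.
\<close>

definition bd ::
  "('k, 'a) module \<Rightarrow> ('k, 'b) module \<Rightarrow> ('k, 'x) module \<Rightarrow> ('a \<Rightarrow> 'b \<Rightarrow> 'x) \<Rightarrow> ('a list \<times> 'b \<Rightarrow> 'k) set \<Rightarrow> 'x" where
  "bd A B X \<phi> t = tensor_lift k [A] B X (\<lambda>xs b. \<phi> (hd xs) b) t"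

lemma bilinI:
  "VS A \<Longrightarrow> VS B \<Longrightarrow> VS X \<Longrightarrow> (\<And>b. b \<in> carrier B \<Longrightarrow> lin A X (\<lambda>a. \<phi> a b)) \<Longrightarrow>
    (\<And>a. a \<in> carrier A \<Longrightarrow> lin B X (\<lambda>b. \<phi> a b)) \<Longrightarrow> bilin A B X \<phi>"
  by (simp add: bilin_def)

lemma bilinD:
  assumes "bilin A B X \<phi>"
  shows "VS A" "VS B" "VS X" "b \<in> carrier B \<Longrightarrow> lin A X (\<lambda>a. \<phi> a b)" "a \<in> carrier A \<Longrightarrow> lin B X (\<phi> a)"
  using assms by (simp_all add: bilin_def)

lemma bilin_closed: "bilin A B X \<phi> \<Longrightarrow> a \<in> carrier A \<Longrightarrow> b \<in> carrier B \<Longrightarrow> \<phi> a b \<in> carrier X"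
  by (rule lin_closed[OF bilinD(5)])

lemma bilin_mlin:
  assumes "bilin A B X \<phi>"
  shows "mlin [A] B X (\<lambda>xs b. \<phi> (hd xs) b)"
  by (rule mlin_Cons, rule bilinD(3)[OF assms], rule mlin_Nil)
    (simp_all add: bilinD[OF assms])

lemma bilin_VSs: "bilin A B X \<phi> \<Longrightarrow> VSs [A]"
  by (simp add: bilin_def)

lemma T2_VS: "VS A \<Longrightarrow> VS B \<Longrightarrow> VS (T2 A B)"
  by (rule tensor_VS) simp_all

lemma bd_lin: "bilin A B X \<phi> \<Longrightarrow> lin (T2 A B) X (bd A B X \<phi>)"
  unfolding bd_def by (rule lift_lin[OF bilin_VSs bilinD(2) bilin_mlin])

lemma bd_tp: "bilin A B X \<phi> \<Longrightarrow> a \<in> carrier A \<Longrightarrow> b \<in> carrier B \<Longrightarrow> bd A B X \<phi> (tp A B a b) = \<phi> a b"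
  unfolding bd_def tp_def by (subst lift_pure[OF bilin_VSs bilinD(2) bilin_mlin]) simp_all

lemma bd_ext:
  assumes "lin (T2 A B) X f" "lin (T2 A B) X g" "VS A" "VS B"
    "\<And>a b. a \<in> carrier A \<Longrightarrow> b \<in> carrier B \<Longrightarrow> f (tp A B a b) = g (tp A B a b)" "t \<in> carrier (T2 A B)"
  shows "f t = g t"
  by (rule tensor_ext[OF _ assms(4,1,2) _ assms(6)]) (use assms(3,5) in \<open>auto simp: tp_def\<close>)

lemma bd_comp:
  assumes \<phi>: "bilin A B X \<phi>" and g: "lin X Y g" and t: "t \<in> carrier (T2 A B)"
  shows "g (bd A B X \<phi> t) = bd A B Y (\<lambda>a b. g (\<phi> a b)) t"
  unfolding bd_def by (rule lift_comp[OF bilin_VSs[OF \<phi>] bilinD(2)[OF \<phi>] g bilin_mlin[OF \<phi>] t])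

lemma bilin_comp:
  assumes \<phi>: "bilin A B X \<phi>" and g: "lin X Y g"
  shows "bilin A B Y (\<lambda>a b. g (\<phi> a b))"
  by (rule bilinI[OF bilinD(1,2)[OF \<phi>] lin_W[OF g]])
    (rule lin_comp[OF g bilinD(4)[OF \<phi>]], assumption, rule lin_comp[OF g bilinD(5)[OF \<phi>]])

lemma bd_cong:
  assumes \<phi>: "bilin A B X \<phi>" and e: "\<And>a b. a \<in> carrier A \<Longrightarrow> b \<in> carrier B \<Longrightarrow> \<phi> a b = \<psi> a b"
    and t: "t \<in> carrier (T2 A B)"
  shows "bd A B X \<phi> t = bd A B X \<psi> t"
  unfolding bd_def
  by (rule lift_cong[OF bilin_VSs[OF \<phi>] bilinD(2)[OF \<phi>] bilin_mlin[OF \<phi>] _ t]) (auto simp: e)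

lemma bd_comp_eq:
  assumes \<phi>: "bilin A B X \<phi>" and g: "lin X Y g" and t: "t \<in> carrier (T2 A B)"
    and e: "\<And>a b. a \<in> carrier A \<Longrightarrow> b \<in> carrier B \<Longrightarrow> g (\<phi> a b) = \<psi> a b"
  shows "g (bd A B X \<phi> t) = bd A B Y \<psi> t"
  unfolding bd_comp[OF \<phi> g t] by (rule bd_cong[OF bilin_comp[OF \<phi> g] e t])

lemma tp_bilin:
  assumes "VS A" "VS B"
  shows "bilin A B (T2 A B) (tp A B)"
proof -
  have m: "mlin [A] B (T2 A B) (pure k [A] B)" by (rule pure_mlin) (simp_all add: assms)
  show ?thesis
  proof (rule bilinI[OF assms T2_VS[OF assms]])
    show "lin A (T2 A B) (\<lambda>a. tp A B a b)" if "b \<in> carrier B" for b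
      unfolding tp_def by (rule mlin_ConsD(2)[OF m _ assms(1), of "[]"]) (simp add: that)
    show "lin B (T2 A B) (\<lambda>b. tp A B a b)" if "a \<in> carrier A" for a
      unfolding tp_def using mlin_ConsD(1)[OF m that] vs_zero[OF assms(2)] by (auto simp: mlin_def)
  qed
qed

lemma bd_id: "VS A \<Longrightarrow> VS B \<Longrightarrow> t \<in> carrier (T2 A B) \<Longrightarrow> bd A B (T2 A B) (tp A B) t = t"
  by (rule bd_ext[OF bd_lin[OF tp_bilin] lin_id[OF T2_VS]]) (simp_all add: bd_tp tp_bilin)

lemma bd_body:
  assumes t: "t \<in> carrier (T2 A B)" and Y: "VS Y"
    and b: "\<And>y. y \<in> carrier Y \<Longrightarrow> bilin A B X (\<lambda>a b. \<phi> y a b)"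
    and l: "\<And>a b. a \<in> carrier A \<Longrightarrow> b \<in> carrier B \<Longrightarrow> lin Y X (\<lambda>y. \<phi> y a b)"
  shows "lin Y X (\<lambda>y. bd A B X (\<phi> y) t)"
proof -
  note b0 = b[OF vs_zero[OF Y]]
  show ?thesis
    unfolding bd_def
    by (rule lift_param[OF bilin_VSs[OF b0] bilinD(2)[OF b0] Y t bilin_mlin[OF b]]) (auto intro: l)
qed

lemma bd_arg: "bilin A B X \<phi> \<Longrightarrow> lin U (T2 A B) g \<Longrightarrow> lin U X (\<lambda>u. bd A B X \<phi> (g u))"
  by (rule lin_comp[OF bd_lin])

lemma tp_lin1: "VS A \<Longrightarrow> VS B \<Longrightarrow> lin U A g \<Longrightarrow> b \<in> carrier B \<Longrightarrow> lin U (T2 A B) (\<lambda>u. tp A B (g u) b)"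
  by (rule lin_comp[OF bilinD(4)[OF tp_bilin]])

lemma tp_lin2: "VS A \<Longrightarrow> VS B \<Longrightarrow> a \<in> carrier A \<Longrightarrow> lin U B g \<Longrightarrow> lin U (T2 A B) (\<lambda>u. tp A B a (g u))"
  by (rule lin_comp[OF bilinD(5)[OF tp_bilin]])

text \<open>Independent Sweedler sums commute: on a pure t both sides reduce to the sum over s, and
  both are linear in t.\<close>

lemma bd_fubini:
  assumes t: "t \<in> carrier (T2 A B)" and s: "s \<in> carrier (T2 C E)"
    and V: "VS A" "VS B" "VS C" "VS E"
    and 1: "\<And>a b. a \<in> carrier A \<Longrightarrow> b \<in> carrier B \<Longrightarrow> bilin C E X (\<lambda>c e. \<phi> a b c e)"
    and 2: "\<And>c e. c \<in> carrier C \<Longrightarrow> e \<in> carrier E \<Longrightarrow> bilin A B X (\<lambda>a b. \<phi> a b c e)"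
  shows "bd A B X (\<lambda>a b. bd C E X (\<lambda>c e. \<phi> a b c e) s) t = bd C E X (\<lambda>c e. bd A B X (\<lambda>a b. \<phi> a b c e) t) s"
proof -
  have X: "VS X" by (rule bilinD(3)[OF 1[OF vs_zero[OF V(1)] vs_zero[OF V(2)]]])
  have b1: "bilin A B X (\<lambda>a b. bd C E X (\<phi> a b) s)"
  proof (rule bilinI[OF V(1,2) X])
    show "lin A X (\<lambda>a. bd C E X (\<phi> a b) s)" if "b \<in> carrier B" for b
      by (rule bd_body[OF s V(1) 1[OF _ that] bilinD(4)[OF 2 that]])
    show "lin B X (\<lambda>b. bd C E X (\<phi> a b) s)" if "a \<in> carrier A" for a
      by (rule bd_body[OF s V(2) 1[OF that] bilinD(5)[OF 2 that]])
  qed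
  have b2: "bilin C E X (\<lambda>c e. bd A B X (\<lambda>a b. \<phi> a b c e) t)" if t: "t \<in> carrier (T2 A B)" for t
  proof (rule bilinI[OF V(3,4) X])
    show "lin C X (\<lambda>c. bd A B X (\<lambda>a b. \<phi> a b c e) t)" if "e \<in> carrier E" for e
      by (rule bd_body[OF t V(3) 2[OF _ that] bilinD(4)[OF 1 that]])
    show "lin E X (\<lambda>e. bd A B X (\<lambda>a b. \<phi> a b c e) t)" if "c \<in> carrier C" for c
      by (rule bd_body[OF t V(4) 2[OF that] bilinD(5)[OF 1 that]])
  qed
  show ?thesis
  proof (rule bd_ext[OF bd_lin[OF b1] _ V(1,2) _ t])
    show "lin (T2 A B) X (\<lambda>t. bd C E X (\<lambda>c e. bd A B X (\<lambda>a b. \<phi> a b c e) t) s)"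
      by (rule bd_body[OF s T2_VS[OF V(1,2)] b2]) (assumption, rule bd_lin[OF 2])
    fix a b assume ab: "a \<in> carrier A" "b \<in> carrier B"
    have "bd C E X (\<lambda>c e. \<phi> a b c e) s = bd C E X (\<lambda>c e. bd A B X (\<lambda>a b. \<phi> a b c e) (tp A B a b)) s"
      by (rule bd_cong[OF 1[OF ab] _ s]) (simp add: bd_tp[OF 2] ab)
    then show "bd A B X (\<lambda>a b. bd C E X (\<phi> a b) s) (tp A B a b) =
      bd C E X (\<lambda>c e. bd A B X (\<lambda>a b. \<phi> a b c e) (tp A B a b)) s"
      by (simp add: bd_tp[OF b1] ab)
  qed
qed

lemma bilin_comp2:
  assumes \<phi>: "bilin U W X \<phi>" and f: "lin V W f"
  shows "bilin U V X (\<lambda>u v. \<phi> u (f v))"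
  by (rule bilinI[OF bilinD(1)[OF \<phi>] lin_V[OF f] bilinD(3)[OF \<phi>] bilinD(4)[OF \<phi> lin_closed[OF f]]
        lin_comp[OF bilinD(5)[OF \<phi>] f]])

lemma id_tensor_bd: "id_tensor k U V W f = bd U V (T2 U W) (\<lambda>u v. tp U W u (f v))"
  by (simp add: fun_eq_iff id_tensor_def bd_def tp_def)

lemma id_tensor_bilin: "VS U \<Longrightarrow> lin V W f \<Longrightarrow> bilin U V (T2 U W) (\<lambda>u v. tp U W u (f v))"
  by (rule bilin_comp2[OF tp_bilin[OF _ lin_W]])

lemma id_tensor_lin: "VS U \<Longrightarrow> lin V W f \<Longrightarrow> lin (T2 U V) (T2 U W) (id_tensor k U V W f)"
  unfolding id_tensor_bd by (rule bd_lin[OF id_tensor_bilin])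

lemma id_tensor_tp:
  "VS U \<Longrightarrow> lin V W f \<Longrightarrow> u \<in> carrier U \<Longrightarrow> v \<in> carrier V \<Longrightarrow> id_tensor k U V W f (tp U V u v) = tp U W u (f v)"
  unfolding id_tensor_bd by (rule bd_tp[OF id_tensor_bilin])

lemma bd_id_tensor:
  assumes \<phi>: "bilin U W X \<phi>" and f: "lin V W f" and t: "t \<in> carrier (T2 U V)"
  shows "bd U W X \<phi> (id_tensor k U V W f t) = bd U V X (\<lambda>u v. \<phi> u (f v)) t"
proof -
  have U: "VS U" by (rule bilinD(1)[OF \<phi>])
  have "bd U W X \<phi> (id_tensor k U V W f t) = bd U V X (\<lambda>u v. bd U W X \<phi> (tp U W u (f v))) t"
    unfolding id_tensor_bd by (rule bd_comp[OF id_tensor_bilin[OF U f] bd_lin[OF \<phi>] t])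
  also have "\<dots> = bd U V X (\<lambda>u v. \<phi> u (f v)) t"
    by (rule bd_cong[OF bilin_comp2[OF \<phi> f] _ t, symmetric]) (simp add: bd_tp[OF \<phi>] lin_closed[OF f])
  finally show ?thesis .
qed

lemma id_tensor_comp:
  assumes "VS U" "lin V W f" "lin W X g" "t \<in> carrier (T2 U V)"
  shows "id_tensor k U W X g (id_tensor k U V W f t) = id_tensor k U V X (\<lambda>v. g (f v)) t"
  unfolding id_tensor_bd[of U W X] id_tensor_bd[of U V X]
  by (rule bd_id_tensor[OF id_tensor_bilin[OF assms(1,3)] assms(2,4)])

lemma id_tensor_cong:
  assumes "VS U" "lin V W f" "\<And>v. v \<in> carrier V \<Longrightarrow> f v = g v" "t \<in> carrier (T2 U V)"
  shows "id_tensor k U V W f t = id_tensor k U V W g t"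
  unfolding id_tensor_bd by (rule bd_cong[OF id_tensor_bilin[OF assms(1,2)] _ assms(4)]) (simp add: assms(3))

lemma id_tensor_ident: "VS U \<Longrightarrow> VS V \<Longrightarrow> t \<in> carrier (T2 U V) \<Longrightarrow> id_tensor k U V V (\<lambda>v. v) t = t"
  unfolding id_tensor_bd by (rule bd_id)

section \<open>Adjoining one tensor factor\<close>

text \<open>The product of p with t, where t already is a tensor with one factor fewer. It replaces
  the associativity isomorphism, as the flat product over \<open>U # Us\<close> is not literally
  \<open>U\<close> tensored with the rest.\<close>

definition cn ::
  "('k, 'u) module \<Rightarrow> ('k, 'u) module list \<Rightarrow> ('k, 'v) module \<Rightarrow> 'u \<Rightarrow>
    ('u list \<times> 'v \<Rightarrow> 'k) set \<Rightarrow> ('u list \<times> 'v \<Rightarrow> 'k) set" where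
  "cn U Us V p t = tensor_lift k Us V (tensor k (U # Us) V) (\<lambda>qs g. pure k (U # Us) V (p # qs) g) t"

text \<open>The universal property belonging to \<open>cn\<close>: a map that is bilinear in the
  first factor and the remaining tensor, lifted to the flat product.\<close>

definition cbd ::
  "('k, 'u) module \<Rightarrow> ('k, 'u) module list \<Rightarrow> ('k, 'v) module \<Rightarrow> ('k, 'x) module \<Rightarrow>
    ('u \<Rightarrow> ('u list \<times> 'v \<Rightarrow> 'k) set \<Rightarrow> 'x) \<Rightarrow> ('u list \<times> 'v \<Rightarrow> 'k) set \<Rightarrow> 'x" where
  "cbd U Us V X \<phi> t = tensor_lift k (U # Us) V X (\<lambda>ps f. \<phi> (hd ps) (pure k Us V (tl ps) f)) t"

context
  fixes U :: "('k, 'u) module" and Us :: "('k, 'u) module list" and V :: "('k, 'v) module"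
  assumes U: "VS U" and Us: "VSs Us" and V: "VS V"
begin

lemma UUs: "VSs (U # Us)" using U Us by simp

lemma cn_mlin: "p \<in> carrier U \<Longrightarrow> mlin Us V (tensor k (U # Us) V) (\<lambda>qs g. pure k (U # Us) V (p # qs) g)"
  by (rule mlin_ConsD(1)[OF pure_mlin[OF UUs V]])

lemma cn_bilin: "bilin U (tensor k Us V) (tensor k (U # Us) V) (cn U Us V)"
proof (rule bilinI[OF U tensor_VS[OF Us V] tensor_VS[OF UUs V]])
  show "lin U (tensor k (U # Us) V) (\<lambda>p. cn U Us V p t)" if "t \<in> carrier (tensor k Us V)" for t
    unfolding cn_def
    by (rule lift_param[OF Us V U that cn_mlin]) (assumption, rule mlin_ConsD(2)[OF pure_mlin[OF UUs V] _ U])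
  show "lin (tensor k Us V) (tensor k (U # Us) V) (\<lambda>t. cn U Us V p t)" if "p \<in> carrier U" for p
    unfolding cn_def by (rule lift_lin[OF Us V cn_mlin[OF that]])
qed

lemma cn_pure:
  "p \<in> carrier U \<Longrightarrow> (qs, g) \<in> tensor_keys Us V \<Longrightarrow> cn U Us V p (pure k Us V qs g) = pure k (U # Us) V (p # qs) g"
  unfolding cn_def by (rule lift_pure[OF Us V cn_mlin])

lemma cn_ext:
  assumes f: "lin (tensor k (U # Us) V) X f" and g: "lin (tensor k (U # Us) V) X g"
    and e: "\<And>p t. p \<in> carrier U \<Longrightarrow> t \<in> carrier (tensor k Us V) \<Longrightarrow> f (cn U Us V p t) = g (cn U Us V p t)"
    and t: "t \<in> carrier (tensor k (U # Us) V)"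
  shows "f t = g t"
proof (rule tensor_ext[OF UUs V f g _ t])
  fix xs v assume "(xs, v) \<in> tensor_keys (U # Us) V"
  then obtain p qs where x: "xs = p # qs" "p \<in> carrier U" "(qs, v) \<in> tensor_keys Us V" by auto
  show "f (pure k (U # Us) V xs v) = g (pure k (U # Us) V xs v)"
    using e[OF x(2) pure_closed[OF Us V, of qs v]] cn_pure[OF x(2,3)] x(1) by simp
qed

lemma cbd_mlin:
  assumes \<phi>: "bilin U (tensor k Us V) X \<phi>"
  shows "mlin (U # Us) V X (\<lambda>ps f. \<phi> (hd ps) (pure k Us V (tl ps) f))"
proof (rule mlin_Cons[OF bilinD(3)[OF \<phi>]])
  show "mlin Us V X (\<lambda>ys f. \<phi> (hd (y # ys)) (pure k Us V (tl (y # ys)) f))" if "y \<in> carrier U" for y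
    using mlin_comp[OF bilinD(5)[OF \<phi> that] pure_mlin[OF Us V]] by simp
  show "lin U X (\<lambda>y. \<phi> (hd (y # ys)) (pure k Us V (tl (y # ys)) v))" if "(ys, v) \<in> tensor_keys Us V" for ys v
    using bilinD(4)[OF \<phi> pure_closed[OF Us V]] by simp
qed

lemma cbd_lin: "bilin U (tensor k Us V) X \<phi> \<Longrightarrow> lin (tensor k (U # Us) V) X (cbd U Us V X \<phi>)"
  unfolding cbd_def by (rule lift_lin[OF UUs V cbd_mlin])

lemma cbd_cn:
  assumes \<phi>: "bilin U (tensor k Us V) X \<phi>" and p: "p \<in> carrier U" and t: "t \<in> carrier (tensor k Us V)"
  shows "cbd U Us V X \<phi> (cn U Us V p t) = \<phi> p t"
proof (rule tensor_ext[OF Us V lin_comp[OF cbd_lin[OF \<phi>] bilinD(5)[OF cn_bilin p]] bilinD(5)[OF \<phi> p] _ t])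
  fix xs v assume k: "(xs, v) \<in> tensor_keys Us V"
  show "cbd U Us V X \<phi> (cn U Us V p (pure k Us V xs v)) = \<phi> p (pure k Us V xs v)"
    unfolding cn_pure[OF p k] cbd_def by (subst lift_pure[OF UUs V cbd_mlin[OF \<phi>]]) (simp_all add: p k)
qed

lemma cn_lin1:
  "lin Y U g \<Longrightarrow> t \<in> carrier (tensor k Us V) \<Longrightarrow> lin Y (tensor k (U # Us) V) (\<lambda>y. cn U Us V (g y) t)"
  by (rule lin_comp[OF bilinD(4)[OF cn_bilin]])

lemma cn_lin2:
  "p \<in> carrier U \<Longrightarrow> lin Y (tensor k Us V) g \<Longrightarrow> lin Y (tensor k (U # Us) V) (\<lambda>y. cn U Us V p (g y))"
  by (rule lin_comp[OF bilinD(5)[OF cn_bilin]])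

lemma cn_closed: "p \<in> carrier U \<Longrightarrow> t \<in> carrier (tensor k Us V) \<Longrightarrow> cn U Us V p t \<in> carrier (tensor k (U # Us) V)"
  by (rule bilin_closed[OF cn_bilin])

end

lemma smult_lin1:
  assumes "lin U (self_module k) g" "VS X" "x \<in> carrier X"
  shows "lin U X (\<lambda>u. g u \<odot>\<^bsub>X\<^esub> x)"
  by (rule linI)
    (use lin_facts[OF assms(1), simplified] assms(2,3) in \<open>simp_all add: vs_add_smult vs_smult_smult\<close>)

definition trilin where
  "trilin A B C X \<psi> \<longleftrightarrow> VS A \<and> VS B \<and> VS C \<and> VS X \<and>
    (\<forall>b\<in>carrier B. \<forall>c\<in>carrier C. lin A X (\<lambda>a. \<psi> a b c)) \<and>
    (\<forall>a\<in>carrier A. \<forall>c\<in>carrier C. lin B X (\<lambda>b. \<psi> a b c)) \<and>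
    (\<forall>a\<in>carrier A. \<forall>b\<in>carrier B. lin C X (\<lambda>c. \<psi> a b c))"

lemma trilinI:
  assumes "VS A" "VS B" "VS C" "VS X"
    "\<And>b c. b \<in> carrier B \<Longrightarrow> c \<in> carrier C \<Longrightarrow> lin A X (\<lambda>a. \<psi> a b c)"
    "\<And>a c. a \<in> carrier A \<Longrightarrow> c \<in> carrier C \<Longrightarrow> lin B X (\<lambda>b. \<psi> a b c)"
    "\<And>a b. a \<in> carrier A \<Longrightarrow> b \<in> carrier B \<Longrightarrow> lin C X (\<lambda>c. \<psi> a b c)"
  shows "trilin A B C X \<psi>"
  using assms by (simp add: trilin_def)

lemma trilinD:
  assumes "trilin A B C X \<psi>"
  shows "VS A" "VS B" "VS C" "VS X"
    "b \<in> carrier B \<Longrightarrow> c \<in> carrier C \<Longrightarrow> lin A X (\<lambda>a. \<psi> a b c)"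
    "a \<in> carrier A \<Longrightarrow> c \<in> carrier C \<Longrightarrow> lin B X (\<lambda>b. \<psi> a b c)"
    "a \<in> carrier A \<Longrightarrow> b \<in> carrier B \<Longrightarrow> lin C X (\<lambda>c. \<psi> a b c)"
  using assms by (simp_all add: trilin_def)

lemma trilin_mlin:
  assumes "trilin A B C X \<psi>"
  shows "mlin [A, B] C X (\<lambda>xs c. \<psi> (hd xs) (hd (tl xs)) c)"
proof (rule mlin_Cons[OF trilinD(4)[OF assms]])
  fix a assume a: "a \<in> carrier A"
  show "mlin [B] C X (\<lambda>ys. \<lambda>c. \<psi> (hd (a # ys)) (hd (tl (a # ys))) c)"
    by (rule mlin_Cons[OF trilinD(4)[OF assms]], rule mlin_Nil) (auto simp: trilinD[OF assms] a)
qed (auto simp: trilinD[OF assms])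

definition tp3 where "tp3 A B C a b c = pure k [A, B] C [a, b] c"

lemma tp3_trilin:
  assumes "VS A" "VS B" "VS C"
  shows "trilin A B C (tensor k [A, B] C) (tp3 A B C)"
proof -
  have m: "mlin [A, B] C (tensor k [A, B] C) (pure k [A, B] C)" by (rule pure_mlin) (simp_all add: assms)
  show ?thesis
  proof (rule trilinI[OF assms])
    show "VS (tensor k [A, B] C)" by (rule tensor_VS) (simp_all add: assms)
    show "lin A (tensor k [A, B] C) (\<lambda>a. tp3 A B C a b c)" if "b \<in> carrier B" "c \<in> carrier C" for b c
      unfolding tp3_def by (rule mlin_ConsD(2)[OF m _ assms(1), of "[b]"]) (simp add: that)
    show "lin B (tensor k [A, B] C) (\<lambda>b. tp3 A B C a b c)" if "a \<in> carrier A" "c \<in> carrier C" for a c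
      unfolding tp3_def by (rule mlin_ConsD(2)[OF mlin_ConsD(1)[OF m that(1)] _ assms(2), of "[]"]) (simp add: that)
    show "lin C (tensor k [A, B] C) (\<lambda>c. tp3 A B C a b c)" if "a \<in> carrier A" "b \<in> carrier B" for a b
      unfolding tp3_def using mlin_ConsD(1)[OF mlin_ConsD(1)[OF m that(1)] that(2)] vs_zero[OF assms(3)] by (auto simp: mlin_def)
  qed
qed

lemma tp3_lin:
  assumes "VS A" "VS B" "VS C"
  shows tp3_lin1: "lin U A g \<Longrightarrow> b \<in> carrier B \<Longrightarrow> c \<in> carrier C \<Longrightarrow> lin U (tensor k [A, B] C) (\<lambda>u. tp3 A B C (g u) b c)"
    and tp3_lin2: "a \<in> carrier A \<Longrightarrow> lin U B g \<Longrightarrow> c \<in> carrier C \<Longrightarrow> lin U (tensor k [A, B] C) (\<lambda>u. tp3 A B C a (g u) c)"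
    and tp3_lin3: "a \<in> carrier A \<Longrightarrow> b \<in> carrier B \<Longrightarrow> lin U C h \<Longrightarrow> lin U (tensor k [A, B] C) (\<lambda>u. tp3 A B C a b (h u))"
  by (rule lin_comp[OF trilinD(5)[OF tp3_trilin[OF assms]]], assumption+)
    (rule lin_comp[OF trilinD(6)[OF tp3_trilin[OF assms]]], assumption+,
     rule lin_comp[OF trilinD(7)[OF tp3_trilin[OF assms]]], assumption+)

lemma tensor3_VS: "VS A \<Longrightarrow> VS B \<Longrightarrow> VS C \<Longrightarrow> VS (tensor k [A, B] C)"
  by (rule tensor_VS) simp_all

text \<open>It carries the coassociativity axiom, stated in a triple tensor product, over to
  arbitrary trilinear expressions.\<close>

lemma trilin_lift:
  assumes \<psi>: "trilin A B C X \<psi>"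
  shows "\<exists>h. lin (tensor k [A, B] C) X h \<and>
    (\<forall>a\<in>carrier A. \<forall>b\<in>carrier B. \<forall>c\<in>carrier C. h (tp3 A B C a b c) = \<psi> a b c)"
proof -
  have v: "VSs [A, B]" "VS C" using trilinD[OF \<psi>] by simp_all
  show ?thesis
    by (rule exI[of _ "tensor_lift k [A, B] C X (\<lambda>xs c. \<psi> (hd xs) (hd (tl xs)) c)"], intro conjI ballI)
      (rule lift_lin[OF v trilin_mlin[OF \<psi>]], simp add: tp3_def lift_pure[OF v trilin_mlin[OF \<psi>]])
qed

text \<open>Side conditions on nested Sweedler sums, namely \<open>bilin\<close>, \<open>lin\<close>
  and membership in carriers, are syntax-directed; repeated resolution with this collection
  discharges them.\<close>

lemmas tens_rules =
  bilinI lin_id bd_body bd_arg tp_lin1 tp_lin2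
  cn_lin1 cn_lin2 cn_closed lin_smultf smult_lin1 tp3_lin1 tp3_lin2 tp3_lin3 T2_VS tensor3_VS tensor_VS
  VSs_Nil VSs_Cons[THEN iffD2, OF conjI] VSs_replicate vs_smult self_VS k_closed

end

section \<open>Comodules\<close>

locale hopf = ground_field k + hopf_algebra k P \<Delta> \<epsilon> S
  for k :: "('k, 'z) ring_scheme" and P :: "('k, 'p) module"
    and \<Delta> :: "'p \<Rightarrow> ('p list \<times> 'p \<Rightarrow> 'k) set" and \<epsilon> :: "'p \<Rightarrow> 'k" and S :: "'p \<Rightarrow> 'p"
begin

lemma P_VS: "VS P" by (rule k_algebra.vectorspace[OF algebra])

lemma P_ring: "ring P" by (rule k_algebra.ring[OF algebra])

lemma mult_closed: "x \<in> carrier P \<Longrightarrow> y \<in> carrier P \<Longrightarrow> x \<otimes>\<^bsub>P\<^esub> y \<in> carrier P"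
  and one_closed: "\<one>\<^bsub>P\<^esub> \<in> carrier P"
  using ring.ring_simprules(5,6)[OF P_ring] by auto

lemma mult_assoc: "x \<in> carrier P \<Longrightarrow> y \<in> carrier P \<Longrightarrow> z \<in> carrier P \<Longrightarrow>
    (x \<otimes>\<^bsub>P\<^esub> y) \<otimes>\<^bsub>P\<^esub> z = x \<otimes>\<^bsub>P\<^esub> (y \<otimes>\<^bsub>P\<^esub> z)"
  and mult_one: "x \<in> carrier P \<Longrightarrow> x \<otimes>\<^bsub>P\<^esub> \<one>\<^bsub>P\<^esub> = x" "x \<in> carrier P \<Longrightarrow> \<one>\<^bsub>P\<^esub> \<otimes>\<^bsub>P\<^esub> x = x"
proof -
  interpret ring P by (rule P_ring)
  show "x \<in> carrier P \<Longrightarrow> y \<in> carrier P \<Longrightarrow> z \<in> carrier P \<Longrightarrow>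
    (x \<otimes>\<^bsub>P\<^esub> y) \<otimes>\<^bsub>P\<^esub> z = x \<otimes>\<^bsub>P\<^esub> (y \<otimes>\<^bsub>P\<^esub> z)"
    "x \<in> carrier P \<Longrightarrow> x \<otimes>\<^bsub>P\<^esub> \<one>\<^bsub>P\<^esub> = x" "x \<in> carrier P \<Longrightarrow> \<one>\<^bsub>P\<^esub> \<otimes>\<^bsub>P\<^esub> x = x"
    by (simp_all add: m_assoc)
qed

lemma mult_bilin: "bilin P P P (\<lambda>x y. x \<otimes>\<^bsub>P\<^esub> y)"
proof -
  interpret ring P by (rule P_ring)
  show ?thesis
    by (rule bilinI[OF P_VS P_VS P_VS]; rule linI[OF P_VS P_VS])
      (simp_all add: l_distr r_distr k_algebra.smult_assoc_left[OF algebra] k_algebra.smult_assoc_right[OF algebra])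
qed

lemma mult_lin1: "lin U P g \<Longrightarrow> b \<in> carrier P \<Longrightarrow> lin U P (\<lambda>u. g u \<otimes>\<^bsub>P\<^esub> b)"
  by (rule lin_comp[OF bilinD(4)[OF mult_bilin]])

lemma mult_lin2: "b \<in> carrier P \<Longrightarrow> lin U P g \<Longrightarrow> lin U P (\<lambda>u. b \<otimes>\<^bsub>P\<^esub> g u)"
  by (rule lin_comp[OF bilinD(5)[OF mult_bilin]])

lemma Delta_lin: "lin P (T2 P P) \<Delta>" by (rule left_comodule.linear[OF left])

lemma eps_closed: "p \<in> carrier P \<Longrightarrow> \<epsilon> p \<in> carrier k"
  using lin_closed[OF counit_linear] by simp

lemmas hopf_rules =
  P_VS mult_closed one_closed mult_lin1 mult_lin2
  lin_comp[OF Delta_lin] lin_closed[OF Delta_lin] lin_comp[OF counit_linear] eps_closed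
  lin_comp[OF antipode_linear] lin_closed[OF antipode_linear] tens_rules

lemma antipode_left_bd: "p \<in> carrier P \<Longrightarrow> bd P P P (\<lambda>q r. S q \<otimes>\<^bsub>P\<^esub> r) (\<Delta> p) = \<epsilon> p \<odot>\<^bsub>P\<^esub> \<one>\<^bsub>P\<^esub>"
  unfolding bd_def by (rule antipode_left)

lemma antipode_right_bd: "p \<in> carrier P \<Longrightarrow> bd P P P (\<lambda>q r. q \<otimes>\<^bsub>P\<^esub> S r) (\<Delta> p) = \<epsilon> p \<odot>\<^bsub>P\<^esub> \<one>\<^bsub>P\<^esub>"
  unfolding bd_def by (rule antipode_right)

lemma right_counit_bd: "p \<in> carrier P \<Longrightarrow> bd P P P (\<lambda>f q. \<epsilon> q \<odot>\<^bsub>P\<^esub> f) (\<Delta> p) = p"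
  unfolding bd_def by (rule right_comodule.counit[OF right])

lemma Delta_one: "\<Delta> \<one>\<^bsub>P\<^esub> = tp P P \<one>\<^bsub>P\<^esub> \<one>\<^bsub>P\<^esub>"
  unfolding tp_def by (rule comult_one)

lemma Delta_mult_bd:
  assumes \<phi>: "bilin P P Z \<phi>" and a: "a \<in> carrier P" and c: "c \<in> carrier P"
  shows "bd P P Z \<phi> (\<Delta> (a \<otimes>\<^bsub>P\<^esub> c)) =
    bd P P Z (\<lambda>a1 a2. bd P P Z (\<lambda>c1 c2. \<phi> (a1 \<otimes>\<^bsub>P\<^esub> c1) (a2 \<otimes>\<^bsub>P\<^esub> c2)) (\<Delta> c)) (\<Delta> a)"
proof -
  have "\<Delta> (a \<otimes>\<^bsub>P\<^esub> c) =
    bd P P (T2 P P) (\<lambda>a1 a2. bd P P (T2 P P) (\<lambda>c1 c2. tp P P (a1 \<otimes>\<^bsub>P\<^esub> c1) (a2 \<otimes>\<^bsub>P\<^esub> c2)) (\<Delta> c)) (\<Delta> a)"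
    unfolding comult_mult[OF a c] by (simp add: tensor_mult_def bd_def tp_def Let_def)
  also have "bd P P Z \<phi> \<dots> =
    bd P P Z (\<lambda>a1 a2. bd P P Z (\<lambda>c1 c2. \<phi> (a1 \<otimes>\<^bsub>P\<^esub> c1) (a2 \<otimes>\<^bsub>P\<^esub> c2)) (\<Delta> c)) (\<Delta> a)"
  proof (rule bd_comp_eq[OF _ bd_lin[OF \<phi>]])
    fix a1 a2 assume m: "a1 \<in> carrier P" "a2 \<in> carrier P"
    show "bd P P Z \<phi> (bd P P (T2 P P) (\<lambda>c1 c2. tp P P (a1 \<otimes>\<^bsub>P\<^esub> c1) (a2 \<otimes>\<^bsub>P\<^esub> c2)) (\<Delta> c)) =
      bd P P Z (\<lambda>c1 c2. \<phi> (a1 \<otimes>\<^bsub>P\<^esub> c1) (a2 \<otimes>\<^bsub>P\<^esub> c2)) (\<Delta> c)"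
    proof (rule bd_comp_eq[OF _ bd_lin[OF \<phi>]])
      show "bd P P Z \<phi> (tp P P (a1 \<otimes>\<^bsub>P\<^esub> c1) (a2 \<otimes>\<^bsub>P\<^esub> c2)) = \<phi> (a1 \<otimes>\<^bsub>P\<^esub> c1) (a2 \<otimes>\<^bsub>P\<^esub> c2)"
        if "c1 \<in> carrier P" "c2 \<in> carrier P" for c1 c2
        by (rule bd_tp[OF \<phi>]) (use m that in \<open>simp_all add: mult_closed\<close>)
    qed (insert m a c, (assumption | rule hopf_rules)+)
  qed (insert a c, (assumption | rule hopf_rules)+)
  finally show ?thesis .
qed

section \<open>Comodules and colinear maps\<close>

abbreviation comodule :: "('k, 'e) module \<Rightarrow> ('e \<Rightarrow> ('p list \<times> 'e \<Rightarrow> 'k) set) \<Rightarrow> bool" where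
  "comodule \<equiv> left_comodule k P \<Delta> \<epsilon>"

lemma comodule_counit: "comodule E \<rho> \<Longrightarrow> e \<in> carrier E \<Longrightarrow> bd P E E (\<lambda>p f. \<epsilon> p \<odot>\<^bsub>E\<^esub> f) (\<rho> e) = e"
  unfolding bd_def by (rule left_comodule.counit)

text \<open>The linear map induced by \<open>\<psi>\<close> is applied to both sides of the axiom
  and pulled into the sums.\<close>

lemma comodule_coassoc:
  assumes E: "comodule E \<rho>" and \<psi>: "trilin P P E X \<psi>" and e: "e \<in> carrier E"
  shows "bd P E X (\<lambda>p f. bd P P X (\<lambda>q r. \<psi> q r f) (\<Delta> p)) (\<rho> e) =
    bd P E X (\<lambda>p f. bd P E X (\<lambda>q g. \<psi> p q g) (\<rho> f)) (\<rho> e)"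
proof -
  let ?T = "tensor k [P, P] E"
  note \<rho> = left_comodule.linear[OF E]
  note EV = lin_V[OF \<rho>]
  note rules = EV lin_comp[OF \<rho>] lin_closed[OF \<rho>] hopf_rules
  obtain h where h: "lin ?T X h" "\<And>a b c. a \<in> carrier P \<Longrightarrow> b \<in> carrier P \<Longrightarrow> c \<in> carrier E \<Longrightarrow> h (tp3 P P E a b c) = \<psi> a b c"
    using trilin_lift[OF \<psi>] by blast
  have "bd P E ?T (\<lambda>p f. bd P P ?T (\<lambda>q r. tp3 P P E q r f) (\<Delta> p)) (\<rho> e) =
    bd P E ?T (\<lambda>p f. bd P E ?T (\<lambda>q g. tp3 P P E p q g) (\<rho> f)) (\<rho> e)"
    unfolding bd_def tp3_def by (rule left_comodule.coassoc[OF E e])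
  then have "h (bd P E ?T (\<lambda>p f. bd P P ?T (\<lambda>q r. tp3 P P E q r f) (\<Delta> p)) (\<rho> e)) =
    h (bd P E ?T (\<lambda>p f. bd P E ?T (\<lambda>q g. tp3 P P E p q g) (\<rho> f)) (\<rho> e))" by simp
  also have "h (bd P E ?T (\<lambda>p f. bd P P ?T (\<lambda>q r. tp3 P P E q r f) (\<Delta> p)) (\<rho> e)) =
    bd P E X (\<lambda>p f. bd P P X (\<lambda>q r. \<psi> q r f) (\<Delta> p)) (\<rho> e)"
  proof (rule bd_comp_eq[OF _ h(1)])
    show "h (bd P P ?T (\<lambda>q r. tp3 P P E q r f) (\<Delta> p)) = bd P P X (\<lambda>q r. \<psi> q r f) (\<Delta> p)"
      if "p \<in> carrier P" "f \<in> carrier E" for p f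
      by (rule bd_comp_eq[OF _ h(1)]) (insert that, (assumption | rule rules h(2))+)
  qed (insert e, (assumption | rule rules)+)
  also have "h (bd P E ?T (\<lambda>p f. bd P E ?T (\<lambda>q g. tp3 P P E p q g) (\<rho> f)) (\<rho> e)) =
    bd P E X (\<lambda>p f. bd P E X (\<lambda>q g. \<psi> p q g) (\<rho> f)) (\<rho> e)"
  proof (rule bd_comp_eq[OF _ h(1)])
    show "h (bd P E ?T (\<lambda>q g. tp3 P P E p q g) (\<rho> f)) = bd P E X (\<lambda>q g. \<psi> p q g) (\<rho> f)"
      if "p \<in> carrier P" "f \<in> carrier E" for p f
      by (rule bd_comp_eq[OF _ h(1)]) (insert that, (assumption | rule rules h(2))+)
  qed (insert e, (assumption | rule rules)+)
  finally show ?thesis .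
qed

lemma comoduleI:
  assumes "lin E (T2 P E) \<rho>"
    and "\<And>e. e \<in> carrier E \<Longrightarrow>
      bd P E (tensor k [P, P] E) (\<lambda>p f. bd P P (tensor k [P, P] E) (\<lambda>q r. tp3 P P E q r f) (\<Delta> p)) (\<rho> e) =
      bd P E (tensor k [P, P] E) (\<lambda>p f. bd P E (tensor k [P, P] E) (\<lambda>q g. tp3 P P E p q g) (\<rho> f)) (\<rho> e)"
    and "\<And>e. e \<in> carrier E \<Longrightarrow> bd P E E (\<lambda>p f. \<epsilon> p \<odot>\<^bsub>E\<^esub> f) (\<rho> e) = e"
  shows "comodule E \<rho>"
  by (rule left_comodule.intro) (rule assms(1), erule assms(2)[unfolded bd_def tp3_def], erule assms(3)[unfolded bd_def])

definition colin ::
  "('k, 'e) module \<Rightarrow> ('e \<Rightarrow> ('p list \<times> 'e \<Rightarrow> 'k) set) \<Rightarrow>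
    ('k, 'f) module \<Rightarrow> ('f \<Rightarrow> ('p list \<times> 'f \<Rightarrow> 'k) set) \<Rightarrow> ('e \<Rightarrow> 'f) \<Rightarrow> bool" where
  "colin E \<rho> F \<sigma> g \<longleftrightarrow> lin E F g \<and> (\<forall>e\<in>carrier E. \<sigma> (g e) = id_tensor k P E F g (\<rho> e))"

lemma colin_lin: "colin E \<rho> F \<sigma> g \<Longrightarrow> lin E F g"
  and colin_eq: "colin E \<rho> F \<sigma> g \<Longrightarrow> e \<in> carrier E \<Longrightarrow> \<sigma> (g e) = id_tensor k P E F g (\<rho> e)"
  by (simp_all add: colin_def)

lemma colin_bd:
  assumes g: "colin E \<rho> F \<sigma> g" and \<rho>: "lin E (T2 P E) \<rho>" and \<phi>: "bilin P F X \<phi>" and e: "e \<in> carrier E"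
  shows "bd P F X \<phi> (\<sigma> (g e)) = bd P E X (\<lambda>p f. \<phi> p (g f)) (\<rho> e)"
  unfolding colin_eq[OF g e] by (rule bd_id_tensor[OF \<phi> colin_lin[OF g] lin_closed[OF \<rho> e]])

text \<open>Each element of \<open>F\<close> is some g e, and colinearity turns every sum over
  \<open>\<sigma> (g e)\<close> into one over \<open>\<rho> e\<close>, where the axioms of
  \<open>E\<close> apply.\<close>

lemma comodule_quotient:
  assumes E: "comodule E \<rho>" and \<sigma>: "lin F (T2 P F) \<sigma>" and g: "colin E \<rho> F \<sigma> g"
    and surj: "carrier F \<subseteq> g ` carrier E"
  shows "comodule F \<sigma>"
proof (rule comoduleI[OF \<sigma>])
  note \<rho> = left_comodule.linear[OF E]
  note gl = colin_lin[OF g]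
  note rules = lin_V[OF \<rho>] lin_V[OF \<sigma>] lin_comp[OF \<rho>] lin_closed[OF \<rho>] lin_comp[OF \<sigma>] lin_closed[OF \<sigma>]
    lin_comp[OF gl] lin_closed[OF gl] hopf_rules
  let ?T = "tensor k [P, P] F"
  fix f assume "f \<in> carrier F"
  then obtain e where e: "e \<in> carrier E" "f = g e" using surj by auto
  have "bd P F F (\<lambda>p f. \<epsilon> p \<odot>\<^bsub>F\<^esub> f) (\<sigma> (g e)) = bd P E F (\<lambda>p f. \<epsilon> p \<odot>\<^bsub>F\<^esub> g f) (\<rho> e)"
    by (rule colin_bd[OF g \<rho> _ e(1)]) (assumption | rule rules)+
  also have "\<dots> = g (bd P E E (\<lambda>p f. \<epsilon> p \<odot>\<^bsub>E\<^esub> f) (\<rho> e))"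
    by (rule bd_comp_eq[OF _ gl, symmetric])
      (insert e(1), simp_all add: lin_smult[OF gl] eps_closed, (assumption | rule rules)+)
  finally show "bd P F F (\<lambda>p f. \<epsilon> p \<odot>\<^bsub>F\<^esub> f) (\<sigma> f) = f" using comodule_counit[OF E e(1)] e(2) by simp
  have "bd P F ?T (\<lambda>p f. bd P P ?T (\<lambda>q r. tp3 P P F q r f) (\<Delta> p)) (\<sigma> (g e)) =
    bd P E ?T (\<lambda>p f. bd P P ?T (\<lambda>q r. tp3 P P F q r (g f)) (\<Delta> p)) (\<rho> e)"
    by (rule colin_bd[OF g \<rho> _ e(1)]) (assumption | rule rules)+
  also have "\<dots> = bd P E ?T (\<lambda>p f. bd P E ?T (\<lambda>q x. tp3 P P F p q (g x)) (\<rho> f)) (\<rho> e)"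
    by (rule comodule_coassoc[OF E _ e(1)]) (assumption | rule trilinI rules)+
  also have "\<dots> = bd P E ?T (\<lambda>p f. bd P F ?T (\<lambda>q x. tp3 P P F p q x) (\<sigma> (g f))) (\<rho> e)"
  proof (rule bd_cong)
    show "bd P E ?T (\<lambda>q x. tp3 P P F p q (g x)) (\<rho> f) = bd P F ?T (\<lambda>q x. tp3 P P F p q x) (\<sigma> (g f))"
      if "p \<in> carrier P" "f \<in> carrier E" for p f
      by (rule colin_bd[OF g \<rho> _ that(2), symmetric]) (insert that, (assumption | rule rules)+)
  qed (insert e(1), (assumption | rule rules)+)
  also have "\<dots> = bd P F ?T (\<lambda>p f. bd P F ?T (\<lambda>q x. tp3 P P F p q x) (\<sigma> f)) (\<sigma> (g e))"
    by (rule colin_bd[OF g \<rho> _ e(1), symmetric]) (assumption | rule rules)+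
  finally show "bd P F ?T (\<lambda>p f. bd P P ?T (\<lambda>q r. tp3 P P F q r f) (\<Delta> p)) (\<sigma> f) =
    bd P F ?T (\<lambda>p f. bd P F ?T (\<lambda>q x. tp3 P P F p q x) (\<sigma> f)) (\<sigma> f)" using e(2) by simp
qed

text \<open>Dual to the quotient case: insert the identity r g, move the sum to \<open>F\<close> by
  colinearity of g, use the axiom there, and move back. The retraction r is merely linear.\<close>

lemma comodule_sub:
  assumes F: "comodule F \<sigma>" and \<rho>: "lin E (T2 P E) \<rho>" and g: "colin E \<rho> F \<sigma> g"
    and r: "lin F E r" and rg: "\<And>e. e \<in> carrier E \<Longrightarrow> r (g e) = e"
  shows "comodule E \<rho>"
proof (rule comoduleI[OF \<rho>])
  note \<sigma> = left_comodule.linear[OF F]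
  note gl = colin_lin[OF g]
  note rules = lin_V[OF \<rho>] lin_V[OF \<sigma>] lin_comp[OF \<rho>] lin_closed[OF \<rho>] lin_comp[OF \<sigma>] lin_closed[OF \<sigma>]
    lin_comp[OF gl] lin_closed[OF gl] lin_comp[OF r] lin_closed[OF r] hopf_rules
  let ?T = "tensor k [P, P] E"
  fix e assume e: "e \<in> carrier E"
  have "bd P E E (\<lambda>p f. \<epsilon> p \<odot>\<^bsub>E\<^esub> f) (\<rho> e) = bd P E E (\<lambda>p f. r (\<epsilon> p \<odot>\<^bsub>F\<^esub> g f)) (\<rho> e)"
    by (rule bd_cong) (insert e, simp_all add: lin_smult[OF r] eps_closed lin_closed[OF gl] rg, (assumption | rule rules)+)
  also have "\<dots> = r (bd P E F (\<lambda>p f. \<epsilon> p \<odot>\<^bsub>F\<^esub> g f) (\<rho> e))"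
    by (rule bd_comp[OF _ r, symmetric]) (insert e, (assumption | rule rules)+)
  also have "bd P E F (\<lambda>p f. \<epsilon> p \<odot>\<^bsub>F\<^esub> g f) (\<rho> e) = bd P F F (\<lambda>p f. \<epsilon> p \<odot>\<^bsub>F\<^esub> f) (\<sigma> (g e))"
    by (rule colin_bd[OF g \<rho> _ e, symmetric]) (assumption | rule rules)+
  finally show "bd P E E (\<lambda>p f. \<epsilon> p \<odot>\<^bsub>E\<^esub> f) (\<rho> e) = e"
    using comodule_counit[OF F lin_closed[OF gl e]] rg[OF e] by simp
  have "bd P E ?T (\<lambda>p f. bd P P ?T (\<lambda>q x. tp3 P P E q x f) (\<Delta> p)) (\<rho> e) =
    bd P E ?T (\<lambda>p f. bd P P ?T (\<lambda>q x. tp3 P P E q x (r (g f))) (\<Delta> p)) (\<rho> e)"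
    by (rule bd_cong) (insert e, simp_all add: rg, (assumption | rule rules)+)
  also have "\<dots> = bd P F ?T (\<lambda>p f. bd P P ?T (\<lambda>q x. tp3 P P E q x (r f)) (\<Delta> p)) (\<sigma> (g e))"
    by (rule colin_bd[OF g \<rho> _ e, symmetric]) (assumption | rule rules)+
  also have "\<dots> = bd P F ?T (\<lambda>p f. bd P F ?T (\<lambda>q x. tp3 P P E p q (r x)) (\<sigma> f)) (\<sigma> (g e))"
    by (rule comodule_coassoc[OF F _ lin_closed[OF gl e]]) (assumption | rule trilinI rules)+
  also have "\<dots> = bd P E ?T (\<lambda>p f. bd P F ?T (\<lambda>q x. tp3 P P E p q (r x)) (\<sigma> (g f))) (\<rho> e)"
    by (rule colin_bd[OF g \<rho> _ e]) (assumption | rule rules)+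
  also have "\<dots> = bd P E ?T (\<lambda>p f. bd P E ?T (\<lambda>q x. tp3 P P E p q x) (\<rho> f)) (\<rho> e)"
  proof (rule bd_cong)
    fix p f assume pf: "p \<in> carrier P" "f \<in> carrier E"
    have "bd P F ?T (\<lambda>q x. tp3 P P E p q (r x)) (\<sigma> (g f)) = bd P E ?T (\<lambda>q x. tp3 P P E p q (r (g x))) (\<rho> f)"
      by (rule colin_bd[OF g \<rho> _ pf(2)]) (insert pf, (assumption | rule rules)+)
    also have "\<dots> = bd P E ?T (\<lambda>q x. tp3 P P E p q x) (\<rho> f)"
      by (rule bd_cong) (insert pf, simp_all add: rg, (assumption | rule rules)+)
    finally show "bd P F ?T (\<lambda>q x. tp3 P P E p q (r x)) (\<sigma> (g f)) = bd P E ?T (\<lambda>q x. tp3 P P E p q x) (\<rho> f)" .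
  qed (insert e, (assumption | rule rules)+)
  finally show "bd P E ?T (\<lambda>p f. bd P P ?T (\<lambda>q x. tp3 P P E q x f) (\<Delta> p)) (\<rho> e) =
    bd P E ?T (\<lambda>p f. bd P E ?T (\<lambda>q x. tp3 P P E p q x) (\<rho> f)) (\<rho> e)" .
qed

end

section \<open>Coinvariants of diagonal coactions\<close>

text \<open>One step of the recursion on tensor powers: T is \<open>P\<close> tensored with X and
  carries the tensor product coaction. X, T and cons are parameters with equations, so that they
  stay opaque to resolution with the collected rules.\<close>

locale diagonal = hopf k P \<Delta> \<epsilon> S
  for k :: "('k, 'z) ring_scheme" and P :: "('k, 'p) module"
    and \<Delta> :: "'p \<Rightarrow> ('p list \<times> 'p \<Rightarrow> 'k) set" and \<epsilon> :: "'p \<Rightarrow> 'k" and S :: "'p \<Rightarrow> 'p" +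
  fixes Us :: "('k, 'p) module list" and V :: "('k, 'f) module"
    and \<gamma> :: "('p list \<times> 'f \<Rightarrow> 'k) set \<Rightarrow> ('p list \<times> ('p list \<times> 'f \<Rightarrow> 'k) set \<Rightarrow> 'k) set"
    and \<Gamma> :: "('p list \<times> 'f \<Rightarrow> 'k) set \<Rightarrow> ('p list \<times> ('p list \<times> 'f \<Rightarrow> 'k) set \<Rightarrow> 'k) set"
    and X :: "('k, ('p list \<times> 'f \<Rightarrow> 'k) set) module" and T :: "('k, ('p list \<times> 'f \<Rightarrow> 'k) set) module"
    and cons :: "'p \<Rightarrow> ('p list \<times> 'f \<Rightarrow> 'k) set \<Rightarrow> ('p list \<times> 'f \<Rightarrow> 'k) set"
  assumes X_def: "X = tensor k Us V" and T_def: "T = tensor k (P # Us) V" and cons_def: "cons = cn P Us V"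
    and Us: "VSs Us" and V: "VS V"
    and X_comodule: "comodule X \<gamma>"
    and Gamma_lin: "lin T (T2 P T) \<Gamma>"
    and Gamma_cons: "p \<in> carrier P \<Longrightarrow> t \<in> carrier X \<Longrightarrow> \<Gamma> (cons p t) =
      bd P P (T2 P T) (\<lambda>a b. bd P X (T2 P T) (\<lambda>c s. tp P T (a \<otimes>\<^bsub>P\<^esub> c) (cons b s)) (\<gamma> t)) (\<Delta> p)"
begin

lemma X_VS: "VS X" unfolding X_def by (rule tensor_VS[OF Us V])

lemma T_VS: "VS T" unfolding T_def by (rule tensor_VS) (simp_all add: Us V P_VS)

lemma gamma_lin: "lin X (T2 P X) \<gamma>" by (rule left_comodule.linear[OF X_comodule])

lemma cons_bilin: "bilin P X T cons"
  unfolding X_def T_def cons_def by (rule cn_bilin[OF P_VS Us V])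

lemma cons_lin1: "lin Y P g \<Longrightarrow> t \<in> carrier X \<Longrightarrow> lin Y T (\<lambda>y. cons (g y) t)"
  by (rule lin_comp[OF bilinD(4)[OF cons_bilin]])

lemma cons_lin2: "p \<in> carrier P \<Longrightarrow> lin Y X g \<Longrightarrow> lin Y T (\<lambda>y. cons p (g y))"
  by (rule lin_comp[OF bilinD(5)[OF cons_bilin]])

lemma cons_closed: "p \<in> carrier P \<Longrightarrow> t \<in> carrier X \<Longrightarrow> cons p t \<in> carrier T"
  by (rule bilin_closed[OF cons_bilin])

lemma cons_smult:
  assumes "c \<in> carrier k" "p \<in> carrier P" "t \<in> carrier X"
  shows "cons (c \<odot>\<^bsub>P\<^esub> p) t = c \<odot>\<^bsub>T\<^esub> cons p t" "cons p (c \<odot>\<^bsub>X\<^esub> t) = c \<odot>\<^bsub>T\<^esub> cons p t"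
  by (rule lin_smult[OF bilinD(4)[OF cons_bilin assms(3)] assms(1,2)])
    (rule lin_smult[OF bilinD(5)[OF cons_bilin assms(2)] assms(1,3)])

lemma cons_ext:
  assumes "lin T Y f" "lin T Y g" "\<And>p t. p \<in> carrier P \<Longrightarrow> t \<in> carrier X \<Longrightarrow> f (cons p t) = g (cons p t)"
    "x \<in> carrier T"
  shows "f x = g x"
  by (rule cn_ext[OF P_VS Us V]) (use assms in \<open>simp_all add: X_def T_def cons_def\<close>)

lemma cbd_T: "bilin P X Y \<phi> \<Longrightarrow> lin T Y (cbd P Us V Y \<phi>)"
  unfolding X_def T_def by (rule cbd_lin[OF P_VS Us V])

lemma cbd_cons: "bilin P X Y \<phi> \<Longrightarrow> p \<in> carrier P \<Longrightarrow> t \<in> carrier X \<Longrightarrow> cbd P Us V Y \<phi> (cons p t) = \<phi> p t"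
  unfolding X_def T_def cons_def by (rule cbd_cn[OF P_VS Us V])

lemmas drules = X_VS T_VS lin_comp[OF gamma_lin] lin_closed[OF gamma_lin] lin_comp[OF Gamma_lin] lin_closed[OF Gamma_lin]
  cons_lin1 cons_lin2 cons_closed trilinI hopf_rules

lemma Gamma_bd:
  assumes \<phi>: "bilin P T Z \<phi>" and p: "p \<in> carrier P" and t: "t \<in> carrier X"
  shows "bd P T Z \<phi> (\<Gamma> (cons p t)) =
    bd P P Z (\<lambda>a b. bd P X Z (\<lambda>c s. \<phi> (a \<otimes>\<^bsub>P\<^esub> c) (cons b s)) (\<gamma> t)) (\<Delta> p)"
  unfolding Gamma_cons[OF p t]
proof (rule bd_comp_eq[OF _ bd_lin[OF \<phi>]])
  fix a b assume ab: "a \<in> carrier P" "b \<in> carrier P"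
  show "bd P T Z \<phi> (bd P X (T2 P T) (\<lambda>c s. tp P T (a \<otimes>\<^bsub>P\<^esub> c) (cons b s)) (\<gamma> t)) =
    bd P X Z (\<lambda>c s. \<phi> (a \<otimes>\<^bsub>P\<^esub> c) (cons b s)) (\<gamma> t)"
    by (rule bd_comp_eq[OF _ bd_lin[OF \<phi>] _ bd_tp[OF \<phi>]])
      (insert ab t, (assumption | rule drules)+)
qed (insert p t, (assumption | rule drules)+)

lemma gamma_coassoc:
  "trilin P P X Z \<psi> \<Longrightarrow> t \<in> carrier X \<Longrightarrow>
    bd P X Z (\<lambda>p f. bd P P Z (\<lambda>q r. \<psi> q r f) (\<Delta> p)) (\<gamma> t) =
    bd P X Z (\<lambda>p f. bd P X Z (\<lambda>q g. \<psi> p q g) (\<gamma> f)) (\<gamma> t)"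
  by (rule comodule_coassoc[OF X_comodule])

text \<open>The counit law uses that \<open>\<epsilon>\<close> is multiplicative, coassociativity
  that \<open>\<Delta>\<close> is; each then splits into the corresponding law for \<open>P\<close>
  and for X.\<close>

lemma T_comodule: "comodule T \<Gamma>"
proof (rule comoduleI[OF Gamma_lin])
  fix x assume x: "x \<in> carrier T"
  show "bd P T T (\<lambda>p f. \<epsilon> p \<odot>\<^bsub>T\<^esub> f) (\<Gamma> x) = x"
  proof (rule cons_ext[OF _ lin_id[OF T_VS] _ x])
    show "lin T T (\<lambda>x. bd P T T (\<lambda>p f. \<epsilon> p \<odot>\<^bsub>T\<^esub> f) (\<Gamma> x))" by (assumption | rule drules)+
    fix p t assume p: "p \<in> carrier P" and t: "t \<in> carrier X"
    have "bd P T T (\<lambda>p f. \<epsilon> p \<odot>\<^bsub>T\<^esub> f) (\<Gamma> (cons p t)) =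
      bd P P T (\<lambda>a b. bd P X T (\<lambda>c s. \<epsilon> (a \<otimes>\<^bsub>P\<^esub> c) \<odot>\<^bsub>T\<^esub> cons b s) (\<gamma> t)) (\<Delta> p)"
      by (rule Gamma_bd[OF _ p t]) (assumption | rule drules)+
    also have "\<dots> = bd P P T (\<lambda>a b. cons (\<epsilon> a \<odot>\<^bsub>P\<^esub> b) t) (\<Delta> p)"
    proof (rule bd_cong)
      fix a b assume ab: "a \<in> carrier P" "b \<in> carrier P"
      have "cons (\<epsilon> a \<odot>\<^bsub>P\<^esub> b) (bd P X X (\<lambda>c s. \<epsilon> c \<odot>\<^bsub>X\<^esub> s) (\<gamma> t)) =
        bd P X T (\<lambda>c s. \<epsilon> (a \<otimes>\<^bsub>P\<^esub> c) \<odot>\<^bsub>T\<^esub> cons b s) (\<gamma> t)"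
      proof (rule bd_comp_eq)
        show "lin X T (cons (\<epsilon> a \<odot>\<^bsub>P\<^esub> b))"
          by (rule cons_lin2) (insert ab, (assumption | rule drules)+)
        show "cons (\<epsilon> a \<odot>\<^bsub>P\<^esub> b) (\<epsilon> c \<odot>\<^bsub>X\<^esub> s) = \<epsilon> (a \<otimes>\<^bsub>P\<^esub> c) \<odot>\<^bsub>T\<^esub> cons b s"
          if "c \<in> carrier P" "s \<in> carrier X" for c s
          using ab that by (simp add: cons_smult eps_closed vs_smult[OF P_VS] counit_mult vs_smult_smult[OF T_VS]
              cons_closed vs_smult_comm[OF T_VS, of "\<epsilon> a"])
      qed (insert t ab, (assumption | rule drules)+)
      then show "bd P X T (\<lambda>c s. \<epsilon> (a \<otimes>\<^bsub>P\<^esub> c) \<odot>\<^bsub>T\<^esub> cons b s) (\<gamma> t) = cons (\<epsilon> a \<odot>\<^bsub>P\<^esub> b) t"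
        by (simp add: comodule_counit[OF X_comodule t])
    qed (insert p t, (assumption | rule drules)+)
    also have "\<dots> = cons (bd P P P (\<lambda>a b. \<epsilon> a \<odot>\<^bsub>P\<^esub> b) (\<Delta> p)) t"
      by (rule bd_comp[symmetric, of P P P _ T "\<lambda>x. cons x t"]) (insert p t, (assumption | rule drules)+)
    finally show "bd P T T (\<lambda>p f. \<epsilon> p \<odot>\<^bsub>T\<^esub> f) (\<Gamma> (cons p t)) = cons p t"
      by (simp add: comodule_counit[OF left p])
  qed
  let ?Y = "tensor k [P, P] T"
  show "bd P T ?Y (\<lambda>p f. bd P P ?Y (\<lambda>q r. tp3 P P T q r f) (\<Delta> p)) (\<Gamma> x) =
    bd P T ?Y (\<lambda>p f. bd P T ?Y (\<lambda>q g. tp3 P P T p q g) (\<Gamma> f)) (\<Gamma> x)"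
  proof (rule cons_ext[OF _ _ _ x])
    show "lin T ?Y (\<lambda>x. bd P T ?Y (\<lambda>p f. bd P P ?Y (\<lambda>q r. tp3 P P T q r f) (\<Delta> p)) (\<Gamma> x))"
      "lin T ?Y (\<lambda>x. bd P T ?Y (\<lambda>p f. bd P T ?Y (\<lambda>q g. tp3 P P T p q g) (\<Gamma> f)) (\<Gamma> x))"
      by (assumption | rule drules)+
    fix p t assume p: "p \<in> carrier P" and t: "t \<in> carrier X"
    \<comment> \<open>The common value of both sides for fixed components of p, with the twice
      iterated coaction of t already inserted.\<close>
    define K where "K a1 a2 b = bd P X ?Y (\<lambda>c s. bd P X ?Y (\<lambda>c2 s2. tp3 P P T (a1 \<otimes>\<^bsub>P\<^esub> c) (a2 \<otimes>\<^bsub>P\<^esub> c2) (cons b s2)) (\<gamma> s)) (\<gamma> t)"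
      for a1 a2 b
    have "bd P T ?Y (\<lambda>p f. bd P P ?Y (\<lambda>q r. tp3 P P T q r f) (\<Delta> p)) (\<Gamma> (cons p t)) =
      bd P P ?Y (\<lambda>a b. bd P X ?Y (\<lambda>c s. bd P P ?Y (\<lambda>q r. tp3 P P T q r (cons b s)) (\<Delta> (a \<otimes>\<^bsub>P\<^esub> c))) (\<gamma> t)) (\<Delta> p)"
      by (rule Gamma_bd[OF _ p t]) (assumption | rule drules)+
    also have "\<dots> = bd P P ?Y (\<lambda>a b. bd P P ?Y (\<lambda>a1 a2. K a1 a2 b) (\<Delta> a)) (\<Delta> p)"
    proof (rule bd_cong)
      fix a b assume ab: "a \<in> carrier P" "b \<in> carrier P"
      have "bd P X ?Y (\<lambda>c s. bd P P ?Y (\<lambda>q r. tp3 P P T q r (cons b s)) (\<Delta> (a \<otimes>\<^bsub>P\<^esub> c))) (\<gamma> t) =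
        bd P X ?Y (\<lambda>c s. bd P P ?Y (\<lambda>a1 a2. bd P P ?Y (\<lambda>c1 c2.
          tp3 P P T (a1 \<otimes>\<^bsub>P\<^esub> c1) (a2 \<otimes>\<^bsub>P\<^esub> c2) (cons b s)) (\<Delta> c)) (\<Delta> a)) (\<gamma> t)"
      proof (rule bd_cong)
        fix c s assume cs: "c \<in> carrier P" "s \<in> carrier X"
        show "bd P P ?Y (\<lambda>q r. tp3 P P T q r (cons b s)) (\<Delta> (a \<otimes>\<^bsub>P\<^esub> c)) =
          bd P P ?Y (\<lambda>a1 a2. bd P P ?Y (\<lambda>c1 c2.
            tp3 P P T (a1 \<otimes>\<^bsub>P\<^esub> c1) (a2 \<otimes>\<^bsub>P\<^esub> c2) (cons b s)) (\<Delta> c)) (\<Delta> a)"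
          by (rule Delta_mult_bd[OF _ ab(1) cs(1)]) (insert ab cs, (assumption | rule drules)+)
      qed (insert ab t, (assumption | rule drules)+)
      also have "\<dots> = bd P P ?Y (\<lambda>a1 a2. bd P X ?Y (\<lambda>c s. bd P P ?Y (\<lambda>c1 c2.
          tp3 P P T (a1 \<otimes>\<^bsub>P\<^esub> c1) (a2 \<otimes>\<^bsub>P\<^esub> c2) (cons b s)) (\<Delta> c)) (\<gamma> t)) (\<Delta> a)"
        by (rule bd_fubini) (insert ab t, (assumption | rule drules)+)
      also have "\<dots> = bd P P ?Y (\<lambda>a1 a2. K a1 a2 b) (\<Delta> a)"
        unfolding K_def
      proof (rule bd_cong)
        fix a1 a2 assume a: "a1 \<in> carrier P" "a2 \<in> carrier P"
        show "bd P X ?Y (\<lambda>c s. bd P P ?Y (\<lambda>c1 c2. tp3 P P T (a1 \<otimes>\<^bsub>P\<^esub> c1) (a2 \<otimes>\<^bsub>P\<^esub> c2) (cons b s)) (\<Delta> c)) (\<gamma> t) =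
          bd P X ?Y (\<lambda>c s. bd P X ?Y (\<lambda>c2 s2. tp3 P P T (a1 \<otimes>\<^bsub>P\<^esub> c) (a2 \<otimes>\<^bsub>P\<^esub> c2) (cons b s2)) (\<gamma> s)) (\<gamma> t)"
          by (rule gamma_coassoc[OF _ t]) (insert ab a, (assumption | rule drules)+)
      qed (insert ab t, (assumption | rule drules)+)
      finally show "bd P X ?Y (\<lambda>c s. bd P P ?Y (\<lambda>q r. tp3 P P T q r (cons b s)) (\<Delta> (a \<otimes>\<^bsub>P\<^esub> c))) (\<gamma> t) =
        bd P P ?Y (\<lambda>a1 a2. K a1 a2 b) (\<Delta> a)" .
    qed (insert p t, (assumption | rule drules)+)
    \<comment> \<open>Coassociativity of \<open>\<Delta>\<close> in the three arguments of
      \<open>K\<close>; the preceding step used that of \<open>\<gamma>\<close>.\<close>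
    also have "\<dots> = bd P P ?Y (\<lambda>a b. bd P P ?Y (\<lambda>b1 b2. K a b1 b2) (\<Delta> b)) (\<Delta> p)"
      unfolding K_def by (rule comodule_coassoc[OF left _ p]) (insert t, (assumption | rule drules)+)
    also have "\<dots> = bd P P ?Y (\<lambda>a b. bd P X ?Y (\<lambda>c s. bd P T ?Y (\<lambda>q g. tp3 P P T (a \<otimes>\<^bsub>P\<^esub> c) q g) (\<Gamma> (cons b s))) (\<gamma> t)) (\<Delta> p)"
      unfolding K_def
    proof (rule bd_cong)
      fix a b assume ab: "a \<in> carrier P" "b \<in> carrier P"
      have "bd P P ?Y (\<lambda>b1 b2. bd P X ?Y (\<lambda>c s. bd P X ?Y (\<lambda>c2 s2.
          tp3 P P T (a \<otimes>\<^bsub>P\<^esub> c) (b1 \<otimes>\<^bsub>P\<^esub> c2) (cons b2 s2)) (\<gamma> s)) (\<gamma> t)) (\<Delta> b) =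
        bd P X ?Y (\<lambda>c s. bd P P ?Y (\<lambda>b1 b2. bd P X ?Y (\<lambda>c2 s2.
          tp3 P P T (a \<otimes>\<^bsub>P\<^esub> c) (b1 \<otimes>\<^bsub>P\<^esub> c2) (cons b2 s2)) (\<gamma> s)) (\<Delta> b)) (\<gamma> t)"
        by (rule bd_fubini) (insert ab t, (assumption | rule drules)+)
      also have "\<dots> = bd P X ?Y (\<lambda>c s. bd P T ?Y (\<lambda>q g. tp3 P P T (a \<otimes>\<^bsub>P\<^esub> c) q g) (\<Gamma> (cons b s))) (\<gamma> t)"
      proof (rule bd_cong)
        fix c s assume cs: "c \<in> carrier P" "s \<in> carrier X"
        show "bd P P ?Y (\<lambda>b1 b2. bd P X ?Y (\<lambda>c2 s2.
          tp3 P P T (a \<otimes>\<^bsub>P\<^esub> c) (b1 \<otimes>\<^bsub>P\<^esub> c2) (cons b2 s2)) (\<gamma> s)) (\<Delta> b) =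
          bd P T ?Y (\<lambda>q g. tp3 P P T (a \<otimes>\<^bsub>P\<^esub> c) q g) (\<Gamma> (cons b s))"
          by (rule Gamma_bd[OF _ ab(2) cs(2), symmetric]) (insert ab cs, (assumption | rule drules)+)
      qed (insert ab t, (assumption | rule drules)+)
      finally show "bd P P ?Y (\<lambda>b1 b2. bd P X ?Y (\<lambda>c s. bd P X ?Y (\<lambda>c2 s2.
          tp3 P P T (a \<otimes>\<^bsub>P\<^esub> c) (b1 \<otimes>\<^bsub>P\<^esub> c2) (cons b2 s2)) (\<gamma> s)) (\<gamma> t)) (\<Delta> b) =
        bd P X ?Y (\<lambda>c s. bd P T ?Y (\<lambda>q g. tp3 P P T (a \<otimes>\<^bsub>P\<^esub> c) q g) (\<Gamma> (cons b s))) (\<gamma> t)" .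
    qed (insert p t, (assumption | rule drules)+)
    also have "\<dots> = bd P T ?Y (\<lambda>p f. bd P T ?Y (\<lambda>q g. tp3 P P T p q g) (\<Gamma> f)) (\<Gamma> (cons p t))"
      by (rule Gamma_bd[OF _ p t, symmetric]) (assumption | rule drules)+
    finally show "bd P T ?Y (\<lambda>p f. bd P P ?Y (\<lambda>q r. tp3 P P T q r f) (\<Delta> p)) (\<Gamma> (cons p t)) =
      bd P T ?Y (\<lambda>p f. bd P T ?Y (\<lambda>q g. tp3 P P T p q g) (\<Gamma> f)) (\<Gamma> (cons p t))" .
  qed
qed

text \<open>
  \<open>tau\<close> untwists the diagonal coaction \<open>\<Gamma>\<close> on \<open>P \<otimes> X\<close> to the coaction \<open>lam\<close>, which only sees the
  factor \<open>P\<close>; its inverse \<open>sig\<close> uses the antipode. The coinvariants of \<open>lam\<close> are \<open>1 \<otimes> X\<close>, and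
  \<open>Phi\<close> is the resulting linear projection onto the coinvariants of \<open>\<Gamma>\<close>. Being natural in \<open>X\<close>, it
  shows that taking coinvariants of \<open>P \<otimes> X\<close> is exact in \<open>X\<close>.
\<close>

definition tau where "tau = cbd P Us V T (\<lambda>p t. bd P X T (\<lambda>c s. cons (p \<otimes>\<^bsub>P\<^esub> c) s) (\<gamma> t))"

definition sig where "sig = cbd P Us V T (\<lambda>p t. bd P X T (\<lambda>c s. cons (p \<otimes>\<^bsub>P\<^esub> S c) s) (\<gamma> t))"

definition lam where "lam = cbd P Us V (T2 P T) (\<lambda>p t. bd P P (T2 P T) (\<lambda>a b. tp P T a (cons b t)) (\<Delta> p))"

definition cu where "cu = cbd P Us V X (\<lambda>p t. \<epsilon> p \<odot>\<^bsub>X\<^esub> t)"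

lemma twist_bilin:
  "bilin P X T (\<lambda>p t. bd P X T (\<lambda>c s. cons (p \<otimes>\<^bsub>P\<^esub> c) s) (\<gamma> t))"
  "bilin P X T (\<lambda>p t. bd P X T (\<lambda>c s. cons (p \<otimes>\<^bsub>P\<^esub> S c) s) (\<gamma> t))"
  "bilin P X (T2 P T) (\<lambda>p t. bd P P (T2 P T) (\<lambda>a b. tp P T a (cons b t)) (\<Delta> p))"
  "bilin P X X (\<lambda>p t. \<epsilon> p \<odot>\<^bsub>X\<^esub> t)"
  by (assumption | rule drules)+

lemmas tau_lin = cbd_T[OF twist_bilin(1), folded tau_def]
lemmas sig_lin = cbd_T[OF twist_bilin(2), folded sig_def]
lemmas lam_lin = cbd_T[OF twist_bilin(3), folded lam_def]
lemmas cu_lin = cbd_T[OF twist_bilin(4), folded cu_def]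
lemmas tau_cons = cbd_cons[OF twist_bilin(1), folded tau_def]
lemmas sig_cons = cbd_cons[OF twist_bilin(2), folded sig_def]
lemmas lam_cons = cbd_cons[OF twist_bilin(3), folded lam_def]
lemmas cu_cons = cbd_cons[OF twist_bilin(4), folded cu_def]

lemmas trules = lin_comp[OF tau_lin] lin_closed[OF tau_lin] lin_comp[OF sig_lin] lin_closed[OF sig_lin]
  lin_comp[OF lam_lin] lin_closed[OF lam_lin] lin_comp[OF cu_lin] lin_closed[OF cu_lin] drules

text \<open>When the convolution of f with g is the counit, twisting with f and then with g changes
  nothing. Taking one of the two maps to be \<open>S\<close> and the other the identity gives both
  inverse laws for \<open>tau\<close> and \<open>sig\<close>.\<close>

lemma convolution_cancel:
  assumes f: "lin P P f" and g: "lin P P g"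
    and fg: "\<And>q. q \<in> carrier P \<Longrightarrow> bd P P P (\<lambda>c c'. f c \<otimes>\<^bsub>P\<^esub> g c') (\<Delta> q) = \<epsilon> q \<odot>\<^bsub>P\<^esub> \<one>\<^bsub>P\<^esub>"
    and p: "p \<in> carrier P" and t: "t \<in> carrier X"
  shows "bd P X T (\<lambda>c s. bd P X T (\<lambda>c' s'. cons ((p \<otimes>\<^bsub>P\<^esub> f c) \<otimes>\<^bsub>P\<^esub> g c') s') (\<gamma> s)) (\<gamma> t) = cons p t"
proof -
  note rules = lin_comp[OF f] lin_closed[OF f] lin_comp[OF g] lin_closed[OF g] trules
  have "bd P X T (\<lambda>c s. bd P X T (\<lambda>c' s'. cons ((p \<otimes>\<^bsub>P\<^esub> f c) \<otimes>\<^bsub>P\<^esub> g c') s') (\<gamma> s)) (\<gamma> t) =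
    bd P X T (\<lambda>q s. bd P P T (\<lambda>c c'. cons ((p \<otimes>\<^bsub>P\<^esub> f c) \<otimes>\<^bsub>P\<^esub> g c') s) (\<Delta> q)) (\<gamma> t)"
    by (rule gamma_coassoc[OF _ t, symmetric]) (insert p, (assumption | rule rules)+)
  also have "\<dots> = bd P X T (\<lambda>q s. cons p (\<epsilon> q \<odot>\<^bsub>X\<^esub> s)) (\<gamma> t)"
  proof (rule bd_cong)
    fix q s assume q: "q \<in> carrier P" and s: "s \<in> carrier X"
    have "cons (p \<otimes>\<^bsub>P\<^esub> bd P P P (\<lambda>c c'. f c \<otimes>\<^bsub>P\<^esub> g c') (\<Delta> q)) s =
      bd P P T (\<lambda>c c'. cons ((p \<otimes>\<^bsub>P\<^esub> f c) \<otimes>\<^bsub>P\<^esub> g c') s) (\<Delta> q)"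
    proof (rule bd_comp_eq[where g = "\<lambda>x. cons (p \<otimes>\<^bsub>P\<^esub> x) s"])
      show "cons (p \<otimes>\<^bsub>P\<^esub> (f c \<otimes>\<^bsub>P\<^esub> g c')) s = cons ((p \<otimes>\<^bsub>P\<^esub> f c) \<otimes>\<^bsub>P\<^esub> g c') s"
        if "c \<in> carrier P" "c' \<in> carrier P" for c c'
        using that p by (simp add: mult_assoc lin_closed[OF f] lin_closed[OF g])
    qed (insert p q s, (assumption | rule rules)+)
    also have "cons (p \<otimes>\<^bsub>P\<^esub> bd P P P (\<lambda>c c'. f c \<otimes>\<^bsub>P\<^esub> g c') (\<Delta> q)) s = cons p (\<epsilon> q \<odot>\<^bsub>X\<^esub> s)"
      using p q s by (simp add: fg k_algebra.smult_assoc_right[OF algebra] eps_closed one_closed mult_one cons_smult)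
    finally show "bd P P T (\<lambda>c c'. cons ((p \<otimes>\<^bsub>P\<^esub> f c) \<otimes>\<^bsub>P\<^esub> g c') s) (\<Delta> q) = cons p (\<epsilon> q \<odot>\<^bsub>X\<^esub> s)" by simp
  qed (insert p t, (assumption | rule rules)+)
  also have "\<dots> = cons p (bd P X X (\<lambda>q s. \<epsilon> q \<odot>\<^bsub>X\<^esub> s) (\<gamma> t))"
    by (rule bd_comp[symmetric]) (insert p t, (assumption | rule rules bilinD(5)[OF cons_bilin])+)
  finally show ?thesis by (simp add: comodule_counit[OF X_comodule t])
qed

lemma tau_sig:
  assumes x: "x \<in> carrier T"
  shows "tau (sig x) = x"
proof (rule cons_ext[OF lin_comp[OF tau_lin sig_lin] lin_id[OF T_VS] _ x])
  fix p t assume p: "p \<in> carrier P" and t: "t \<in> carrier X"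
  have "tau (sig (cons p t)) = bd P X T (\<lambda>c s. bd P X T (\<lambda>c' s'. cons ((p \<otimes>\<^bsub>P\<^esub> S c) \<otimes>\<^bsub>P\<^esub> c') s') (\<gamma> s)) (\<gamma> t)"
    unfolding sig_cons[OF p t]
    by (rule bd_comp_eq[OF _ tau_lin _ tau_cons]) (insert p t, (assumption | rule trules)+)
  also have "\<dots> = cons p t"
    by (rule convolution_cancel[OF antipode_linear lin_id[OF P_VS] antipode_left_bd p t])
  finally show "tau (sig (cons p t)) = cons p t" .
qed

lemma sig_tau:
  assumes x: "x \<in> carrier T"
  shows "sig (tau x) = x"
proof (rule cons_ext[OF lin_comp[OF sig_lin tau_lin] lin_id[OF T_VS] _ x])
  fix p t assume p: "p \<in> carrier P" and t: "t \<in> carrier X"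
  have "sig (tau (cons p t)) = bd P X T (\<lambda>c s. bd P X T (\<lambda>c' s'. cons ((p \<otimes>\<^bsub>P\<^esub> c) \<otimes>\<^bsub>P\<^esub> S c') s') (\<gamma> s)) (\<gamma> t)"
    unfolding tau_cons[OF p t]
    by (rule bd_comp_eq[OF _ sig_lin _ sig_cons]) (insert p t, (assumption | rule trules)+)
  also have "\<dots> = cons p t"
    by (rule convolution_cancel[OF lin_id[OF P_VS] antipode_linear antipode_right_bd p t])
  finally show "sig (tau (cons p t)) = cons p t" .
qed

text \<open>In Sweedler notation both sides are the sum of p1 c1, p2 c2 and s: on the left because
  \<open>\<Delta>\<close> is multiplicative, on the right by the formula for
  \<open>\<Gamma>\<close>, matched by coassociativity of \<open>\<gamma>\<close>.\<close>

lemma lam_tau: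
  assumes x: "x \<in> carrier T"
  shows "lam (tau x) = id_tensor k P T T tau (\<Gamma> x)"
proof (rule cons_ext[OF lin_comp[OF lam_lin tau_lin] lin_comp[OF id_tensor_lin[OF P_VS tau_lin] Gamma_lin] _ x])
  fix p t assume p: "p \<in> carrier P" and t: "t \<in> carrier X"
  let ?Y = "T2 P T"
  have "lam (tau (cons p t)) = bd P X ?Y (\<lambda>c s. bd P P ?Y (\<lambda>a b. tp P T a (cons b s)) (\<Delta> (p \<otimes>\<^bsub>P\<^esub> c))) (\<gamma> t)"
    unfolding tau_cons[OF p t]
    by (rule bd_comp_eq[OF _ lam_lin _ lam_cons]) (insert p t, (assumption | rule trules)+)
  also have "\<dots> = bd P X ?Y (\<lambda>c s. bd P P ?Y (\<lambda>p1 p2. bd P P ?Y (\<lambda>c1 c2.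
      tp P T (p1 \<otimes>\<^bsub>P\<^esub> c1) (cons (p2 \<otimes>\<^bsub>P\<^esub> c2) s)) (\<Delta> c)) (\<Delta> p)) (\<gamma> t)"
  proof (rule bd_cong)
    fix c s assume cs: "c \<in> carrier P" "s \<in> carrier X"
    show "bd P P ?Y (\<lambda>a b. tp P T a (cons b s)) (\<Delta> (p \<otimes>\<^bsub>P\<^esub> c)) =
      bd P P ?Y (\<lambda>p1 p2. bd P P ?Y (\<lambda>c1 c2. tp P T (p1 \<otimes>\<^bsub>P\<^esub> c1) (cons (p2 \<otimes>\<^bsub>P\<^esub> c2) s)) (\<Delta> c)) (\<Delta> p)"
      by (rule Delta_mult_bd[OF _ p cs(1)]) (insert cs, (assumption | rule trules)+)
  qed (insert p t, (assumption | rule trules)+)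
  also have "\<dots> = bd P P ?Y (\<lambda>p1 p2. bd P X ?Y (\<lambda>c s. bd P P ?Y (\<lambda>c1 c2.
      tp P T (p1 \<otimes>\<^bsub>P\<^esub> c1) (cons (p2 \<otimes>\<^bsub>P\<^esub> c2) s)) (\<Delta> c)) (\<gamma> t)) (\<Delta> p)"
    by (rule bd_fubini) (insert p t, (assumption | rule trules)+)
  also have "\<dots> = bd P P ?Y (\<lambda>a b. bd P X ?Y (\<lambda>c s. tp P T (a \<otimes>\<^bsub>P\<^esub> c) (tau (cons b s))) (\<gamma> t)) (\<Delta> p)"
  proof (rule bd_cong)
    fix a b assume ab: "a \<in> carrier P" "b \<in> carrier P"
    have "bd P X ?Y (\<lambda>c s. bd P P ?Y (\<lambda>c1 c2. tp P T (a \<otimes>\<^bsub>P\<^esub> c1) (cons (b \<otimes>\<^bsub>P\<^esub> c2) s)) (\<Delta> c)) (\<gamma> t) =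
      bd P X ?Y (\<lambda>c s. bd P X ?Y (\<lambda>c2 s2. tp P T (a \<otimes>\<^bsub>P\<^esub> c) (cons (b \<otimes>\<^bsub>P\<^esub> c2) s2)) (\<gamma> s)) (\<gamma> t)"
      by (rule gamma_coassoc[OF _ t]) (insert ab, (assumption | rule trules)+)
    also have "\<dots> = bd P X ?Y (\<lambda>c s. tp P T (a \<otimes>\<^bsub>P\<^esub> c) (tau (cons b s))) (\<gamma> t)"
    proof (rule bd_cong)
      fix c s assume cs: "c \<in> carrier P" "s \<in> carrier X"
      show "bd P X ?Y (\<lambda>c2 s2. tp P T (a \<otimes>\<^bsub>P\<^esub> c) (cons (b \<otimes>\<^bsub>P\<^esub> c2) s2)) (\<gamma> s) = tp P T (a \<otimes>\<^bsub>P\<^esub> c) (tau (cons b s))"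
        unfolding tau_cons[OF ab(2) cs(2)]
        by (rule bd_comp[symmetric]) (insert ab cs, (assumption | rule bilinD(5)[OF tp_bilin] trules)+)
    qed (insert ab t, (assumption | rule trules)+)
    finally show "bd P X ?Y (\<lambda>c s. bd P P ?Y (\<lambda>c1 c2. tp P T (a \<otimes>\<^bsub>P\<^esub> c1) (cons (b \<otimes>\<^bsub>P\<^esub> c2) s)) (\<Delta> c)) (\<gamma> t) =
      bd P X ?Y (\<lambda>c s. tp P T (a \<otimes>\<^bsub>P\<^esub> c) (tau (cons b s))) (\<gamma> t)" .
  qed (insert p t, (assumption | rule trules)+)
  also have "\<dots> = id_tensor k P T T tau (\<Gamma> (cons p t))"
    unfolding id_tensor_bd by (rule Gamma_bd[OF id_tensor_bilin[OF P_VS tau_lin] p t, symmetric])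
  finally show "lam (tau (cons p t)) = id_tensor k P T T tau (\<Gamma> (cons p t))" .
qed

text \<open>\<open>lam\<close> splits p into p1 and p2, and \<open>cu\<close> applies the counit to
  p2. It follows that a coinvariant of \<open>lam\<close> has the unit as its leading
  factor.\<close>

lemma lam_counit:
  assumes x: "x \<in> carrier T"
  shows "bd P T T (\<lambda>q s. cons q (cu s)) (lam x) = x"
proof -
  have b: "bilin P T T (\<lambda>q s. cons q (cu s))" by (assumption | rule trules)+
  show ?thesis
  proof (rule cons_ext[OF lin_comp[OF bd_lin[OF b] lam_lin] lin_id[OF T_VS] _ x])
    fix p t assume p: "p \<in> carrier P" and t: "t \<in> carrier X"
    have "bd P T T (\<lambda>q s. cons q (cu s)) (lam (cons p t)) = bd P P T (\<lambda>a b. cons a (cu (cons b t))) (\<Delta> p)"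
      unfolding lam_cons[OF p t]
      by (rule bd_comp_eq[OF _ bd_lin[OF b] _ bd_tp[OF b]]) (insert p t, (assumption | rule trules)+)
    also have "\<dots> = bd P P T (\<lambda>a b. cons (\<epsilon> b \<odot>\<^bsub>P\<^esub> a) t) (\<Delta> p)"
    proof (rule bd_cong)
      show "cons a (cu (cons b t)) = cons (\<epsilon> b \<odot>\<^bsub>P\<^esub> a) t" if "a \<in> carrier P" "b \<in> carrier P" for a b
        using that t by (simp add: cu_cons cons_smult eps_closed)
    qed (insert p t, (assumption | rule trules)+)
    also have "\<dots> = cons (bd P P P (\<lambda>a b. \<epsilon> b \<odot>\<^bsub>P\<^esub> a) (\<Delta> p)) t"
      by (rule bd_comp[symmetric, of P P P _ T "\<lambda>x. cons x t"]) (insert p t, (assumption | rule trules)+)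
    finally show "bd P T T (\<lambda>q s. cons q (cu s)) (lam (cons p t)) = cons p t"
      by (simp add: right_counit_bd[OF p])
  qed
qed

definition Phi where "Phi x = sig (cons \<one>\<^bsub>P\<^esub> (cu (tau x)))"

lemma Phi_lin: "lin T T Phi"
  unfolding Phi_def by (assumption | rule trules)+

text \<open>Since \<open>\<Delta>\<close> preserves the unit, a tensor with leading factor 1 is
  coinvariant for \<open>lam\<close>; \<open>sig\<close>, the inverse of \<open>tau\<close>,
  transports this to \<open>\<Gamma>\<close>.\<close>

lemma Phi_coinvariant:
  assumes x: "x \<in> carrier T"
  shows "\<Gamma> (Phi x) = tp P T \<one>\<^bsub>P\<^esub> (Phi x)"
proof -
  define y where "y = cu (tau x)"
  have y: "y \<in> carrier X" unfolding y_def by (insert x, (assumption | rule trules)+)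
  let ?u = "cons \<one>\<^bsub>P\<^esub> y"
  have u: "?u \<in> carrier T" "sig ?u \<in> carrier T" "\<Gamma> (sig ?u) \<in> carrier (T2 P T)"
    by (insert y, (assumption | rule trules)+)
  have "lam ?u = tp P T \<one>\<^bsub>P\<^esub> ?u"
    unfolding lam_cons[OF one_closed y] Delta_one
    by (rule bd_tp) (insert y, (assumption | rule trules)+)
  then have "id_tensor k P T T tau (\<Gamma> (sig ?u)) = tp P T \<one>\<^bsub>P\<^esub> ?u"
    using lam_tau[OF u(2)] by (simp add: tau_sig[OF u(1)])
  then have "id_tensor k P T T sig (id_tensor k P T T tau (\<Gamma> (sig ?u))) = tp P T \<one>\<^bsub>P\<^esub> (sig ?u)"
    by (simp add: id_tensor_tp[OF P_VS sig_lin one_closed u(1)])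
  moreover have "id_tensor k P T T sig (id_tensor k P T T tau (\<Gamma> (sig ?u))) = \<Gamma> (sig ?u)"
  proof -
    have "id_tensor k P T T (\<lambda>v. sig (tau v)) (\<Gamma> (sig ?u)) = id_tensor k P T T (\<lambda>v. v) (\<Gamma> (sig ?u))"
      by (rule id_tensor_cong[OF P_VS lin_comp[OF sig_lin tau_lin] sig_tau u(3)])
    then show ?thesis
      by (simp add: id_tensor_comp[OF P_VS tau_lin sig_lin u(3)] id_tensor_ident[OF P_VS T_VS u(3)])
  qed
  ultimately show ?thesis by (simp add: Phi_def y_def)
qed

text \<open>If x is coinvariant for \<open>\<Gamma>\<close>, then \<open>tau x\<close> is so for
  \<open>lam\<close>, and \<open>lam_counit\<close> recovers \<open>tau x\<close> from
  \<open>cu (tau x)\<close> with leading factor 1.\<close>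

lemma Phi_fix:
  assumes x: "x \<in> carrier T" and c: "\<Gamma> x = tp P T \<one>\<^bsub>P\<^esub> x"
  shows "Phi x = x"
proof -
  have tx: "tau x \<in> carrier T" by (rule lin_closed[OF tau_lin x])
  have b: "bilin P T T (\<lambda>q s. cons q (cu s))" by (assumption | rule trules)+
  have "lam (tau x) = tp P T \<one>\<^bsub>P\<^esub> (tau x)"
    unfolding lam_tau[OF x] c by (rule id_tensor_tp[OF P_VS tau_lin one_closed x])
  then have "tau x = cons \<one>\<^bsub>P\<^esub> (cu (tau x))"
    using lam_counit[OF tx] bd_tp[OF b one_closed tx] by simp
  then show ?thesis using sig_tau[OF x] by (simp add: Phi_def)
qed

end

text \<open>A colinear map f of the inner comodules together with its extension g, which leaves the
  leading factor alone. This is the naturality in X that makes the projection useful.\<close>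

locale diagonal_map = hopf k P \<Delta> \<epsilon> S +
  A: diagonal k P \<Delta> \<epsilon> S Us V \<gamma> \<Gamma> X T cons + B: diagonal k P \<Delta> \<epsilon> S Us' V' \<gamma>' \<Gamma>' X' T' cons'
  for k :: "('k, 'z) ring_scheme" and P :: "('k, 'p) module"
    and \<Delta> :: "'p \<Rightarrow> ('p list \<times> 'p \<Rightarrow> 'k) set" and \<epsilon> :: "'p \<Rightarrow> 'k" and S :: "'p \<Rightarrow> 'p"
    and Us and V :: "('k, 'f) module" and \<gamma> \<Gamma> X T cons
    and Us' and V' :: "('k, 'g) module" and \<gamma>' \<Gamma>' X' T' cons' +
  fixes f g
  assumes f: "colin X \<gamma> X' \<gamma>' f" and g_lin: "lin T T' g"
    and g_cons: "p \<in> carrier P \<Longrightarrow> t \<in> carrier X \<Longrightarrow> g (cons p t) = cons' p (f t)"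
begin

lemmas f_lin = colin_lin[OF f]

lemmas frules = lin_comp[OF f_lin] lin_closed[OF f_lin] lin_comp[OF g_lin] lin_closed[OF g_lin] A.trules B.trules

lemma g_colin: "colin T \<Gamma> T' \<Gamma>' g"
  unfolding colin_def
proof (intro conjI ballI)
  show "lin T T' g" by (rule g_lin)
  fix x assume x: "x \<in> carrier T"
  let ?Y = "T2 P T'"
  show "\<Gamma>' (g x) = id_tensor k P T T' g (\<Gamma> x)"
  proof (rule A.cons_ext[OF lin_comp[OF B.Gamma_lin g_lin] lin_comp[OF id_tensor_lin[OF P_VS g_lin] A.Gamma_lin] _ x])
    fix p t assume p: "p \<in> carrier P" and t: "t \<in> carrier X"
    have "\<Gamma>' (g (cons p t)) = bd P P ?Y (\<lambda>a b. bd P X' ?Y (\<lambda>c s. tp P T' (a \<otimes>\<^bsub>P\<^esub> c) (cons' b s)) (\<gamma>' (f t))) (\<Delta> p)"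
      unfolding g_cons[OF p t] by (rule B.Gamma_cons[OF p lin_closed[OF f_lin t]])
    also have "\<dots> = bd P P ?Y (\<lambda>a b. bd P X ?Y (\<lambda>c s. tp P T' (a \<otimes>\<^bsub>P\<^esub> c) (g (cons b s))) (\<gamma> t)) (\<Delta> p)"
    proof (rule bd_cong)
      fix a b assume ab: "a \<in> carrier P" "b \<in> carrier P"
      have "bd P X' ?Y (\<lambda>c s. tp P T' (a \<otimes>\<^bsub>P\<^esub> c) (cons' b s)) (\<gamma>' (f t)) =
        bd P X ?Y (\<lambda>c s. tp P T' (a \<otimes>\<^bsub>P\<^esub> c) (cons' b (f s))) (\<gamma> t)"
        by (rule colin_bd[OF f A.gamma_lin _ t]) (insert ab, (assumption | rule frules)+)
      also have "\<dots> = bd P X ?Y (\<lambda>c s. tp P T' (a \<otimes>\<^bsub>P\<^esub> c) (g (cons b s))) (\<gamma> t)"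
      proof (rule bd_cong)
        show "tp P T' (a \<otimes>\<^bsub>P\<^esub> c) (cons' b (f s)) = tp P T' (a \<otimes>\<^bsub>P\<^esub> c) (g (cons b s))"
          if "c \<in> carrier P" "s \<in> carrier X" for c s using g_cons[OF ab(2) that(2)] by simp
      qed (insert ab t, (assumption | rule frules)+)
      finally show "bd P X' ?Y (\<lambda>c s. tp P T' (a \<otimes>\<^bsub>P\<^esub> c) (cons' b s)) (\<gamma>' (f t)) =
        bd P X ?Y (\<lambda>c s. tp P T' (a \<otimes>\<^bsub>P\<^esub> c) (g (cons b s))) (\<gamma> t)" .
    qed (insert p t, (assumption | rule frules)+)
    also have "\<dots> = id_tensor k P T T' g (\<Gamma> (cons p t))"
      unfolding id_tensor_bd by (rule A.Gamma_bd[OF id_tensor_bilin[OF P_VS g_lin] p t, symmetric])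
    finally show "\<Gamma>' (g (cons p t)) = id_tensor k P T T' g (\<Gamma> (cons p t))" .
  qed
qed

text \<open>With h the identity this is naturality of \<open>tau\<close>, with h = S that of
  \<open>sig\<close>.\<close>

lemma twist_natural:
  assumes h: "lin P P h" and p: "p \<in> carrier P" and t: "t \<in> carrier X"
  shows "g (bd P X T (\<lambda>c s. cons (p \<otimes>\<^bsub>P\<^esub> h c) s) (\<gamma> t)) = bd P X' T' (\<lambda>c s. cons' (p \<otimes>\<^bsub>P\<^esub> h c) s) (\<gamma>' (f t))"
proof -
  have "g (bd P X T (\<lambda>c s. cons (p \<otimes>\<^bsub>P\<^esub> h c) s) (\<gamma> t)) = bd P X T' (\<lambda>c s. cons' (p \<otimes>\<^bsub>P\<^esub> h c) (f s)) (\<gamma> t)"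
    by (rule bd_comp_eq[OF _ g_lin _ g_cons])
      (insert p t, (assumption | rule lin_comp[OF h] lin_closed[OF h] frules)+)
  also have "\<dots> = bd P X' T' (\<lambda>c s. cons' (p \<otimes>\<^bsub>P\<^esub> h c) s) (\<gamma>' (f t))"
    by (rule colin_bd[OF f A.gamma_lin _ t, symmetric])
      (insert p, (assumption | rule lin_comp[OF h] lin_closed[OF h] frules)+)
  finally show ?thesis .
qed

lemma Phi_natural:
  assumes x: "x \<in> carrier T"
  shows "g (A.Phi x) = B.Phi (g x)"
proof -
  have tau: "g (A.tau y) = B.tau (g y)" if "y \<in> carrier T" for y
    by (rule A.cons_ext[OF lin_comp[OF g_lin A.tau_lin] lin_comp[OF B.tau_lin g_lin] _ that])
      (simp add: A.tau_cons g_cons B.tau_cons lin_closed[OF f_lin] twist_natural[OF lin_id[OF P_VS]])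
  have sig: "g (A.sig y) = B.sig (g y)" if "y \<in> carrier T" for y
    by (rule A.cons_ext[OF lin_comp[OF g_lin A.sig_lin] lin_comp[OF B.sig_lin g_lin] _ that])
      (simp add: A.sig_cons g_cons B.sig_cons lin_closed[OF f_lin] twist_natural[OF antipode_linear])
  have cu: "f (A.cu y) = B.cu (g y)" if "y \<in> carrier T" for y
    by (rule A.cons_ext[OF lin_comp[OF f_lin A.cu_lin] lin_comp[OF B.cu_lin g_lin] _ that])
      (simp add: A.cu_cons g_cons B.cu_cons lin_closed[OF f_lin] lin_smult[OF f_lin] eps_closed)
  have c: "A.tau x \<in> carrier T" "A.cu (A.tau x) \<in> carrier X" "cons \<one>\<^bsub>P\<^esub> (A.cu (A.tau x)) \<in> carrier T"
    by (insert x, (assumption | rule A.trules)+)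
  show ?thesis
    unfolding A.Phi_def B.Phi_def sig[OF c(3)] g_cons[OF one_closed c(2)] cu[OF c(1)] tau[OF x] ..
qed

end

context ground_field
begin

section \<open>Tensor products without left factors, and functoriality in the last factor\<close>

text \<open>The canonical isomorphism onto the tensor product with empty list, which is not
  literally \<open>V\<close>; its inverse is \<open>unl\<close>.\<close>

definition nil :: "('k, 'v) module \<Rightarrow> 'v \<Rightarrow> ('u list \<times> 'v \<Rightarrow> 'k) set" where
  "nil V v = pure k ([] :: ('k, 'u) module list) V [] v"

definition unl :: "('k, 'v) module \<Rightarrow> ('u list \<times> 'v \<Rightarrow> 'k) set \<Rightarrow> 'v" where
  "unl V t = tensor_lift k ([] :: ('k, 'u) module list) V V (\<lambda>_ v. v) t"

context
  fixes V :: "('k, 'v) module"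
  assumes V: "VS V"
begin

lemma nil_lin: "lin V (tensor k [] V) (nil V)"
  unfolding nil_def using pure_mlin[OF VSs_Nil V] vs_zero[OF V] by (auto simp: mlin_def)

lemma unl_mlin: "mlin [] V V (\<lambda>_ v. v)"
  by (rule mlin_Nil[OF lin_id[OF V]])

lemma unl_lin: "lin (tensor k [] V) V (unl V)"
  unfolding unl_def by (rule lift_lin[OF VSs_Nil V unl_mlin])

lemma unl_nil: "v \<in> carrier V \<Longrightarrow> unl V (nil V v) = v"
  unfolding unl_def nil_def by (subst lift_pure[OF VSs_Nil V unl_mlin]) simp_all

lemma nil_unl: "t \<in> carrier (tensor k [] V) \<Longrightarrow> nil V (unl V t) = t"
proof -
  assume t: "t \<in> carrier (tensor k [] V)"
  show ?thesis
    by (rule tensor_ext[OF VSs_Nil V lin_comp[OF nil_lin unl_lin] lin_id[OF tensor_VS[OF VSs_Nil V]] _ t])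
      (auto simp: unl_nil simp flip: nil_def)
qed

lemma nil_surj: "carrier (tensor k [] V) \<subseteq> nil V ` carrier V"
proof
  fix t assume t: "t \<in> carrier (tensor k [] V)"
  then have "t = nil V (unl V t)" by (simp add: nil_unl)
  then show "t \<in> nil V ` carrier V" using lin_closed[OF unl_lin t] by (rule image_eqI)
qed

end

lemma nil_ext:
  assumes "lin (tensor k [] V) X f" "lin (tensor k [] V) X g" "VS V"
    "\<And>v. v \<in> carrier V \<Longrightarrow> f (nil V v) = g (nil V v)" "t \<in> carrier (tensor k [] V)"
  shows "f t = g t"
  using assms(4)[OF lin_closed[OF unl_lin[OF assms(3)] assms(5)]] by (simp add: nil_unl[OF assms(3,5)])

text \<open>The identity on all left factors tensored with f.\<close>

definition pm ::
  "('k, 'u) module list \<Rightarrow> ('k, 'v) module \<Rightarrow> ('k, 'w) module \<Rightarrow> ('v \<Rightarrow> 'w) \<Rightarrow>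
    ('u list \<times> 'v \<Rightarrow> 'k) set \<Rightarrow> ('u list \<times> 'w \<Rightarrow> 'k) set" where
  "pm Us V W f = tensor_lift k Us V (tensor k Us W) (\<lambda>xs v. pure k Us W xs (f v))"

lemma pm_mlin:
  assumes Us: "VSs Us" and f: "lin V W f"
  shows "mlin Us V (tensor k Us W) (\<lambda>xs v. pure k Us W xs (f v))"
  using Us
proof (induction Us)
  case Nil
  show ?case by (rule mlin_Nil) (use lin_comp[OF nil_lin[OF lin_W[OF f]] f] in \<open>simp add: nil_def\<close>)
next
  case (Cons U Us)
  then have U: "VS U" and Us: "VSs Us" by simp_all
  note W = lin_W[OF f]
  have fv: "(ys, f v) \<in> tensor_keys Us W" if "(ys, v) \<in> tensor_keys Us V" for ys v
    using that lin_closed[OF f] by (auto simp: tensor_keys_def)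
  show ?case
  proof (rule mlin_Cons)
    show "VS (tensor k (U # Us) W)" by (rule tensor_VS[OF Cons.prems W])
    fix y assume y: "y \<in> carrier U"
    show "mlin Us V (tensor k (U # Us) W) (\<lambda>ys v. pure k (U # Us) W (y # ys) (f v))"
      by (rule mlin_cong[OF mlin_comp[OF bilinD(5)[OF cn_bilin[OF U Us W] y] Cons.IH[OF Us]]])
        (rule cn_pure[OF U Us W y fv])
  next
    fix ys v assume k: "(ys, v) \<in> tensor_keys Us V"
    show "lin U (tensor k (U # Us) W) (\<lambda>y. pure k (U # Us) W (y # ys) (f v))"
      by (rule mlin_ConsD(2)[OF pure_mlin[OF Cons.prems W] fv[OF k] U])
  qed
qed

context
  fixes Us :: "('k, 'u) module list" and V :: "('k, 'v) module" and W :: "('k, 'w) module" and f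
  assumes Us: "VSs Us" and f: "lin V W f"
begin

lemma pm_lin: "lin (tensor k Us V) (tensor k Us W) (pm Us V W f)"
  unfolding pm_def by (rule lift_lin[OF Us lin_V[OF f] pm_mlin[OF Us f]])

lemma pm_pure: "(xs, v) \<in> tensor_keys Us V \<Longrightarrow> pm Us V W f (pure k Us V xs v) = pure k Us W xs (f v)"
  unfolding pm_def by (rule lift_pure[OF Us lin_V[OF f] pm_mlin[OF Us f]])

lemma pm_cn:
  assumes U: "VS U" and p: "p \<in> carrier U" and t: "t \<in> carrier (tensor k Us V)"
  shows "pm (U # Us) V W f (cn U Us V p t) = cn U Us W p (pm Us V W f t)"
proof -
  note V = lin_V[OF f] and W = lin_W[OF f]
  have UU: "VSs (U # Us)" using U Us by simp
  have l: "lin (tensor k (U # Us) V) (tensor k (U # Us) W) (pm (U # Us) V W f)"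
    unfolding pm_def by (rule lift_lin[OF UU V pm_mlin[OF UU f]])
  have lp: "pm (U # Us) V W f (pure k (U # Us) V xs v) = pure k (U # Us) W xs (f v)"
    if "(xs, v) \<in> tensor_keys (U # Us) V" for xs v
    unfolding pm_def by (rule lift_pure[OF UU V pm_mlin[OF UU f] that])
  show ?thesis
  proof (rule tensor_ext[OF Us V lin_comp[OF l bilinD(5)[OF cn_bilin[OF U Us V] p]]
        lin_comp[OF bilinD(5)[OF cn_bilin[OF U Us W] p] pm_lin] _ t])
    fix xs v assume k: "(xs, v) \<in> tensor_keys Us V"
    have k': "(xs, f v) \<in> tensor_keys Us W" using k lin_closed[OF f] by (auto simp: tensor_keys_def)
    show "pm (U # Us) V W f (cn U Us V p (pure k Us V xs v)) = cn U Us W p (pm Us V W f (pure k Us V xs v))"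
      using k p by (simp add: cn_pure[OF U Us V p k] pm_pure[OF k] cn_pure[OF U Us W p k'] lp)
  qed
qed

end

lemma pm_nil: "lin V W f \<Longrightarrow> v \<in> carrier V \<Longrightarrow> pm [] V W f (nil V v) = nil W (f v)"
  unfolding nil_def by (rule pm_pure) simp_all

lemma pm_comp:
  assumes Us: "VSs Us" and f: "lin V W f" and g: "lin W X g" and t: "t \<in> carrier (tensor k Us V)"
  shows "pm Us W X g (pm Us V W f t) = pm Us V X (\<lambda>v. g (f v)) t"
proof (rule tensor_ext[OF Us lin_V[OF f] lin_comp[OF pm_lin[OF Us g] pm_lin[OF Us f]] pm_lin[OF Us lin_comp[OF g f]] _ t])
  fix xs v assume k: "(xs, v) \<in> tensor_keys Us V"
  have k': "(xs, f v) \<in> tensor_keys Us W" using k lin_closed[OF f] by (auto simp: tensor_keys_def)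
  show "pm Us W X g (pm Us V W f (pure k Us V xs v)) = pm Us V X (\<lambda>v. g (f v)) (pure k Us V xs v)"
    by (simp add: pm_pure[OF Us f k] pm_pure[OF Us g k'] pm_pure[OF Us lin_comp[OF g f] k])
qed

lemma pm_cong:
  assumes Us: "VSs Us" and f: "lin V W f" and e: "\<And>v. v \<in> carrier V \<Longrightarrow> f v = g v" and t: "t \<in> carrier (tensor k Us V)"
  shows "pm Us V W f t = pm Us V W g t"
  unfolding pm_def
  by (rule lift_cong[OF Us lin_V[OF f] pm_mlin[OF Us f] _ t]) (simp add: e keys_facts(2))

lemma pm_id:
  assumes Us: "VSs Us" and V: "VS V" and t: "t \<in> carrier (tensor k Us V)"
  shows "pm Us V V (\<lambda>v. v) t = t"
  by (rule tensor_ext[OF Us V pm_lin[OF Us lin_id[OF V]] lin_id[OF tensor_VS[OF Us V]] _ t])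
    (rule pm_pure[OF Us lin_id[OF V]])

lemma pm_dif:
  assumes Us: "VSs Us" and f: "lin V W f" and g: "lin V W g" and t: "t \<in> carrier (tensor k Us V)"
  shows "pm Us V W (\<lambda>v. dif W (f v) (g v)) t = dif (tensor k Us W) (pm Us V W f t) (pm Us V W g t)"
proof (rule tensor_ext[OF Us lin_V[OF f] pm_lin[OF Us lin_diff[OF f g]] lin_diff[OF pm_lin[OF Us f] pm_lin[OF Us g]] _ t])
  fix xs v assume k: "(xs, v) \<in> tensor_keys Us V"
  have v: "v \<in> carrier V" by (rule keys_facts(2)[OF k])
  have k': "(xs, f v) \<in> tensor_keys Us W" using k lin_closed[OF f] by (auto simp: tensor_keys_def)
  have "lin W (tensor k Us W) (pure k Us W xs)"
    using pure_mlin[OF Us lin_W[OF f]] k' by (auto simp: mlin_def)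
  from lin_dif[OF this lin_closed[OF f v] lin_closed[OF g v]]
  show "pm Us V W (\<lambda>v. dif W (f v) (g v)) (pure k Us V xs v) =
    dif (tensor k Us W) (pm Us V W f (pure k Us V xs v)) (pm Us V W g (pure k Us V xs v))"
    by (simp add: pm_pure[OF Us f k] pm_pure[OF Us g k] pm_pure[OF Us lin_diff[OF f g] k])
qed

lemma pm_zero:
  assumes Us: "VSs Us" and V: "VS V" and W: "VS W" and t: "t \<in> carrier (tensor k Us V)"
  shows "pm Us V W (\<lambda>v. \<zero>\<^bsub>W\<^esub>) t = \<zero>\<^bsub>tensor k Us W\<^esub>"
proof (rule tensor_ext[OF Us V pm_lin[OF Us lin_const_zero[OF V W]] lin_const_zero[OF tensor_VS[OF Us V] tensor_VS[OF Us W]] _ t])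
  fix xs v assume k: "(xs, v) \<in> tensor_keys Us V"
  have k': "(xs, \<zero>\<^bsub>W\<^esub>) \<in> tensor_keys Us W" using k W by (auto simp: tensor_keys_def)
  have "lin W (tensor k Us W) (pure k Us W xs)"
    using pure_mlin[OF Us W] k' by (auto simp: mlin_def)
  then show "pm Us V W (\<lambda>v. \<zero>\<^bsub>W\<^esub>) (pure k Us V xs v) = \<zero>\<^bsub>tensor k Us W\<^esub>"
    by (simp add: pm_pure[OF Us lin_const_zero[OF V W] k] lin_zero)
qed

lemma id_tensor_dif:
  assumes U: "VS U" and f: "lin V W f" and g: "lin V W g" and t: "t \<in> carrier (T2 U V)"
  shows "id_tensor k U V W (\<lambda>v. dif W (f v) (g v)) t = dif (T2 U W) (id_tensor k U V W f t) (id_tensor k U V W g t)"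
proof (rule bd_ext[OF id_tensor_lin[OF U lin_diff[OF f g]]
      lin_diff[OF id_tensor_lin[OF U f] id_tensor_lin[OF U g]] U lin_V[OF f] _ t])
  fix u v assume uv: "u \<in> carrier U" "v \<in> carrier V"
  show "id_tensor k U V W (\<lambda>v. dif W (f v) (g v)) (tp U V u v) =
    dif (T2 U W) (id_tensor k U V W f (tp U V u v)) (id_tensor k U V W g (tp U V u v))"
    using lin_dif[OF bilinD(5)[OF tp_bilin[OF U lin_W[OF f]] uv(1)] lin_closed[OF f uv(2)] lin_closed[OF g uv(2)]]
    by (simp add: id_tensor_tp[OF U lin_diff[OF f g] uv] id_tensor_tp[OF U f uv] id_tensor_tp[OF U g uv])
qed

lemma id_tensor_zero:
  assumes U: "VS U" and V: "VS V" and W: "VS W" and t: "t \<in> carrier (T2 U V)"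
  shows "id_tensor k U V W (\<lambda>v. \<zero>\<^bsub>W\<^esub>) t = \<zero>\<^bsub>T2 U W\<^esub>"
proof (rule bd_ext[OF id_tensor_lin[OF U lin_const_zero[OF V W]] lin_const_zero[OF T2_VS[OF U V] T2_VS[OF U W]] U V _ t])
  fix u v assume uv: "u \<in> carrier U" "v \<in> carrier V"
  show "id_tensor k U V W (\<lambda>v. \<zero>\<^bsub>W\<^esub>) (tp U V u v) = \<zero>\<^bsub>T2 U W\<^esub>"
    using lin_zero[OF bilinD(5)[OF tp_bilin[OF U W] uv(1)]]
    by (simp add: id_tensor_tp[OF U lin_const_zero[OF V W] uv])
qed

end

context hopf
begin

lemma colin_dif:
  assumes f: "colin E \<rho> F \<sigma> f" and g: "colin E \<rho> F \<sigma> g" and \<rho>: "lin E (T2 P E) \<rho>" and \<sigma>: "lin F (T2 P F) \<sigma>"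
  shows "colin E \<rho> F \<sigma> (\<lambda>e. dif F (f e) (g e))"
  unfolding colin_def
proof (intro conjI ballI)
  note fl = colin_lin[OF f] and gl = colin_lin[OF g]
  show "lin E F (\<lambda>e. dif F (f e) (g e))" by (rule lin_diff[OF fl gl])
  fix e assume e: "e \<in> carrier E"
  show "\<sigma> (dif F (f e) (g e)) = id_tensor k P E F (\<lambda>e. dif F (f e) (g e)) (\<rho> e)"
    unfolding lin_dif[OF \<sigma> lin_closed[OF fl e] lin_closed[OF gl e]] colin_eq[OF f e] colin_eq[OF g e]
    by (rule id_tensor_dif[OF P_VS fl gl lin_closed[OF \<rho> e], symmetric])
qed

lemma colin_zero:
  assumes \<rho>: "lin E (T2 P E) \<rho>" and \<sigma>: "lin F (T2 P F) \<sigma>"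
  shows "colin E \<rho> F \<sigma> (\<lambda>e. \<zero>\<^bsub>F\<^esub>)"
  unfolding colin_def
  by (auto simp: lin_const_zero[OF lin_V[OF \<rho>] lin_V[OF \<sigma>]] lin_zero[OF \<sigma>]
      id_tensor_zero[OF P_VS lin_V[OF \<rho>] lin_V[OF \<sigma>] lin_closed[OF \<rho>]])

section \<open>Coinvariants and the coaction on tensor powers\<close>

definition coinv :: "('k, 'e) module \<Rightarrow> ('e \<Rightarrow> ('p list \<times> 'e \<Rightarrow> 'k) set) \<Rightarrow> 'e set" where
  "coinv E \<rho> = {e \<in> carrier E. \<rho> e = tp P E \<one>\<^bsub>P\<^esub> e}"

lemma coinvariants_eq: "coinvariants k P E \<rho> = E\<lparr>carrier := coinv E \<rho>\<rparr>"
  by (simp add: coinvariants_def coinv_def tp_def)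

text \<open>Coinvariants are the kernel of the linear difference between \<open>\<rho>\<close> and
  tensoring with 1.\<close>

lemma coinv_sub:
  assumes \<rho>: "lin E (T2 P E) \<rho>"
  shows "sub (coinv E \<rho>) E"
proof -
  note E = lin_V[OF \<rho>]
  have t: "lin E (T2 P E) (tp P E \<one>\<^bsub>P\<^esub>)" by (rule bilinD(5)[OF tp_bilin[OF P_VS E] one_closed])
  have "coinv E \<rho> = {e \<in> carrier E. dif (T2 P E) (\<rho> e) (tp P E \<one>\<^bsub>P\<^esub> e) = \<zero>\<^bsub>T2 P E\<^esub>}"
    using lin_closed[OF \<rho>] lin_closed[OF t] lin_W[OF t]
    by (auto simp: coinv_def vs_dif_eq)
  then show ?thesis using sub_kernel[OF lin_diff[OF \<rho> t]] by simp
qed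

lemma colin_coinv:
  assumes g: "colin E \<rho> F \<sigma> g" and e: "e \<in> coinv E \<rho>"
  shows "g e \<in> coinv F \<sigma>"
  using e lin_closed[OF colin_lin[OF g]]
  by (auto simp: coinv_def colin_eq[OF g] id_tensor_tp[OF P_VS colin_lin[OF g] one_closed])

abbreviation TP :: "nat \<Rightarrow> ('k, 'f) module \<Rightarrow> ('k, ('p list \<times> 'f \<Rightarrow> 'k) set) module" where
  "TP n F \<equiv> tensor k (replicate n P) F"

abbreviation cns :: "nat \<Rightarrow> ('k, 'f) module \<Rightarrow> 'p \<Rightarrow> ('p list \<times> 'f \<Rightarrow> 'k) set \<Rightarrow> ('p list \<times> 'f \<Rightarrow> 'k) set" where
  "cns n F \<equiv> cn P (replicate n P) F"

lemma PP: "VSs (replicate n P)" by (rule VSs_replicate[OF P_VS])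

lemma keys_length: "(ps, f) \<in> tensor_keys (replicate n P) F \<Longrightarrow> length ps = n"
  using keys_facts(1) by fastforce

text \<open>The recursion reads the number of factors off the list, everything else uses n; on
  tensor keys the two agree.\<close>

lemma codiag_pure_Cons:
  assumes "length ps = n"
  shows "codiag_pure k P \<Delta> F \<rho> (p # ps) f =
    bd P P (T2 P (TP (Suc n) F)) (\<lambda>a b. bd P (TP n F) (T2 P (TP (Suc n) F))
      (\<lambda>c t. tp P (TP (Suc n) F) (a \<otimes>\<^bsub>P\<^esub> c) (cns n F b t)) (codiag_pure k P \<Delta> F \<rho> ps f)) (\<Delta> p)"
  using assms by (simp add: Let_def bd_def tp_def cn_def)

context
  fixes F :: "('k, 'f) module" and \<rho> :: "'f \<Rightarrow> ('p list \<times> 'f \<Rightarrow> 'k) set"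
  assumes F: "comodule F \<rho>"
begin

lemma rho_lin: "lin F (T2 P F) \<rho>" by (rule left_comodule.linear[OF F])

lemma F_VS: "VS F" by (rule lin_V[OF rho_lin])

lemma TP_VS: "VS (TP n F)" by (rule tensor_VS[OF PP F_VS])

lemma codiag_step_bilin:
  "bilin P (T2 P (TP n F)) (T2 P (TP (Suc n) F))
    (\<lambda>p u. bd P P (T2 P (TP (Suc n) F)) (\<lambda>a b. bd P (TP n F) (T2 P (TP (Suc n) F))
      (\<lambda>c t. tp P (TP (Suc n) F) (a \<otimes>\<^bsub>P\<^esub> c) (cns n F b t)) u) (\<Delta> p))"
  unfolding replicate_Suc
  by (assumption | rule TP_VS TP_VS[of "Suc n", unfolded replicate_Suc] F_VS PP hopf_rules)+

text \<open>This frees \<open>codiag\<close> from the choice of representative inside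
  \<open>tensor_lift\<close>.\<close>

lemma codiag_mlin: "mlin (replicate n P) F (T2 P (TP n F)) (codiag_pure k P \<Delta> F \<rho>)"
proof (induction n)
  case 0
  have "lin F (T2 P (TP 0 F)) (\<lambda>f. id_tensor k P F (tensor k [] F) (nil F) (\<rho> f))"
    using lin_comp[OF id_tensor_lin[OF P_VS nil_lin[OF F_VS]] rho_lin] by simp
  then show ?case by (auto intro!: mlin_Nil simp: nil_def[abs_def])
next
  case (Suc n)
  let ?G = "\<lambda>p u. bd P P (T2 P (TP (Suc n) F)) (\<lambda>a b. bd P (TP n F) (T2 P (TP (Suc n) F))
      (\<lambda>c t. tp P (TP (Suc n) F) (a \<otimes>\<^bsub>P\<^esub> c) (cns n F b t)) u) (\<Delta> p)"
  note G = codiag_step_bilin[of n]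
  have e: "codiag_pure k P \<Delta> F \<rho> (p # ps) f = ?G p (codiag_pure k P \<Delta> F \<rho> ps f)"
    if "(ps, f) \<in> tensor_keys (replicate n P) F" for p ps f
    by (rule codiag_pure_Cons[OF keys_length[OF that]])
  have "mlin (P # replicate n P) F (T2 P (TP (Suc n) F)) (codiag_pure k P \<Delta> F \<rho>)"
  proof (rule mlin_Cons)
    show "VS (T2 P (TP (Suc n) F))" by (rule bilinD(3)[OF G])
    show "mlin (replicate n P) F (T2 P (TP (Suc n) F)) (\<lambda>ps. codiag_pure k P \<Delta> F \<rho> (p # ps))" if "p \<in> carrier P" for p
      by (rule mlin_cong[OF mlin_comp[OF bilinD(5)[OF G that] Suc.IH]]) (rule e[symmetric])
    show "lin P (T2 P (TP (Suc n) F)) (\<lambda>p. codiag_pure k P \<Delta> F \<rho> (p # ps) f)"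
      if k: "(ps, f) \<in> tensor_keys (replicate n P) F" for ps f
      unfolding e[OF k] by (rule bilinD(4)[OF G mlin_closed[OF Suc.IH k]])
  qed
  then show ?case by simp
qed

lemma codiag_lin: "lin (TP n F) (T2 P (TP n F)) (codiag k P \<Delta> F \<rho> n)"
  unfolding codiag_def by (rule lift_lin[OF PP F_VS codiag_mlin])

lemma codiag_nil: "f \<in> carrier F \<Longrightarrow> codiag k P \<Delta> F \<rho> 0 (nil F f) = id_tensor k P F (tensor k [] F) (nil F) (\<rho> f)"
  unfolding codiag_def nil_def using lift_pure[OF PP F_VS codiag_mlin, of "[]" f 0] by simp

lemma codiag_cons:
  assumes p: "p \<in> carrier P" and t: "t \<in> carrier (TP n F)"
  shows "codiag k P \<Delta> F \<rho> (Suc n) (cns n F p t) =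
    bd P P (T2 P (TP (Suc n) F)) (\<lambda>a b. bd P (TP n F) (T2 P (TP (Suc n) F))
      (\<lambda>c t. tp P (TP (Suc n) F) (a \<otimes>\<^bsub>P\<^esub> c) (cns n F b t)) (codiag k P \<Delta> F \<rho> n t)) (\<Delta> p)"
proof (rule tensor_ext[OF PP F_VS _ lin_comp[OF bilinD(5)[OF codiag_step_bilin p] codiag_lin] _ t])
  show "lin (TP n F) (T2 P (TP (Suc n) F)) (\<lambda>t. codiag k P \<Delta> F \<rho> (Suc n) (cns n F p t))"
    by (rule lin_comp[OF codiag_lin[of "Suc n", unfolded replicate_Suc] bilinD(5)[OF cn_bilin[OF P_VS PP F_VS] p], folded replicate_Suc])
  fix xs f assume k: "(xs, f) \<in> tensor_keys (replicate n P) F"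
  have k': "(p # xs, f) \<in> tensor_keys (replicate (Suc n) P) F" using k p by simp
  have "codiag k P \<Delta> F \<rho> (Suc n) (cns n F p (pure k (replicate n P) F xs f)) = codiag_pure k P \<Delta> F \<rho> (p # xs) f"
    unfolding cn_pure[OF P_VS PP F_VS p k] codiag_def using lift_pure[OF PP F_VS codiag_mlin k'] by simp
  also have "codiag_pure k P \<Delta> F \<rho> xs f = codiag k P \<Delta> F \<rho> n (pure k (replicate n P) F xs f)"
    unfolding codiag_def by (rule lift_pure[OF PP F_VS codiag_mlin k, symmetric])
  note codiag_pure_Cons[OF keys_length[OF k], of F \<rho> p f, unfolded this]
  finally show "codiag k P \<Delta> F \<rho> (Suc n) (cns n F p (pure k (replicate n P) F xs f)) =
    bd P P (T2 P (TP (Suc n) F)) (\<lambda>a b. bd P (TP n F) (T2 P (TP (Suc n) F))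
      (\<lambda>c t. tp P (TP (Suc n) F) (a \<otimes>\<^bsub>P\<^esub> c) (cns n F b t)) (codiag k P \<Delta> F \<rho> n (pure k (replicate n P) F xs f))) (\<Delta> p)" .
qed

lemma nil_colin: "colin F \<rho> (tensor k [] F) (codiag k P \<Delta> F \<rho> 0) (nil F)"
  unfolding colin_def by (auto simp: nil_lin[OF F_VS] codiag_nil)

lemma codiag_0_comodule: "comodule (tensor k [] F) (codiag k P \<Delta> F \<rho> 0)"
  by (rule comodule_quotient[OF F _ nil_colin nil_surj[OF F_VS]]) (use codiag_lin[of 0] in simp)

text \<open>The comodule property of the n-fold power is the hypothesis of \<open>diagonal\<close>,
  whose conclusion is that of the next power; the induction starts from F itself, carried over by
  \<open>nil\<close>.\<close>

lemma codiag_diagonal_step: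
  assumes "comodule (TP n F) (codiag k P \<Delta> F \<rho> n)"
  shows "diagonal k P \<Delta> \<epsilon> S (replicate n P) F (codiag k P \<Delta> F \<rho> n) (codiag k P \<Delta> F \<rho> (Suc n))
    (TP n F) (TP (Suc n) F) (cns n F)"
  by (intro diagonal.intro diagonal_axioms.intro hopf_axioms assms PP F_VS codiag_lin codiag_cons refl)
    simp_all

lemma codiag_comodule: "comodule (TP n F) (codiag k P \<Delta> F \<rho> n)"
proof (induction n)
  case 0
  show ?case using codiag_0_comodule by simp
next
  case (Suc n)
  show ?case by (rule diagonal.T_comodule[OF codiag_diagonal_step[OF Suc.IH]])
qed

lemmas codiag_diagonal = codiag_diagonal_step[OF codiag_comodule]

end

end

section \<open>Hopf cochains\<close>

context ground_field
begin

lemma vs_dif_dif: "VS V \<Longrightarrow> x \<in> carrier V \<Longrightarrow> y \<in> carrier V \<Longrightarrow> dif V x (dif V x y) = y"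
  by (subst vs_dif_eq) simp_all

text \<open>Sign bookkeeping for the contracting homotopy in lowest degree: -a + b + a = b.\<close>

lemma dif_cancel:
  assumes V: "VS V" and a: "a \<in> carrier V" and b: "b \<in> carrier V"
  shows "dif V (dif V \<zero>\<^bsub>V\<^esub> a) (dif V \<zero>\<^bsub>V\<^esub> b) \<oplus>\<^bsub>V\<^esub> a = b"
proof -
  interpret V: vectorspace k V by (rule V)
  have d: "dif V x y = x \<oplus>\<^bsub>V\<^esub> \<ominus>\<^bsub>V\<^esub> y" if "y \<in> carrier V" for x y
    using that by (simp add: vdiff_def V.smult_l_minus)
  have "(\<ominus>\<^bsub>V\<^esub> a \<oplus>\<^bsub>V\<^esub> b) \<oplus>\<^bsub>V\<^esub> a = (b \<oplus>\<^bsub>V\<^esub> \<ominus>\<^bsub>V\<^esub> a) \<oplus>\<^bsub>V\<^esub> a"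
    using a b by (simp add: V.a_comm)
  also have "\<dots> = b" using a b by (simp add: V.a_assoc V.l_neg)
  finally show ?thesis using a b by (simp add: d)
qed

text \<open>The same bookkeeping in higher degrees: (a + b) - (a - e) = b + e.\<close>

lemma dif_cancel':
  assumes V: "VS V" and a: "a \<in> carrier V" and b: "b \<in> carrier V" and e: "e \<in> carrier V"
  shows "dif V (dif V \<zero>\<^bsub>V\<^esub> (dif V \<zero>\<^bsub>V\<^esub> a)) (dif V \<zero>\<^bsub>V\<^esub> b) \<oplus>\<^bsub>V\<^esub> dif V \<zero>\<^bsub>V\<^esub> (dif V a e) = b \<oplus>\<^bsub>V\<^esub> e"
proof -
  interpret V: vectorspace k V by (rule V)
  have d: "dif V x y = x \<oplus>\<^bsub>V\<^esub> \<ominus>\<^bsub>V\<^esub> y" if "y \<in> carrier V" for x y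
    using that by (simp add: vdiff_def V.smult_l_minus)
  have "(a \<oplus>\<^bsub>V\<^esub> b) \<oplus>\<^bsub>V\<^esub> (\<ominus>\<^bsub>V\<^esub> a \<oplus>\<^bsub>V\<^esub> e) = (b \<oplus>\<^bsub>V\<^esub> a) \<oplus>\<^bsub>V\<^esub> (\<ominus>\<^bsub>V\<^esub> a \<oplus>\<^bsub>V\<^esub> e)"
    using a b by (simp add: V.a_comm)
  also have "\<dots> = b \<oplus>\<^bsub>V\<^esub> (a \<oplus>\<^bsub>V\<^esub> (\<ominus>\<^bsub>V\<^esub> a \<oplus>\<^bsub>V\<^esub> e))" using a b e by (simp add: V.a_assoc)
  also have "\<dots> = b \<oplus>\<^bsub>V\<^esub> e" using a e by (simp add: V.r_neg2)
  finally show ?thesis using a b e by (simp add: d V.minus_add)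
qed

end

context diagonal
begin

text \<open>The unit is group-like, so a leading factor 1 leaves the coaction unchanged.\<close>

lemma cons_one_colin: "colin X \<gamma> T \<Gamma> (cons \<one>\<^bsub>P\<^esub>)"
  unfolding colin_def
proof (intro conjI ballI)
  show l: "lin X T (cons \<one>\<^bsub>P\<^esub>)" by (rule bilinD(5)[OF cons_bilin one_closed])
  fix t assume t: "t \<in> carrier X"
  have "\<Gamma> (cons \<one>\<^bsub>P\<^esub> t) = bd P X (T2 P T) (\<lambda>c s. tp P T (\<one>\<^bsub>P\<^esub> \<otimes>\<^bsub>P\<^esub> c) (cons \<one>\<^bsub>P\<^esub> s)) (\<gamma> t)"
    unfolding Gamma_cons[OF one_closed t] Delta_one
    by (rule bd_tp) (insert t, (assumption | rule drules)+)
  also have "\<dots> = bd P X (T2 P T) (\<lambda>c s. tp P T c (cons \<one>\<^bsub>P\<^esub> s)) (\<gamma> t)"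
  proof (rule bd_cong)
    show "tp P T (\<one>\<^bsub>P\<^esub> \<otimes>\<^bsub>P\<^esub> c) (cons \<one>\<^bsub>P\<^esub> s) = tp P T c (cons \<one>\<^bsub>P\<^esub> s)" if "c \<in> carrier P" for c s
      using that by (simp add: mult_one)
  qed (insert t, (assumption | rule drules)+)
  finally show "\<Gamma> (cons \<one>\<^bsub>P\<^esub> t) = id_tensor k P X T (cons \<one>\<^bsub>P\<^esub>) (\<gamma> t)"
    unfolding id_tensor_bd .
qed

end

context hopf
begin

lemma colin_uminus:
  assumes f: "colin E \<rho> F \<sigma> f" and \<rho>: "lin E (T2 P E) \<rho>" and \<sigma>: "lin F (T2 P F) \<sigma>"
  shows "colin E \<rho> F \<sigma> (\<lambda>e. dif F \<zero>\<^bsub>F\<^esub> (f e))"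
  by (rule colin_dif[OF colin_zero[OF \<rho> \<sigma>] f \<rho> \<sigma>])

abbreviation cbds where "cbds n F \<equiv> cbd P (replicate n P) F"

abbreviation pms where "pms n F G \<equiv> pm (replicate n P) F G"

context
  fixes F :: "('k, 'f) module"
  assumes F: "VS F"
begin

lemma TP_VS': "VS (TP n F)" by (rule tensor_VS[OF PP F])

lemma cns_bilin: "bilin P (TP n F) (TP (Suc n) F) (cns n F)"
  using cn_bilin[OF P_VS PP F, of n] by simp

lemma cns_closed: "p \<in> carrier P \<Longrightarrow> t \<in> carrier (TP n F) \<Longrightarrow> cns n F p t \<in> carrier (TP (Suc n) F)"
  by (rule bilin_closed[OF cns_bilin])

lemma cns_lin: "p \<in> carrier P \<Longrightarrow> lin (TP n F) (TP (Suc n) F) (cns n F p)"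
  by (rule bilinD(5)[OF cns_bilin])

lemma cns_ext:
  assumes "lin (TP (Suc n) F) Y f" "lin (TP (Suc n) F) Y g"
    "\<And>p t. p \<in> carrier P \<Longrightarrow> t \<in> carrier (TP n F) \<Longrightarrow> f (cns n F p t) = g (cns n F p t)"
    "x \<in> carrier (TP (Suc n) F)"
  shows "f x = g x"
  by (rule cn_ext[OF P_VS PP F assms(1,2)[unfolded replicate_Suc] assms(3) assms(4)[unfolded replicate_Suc]])

lemma cbds_lin: "bilin P (TP n F) Y \<phi> \<Longrightarrow> lin (TP (Suc n) F) Y (cbds n F Y \<phi>)"
  unfolding replicate_Suc by (rule cbd_lin[OF P_VS PP F])

lemma cbds_cns: "bilin P (TP n F) Y \<phi> \<Longrightarrow> p \<in> carrier P \<Longrightarrow> t \<in> carrier (TP n F) \<Longrightarrow>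
    cbds n F Y \<phi> (cns n F p t) = \<phi> p t"
  by (rule cbd_cn[OF P_VS PP F])

end

text \<open>
  The differential of the Hopf cochain complex, in the recursive form
  \<open>d (p \<otimes> t) = 1 \<otimes> p \<otimes> t - p \<otimes> d t\<close>.
\<close>

primrec dr :: "('k, 'f) module \<Rightarrow> nat \<Rightarrow> ('p list \<times> 'f \<Rightarrow> 'k) set \<Rightarrow> ('p list \<times> 'f \<Rightarrow> 'k) set" where
  "dr F 0 = cns 0 F \<one>\<^bsub>P\<^esub>"
| "dr F (Suc n) = (\<lambda>x. dif (TP (Suc (Suc n)) F) (cns (Suc n) F \<one>\<^bsub>P\<^esub> x)
    (cbds n F (TP (Suc (Suc n)) F) (\<lambda>p t. cns (Suc n) F p (dr F n t)) x))"

lemma dr_bilin: "VS F \<Longrightarrow> lin (TP n F) (TP (Suc n) F) (dr F n) \<Longrightarrow>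
    bilin P (TP n F) (TP (Suc (Suc n)) F) (\<lambda>p t. cns (Suc n) F p (dr F n t))"
  by (rule bilin_comp2[OF cns_bilin])

text \<open>The index of \<open>dr\<close> counts tensor factors, not cochain degree: degree n of
  the Hopf complex uses \<open>dr F (Suc n)\<close>, and \<open>dr F 0\<close> is the augmentation
  that puts 1 in front.\<close>

lemma dr_lin: "VS F \<Longrightarrow> lin (TP n F) (TP (Suc n) F) (dr F n)"
proof (induction n)
  case 0
  show ?case unfolding dr.simps(1) by (rule cns_lin[OF 0 one_closed])
next
  case (Suc n)
  show ?case
    unfolding dr.simps(2)
    by (rule lin_diff[OF cns_lin[OF Suc.prems one_closed] cbds_lin[OF Suc.prems dr_bilin[OF Suc.prems Suc.IH[OF Suc.prems]]]])
qed

lemma dr_closed: "VS F \<Longrightarrow> t \<in> carrier (TP n F) \<Longrightarrow> dr F n t \<in> carrier (TP (Suc n) F)"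
  by (rule lin_closed[OF dr_lin])

lemma dr_cns:
  assumes F: "VS F" and p: "p \<in> carrier P" and t: "t \<in> carrier (TP n F)"
  shows "dr F (Suc n) (cns n F p t) =
    dif (TP (Suc (Suc n)) F) (cns (Suc n) F \<one>\<^bsub>P\<^esub> (cns n F p t)) (cns (Suc n) F p (dr F n t))"
  unfolding dr.simps(2) cbds_cns[OF F dr_bilin[OF F dr_lin[OF F]] p t] ..

text \<open>Write d (p t) = A - B with A = 1 p t and B = p d t, juxtaposition being the tensor
  product. Then d A = 1 A - 1 (A - B) = 1 B, and d B = 1 B - p d d t = 1 B by induction.\<close>

lemma dr_dr:
  assumes F: "VS F"
  shows "x \<in> carrier (TP n F) \<Longrightarrow> dr F (Suc n) (dr F n x) = \<zero>\<^bsub>TP (Suc (Suc n)) F\<^esub>"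
proof (induction n arbitrary: x)
  case 0
  have "cns (Suc 0) F \<one>\<^bsub>P\<^esub> (cns 0 F \<one>\<^bsub>P\<^esub> x) \<in> carrier (TP (Suc (Suc 0)) F)"
    by (intro cns_closed[OF F] one_closed 0)
  then show ?case
    unfolding dr.simps(1) dr_cns[OF F one_closed 0] by (rule vs_dif_self[OF TP_VS'[OF F]])
next
  case (Suc n)
  show ?case
  proof (rule cns_ext[OF F lin_comp[OF dr_lin[OF F] dr_lin[OF F]] lin_const_zero[OF TP_VS'[OF F] TP_VS'[OF F]] _ Suc.prems])
    fix p t assume p: "p \<in> carrier P" and t: "t \<in> carrier (TP n F)"
    define A where "A = cns (Suc n) F \<one>\<^bsub>P\<^esub> (cns n F p t)"
    define B where "B = cns (Suc n) F p (dr F n t)"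
    have c: "cns n F p t \<in> carrier (TP (Suc n) F)" "dr F n t \<in> carrier (TP (Suc n) F)"
      "A \<in> carrier (TP (Suc (Suc n)) F)" "B \<in> carrier (TP (Suc (Suc n)) F)"
      unfolding A_def B_def by (intro cns_closed[OF F] dr_closed[OF F] one_closed p t)+
    let ?c = "cns (Suc (Suc n)) F \<one>\<^bsub>P\<^esub>"
    note cl = cns_lin[OF F one_closed, of "Suc (Suc n)"]
    have d: "dr F (Suc n) (cns n F p t) = dif (TP (Suc (Suc n)) F) A B"
      unfolding A_def B_def by (rule dr_cns[OF F p t])
    have "dr F (Suc (Suc n)) A = dif (TP (Suc (Suc (Suc n))) F) (?c A) (?c (dif (TP (Suc (Suc n)) F) A B))"
      using dr_cns[OF F one_closed c(1)] unfolding d A_def[symmetric] .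
    also have "\<dots> = ?c B"
      unfolding lin_dif[OF cl c(3,4)]
      by (rule vs_dif_dif[OF TP_VS'[OF F] lin_closed[OF cl c(3)] lin_closed[OF cl c(4)]])
    finally have A: "dr F (Suc (Suc n)) A = ?c B" .
    have "dr F (Suc (Suc n)) B = dif (TP (Suc (Suc (Suc n))) F) (?c B) (cns (Suc (Suc n)) F p (dr F (Suc n) (dr F n t)))"
      unfolding B_def by (rule dr_cns[OF F p c(2)])
    also have "\<dots> = ?c B"
      unfolding Suc.IH[OF t] lin_zero[OF cns_lin[OF F p]]
      by (rule vs_dif_zero[OF TP_VS'[OF F] lin_closed[OF cl c(4)]])
    finally have B: "dr F (Suc (Suc n)) B = ?c B" .
    show "dr F (Suc (Suc n)) (dr F (Suc n) (cns n F p t)) = \<zero>\<^bsub>TP (Suc (Suc (Suc n))) F\<^esub>"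
      unfolding d lin_dif[OF dr_lin[OF F] c(3,4)] A B
      by (rule vs_dif_self[OF TP_VS'[OF F] lin_closed[OF cl c(4)]])
  qed
qed

lemma pms_lin: "lin F G f \<Longrightarrow> lin (TP n F) (TP n G) (pms n F G f)"
  by (rule pm_lin[OF PP])

lemma pms_cns: "lin F G f \<Longrightarrow> p \<in> carrier P \<Longrightarrow> t \<in> carrier (TP n F) \<Longrightarrow>
    pms (Suc n) F G f (cns n F p t) = cns n G p (pms n F G f t)"
  unfolding replicate_Suc by (rule pm_cn[OF PP _ P_VS])

lemma pms_dr:
  assumes f: "lin F G f"
  shows "x \<in> carrier (TP n F) \<Longrightarrow> pms (Suc n) F G f (dr F n x) = dr G n (pms n F G f x)"
proof (induction n arbitrary: x)
  case 0
  show ?case unfolding dr.simps(1) by (rule pms_cns[OF f one_closed 0])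
next
  case (Suc n)
  note F = lin_V[OF f] and G = lin_W[OF f]
  show ?case
  proof (rule cns_ext[OF F lin_comp[OF pms_lin[OF f] dr_lin[OF F]] lin_comp[OF dr_lin[OF G] pms_lin[OF f]] _ Suc.prems])
    fix p t assume p: "p \<in> carrier P" and t: "t \<in> carrier (TP n F)"
    have c: "cns n F p t \<in> carrier (TP (Suc n) F)" "dr F n t \<in> carrier (TP (Suc n) F)"
      "cns (Suc n) F \<one>\<^bsub>P\<^esub> (cns n F p t) \<in> carrier (TP (Suc (Suc n)) F)"
      "cns (Suc n) F p (dr F n t) \<in> carrier (TP (Suc (Suc n)) F)"
      by (intro cns_closed[OF F] dr_closed[OF F] one_closed p t)+
    show "pms (Suc (Suc n)) F G f (dr F (Suc n) (cns n F p t)) = dr G (Suc n) (pms (Suc n) F G f (cns n F p t))"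
      unfolding dr_cns[OF F p t] lin_dif[OF pms_lin[OF f] c(3,4)] pms_cns[OF f one_closed c(1)]
        pms_cns[OF f p c(2)] pms_cns[OF f p t] Suc.IH[OF t]
      by (rule dr_cns[OF G p lin_closed[OF pms_lin[OF f] t], symmetric])
  qed
qed

lemma alt_sign_0: "alt_sign k 0 = \<one>\<^bsub>k\<^esub>"
  and alt_sign_Suc: "alt_sign k (Suc i) = \<ominus>\<^bsub>k\<^esub> \<one>\<^bsub>k\<^esub> \<otimes>\<^bsub>k\<^esub> alt_sign k i"
  and alt_sign_closed: "alt_sign k i \<in> carrier k"
proof -
  interpret K: field k by (rule is_field)
  show "alt_sign k 0 = \<one>\<^bsub>k\<^esub>" by (simp add: alt_sign_def)
  show c: "alt_sign k i \<in> carrier k" for i by (simp add: alt_sign_def)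
  have "alt_sign k (Suc i) = alt_sign k i \<otimes>\<^bsub>k\<^esub> (\<ominus>\<^bsub>k\<^esub> \<one>\<^bsub>k\<^esub>)" by (simp add: alt_sign_def)
  then show "alt_sign k (Suc i) = \<ominus>\<^bsub>k\<^esub> \<one>\<^bsub>k\<^esub> \<otimes>\<^bsub>k\<^esub> alt_sign k i"
    using c k_mcomm[of "alt_sign k i" "\<ominus>\<^bsub>k\<^esub> \<one>\<^bsub>k\<^esub>"] by simp
qed

text \<open>Behind the leading factor p, the i-th insertion of 1 into the tail is the (i + 1)-st
  insertion into the whole, and the minus sign of the recursion supplies the change of sign. The
  insertion at 0 is the first term of the recursion.\<close>

lemma dr_pure:
  assumes F: "VS F"
  shows "(ps, f) \<in> tensor_keys (replicate n P) F \<Longrightarrow> dr F n (pure k (replicate n P) F ps f) =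
    (\<Oplus>\<^bsub>TP (Suc n) F\<^esub>i\<in>{..n}. alt_sign k i \<odot>\<^bsub>TP (Suc n) F\<^esub>
      pure k (replicate (Suc n) P) F (take i ps @ \<one>\<^bsub>P\<^esub> # drop i ps) f)"
proof (induction n arbitrary: ps)
  case 0
  interpret T: vectorspace k "TP (Suc 0) F" by (rule TP_VS'[OF F])
  have ps: "ps = []" using 0 by simp
  have c: "pure k (replicate (Suc 0) P) F [\<one>\<^bsub>P\<^esub>] f \<in> carrier (TP (Suc 0) F)" by (rule pure_closed[OF PP F])
  have "dr F 0 (pure k (replicate 0 P) F ps f) = pure k (replicate (Suc 0) P) F [\<one>\<^bsub>P\<^esub>] f"
    using cn_pure[OF P_VS PP F one_closed, of "[]" f 0] 0 by simp
  also have "\<dots> = (\<Oplus>\<^bsub>TP (Suc 0) F\<^esub>i\<in>{0}. alt_sign k i \<odot>\<^bsub>TP (Suc 0) F\<^esub>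
      pure k (replicate (Suc 0) P) F (take i ps @ \<one>\<^bsub>P\<^esub> # drop i ps) f)"
  proof -
    let ?g = "\<lambda>i. alt_sign k i \<odot>\<^bsub>TP (Suc 0) F\<^esub> pure k (replicate (Suc 0) P) F (take i ps @ \<one>\<^bsub>P\<^esub> # drop i ps) f"
    have g: "?g i \<in> carrier (TP (Suc 0) F)" for i by (rule T.smult_closed[OF alt_sign_closed pure_closed[OF PP F]])
    have "(\<Oplus>\<^bsub>TP (Suc 0) F\<^esub>i\<in>{0}. ?g i) = ?g 0 \<oplus>\<^bsub>TP (Suc 0) F\<^esub> (\<Oplus>\<^bsub>TP (Suc 0) F\<^esub>i\<in>{}. ?g i)"
      by (rule T.finsum_insert) (rule finite.emptyI, simp, rule Pi_I, rule g, rule g)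
    also have "\<dots> = ?g 0" unfolding T.finsum_empty by (rule vs_add_zero(1)[OF TP_VS'[OF F] g])
    also have "\<dots> = pure k (replicate (Suc 0) P) F [\<one>\<^bsub>P\<^esub>] f"
      unfolding ps alt_sign_0 using vs_smult_one[OF TP_VS'[OF F] c] by simp
    finally show ?thesis ..
  qed
  also have "{0} = {..0::nat}" by auto
  finally show ?case .
next
  case (Suc n)
  let ?T = "TP (Suc (Suc n)) F" and ?U = "TP (Suc n) F"
  let ?q = "\<lambda>ps i. pure k (replicate (Suc n) P) F (take i ps @ \<one>\<^bsub>P\<^esub> # drop i ps) f"
  let ?r = "\<lambda>ps i. pure k (replicate (Suc (Suc n)) P) F (take i ps @ \<one>\<^bsub>P\<^esub> # drop i ps) f"
  interpret T: vectorspace k ?T by (rule TP_VS'[OF F])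
  interpret U: vectorspace k ?U by (rule TP_VS'[OF F])
  obtain p qs where ps: "ps = p # qs" "p \<in> carrier P" "(qs, f) \<in> tensor_keys (replicate n P) F"
    using Suc.prems by auto
  have qc: "?q qs i \<in> carrier ?U" for i by (rule pure_closed[OF PP F])
  have rc: "?r ps i \<in> carrier ?T" for i by (rule pure_closed[OF PP F])
  have cq: "cns (Suc n) F p (?q qs i) = ?r ps (Suc i)" if "i \<le> n" for i
  proof -
    have "(take i qs @ \<one>\<^bsub>P\<^esub> # drop i qs, f) \<in> tensor_keys (replicate (Suc n) P) F"
    proof -
      have "list_all2 (\<lambda>x U. x \<in> carrier U) qs (replicate n P)" "f \<in> carrier F" using ps(3) by (auto simp: tensor_keys_def)
      then have "set qs \<subseteq> carrier P" "length qs = n" by (auto simp: list_all2_conv_all_nth set_conv_nth)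
      then have L: "set (take i qs @ \<one>\<^bsub>P\<^esub> # drop i qs) \<subseteq> carrier P" "length (take i qs @ \<one>\<^bsub>P\<^esub> # drop i qs) = Suc n"
        using one_closed set_take_subset[of i qs] set_drop_subset[of i qs] by auto
      have "list_all2 (\<lambda>x U. x \<in> carrier U) (take i qs @ \<one>\<^bsub>P\<^esub> # drop i qs) (replicate (Suc n) P)"
      proof (rule list_all2_all_nthI)
        fix j assume j: "j < length (take i qs @ \<one>\<^bsub>P\<^esub> # drop i qs)"
        then have "replicate (Suc n) P ! j = P" unfolding L(2) by (rule nth_replicate)
        then show "(take i qs @ \<one>\<^bsub>P\<^esub> # drop i qs) ! j \<in> carrier (replicate (Suc n) P ! j)"
          using subsetD[OF L(1) nth_mem[OF j]] by (simp only:)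
      qed (simp only: L(2) length_replicate)
      then show ?thesis using \<open>f \<in> carrier F\<close> by (simp only: tensor_keys_def mem_Collect_eq prod.case)
    qed
    from cn_pure[OF P_VS PP F ps(2) this] show ?thesis by (simp add: ps(1))
  qed
  have "dr F (Suc n) (pure k (replicate (Suc n) P) F ps f) = dr F (Suc n) (cns n F p (pure k (replicate n P) F qs f))"
    using cn_pure[OF P_VS PP F ps(2,3)] ps(1) by simp
  also have "\<dots> = dif ?T (cns (Suc n) F \<one>\<^bsub>P\<^esub> (cns n F p (pure k (replicate n P) F qs f)))
      (cns (Suc n) F p (dr F n (pure k (replicate n P) F qs f)))"
    by (rule dr_cns[OF F ps(2) pure_closed[OF PP F]])
  also have "cns (Suc n) F \<one>\<^bsub>P\<^esub> (cns n F p (pure k (replicate n P) F qs f)) = ?r ps 0"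
    unfolding cn_pure[OF P_VS PP F ps(2,3)]
    using cn_pure[OF P_VS PP[of "Suc n"] F one_closed, of "p # qs" f] ps by simp
  also have "cns (Suc n) F p (dr F n (pure k (replicate n P) F qs f)) =
      (\<Oplus>\<^bsub>?T\<^esub>i\<in>{..n}. cns (Suc n) F p (alt_sign k i \<odot>\<^bsub>?U\<^esub> ?q qs i))"
    unfolding Suc.IH[OF ps(3)]
    by (rule conjunct2[OF lin_finsum[OF cns_lin[OF F ps(2)]]]) (simp_all add: U.smult_closed alt_sign_closed qc del: replicate_Suc)
  also have "\<dots> = (\<Oplus>\<^bsub>?T\<^esub>i\<in>{..n}. alt_sign k i \<odot>\<^bsub>?T\<^esub> ?r ps (Suc i))"
  proof (rule T.finsum_cong')
    show "cns (Suc n) F p (alt_sign k i \<odot>\<^bsub>?U\<^esub> ?q qs i) = alt_sign k i \<odot>\<^bsub>?T\<^esub> ?r ps (Suc i)" if "i \<in> {..n}" for i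
      unfolding lin_smult[OF cns_lin[OF F ps(2)] alt_sign_closed qc] using cq[of i] that by simp
    show "(\<lambda>i. alt_sign k i \<odot>\<^bsub>?T\<^esub> ?r ps (Suc i)) \<in> {..n} \<rightarrow> carrier ?T"
      using rc by (intro Pi_I T.smult_closed alt_sign_closed)
  qed simp
  also have "dif ?T (?r ps 0) \<dots> =
    (\<Oplus>\<^bsub>?T\<^esub>i\<in>{..n}. (\<ominus>\<^bsub>k\<^esub> \<one>\<^bsub>k\<^esub>) \<odot>\<^bsub>?T\<^esub> (alt_sign k i \<odot>\<^bsub>?T\<^esub> ?r ps (Suc i))) \<oplus>\<^bsub>?T\<^esub> ?r ps 0"
  proof -
    note fs = lin_finsum[OF lin_smultf[OF k_closed(3)[OF k_closed(2)] lin_id[OF TP_VS'[OF F]]],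
        of "{..n}" "\<lambda>i. alt_sign k i \<odot>\<^bsub>?T\<^esub> ?r ps (Suc i)" "Suc (Suc n)"]
    have a: "(\<ominus>\<^bsub>k\<^esub> \<one>\<^bsub>k\<^esub>) \<odot>\<^bsub>?T\<^esub> (\<Oplus>\<^bsub>?T\<^esub>i\<in>{..n}. alt_sign k i \<odot>\<^bsub>?T\<^esub> ?r ps (Suc i)) =
      (\<Oplus>\<^bsub>?T\<^esub>i\<in>{..n}. (\<ominus>\<^bsub>k\<^esub> \<one>\<^bsub>k\<^esub>) \<odot>\<^bsub>?T\<^esub> (alt_sign k i \<odot>\<^bsub>?T\<^esub> ?r ps (Suc i)))"
      and b: "(\<Oplus>\<^bsub>?T\<^esub>i\<in>{..n}. alt_sign k i \<odot>\<^bsub>?T\<^esub> ?r ps (Suc i)) \<in> carrier ?T"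
      using fs rc by (auto simp: T.smult_closed alt_sign_closed simp del: replicate_Suc)
    show ?thesis
      unfolding vdiff_def a[symmetric]
      by (rule vs_comm[OF TP_VS'[OF F] rc vs_smult[OF TP_VS'[OF F] k_closed(3)[OF k_closed(2)] b]])
  qed
  also have "(\<Oplus>\<^bsub>?T\<^esub>i\<in>{..n}. (\<ominus>\<^bsub>k\<^esub> \<one>\<^bsub>k\<^esub>) \<odot>\<^bsub>?T\<^esub> (alt_sign k i \<odot>\<^bsub>?T\<^esub> ?r ps (Suc i))) =
    (\<Oplus>\<^bsub>?T\<^esub>i\<in>{..n}. alt_sign k (Suc i) \<odot>\<^bsub>?T\<^esub> ?r ps (Suc i))"
    by (rule T.finsum_cong') (simp_all add: T.smult_closed alt_sign_closed rc alt_sign_Suc T.smult_assoc1 k_closed del: replicate_Suc)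
  also have "\<dots> \<oplus>\<^bsub>?T\<^esub> ?r ps 0 = (\<Oplus>\<^bsub>?T\<^esub>i\<in>{..Suc n}. alt_sign k i \<odot>\<^bsub>?T\<^esub> ?r ps i)"
  proof -
    have one: "alt_sign k 0 \<odot>\<^bsub>?T\<^esub> ?r ps 0 = ?r ps 0" unfolding alt_sign_0 by (rule vs_smult_one[OF TP_VS'[OF F] rc])
    show ?thesis
      using T.finsum_Suc2[of "\<lambda>i. alt_sign k i \<odot>\<^bsub>?T\<^esub> ?r ps i" n, OF Pi_I[OF vs_smult[OF TP_VS'[OF F] alt_sign_closed rc]]]
      unfolding one by (rule sym)
  qed
  finally show ?case .
qed

text \<open>The two linear maps agree on pure tensors. The shift occurs because cochains of degree n
  have n + 1 factors.\<close>

lemma hopf_d_eq: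
  assumes F: "VS F" and t: "t \<in> carrier (TP (Suc n) F)"
  shows "hopf_d k P F n t = dr F (Suc n) t"
proof -
  let ?\<phi> = "\<lambda>ps f. \<Oplus>\<^bsub>TP (Suc (Suc n)) F\<^esub>i\<in>{..Suc n}. alt_sign k i \<odot>\<^bsub>TP (Suc (Suc n)) F\<^esub>
      pure k (replicate (Suc (Suc n)) P) F (take i ps @ \<one>\<^bsub>P\<^esub> # drop i ps) f"
  have m: "mlin (replicate (Suc n) P) F (TP (Suc (Suc n)) F) ?\<phi>"
    by (rule mlin_cong[OF mlin_comp[OF dr_lin[OF F] pure_mlin[OF PP F]]]) (rule dr_pure[OF F])
  have "hopf_d k P F n t = tensor_lift k (replicate (Suc n) P) F (TP (Suc (Suc n)) F) ?\<phi> t"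
    by (simp add: hopf_d_def Let_def atLeast0AtMost del: replicate_Suc)
  also have "\<dots> = dr F (Suc n) t"
    by (rule tensor_ext[OF PP F lift_lin[OF PP F m] dr_lin[OF F] _ t])
      (simp only: lift_pure[OF PP F m] dr_pure[OF F])
  finally show ?thesis .
qed

abbreviation cd where "cd F \<rho> n \<equiv> codiag k P \<Delta> F \<rho> n"

lemma diagonal_mapI:
  assumes F: "comodule F \<rho>" and G: "comodule G \<sigma>"
    and f: "colin (TP n F) (cd F \<rho> n) (TP m G) (cd G \<sigma> m) f"
    and g: "lin (TP (Suc n) F) (TP (Suc m) G) g"
    and gc: "\<And>p t. p \<in> carrier P \<Longrightarrow> t \<in> carrier (TP n F) \<Longrightarrow> g (cns n F p t) = cns m G p (f t)"
  shows "diagonal_map k P \<Delta> \<epsilon> S (replicate n P) F (cd F \<rho> n) (cd F \<rho> (Suc n)) (TP n F) (TP (Suc n) F) (cns n F)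
    (replicate m P) G (cd G \<sigma> m) (cd G \<sigma> (Suc m)) (TP m G) (TP (Suc m) G) (cns m G) f g"
  by (intro diagonal_map.intro diagonal_map_axioms.intro hopf_axioms codiag_diagonal F G f g gc)

text \<open>Both terms of the recursion are colinear: the first because the unit is group-like, the
  second because extending a colinear map by a leading factor keeps it colinear.\<close>

lemma dr_colin:
  assumes F: "comodule F \<rho>"
  shows "colin (TP n F) (cd F \<rho> n) (TP (Suc n) F) (cd F \<rho> (Suc n)) (dr F n)"
proof (induction n)
  case 0
  show ?case unfolding dr.simps(1) by (rule diagonal.cons_one_colin[OF codiag_diagonal[OF F]])
next
  case (Suc n)
  note V = F_VS[OF F]
  note b = dr_bilin[OF V dr_lin[OF V], of n]
  show ?case
    unfolding dr.simps(2)
    by (rule colin_dif[OF diagonal.cons_one_colin[OF codiag_diagonal[OF F]]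
          diagonal_map.g_colin[OF diagonal_mapI[OF F F Suc.IH cbds_lin[OF V b] cbds_cns[OF V b]]]
          codiag_lin[OF F] codiag_lin[OF F]])
qed

lemma pms_colin:
  assumes F: "comodule F \<rho>" and G: "comodule G \<sigma>" and f: "colin F \<rho> G \<sigma> f"
  shows "colin (TP n F) (cd F \<rho> n) (TP n G) (cd G \<sigma> n) (pms n F G f)"
proof (induction n)
  case 0
  note fl = colin_lin[OF f]
  note V = F_VS[OF F] F_VS[OF G]
  have pl: "lin (tensor k [] F) (tensor k [] G) (pm [] F G f)" by (rule pm_lin[OF VSs_Nil fl])
  have cl: "lin (tensor k [] F) (T2 P (tensor k [] F)) (cd F \<rho> 0)" "lin (tensor k [] G) (T2 P (tensor k [] G)) (cd G \<sigma> 0)"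
    using codiag_lin[OF F, of 0] codiag_lin[OF G, of 0] by simp_all
  have "cd G \<sigma> 0 (pm [] F G f t) = id_tensor k P (tensor k [] F) (tensor k [] G) (pm [] F G f) (cd F \<rho> 0 t)"
    if t: "t \<in> carrier (tensor k [] F)" for t
  proof (rule nil_ext[OF lin_comp[OF cl(2) pl] lin_comp[OF id_tensor_lin[OF P_VS pl] cl(1)] V(1) _ t])
    fix v assume v: "v \<in> carrier F"
    note rv = lin_closed[OF rho_lin[OF F] v]
    have "cd G \<sigma> 0 (pm [] F G f (nil F v)) = id_tensor k P F (tensor k [] G) (\<lambda>v. nil G (f v)) (\<rho> v)"
      by (simp add: pm_nil[OF fl v] codiag_nil[OF G lin_closed[OF fl v]] colin_eq[OF f v]
          id_tensor_comp[OF P_VS fl nil_lin[OF V(2)] rv])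
    also have "\<dots> = id_tensor k P F (tensor k [] G) (\<lambda>v. pm [] F G f (nil F v)) (\<rho> v)"
      by (rule id_tensor_cong[OF P_VS lin_comp[OF nil_lin[OF V(2)] fl] _ rv]) (simp add: pm_nil[OF fl])
    also have "\<dots> = id_tensor k P (tensor k [] F) (tensor k [] G) (pm [] F G f) (cd F \<rho> 0 (nil F v))"
      by (simp add: codiag_nil[OF F v] id_tensor_comp[OF P_VS nil_lin[OF V(1)] pl rv])
    finally show "cd G \<sigma> 0 (pm [] F G f (nil F v)) =
      id_tensor k P (tensor k [] F) (tensor k [] G) (pm [] F G f) (cd F \<rho> 0 (nil F v))" .
  qed
  then show ?case by (simp add: colin_def pl)
next
  case (Suc n)
  show ?case
    by (rule diagonal_map.g_colin[OF diagonal_mapI[OF F G Suc.IH pms_lin[OF colin_lin[OF f]] pms_cns[OF colin_lin[OF f]]]])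
qed

text \<open>The heart of exactness. Projecting an arbitrary preimage u by \<open>Phi\<close> makes
  it coinvariant; by naturality its image is the projection of t, and this is t. The projection
  needs a leading factor, hence \<open>Suc n\<close>.\<close>

lemma coinv_preimage:
  assumes F: "comodule F \<rho>" and G: "comodule G \<sigma>" and f: "colin F \<rho> G \<sigma> f"
    and t: "t \<in> coinv (TP (Suc n) G) (cd G \<sigma> (Suc n))"
    and u: "u \<in> carrier (TP (Suc n) F)" "t = pms (Suc n) F G f u"
  shows "\<exists>w\<in>coinv (TP (Suc n) F) (cd F \<rho> (Suc n)). t = pms (Suc n) F G f w"
proof -
  note fl = colin_lin[OF f]
  interpret M: diagonal_map k P \<Delta> \<epsilon> S "replicate n P" F "cd F \<rho> n" "cd F \<rho> (Suc n)" "TP n F" "TP (Suc n) F" "cns n F"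
    "replicate n P" G "cd G \<sigma> n" "cd G \<sigma> (Suc n)" "TP n G" "TP (Suc n) G" "cns n G" "pms n F G f" "pms (Suc n) F G f"
    by (rule diagonal_mapI[OF F G pms_colin[OF F G f] pms_lin[OF fl] pms_cns[OF fl]])
  have "M.A.Phi u \<in> coinv (TP (Suc n) F) (cd F \<rho> (Suc n))"
    unfolding coinv_def using lin_closed[OF M.A.Phi_lin u(1)] M.A.Phi_coinvariant[OF u(1)] by simp
  moreover have "pms (Suc n) F G f (M.A.Phi u) = t"
    unfolding M.Phi_natural[OF u(1)] u(2)[symmetric] by (rule M.B.Phi_fix) (use t in \<open>simp_all add: coinv_def\<close>)
  ultimately show ?thesis by metis
qed

text \<open>Coinvariance may be tested after a linearly split colinear map: tensoring the retraction
  with the identity of \<open>P\<close> brings the equation back.\<close>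

lemma coinv_inject:
  assumes i: "colin E \<rho> F \<sigma> i" and \<rho>: "lin E (T2 P E) \<rho>" and r: "lin F E r" "\<And>e. e \<in> carrier E \<Longrightarrow> r (i e) = e"
    and e: "e \<in> carrier E" and c: "i e \<in> coinv F \<sigma>"
  shows "e \<in> coinv E \<rho>"
proof -
  note il = colin_lin[OF i] and re = lin_closed[OF \<rho> e]
  have E: "VS E" by (rule lin_V[OF il])
  have "id_tensor k P E F i (\<rho> e) = tp P F \<one>\<^bsub>P\<^esub> (i e)" using c colin_eq[OF i e] by (simp add: coinv_def)
  then have "id_tensor k P F E r (id_tensor k P E F i (\<rho> e)) = tp P E \<one>\<^bsub>P\<^esub> e"
    using id_tensor_tp[OF P_VS r(1) one_closed lin_closed[OF il e]] r(2)[OF e] by simp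
  moreover have "id_tensor k P F E r (id_tensor k P E F i (\<rho> e)) = id_tensor k P E E (\<lambda>e. e) (\<rho> e)"
    unfolding id_tensor_comp[OF P_VS il r(1) re]
    by (rule id_tensor_cong[OF P_VS lin_comp[OF r(1) il] r(2) re])
  ultimately show ?thesis using e id_tensor_ident[OF P_VS E re] by (simp add: coinv_def)
qed

end

text \<open>
  A Hopf module: a comodule with a compatible action of \<open>P\<close>. Multiplying the last tensor factor
  into the module is a colinear contraction of the Hopf cochain complex; no antipode is involved.
\<close>

locale hopf_module = hopf k P \<Delta> \<epsilon> S
  for k :: "('k, 'z) ring_scheme" and P :: "('k, 'p) module"
    and \<Delta> :: "'p \<Rightarrow> ('p list \<times> 'p \<Rightarrow> 'k) set" and \<epsilon> :: "'p \<Rightarrow> 'k" and S :: "'p \<Rightarrow> 'p" +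
  fixes F :: "('k, 'f) module" and \<rho> :: "'f \<Rightarrow> ('p list \<times> 'f \<Rightarrow> 'k) set" and act :: "'p \<Rightarrow> 'f \<Rightarrow> 'f"
  assumes F: "comodule F \<rho>" and act: "bilin P F F act"
    and act_one: "w \<in> carrier F \<Longrightarrow> act \<one>\<^bsub>P\<^esub> w = w"
    and act_coaction: "p \<in> carrier P \<Longrightarrow> w \<in> carrier F \<Longrightarrow>
      \<rho> (act p w) = bd P P (T2 P F) (\<lambda>a b. bd P F (T2 P F) (\<lambda>c v. tp P F (a \<otimes>\<^bsub>P\<^esub> c) (act b v)) (\<rho> w)) (\<Delta> p)"
begin

lemmas V = F_VS[OF F]

text \<open>Up to the sign (-1)^n, the map from n + 1 factors to n factors that lets the last
  \<open>P\<close>-factor act on the module element. The sign balances the minus in the recursion of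
  \<open>dr\<close>.\<close>

primrec hm :: "nat \<Rightarrow> ('p list \<times> 'f \<Rightarrow> 'k) set \<Rightarrow> ('p list \<times> 'f \<Rightarrow> 'k) set" where
  "hm 0 = cbds 0 F (TP 0 F) (\<lambda>p t. nil F (act p (unl F t)))"
| "hm (Suc n) = (\<lambda>x. dif (TP (Suc n) F) \<zero>\<^bsub>TP (Suc n) F\<^esub> (cbds (Suc n) F (TP (Suc n) F) (\<lambda>p t. cns n F p (hm n t)) x))"

lemma unl0: "lin (TP 0 F) F (unl F)" and nil0: "lin F (TP 0 F) (nil F)"
  using unl_lin[OF V] nil_lin[OF V] by simp_all

lemma hm_bilin0: "bilin P (TP 0 F) (TP 0 F) (\<lambda>p t. nil F (act p (unl F t)))"
  by (rule bilin_comp[OF bilin_comp2[OF act unl0] nil0])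

lemma hm_bilin: "lin (TP (Suc n) F) (TP n F) (hm n) \<Longrightarrow> bilin P (TP (Suc n) F) (TP (Suc n) F) (\<lambda>p t. cns n F p (hm n t))"
  by (rule bilin_comp2[OF cns_bilin[OF V]])

lemma hm_lin: "lin (TP (Suc n) F) (TP n F) (hm n)"
proof (induction n)
  case 0
  show ?case unfolding hm.simps(1) by (rule cbds_lin[OF V hm_bilin0])
next
  case (Suc n)
  show ?case
    unfolding hm.simps(2)
    by (rule lin_diff[OF lin_const_zero[OF TP_VS'[OF V] TP_VS'[OF V]] cbds_lin[OF V hm_bilin[OF Suc.IH]]])
qed

lemma hm_cns0: "p \<in> carrier P \<Longrightarrow> w \<in> carrier F \<Longrightarrow> hm 0 (cns 0 F p (nil F w)) = nil F (act p w)"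
  unfolding hm.simps(1) by (subst cbds_cns[OF V hm_bilin0]) (use lin_closed[OF nil0] in \<open>simp_all add: unl_nil[OF V]\<close>)

lemma hm_cns: "p \<in> carrier P \<Longrightarrow> t \<in> carrier (TP (Suc n) F) \<Longrightarrow>
    hm (Suc n) (cns (Suc n) F p t) = dif (TP (Suc n) F) \<zero>\<^bsub>TP (Suc n) F\<^esub> (cns n F p (hm n t))"
  unfolding hm.simps(2) by (simp only: cbds_cns[OF V hm_bilin[OF hm_lin]])

text \<open>On p t the terms with leading factors 1 and p cancel; the rest is p times (h d t + d h
  t), which the induction hypothesis reduces to p t.\<close>

lemma hm_homotopy:
  "x \<in> carrier (TP (Suc n) F) \<Longrightarrow> hm (Suc n) (dr F (Suc n) x) \<oplus>\<^bsub>TP (Suc n) F\<^esub> dr F n (hm n x) = x"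
proof (induction n arbitrary: x)
  case 0
  let ?T = "TP (Suc 0) F"
  note T = TP_VS'[OF V, of "Suc 0"]
  show ?case
  proof (rule cns_ext[OF V lin_addf[OF lin_comp[OF hm_lin dr_lin[OF V]] lin_comp[OF dr_lin[OF V] hm_lin]] lin_id[OF T] _ 0])
    fix p t assume p: "p \<in> carrier P" and "t \<in> carrier (TP 0 F)"
    then obtain w where w: "w \<in> carrier F" "t = nil F w" using nil_surj[OF V] by auto
    have t: "t \<in> carrier (TP 0 F)" by fact
    have c: "cns 0 F p t \<in> carrier ?T" "dr F 0 t \<in> carrier ?T" by (intro cns_closed[OF V] dr_closed[OF V] p t)+
    \<comment> \<open>The unit law of the action: putting 1 in front and letting it act does
      nothing. This is where the homotopy starts.\<close>
    have hd: "hm 0 (dr F 0 t) = t" unfolding dr.simps(1) w(2) hm_cns0[OF one_closed w(1)] act_one[OF w(1)] ..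
    define a where "a = cns 0 F \<one>\<^bsub>P\<^esub> (hm 0 (cns 0 F p t))"
    have a: "a \<in> carrier ?T" unfolding a_def by (intro cns_closed[OF V] one_closed lin_closed[OF hm_lin] c)
    have "hm (Suc 0) (dr F (Suc 0) (cns 0 F p t)) = dif ?T (dif ?T \<zero>\<^bsub>?T\<^esub> a) (dif ?T \<zero>\<^bsub>?T\<^esub> (cns 0 F p t))"
      unfolding dr_cns[OF V p t] a_def
        lin_dif[OF hm_lin cns_closed[OF V one_closed c(1)] cns_closed[OF V p c(2)]]
        hm_cns[OF one_closed c(1)] hm_cns[OF p c(2)] hd ..
    moreover have "dr F 0 (hm 0 (cns 0 F p t)) = a" by (simp add: a_def)
    moreover have "dif ?T (dif ?T \<zero>\<^bsub>?T\<^esub> a) (dif ?T \<zero>\<^bsub>?T\<^esub> b) \<oplus>\<^bsub>?T\<^esub> a = b" if "b \<in> carrier ?T" for b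
      by (rule dif_cancel[OF T a that])
    ultimately show "hm (Suc 0) (dr F (Suc 0) (cns 0 F p t)) \<oplus>\<^bsub>?T\<^esub> dr F 0 (hm 0 (cns 0 F p t)) = cns 0 F p t"
      using c(1) by simp
  qed
next
  case (Suc n)
  let ?T = "TP (Suc (Suc n)) F"
  note T = TP_VS'[OF V, of "Suc (Suc n)"]
  show ?case
  proof (rule cns_ext[OF V lin_addf[OF lin_comp[OF hm_lin dr_lin[OF V]] lin_comp[OF dr_lin[OF V] hm_lin]] lin_id[OF T] _ Suc.prems])
    fix p t assume p: "p \<in> carrier P" and t: "t \<in> carrier (TP (Suc n) F)"
    have c: "cns (Suc n) F p t \<in> carrier ?T" "dr F (Suc n) t \<in> carrier ?T" "hm n t \<in> carrier (TP n F)"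
      by (intro cns_closed[OF V] dr_closed[OF V] lin_closed[OF hm_lin] p t)+
    have c': "cns n F p (hm n t) \<in> carrier (TP (Suc n) F)" "dr F n (hm n t) \<in> carrier (TP (Suc n) F)"
      "hm (Suc n) (dr F (Suc n) t) \<in> carrier (TP (Suc n) F)"
      by (intro cns_closed[OF V] dr_closed[OF V] lin_closed[OF hm_lin] p c)+
    define a where "a = cns (Suc n) F \<one>\<^bsub>P\<^esub> (cns n F p (hm n t))"
    define b where "b = cns (Suc n) F p (hm (Suc n) (dr F (Suc n) t))"
    define e where "e = cns (Suc n) F p (dr F n (hm n t))"
    have abe: "a \<in> carrier ?T" "b \<in> carrier ?T" "e \<in> carrier ?T"
      unfolding a_def b_def e_def by (intro cns_closed[OF V] one_closed p c')+
    note z = vs_zero[OF TP_VS'[OF V]]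
    have "hm (Suc (Suc n)) (dr F (Suc (Suc n)) (cns (Suc n) F p t)) =
      dif ?T (dif ?T \<zero>\<^bsub>?T\<^esub> (dif ?T \<zero>\<^bsub>?T\<^esub> a)) (dif ?T \<zero>\<^bsub>?T\<^esub> b)"
      unfolding dr_cns[OF V p t] a_def b_def
        lin_dif[OF hm_lin cns_closed[OF V one_closed c(1)] cns_closed[OF V p c(2)]]
        hm_cns[OF one_closed c(1)] hm_cns[OF p c(2)] hm_cns[OF p t]
        lin_dif[OF cns_lin[OF V one_closed] z c'(1)] lin_zero[OF cns_lin[OF V one_closed]] ..
    moreover have "dr F (Suc n) (hm (Suc n) (cns (Suc n) F p t)) = dif ?T \<zero>\<^bsub>?T\<^esub> (dif ?T a e)"
      unfolding hm_cns[OF p t] lin_dif[OF dr_lin[OF V] z c'(1)] lin_zero[OF dr_lin[OF V]]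
        dr_cns[OF V p c(3)] a_def e_def ..
    moreover have "b \<oplus>\<^bsub>?T\<^esub> e = cns (Suc n) F p t"
      unfolding b_def e_def lin_add[OF cns_lin[OF V p] c'(3,2), symmetric] Suc.IH[OF t] ..
    ultimately show "hm (Suc (Suc n)) (dr F (Suc (Suc n)) (cns (Suc n) F p t)) \<oplus>\<^bsub>?T\<^esub>
      dr F (Suc n) (hm (Suc n) (cns (Suc n) F p t)) = cns (Suc n) F p t"
      using dif_cancel'[OF T abe] by simp
  qed
qed

text \<open>The base case is the compatibility of action and coaction, transported along
  \<open>nil\<close>; the step extends a colinear map by a leading factor and changes the
  sign.\<close>

lemma hm_colin: "colin (TP (Suc n) F) (cd F \<rho> (Suc n)) (TP n F) (cd F \<rho> n) (hm n)"
proof (induction n)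
  case 0
  interpret D: diagonal k P \<Delta> \<epsilon> S "replicate 0 P" F "cd F \<rho> 0" "cd F \<rho> (Suc 0)" "TP 0 F" "TP (Suc 0) F" "cns 0 F"
    by (rule codiag_diagonal[OF F])
  note rl = rho_lin[OF F]
  note hb = id_tensor_bilin[OF P_VS hm_lin[of 0]]
  let ?Y = "T2 P (TP 0 F)"
  note rules = lin_comp[OF rl] lin_closed[OF rl] lin_comp[OF nil0] lin_closed[OF nil0] V
    lin_comp[OF hm_lin[of 0]] lin_closed[OF hm_lin[of 0]]
    lin_comp[OF bilinD(4)[OF act]] lin_comp[OF bilinD(5)[OF act]] bilin_closed[OF act] D.drules
  have "cd F \<rho> 0 (hm 0 x) = id_tensor k P (TP (Suc 0) F) (TP 0 F) (hm 0) (cd F \<rho> (Suc 0) x)"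
    if x: "x \<in> carrier (TP (Suc 0) F)" for x
  proof (rule D.cons_ext[OF lin_comp[OF D.gamma_lin hm_lin] lin_comp[OF id_tensor_lin[OF P_VS hm_lin] D.Gamma_lin] _ x])
    fix p t assume p: "p \<in> carrier P" and t: "t \<in> carrier (TP 0 F)"
    obtain w where w: "w \<in> carrier F" "t = nil F w" using nil_surj[OF V] t by auto
    have cn: "cd F \<rho> 0 (nil F v) = id_tensor k P F (TP 0 F) (nil F) (\<rho> v)" if "v \<in> carrier F" for v
      using codiag_nil[OF F that] by simp
    have "cd F \<rho> 0 (hm 0 (cns 0 F p t)) = id_tensor k P F (TP 0 F) (nil F) (\<rho> (act p w))"
      unfolding w(2) hm_cns0[OF p w(1)] by (rule cn[OF bilin_closed[OF act p w(1)]])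
    also have "\<dots> = bd P P ?Y (\<lambda>a b. bd P F ?Y (\<lambda>c v. tp P (TP 0 F) (a \<otimes>\<^bsub>P\<^esub> c) (nil F (act b v))) (\<rho> w)) (\<Delta> p)"
      unfolding act_coaction[OF p w(1)]
    proof (rule bd_comp_eq[OF _ id_tensor_lin[OF P_VS nil0]])
      fix a b assume ab: "a \<in> carrier P" "b \<in> carrier P"
      show "id_tensor k P F (TP 0 F) (nil F) (bd P F (T2 P F) (\<lambda>c v. tp P F (a \<otimes>\<^bsub>P\<^esub> c) (act b v)) (\<rho> w)) =
        bd P F ?Y (\<lambda>c v. tp P (TP 0 F) (a \<otimes>\<^bsub>P\<^esub> c) (nil F (act b v))) (\<rho> w)"
        by (rule bd_comp_eq[OF _ id_tensor_lin[OF P_VS nil0] _ id_tensor_tp[OF P_VS nil0]])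
          (insert ab w(1), (assumption | rule rules)+)
    qed (insert p w(1), (assumption | rule rules)+)
    also have "\<dots> = bd P P ?Y (\<lambda>a b. bd P (TP 0 F) ?Y (\<lambda>c s. tp P (TP 0 F) (a \<otimes>\<^bsub>P\<^esub> c) (hm 0 (cns 0 F b s))) (cd F \<rho> 0 t)) (\<Delta> p)"
    proof (rule bd_cong)
      fix a b assume ab: "a \<in> carrier P" "b \<in> carrier P"
      have "bd P (TP 0 F) ?Y (\<lambda>c s. tp P (TP 0 F) (a \<otimes>\<^bsub>P\<^esub> c) (hm 0 (cns 0 F b s))) (cd F \<rho> 0 t) =
        bd P F ?Y (\<lambda>c v. tp P (TP 0 F) (a \<otimes>\<^bsub>P\<^esub> c) (hm 0 (cns 0 F b (nil F v)))) (\<rho> w)"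
        unfolding w(2) cn[OF w(1)]
        by (rule bd_id_tensor[OF _ nil0 lin_closed[OF rl w(1)]]) (insert ab, (assumption | rule rules)+)
      also have "\<dots> = bd P F ?Y (\<lambda>c v. tp P (TP 0 F) (a \<otimes>\<^bsub>P\<^esub> c) (nil F (act b v))) (\<rho> w)"
      proof (rule bd_cong)
        show "tp P (TP 0 F) (a \<otimes>\<^bsub>P\<^esub> c) (hm 0 (cns 0 F b (nil F v))) = tp P (TP 0 F) (a \<otimes>\<^bsub>P\<^esub> c) (nil F (act b v))"
          if "v \<in> carrier F" for c v
          unfolding hm_cns0[OF ab(2) that] ..
      qed (insert ab w(1), (assumption | rule rules)+)
      finally show "bd P F ?Y (\<lambda>c v. tp P (TP 0 F) (a \<otimes>\<^bsub>P\<^esub> c) (nil F (act b v))) (\<rho> w) =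
        bd P (TP 0 F) ?Y (\<lambda>c s. tp P (TP 0 F) (a \<otimes>\<^bsub>P\<^esub> c) (hm 0 (cns 0 F b s))) (cd F \<rho> 0 t)" by simp
    qed (insert p w(1), (assumption | rule rules)+)
    also have "\<dots> = id_tensor k P (TP (Suc 0) F) (TP 0 F) (hm 0) (cd F \<rho> (Suc 0) (cns 0 F p t))"
      unfolding id_tensor_bd by (rule D.Gamma_bd[OF hb p t, symmetric])
    finally show "cd F \<rho> 0 (hm 0 (cns 0 F p t)) =
      id_tensor k P (TP (Suc 0) F) (TP 0 F) (hm 0) (cd F \<rho> (Suc 0) (cns 0 F p t))" .
  qed
  then show ?case unfolding colin_def by (intro conjI ballI hm_lin)
next
  case (Suc n)
  note b = hm_bilin[OF hm_lin, of n]
  show ?case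
    unfolding hm.simps(2)
    by (rule colin_uminus[OF diagonal_map.g_colin[OF diagonal_mapI[OF F F Suc.IH cbds_lin[OF V b] cbds_cns[OF V b]]]
          codiag_lin[OF F] codiag_lin[OF F]])
qed

text \<open>For closed x the homotopy gives x = d (h x), and h x is coinvariant because h is
  colinear. The case n = 0 says that the kernel in degree 0 comes from the augmentation.\<close>

lemma row_exact:
  assumes x: "x \<in> coinv (TP (Suc n) F) (cd F \<rho> (Suc n))" and d: "dr F (Suc n) x = \<zero>\<^bsub>TP (Suc (Suc n)) F\<^esub>"
  shows "\<exists>y\<in>coinv (TP n F) (cd F \<rho> n). x = dr F n y"
proof -
  have xT: "x \<in> carrier (TP (Suc n) F)" using x by (simp add: coinv_def)
  have "x = \<zero>\<^bsub>TP (Suc n) F\<^esub> \<oplus>\<^bsub>TP (Suc n) F\<^esub> dr F n (hm n x)"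
    using hm_homotopy[OF xT] d lin_zero[OF hm_lin[of "Suc n"]] by (simp only:)
  also have "\<dots> = dr F n (hm n x)" by (rule vs_add_zero(2)[OF TP_VS'[OF V] dr_closed[OF V lin_closed[OF hm_lin xT]]])
  finally show ?thesis using colin_coinv[OF hm_colin x] by blast
qed

end

section \<open>Cohomology of comodules\<close>

text \<open>
  Cohomology at \<open>E\<close> of a complex \<open>F \<rightarrow> E \<rightarrow> G\<close> of comodules. Over a field \<open>E\<close> retracts onto the
  kernel of \<open>g\<close>, so that tensoring with \<open>P\<close> commutes with taking cohomology.
\<close>

locale comodule_complex = hopf k P \<Delta> \<epsilon> S
  for k :: "('k, 'z) ring_scheme" and P :: "('k, 'p) module"
    and \<Delta> :: "'p \<Rightarrow> ('p list \<times> 'p \<Rightarrow> 'k) set" and \<epsilon> :: "'p \<Rightarrow> 'k" and S :: "'p \<Rightarrow> 'p" +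
  fixes F :: "('k, 'f) module" and \<phi> f and E :: "('k, 'f) module" and \<rho> and G :: "('k, 'f) module" and \<gamma> g
  assumes F: "comodule F \<phi>" and E: "comodule E \<rho>" and G: "comodule G \<gamma>"
    and f: "colin F \<phi> E \<rho> f" and g: "colin E \<rho> G \<gamma> g"
    and g_f: "x \<in> carrier F \<Longrightarrow> g (f x) = \<zero>\<^bsub>G\<^esub>"
begin

abbreviation Z where "Z \<equiv> E\<lparr>carrier := {x \<in> carrier E. g x = \<zero>\<^bsub>G\<^esub>}\<rparr>"

abbreviation B where "B \<equiv> f ` carrier F"

abbreviation H where "H \<equiv> quot_module Z B"

abbreviation \<pi> where "\<pi> \<equiv> \<lambda>z. B +>\<^bsub>Z\<^esub> z"

section \<open>The coactions on cocycles and on cohomology\<close>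

text \<open>The same expression as in \<open>de_Rham_coaction\<close>, so that the two can be
  identified by unfolding.\<close>

definition \<kappa> where
  "\<kappa> c = (THE t. \<exists>\<omega>\<in>c. \<exists>u\<in>carrier (T2 P Z). id_tensor k P Z E (\<lambda>z. z) u = \<rho> \<omega> \<and> t = id_tensor k P Z H \<pi> u)"

lemmas f_lin = colin_lin[OF f]
lemmas g_lin = colin_lin[OF g]

lemma Z_sub: "sub (carrier Z) E" using sub_kernel[OF g_lin] by simp

lemma Z_VS: "VS Z" using sub_VS[OF Z_sub] by simp

lemma f_lin_Z: "lin F Z f"
  using lin_corestrict[OF f_lin Z_sub] g_f lin_closed[OF f_lin] by simp

lemma B_sub: "sub B Z" by (rule sub_range[OF f_lin_Z])

lemma H_VS: "VS H" by (rule quot_VS[OF B_sub])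

lemma incl_lin: "lin Z E (\<lambda>z. z)"
  using lin_restrict[OF lin_id[OF F_VS[OF E]] Z_sub] by simp

lemma \<pi>_lin: "lin Z H \<pi>" by (rule lin_quot[OF B_sub])

lemma \<pi>_surj: "carrier H \<subseteq> \<pi> ` carrier Z" by (simp only: quot_carrier subset_refl)

lemma \<pi>_f: "x \<in> carrier F \<Longrightarrow> \<pi> (f x) = \<zero>\<^bsub>H\<^esub>"
  unfolding quot_zero by (rule iffD2[OF coset_eq_zero[OF B_sub lin_closed[OF f_lin_Z]]]) simp_all

lemma q_exists: "\<exists>q. lin G E q \<and> (\<forall>e\<in>carrier E. g (q (g e)) = g e)"
  by (rule generalized_inverse[OF g_lin])

definition q where "q = (SOME q. lin G E q \<and> (\<forall>e\<in>carrier E. g (q (g e)) = g e))"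

lemma q_lin: "lin G E q" and g_q: "e \<in> carrier E \<Longrightarrow> g (q (g e)) = g e"
  using someI_ex[OF q_exists] unfolding q_def[symmetric] by simp_all

text \<open>The projection 1 - q g; its values lie in the kernel of g because g q g = g.\<close>

definition r where "r e = dif E e (q (g e))"

lemma qg_lin: "lin E E (\<lambda>e. q (g e))" by (rule lin_comp[OF q_lin g_lin])

lemma r_lin_E: "lin E E r"
  unfolding r_def[abs_def] by (rule lin_diff[OF lin_id[OF F_VS[OF E]] qg_lin])

lemma r_lin: "lin E Z r"
proof -
  have "r e \<in> carrier Z" if e: "e \<in> carrier E" for e
  proof -
    have "g (r e) = \<zero>\<^bsub>G\<^esub>"
      unfolding r_def lin_dif[OF g_lin e lin_closed[OF qg_lin e]] g_q[OF e]
      by (rule vs_dif_self[OF F_VS[OF G] lin_closed[OF g_lin e]])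
    then show ?thesis using lin_closed[OF r_lin_E e] by simp
  qed
  from lin_corestrict[OF r_lin_E Z_sub this] show ?thesis by simp
qed

lemma r_Z: "z \<in> carrier Z \<Longrightarrow> r z = z"
  using lin_zero[OF q_lin] vs_dif_zero[OF F_VS[OF E]] by (simp add: r_def)

text \<open>The coaction of cocycles, forced into the smaller tensor product by the linear
  retraction; \<open>incl_colin\<close> shows that on cocycles nothing is lost.\<close>

definition \<zeta> where "\<zeta> z = id_tensor k P E Z r (\<rho> z)"

text \<open>The error made by the retraction is governed by the coaction of g e, so it vanishes on
  cocycles: their coaction lies in \<open>P\<close> tensored with cocycles.\<close>

lemma id_r: "e \<in> carrier E \<Longrightarrow> id_tensor k P Z E (\<lambda>z. z) (id_tensor k P E Z r (\<rho> e)) =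
    dif (T2 P E) (\<rho> e) (id_tensor k P G E q (\<gamma> (g e)))"
proof -
  assume e: "e \<in> carrier E"
  note re = lin_closed[OF rho_lin[OF E] e]
  have "id_tensor k P Z E (\<lambda>z. z) (id_tensor k P E Z r (\<rho> e)) = id_tensor k P E E (\<lambda>e. dif E e (q (g e))) (\<rho> e)"
    unfolding id_tensor_comp[OF P_VS r_lin incl_lin re] r_def ..
  also have "\<dots> = dif (T2 P E) (\<rho> e) (id_tensor k P E E (\<lambda>e. q (g e)) (\<rho> e))"
    unfolding id_tensor_dif[OF P_VS lin_id[OF F_VS[OF E]] qg_lin re] id_tensor_ident[OF P_VS F_VS[OF E] re] ..
  also have "id_tensor k P E E (\<lambda>e. q (g e)) (\<rho> e) = id_tensor k P G E q (\<gamma> (g e))"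
    unfolding colin_eq[OF g e] by (rule id_tensor_comp[OF P_VS g_lin q_lin re, symmetric])
  finally show ?thesis .
qed

lemma \<zeta>_lin: "lin Z (T2 P Z) \<zeta>"
  unfolding \<zeta>_def[abs_def]
  by (rule lin_comp[OF id_tensor_lin[OF P_VS r_lin] lin_comp[OF rho_lin[OF E] incl_lin]])

lemma incl_colin: "colin Z \<zeta> E \<rho> (\<lambda>z. z)"
  unfolding colin_def
proof (intro conjI ballI incl_lin)
  fix z assume z: "z \<in> carrier Z"
  then have e: "z \<in> carrier E" and gz: "g z = \<zero>\<^bsub>G\<^esub>" by simp_all
  have "id_tensor k P G E q (\<gamma> (g z)) = \<zero>\<^bsub>T2 P E\<^esub>"
    unfolding gz lin_zero[OF rho_lin[OF G]] by (rule lin_zero[OF id_tensor_lin[OF P_VS q_lin]])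
  then show "\<rho> z = id_tensor k P Z E (\<lambda>z. z) (\<zeta> z)"
    unfolding \<zeta>_def id_r[OF e] using vs_dif_zero[OF lin_W[OF rho_lin[OF E]] lin_closed[OF rho_lin[OF E] e]] by simp
qed

lemma Z_comodule: "comodule Z \<zeta>"
  by (rule comodule_sub[OF E \<zeta>_lin incl_colin r_lin r_Z])

lemma f_colin_Z: "colin F \<phi> Z \<zeta> f"
  unfolding colin_def
proof (intro conjI ballI f_lin_Z)
  fix x assume x: "x \<in> carrier F"
  note px = lin_closed[OF rho_lin[OF F] x]
  have "\<zeta> (f x) = id_tensor k P F Z (\<lambda>x. r (f x)) (\<phi> x)"
    unfolding \<zeta>_def colin_eq[OF f x] by (rule id_tensor_comp[OF P_VS f_lin r_lin px])
  also have "\<dots> = id_tensor k P F Z f (\<phi> x)"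
    by (rule id_tensor_cong[OF P_VS lin_comp[OF r_lin f_lin] r_Z[OF lin_closed[OF f_lin_Z]] px])
  finally show "\<zeta> (f x) = id_tensor k P F Z f (\<phi> x)" .
qed

lemma coaction_f: "x \<in> carrier F \<Longrightarrow> id_tensor k P Z H \<pi> (\<zeta> (f x)) = \<zero>\<^bsub>T2 P H\<^esub>"
proof -
  assume x: "x \<in> carrier F"
  note px = lin_closed[OF rho_lin[OF F] x]
  have "id_tensor k P Z H \<pi> (\<zeta> (f x)) = id_tensor k P F H (\<lambda>x. \<pi> (f x)) (\<phi> x)"
    unfolding colin_eq[OF f_colin_Z x] by (rule id_tensor_comp[OF P_VS f_lin_Z \<pi>_lin px])
  also have "\<dots> = id_tensor k P F H (\<lambda>x. \<zero>\<^bsub>H\<^esub>) (\<phi> x)"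
    by (rule id_tensor_cong[OF P_VS lin_comp[OF \<pi>_lin f_lin_Z] \<pi>_f px])
  also have "\<dots> = \<zero>\<^bsub>T2 P H\<^esub>" by (rule id_tensor_zero[OF P_VS F_VS[OF F] H_VS px])
  finally show ?thesis .
qed

lemma pz_lin: "lin Z (T2 P H) (\<lambda>z. id_tensor k P Z H \<pi> (\<zeta> z))"
  by (rule lin_comp[OF id_tensor_lin[OF P_VS \<pi>_lin] \<zeta>_lin])

text \<open>The definite description is well posed for two reasons. The retraction recovers u from
  its image, so u is determined by \<open>\<omega>\<close>; and another representative differs by a
  coboundary, whose coaction dies in cohomology.\<close>

lemma kappa_class: "z \<in> carrier Z \<Longrightarrow> \<kappa> (\<pi> z) = id_tensor k P Z H \<pi> (\<zeta> z)"
proof -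
  assume z: "z \<in> carrier Z"
  show ?thesis
    unfolding \<kappa>_def
  proof (rule the_equality)
    show "\<exists>\<omega>\<in>\<pi> z. \<exists>u\<in>carrier (T2 P Z). id_tensor k P Z E (\<lambda>z. z) u = \<rho> \<omega> \<and>
        id_tensor k P Z H \<pi> (\<zeta> z) = id_tensor k P Z H \<pi> u"
      by (rule bexI[OF _ coset_self[OF B_sub z]], rule bexI[OF _ lin_closed[OF \<zeta>_lin z]],
          rule conjI[OF colin_eq[OF incl_colin z, symmetric] refl])
  next
    fix t assume "\<exists>\<omega>\<in>\<pi> z. \<exists>u\<in>carrier (T2 P Z). id_tensor k P Z E (\<lambda>z. z) u = \<rho> \<omega> \<and> t = id_tensor k P Z H \<pi> u"
    then obtain \<omega> u where w: "\<omega> \<in> \<pi> z" and u: "u \<in> carrier (T2 P Z)" "id_tensor k P Z E (\<lambda>z. z) u = \<rho> \<omega>"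
      and t: "t = id_tensor k P Z H \<pi> u" by blast
    obtain b where b: "b \<in> B" "\<omega> = b \<oplus>\<^bsub>Z\<^esub> z" using iffD1[OF coset_iff[OF B_sub z] w] by blast
    obtain x where x: "x \<in> carrier F" "b = f x" using b(1) by blast
    note fx = lin_closed[OF f_lin_Z x(1)]
    have "\<zeta> \<omega> = id_tensor k P Z Z (\<lambda>z. r z) u"
      unfolding \<zeta>_def u(2)[symmetric] by (rule id_tensor_comp[OF P_VS incl_lin r_lin u(1)])
    also have "\<dots> = id_tensor k P Z Z (\<lambda>z. z) u"
      by (rule id_tensor_cong[OF P_VS lin_comp[OF r_lin incl_lin] r_Z u(1)])
    also have "\<dots> = u" by (rule id_tensor_ident[OF P_VS Z_VS u(1)])
    finally have "t = id_tensor k P Z H \<pi> (\<zeta> (f x \<oplus>\<^bsub>Z\<^esub> z))" using t b(2) x(2) by simp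
    also have "\<dots> = id_tensor k P Z H \<pi> (\<zeta> (f x)) \<oplus>\<^bsub>T2 P H\<^esub> id_tensor k P Z H \<pi> (\<zeta> z)" by (rule lin_add[OF pz_lin fx z])
    also have "\<dots> = id_tensor k P Z H \<pi> (\<zeta> z)"
      unfolding coaction_f[OF x(1)] by (rule vs_add_zero(2)[OF lin_W[OF pz_lin] lin_closed[OF pz_lin z]])
    finally show "t = id_tensor k P Z H \<pi> (\<zeta> z)" .
  qed
qed

lemma kappa_lin: "lin H (T2 P H) \<kappa>"
  by (rule lin_factor[OF \<pi>_lin \<pi>_surj lin_cong[OF pz_lin]]) (simp only: kappa_class)

lemma pi_colin: "colin Z \<zeta> H \<kappa> \<pi>"
  unfolding colin_def by (intro conjI ballI \<pi>_lin kappa_class)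

lemma H_comodule: "comodule H \<kappa>"
  by (rule comodule_quotient[OF Z_comodule kappa_lin pi_colin \<pi>_surj])

text \<open>The functor \<open>coinv (TP (Suc n) -)\<close> is exact.\<close>

abbreviation co where "co n M \<sigma> \<equiv> coinv (TP (Suc n) M) (cd M \<sigma> (Suc n))"

text \<open>Only its values on vertical cocycles matter; composing with the retraction extends it
  linearly to all of the tensor power of \<open>E\<close>.\<close>

definition pr where "pr n t = pms (Suc n) Z H \<pi> (pms (Suc n) E Z r t)"

lemma pr_lin: "lin (TP (Suc n) E) (TP (Suc n) H) (pr n)"
  unfolding pr_def[abs_def] by (rule lin_comp[OF pms_lin[OF \<pi>_lin] pms_lin[OF r_lin]])

lemma pms_incl_r:
  assumes t: "t \<in> carrier (TP n E)" and gt: "pms n E G g t = \<zero>\<^bsub>TP n G\<^esub>"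
  shows "pms n Z E (\<lambda>z. z) (pms n E Z r t) = t"
proof -
  have "pms n Z E (\<lambda>z. z) (pms n E Z r t) = pms n E E (\<lambda>e. dif E e (q (g e))) t"
    unfolding pm_comp[OF PP r_lin incl_lin t] r_def ..
  also have "\<dots> = dif (TP n E) t (pms n E E (\<lambda>e. q (g e)) t)"
    unfolding pm_dif[OF PP lin_id[OF F_VS[OF E]] qg_lin t] pm_id[OF PP F_VS[OF E] t] ..
  also have "pms n E E (\<lambda>e. q (g e)) t = \<zero>\<^bsub>TP n E\<^esub>"
    unfolding pm_comp[OF PP g_lin q_lin t, symmetric] gt by (rule lin_zero[OF pms_lin[OF q_lin]])
  also have "dif (TP n E) t \<zero>\<^bsub>TP n E\<^esub> = t" by (rule vs_dif_zero[OF TP_VS'[OF F_VS[OF E]] t])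
  finally show ?thesis .
qed

lemma pms_r_incl:
  assumes t: "t \<in> carrier (TP n Z)"
  shows "pms n E Z r (pms n Z E (\<lambda>z. z) t) = t"
proof -
  have "pms n E Z r (pms n Z E (\<lambda>z. z) t) = pms n Z Z (\<lambda>z. r z) t" by (rule pm_comp[OF PP incl_lin r_lin t])
  also have "\<dots> = pms n Z Z (\<lambda>z. z) t" by (rule pm_cong[OF PP lin_comp[OF r_lin incl_lin] r_Z t])
  also have "\<dots> = t" by (rule pm_id[OF PP Z_VS t])
  finally show ?thesis .
qed

lemma pms_r_coinv:
  assumes t: "t \<in> co n E \<rho>" and gt: "pms (Suc n) E G g t = \<zero>\<^bsub>TP (Suc n) G\<^esub>"
  shows "pms (Suc n) E Z r t \<in> co n Z \<zeta>"
proof (rule coinv_inject[OF pms_colin[OF Z_comodule E incl_colin] codiag_lin[OF Z_comodule] pms_lin[OF r_lin] pms_r_incl])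
  have c: "t \<in> carrier (TP (Suc n) E)" using t by (simp add: coinv_def)
  show "pms (Suc n) E Z r t \<in> carrier (TP (Suc n) Z)" by (rule lin_closed[OF pms_lin[OF r_lin] c])
  show "pms (Suc n) Z E (\<lambda>z. z) (pms (Suc n) E Z r t) \<in> co n E \<rho>" unfolding pms_incl_r[OF c gt] by (rule t)
qed assumption

lemma pr_coinv:
  "t \<in> co n E \<rho> \<Longrightarrow> pms (Suc n) E G g t = \<zero>\<^bsub>TP (Suc n) G\<^esub> \<Longrightarrow> pr n t \<in> co n H \<kappa>"
  unfolding pr_def by (rule colin_coinv[OF pms_colin[OF Z_comodule H_comodule pi_colin] pms_r_coinv])

text \<open>A linear section of \<open>\<pi>\<close>, applied in the last factor, lifts v to a
  tensor over cocycles; \<open>coinv_preimage\<close> then makes the lift coinvariant.\<close>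

lemma pr_surj:
  assumes v: "v \<in> co n H \<kappa>"
  shows "\<exists>t\<in>co n E \<rho>. pms (Suc n) E G g t = \<zero>\<^bsub>TP (Suc n) G\<^esub> \<and> pr n t = v"
proof -
  have vc: "v \<in> carrier (TP (Suc n) H)" using v by (simp add: coinv_def)
  obtain s where s: "lin H Z s" "\<And>h. h \<in> carrier H \<Longrightarrow> \<pi> (s h) = h" using linear_section[OF \<pi>_lin \<pi>_surj] by blast
  have "pms (Suc n) Z H \<pi> (pms (Suc n) H Z s v) = pms (Suc n) H H (\<lambda>h. \<pi> (s h)) v" by (rule pm_comp[OF PP s(1) \<pi>_lin vc])
  also have "\<dots> = pms (Suc n) H H (\<lambda>h. h) v" by (rule pm_cong[OF PP lin_comp[OF \<pi>_lin s(1)] s(2) vc])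
  also have "\<dots> = v" by (rule pm_id[OF PP H_VS vc])
  finally have sv: "v = pms (Suc n) Z H \<pi> (pms (Suc n) H Z s v)" by (rule sym)
  obtain w where w: "w \<in> co n Z \<zeta>" "v = pms (Suc n) Z H \<pi> w"
    using coinv_preimage[OF Z_comodule H_comodule pi_colin v lin_closed[OF pms_lin[OF s(1)] vc] sv] by blast
  have wc: "w \<in> carrier (TP (Suc n) Z)" using w(1) by (simp add: coinv_def)
  let ?t = "pms (Suc n) Z E (\<lambda>z. z) w"
  have "pms (Suc n) E G g ?t = pms (Suc n) Z G (\<lambda>z. g z) w" by (rule pm_comp[OF PP incl_lin g_lin wc])
  also have "\<dots> = pms (Suc n) Z G (\<lambda>z. \<zero>\<^bsub>G\<^esub>) w" by (rule pm_cong[OF PP lin_comp[OF g_lin incl_lin] _ wc]) simp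
  also have "\<dots> = \<zero>\<^bsub>TP (Suc n) G\<^esub>" by (rule pm_zero[OF PP Z_VS F_VS[OF G] wc])
  finally have "pms (Suc n) E G g ?t = \<zero>\<^bsub>TP (Suc n) G\<^esub>" .
  moreover have "pr n ?t = v" unfolding pr_def pms_r_incl[OF wc] w(2) ..
  moreover have "?t \<in> co n E \<rho>" by (rule colin_coinv[OF pms_colin[OF Z_comodule E incl_colin] w(1)])
  ultimately show ?thesis by blast
qed

lemma pr_f:
  assumes w: "w \<in> carrier (TP (Suc n) F)"
  shows "pr n (pms (Suc n) F E f w) = \<zero>\<^bsub>TP (Suc n) H\<^esub>"
proof -
  have "pms (Suc n) E Z r (pms (Suc n) F E f w) = pms (Suc n) F Z (\<lambda>x. r (f x)) w" by (rule pm_comp[OF PP f_lin r_lin w])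
  also have "\<dots> = pms (Suc n) F Z f w" by (rule pm_cong[OF PP lin_comp[OF r_lin f_lin] r_Z[OF lin_closed[OF f_lin_Z]] w])
  finally have "pr n (pms (Suc n) F E f w) = pms (Suc n) F H (\<lambda>x. \<pi> (f x)) w"
    unfolding pr_def by (simp only: pm_comp[OF PP f_lin_Z \<pi>_lin w])
  also have "\<dots> = pms (Suc n) F H (\<lambda>x. \<zero>\<^bsub>H\<^esub>) w" by (rule pm_cong[OF PP lin_comp[OF \<pi>_lin f_lin_Z] \<pi>_f w])
  also have "\<dots> = \<zero>\<^bsub>TP (Suc n) H\<^esub>" by (rule pm_zero[OF PP F_VS[OF F] H_VS w])
  finally show ?thesis .
qed

text \<open>z minus the chosen representative of its class is a coboundary, and the generalized
  inverse of f selects a primitive. The selection has to be linear so that it can be applied inside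
  a tensor product.\<close>

lemma boundary_lift_exists: "\<exists>s l. lin H Z s \<and> lin Z F l \<and> (\<forall>z\<in>carrier Z. f (l z) = dif Z z (s (\<pi> z)))"
proof -
  obtain s where s: "lin H Z s" "\<And>h. h \<in> carrier H \<Longrightarrow> \<pi> (s h) = h" using linear_section[OF \<pi>_lin \<pi>_surj] by blast
  obtain f' where f': "lin Z F f'" "\<forall>x\<in>carrier F. f (f' (f x)) = f x" using generalized_inverse[OF f_lin_Z] by blast
  let ?m = "\<lambda>z. dif Z z (s (\<pi> z))"
  have m: "lin Z Z ?m" by (rule lin_diff[OF lin_id[OF Z_VS] lin_comp[OF s(1) \<pi>_lin]])
  have "f (f' (?m z)) = ?m z" if z: "z \<in> carrier Z" for z
  proof -
    have sz: "s (\<pi> z) \<in> carrier Z" by (rule lin_closed[OF s(1) lin_closed[OF \<pi>_lin z]])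
    have "\<pi> (s (\<pi> z)) = \<pi> z" by (rule s(2)[OF lin_closed[OF \<pi>_lin z]])
    then have "?m z \<in> B" using coset_eq_iff[OF B_sub z sz] by simp
    then obtain x where x: "x \<in> carrier F" "?m z = f x" by (rule imageE)
    show ?thesis unfolding x(2) using f'(2) x(1) by blast
  qed
  then show ?thesis using s(1) lin_comp[OF f'(1) m] by blast
qed

text \<open>If the class vanishes, the linear choice of primitives in the last factor makes the
  retracted tensor an image under f; the primitive is then made coinvariant by
  \<open>coinv_preimage\<close>.\<close>

lemma pr_ker:
  assumes t: "t \<in> co n E \<rho>" and gt: "pms (Suc n) E G g t = \<zero>\<^bsub>TP (Suc n) G\<^esub>"
  shows "pr n t = \<zero>\<^bsub>TP (Suc n) H\<^esub> \<longleftrightarrow> (\<exists>w\<in>co n F \<phi>. t = pms (Suc n) F E f w)"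
proof
  assume "\<exists>w\<in>co n F \<phi>. t = pms (Suc n) F E f w"
  then show "pr n t = \<zero>\<^bsub>TP (Suc n) H\<^esub>" using pr_f unfolding coinv_def by blast
next
  assume 0: "pr n t = \<zero>\<^bsub>TP (Suc n) H\<^esub>"
  let ?z = "pms (Suc n) E Z r t"
  have tc: "t \<in> carrier (TP (Suc n) E)" using t by (simp add: coinv_def)
  have z: "?z \<in> co n Z \<zeta>" by (rule pms_r_coinv[OF t gt])
  have zc: "?z \<in> carrier (TP (Suc n) Z)" by (rule lin_closed[OF pms_lin[OF r_lin] tc])
  obtain s l where s: "lin H Z s" and l: "lin Z F l" and fl: "\<And>z. z \<in> carrier Z \<Longrightarrow> f (l z) = dif Z z (s (\<pi> z))"
    using boundary_lift_exists by blast
  let ?u = "pms (Suc n) Z F l ?z"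
  have uc: "?u \<in> carrier (TP (Suc n) F)" by (rule lin_closed[OF pms_lin[OF l] zc])
  have "pms (Suc n) F Z f ?u = pms (Suc n) Z Z (\<lambda>z. f (l z)) ?z" by (rule pm_comp[OF PP l f_lin_Z zc])
  also have "\<dots> = pms (Suc n) Z Z (\<lambda>z. dif Z z (s (\<pi> z))) ?z" by (rule pm_cong[OF PP lin_comp[OF f_lin_Z l] fl zc])
  also have "\<dots> = dif (TP (Suc n) Z) ?z (pms (Suc n) Z Z (\<lambda>z. s (\<pi> z)) ?z)"
    unfolding pm_dif[OF PP lin_id[OF Z_VS] lin_comp[OF s \<pi>_lin] zc] pm_id[OF PP Z_VS zc] ..
  also have "pms (Suc n) Z Z (\<lambda>z. s (\<pi> z)) ?z = \<zero>\<^bsub>TP (Suc n) Z\<^esub>"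
    unfolding pm_comp[OF PP \<pi>_lin s zc, symmetric] 0[unfolded pr_def] by (rule lin_zero[OF pms_lin[OF s]])
  also have "dif (TP (Suc n) Z) ?z \<zero>\<^bsub>TP (Suc n) Z\<^esub> = ?z" by (rule vs_dif_zero[OF TP_VS'[OF Z_VS] zc])
  finally have "?z = pms (Suc n) F Z f ?u" by (rule sym)
  from coinv_preimage[OF F Z_comodule f_colin_Z z uc this]
  obtain w where w: "w \<in> co n F \<phi>" "?z = pms (Suc n) F Z f w" by blast
  have wc: "w \<in> carrier (TP (Suc n) F)" using w(1) by (simp add: coinv_def)
  have "t = pms (Suc n) Z E (\<lambda>z. z) ?z" by (rule pms_incl_r[OF tc gt, symmetric])
  also have "\<dots> = pms (Suc n) F E f w" unfolding w(2) by (rule pm_comp[OF PP f_lin_Z incl_lin wc])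
  finally show "\<exists>w\<in>co n F \<phi>. t = pms (Suc n) F E f w" using w(1) by blast
qed

lemma pr_dr: "t \<in> carrier (TP (Suc n) E) \<Longrightarrow> pr (Suc n) (dr E (Suc n) t) = dr H (Suc n) (pr n t)"
  unfolding pr_def by (simp only: pms_dr[OF r_lin] pms_dr[OF \<pi>_lin] lin_closed[OF pms_lin[OF r_lin]])

end

section \<open>The double complex of a bicovariant calculus\<close>

declare replicate_Suc [simp del]

context hopf
begin

section \<open>Coinvariant cochains with integer index\<close>

lemma alt_sign_square: "alt_sign k n \<otimes>\<^bsub>k\<^esub> alt_sign k n = \<one>\<^bsub>k\<^esub>"
proof -
  interpret K: field k by (rule is_field)
  show ?thesis
  proof (induction n)
    case 0 then show ?case by (simp add: alt_sign_0)
  next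
    case (Suc n)
    have a: "alt_sign k n \<in> carrier k" by (rule alt_sign_closed)
    have "\<ominus>\<^bsub>k\<^esub> \<one>\<^bsub>k\<^esub> \<otimes>\<^bsub>k\<^esub> alt_sign k n = \<ominus>\<^bsub>k\<^esub> alt_sign k n" using a by (simp add: K.l_minus)
    then show ?case unfolding alt_sign_Suc using a Suc by (simp add: K.l_minus K.r_minus)
  qed
qed

lemma sign_sign: "VS V \<Longrightarrow> x \<in> carrier V \<Longrightarrow> alt_sign k n \<odot>\<^bsub>V\<^esub> (alt_sign k n \<odot>\<^bsub>V\<^esub> x) = x"
  by (simp add: vs_smult_smult[symmetric] alt_sign_closed alt_sign_square)

lemma sign_zero_iff: "VS V \<Longrightarrow> x \<in> carrier V \<Longrightarrow> alt_sign k n \<odot>\<^bsub>V\<^esub> x = \<zero>\<^bsub>V\<^esub> \<longleftrightarrow> x = \<zero>\<^bsub>V\<^esub>"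
  using sign_sign[of V x n] vs_smult_zero(1)[of V "alt_sign k n"] alt_sign_closed by auto

text \<open>Neighbouring columns carry opposite signs; this turns the commuting differentials into
  anticommuting ones.\<close>

lemma sign_Suc_cancel:
  assumes V: "VS V" and x: "x \<in> carrier V"
  shows "alt_sign k n \<odot>\<^bsub>V\<^esub> x \<oplus>\<^bsub>V\<^esub> alt_sign k (Suc n) \<odot>\<^bsub>V\<^esub> x = \<zero>\<^bsub>V\<^esub>"
proof -
  have y: "alt_sign k n \<odot>\<^bsub>V\<^esub> x \<in> carrier V" by (rule vs_smult[OF V alt_sign_closed x])
  have "alt_sign k (Suc n) \<odot>\<^bsub>V\<^esub> x = (\<ominus>\<^bsub>k\<^esub> \<one>\<^bsub>k\<^esub>) \<odot>\<^bsub>V\<^esub> (alt_sign k n \<odot>\<^bsub>V\<^esub> x)"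
    unfolding alt_sign_Suc by (rule vs_smult_smult[OF V k_closed(3)[OF k_closed(2)] alt_sign_closed x])
  then show ?thesis using vs_dif_self[OF V y] by (simp add: vdiff_def)
qed

text \<open>For negative i the number \<open>nat i\<close> is 0, so the ambient record is the one of
  column zero, cut down to its zero.\<close>

definition ccs where
  "ccs F \<rho> i = (if i < 0 then {\<zero>\<^bsub>TP (Suc (nat i)) F\<^esub>} else coinv (TP (Suc (nat i)) F) (cd F \<rho> (Suc (nat i))))"
  for i :: int

abbreviation cc where "cc F \<rho> i \<equiv> (TP (Suc (nat i)) F)\<lparr>carrier := ccs F \<rho> i\<rparr>"

definition dd where
  "dd F i = (if i < 0 then (\<lambda>_. \<zero>\<^bsub>TP (Suc 0) F\<^esub>) else dr F (Suc (nat i)))" for i :: int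

lemma ccs_int: "ccs F \<rho> (int n) = coinv (TP (Suc n) F) (cd F \<rho> (Suc n))" by (simp add: ccs_def)

lemma ccs_int_Suc: "ccs F \<rho> (int n + 1) = coinv (TP (Suc (Suc n)) F) (cd F \<rho> (Suc (Suc n)))"
  using ccs_int[of F \<rho> "Suc n"] by (simp add: add.commute)

lemma ccs_neg: "i < 0 \<Longrightarrow> ccs F \<rho> i = {\<zero>\<^bsub>TP (Suc (nat i)) F\<^esub>}" by (simp add: ccs_def)

lemma dd_int: "dd F (int n) = dr F (Suc n)" by (simp add: dd_def)

lemma dd_int_Suc: "dd F (int n + 1) = dr F (Suc (Suc n))"
  using dd_int[of F "Suc n"] by (simp add: add.commute del: dr.simps)

lemma ccs_0: "ccs F \<rho> 0 = coinv (TP (Suc 0) F) (cd F \<rho> (Suc 0))"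
  and dd_0: "dd F 0 = dr F (Suc 0)"
  by (simp_all add: ccs_def dd_def del: dr.simps)

lemma nat_int_Suc: "nat (int n + 1) = Suc n" by simp

lemma int_cases_neg:
  fixes i :: int
  obtains (neg) "i < 0" | (nonneg) n where "i = int n"
  using zero_le_imp_eq_int[of i] by (cases "i < 0") auto

context
  fixes F :: "('k, 'f) module" and \<rho>
  assumes F: "comodule F \<rho>"
begin

lemma ccs_sub: "sub (ccs F \<rho> i) (TP (Suc (nat i)) F)"
  unfolding ccs_def using sub_zero_space[OF TP_VS'[OF F_VS[OF F]]] coinv_sub[OF codiag_lin[OF F]] by simp

lemma cc_VS: "VS (cc F \<rho> i)" by (rule sub_VS[OF ccs_sub])

lemma cc_incl: "lin (cc F \<rho> i) (TP (Suc (nat i)) F) (\<lambda>x. x)"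
  by (rule lin_extend[OF lin_id[OF cc_VS] ccs_sub])

lemma ccs_carrier: "x \<in> ccs F \<rho> i \<Longrightarrow> x \<in> carrier (TP (Suc (nat i)) F)" by (rule sub_carrier[OF ccs_sub])

lemma dd_lin: "lin (cc F \<rho> i) (cc F \<rho> (i + 1)) (dd F i)"
proof (cases i rule: int_cases_neg)
  case neg
  then have "nat (i + 1) = 0" by simp
  then show ?thesis using lin_const_zero[OF cc_VS[of i] cc_VS[of "i + 1"]] neg by (simp add: dd_def)
next
  case (nonneg n)
  have "lin ((TP (Suc n) F)\<lparr>carrier := coinv (TP (Suc n) F) (cd F \<rho> (Suc n))\<rparr>)
     ((TP (Suc (Suc n)) F)\<lparr>carrier := coinv (TP (Suc (Suc n)) F) (cd F \<rho> (Suc (Suc n)))\<rparr>) (dr F (Suc n))"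
  proof (rule lin_corestrict[OF lin_restrict[OF dr_lin[OF F_VS[OF F]] coinv_sub[OF codiag_lin[OF F]]] coinv_sub[OF codiag_lin[OF F]]])
    fix x assume "x \<in> carrier ((TP (Suc n) F)\<lparr>carrier := coinv (TP (Suc n) F) (cd F \<rho> (Suc n))\<rparr>)"
    then have x: "x \<in> coinv (TP (Suc n) F) (cd F \<rho> (Suc n))" by simp
    show "dr F (Suc n) x \<in> coinv (TP (Suc (Suc n)) F) (cd F \<rho> (Suc (Suc n)))" by (rule colin_coinv[OF dr_colin[OF F] x])
  qed
  then show ?thesis unfolding nonneg nat_int_Suc nat_int ccs_int ccs_int_Suc dd_int .
qed

lemma dd_dd: "x \<in> ccs F \<rho> i \<Longrightarrow> dd F (i + 1) (dd F i x) = \<zero>\<^bsub>TP (Suc (nat (i + 1 + 1))) F\<^esub>"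
proof (cases i rule: int_cases_neg)
  case neg
  then show ?thesis using lin_zero[OF dd_lin[of "i + 1"]] by (simp add: dd_def)
next
  case (nonneg n)
  assume "x \<in> ccs F \<rho> i"
  then have "x \<in> carrier (TP (Suc n) F)" using ccs_carrier nonneg by fastforce
  moreover have "nat (int n + 1 + 1) = Suc (Suc n)" by simp
  ultimately show ?thesis unfolding nonneg dd_int dd_int_Suc using dr_dr[OF F_VS[OF F]] by (simp only:)
qed

text \<open>An equality of records: \<open>dd\<close> and \<open>hopf_d\<close> agree on
  coinvariants, and both quotients evaluate them only there. For n = 0 the image of the zero column
  is the {0} in the definition of coboundaries.\<close>

lemma hopf_cohomology_eq:
  "quot_module ((cc F \<rho> (int n))\<lparr>carrier := {v \<in> carrier (cc F \<rho> (int n)). dd F (int n) v = \<zero>\<^bsub>cc F \<rho> (int n + 1)\<^esub>}\<rparr>)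
    (dd F (int n - 1) ` carrier (cc F \<rho> (int n - 1))) = hopf_cohomology k P \<Delta> F \<rho> n"
proof -
  have h: "hopf_cochains k P \<Delta> F \<rho> n = (TP (Suc n) F)\<lparr>carrier := coinv (TP (Suc n) F) (cd F \<rho> (Suc n))\<rparr>" for n
    unfolding hopf_cochains_def coinvariants_eq by simp
  have c: "x \<in> coinv (TP (Suc n) F) (cd F \<rho> (Suc n)) \<Longrightarrow> hopf_d k P F n x = dr F (Suc n) x" for x n
    by (rule hopf_d_eq[OF F_VS[OF F]]) (simp add: coinv_def)
  have b: "dd F (int n - 1) ` ccs F \<rho> (int n - 1) = coboundaries (hopf_cochains k P \<Delta> F \<rho>) (hopf_d k P F) n"
  proof (cases n)
    case 0
    then show ?thesis by (simp add: coboundaries_def ccs_neg dd_def h)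
  next
    case (Suc m)
    have "dr F (Suc m) ` coinv (TP (Suc m) F) (cd F \<rho> (Suc m)) = hopf_d k P F m ` coinv (TP (Suc m) F) (cd F \<rho> (Suc m))"
      by (rule image_cong[OF refl c[symmetric]])
    then show ?thesis
      unfolding Suc coboundaries_def nat.case h using ccs_int[of F \<rho> m] dd_int[of F m] by (simp del: dr.simps)
  qed
  have z: "{v \<in> ccs F \<rho> (int n). dd F (int n) v = \<zero>\<^bsub>TP (Suc (Suc n)) F\<^esub>} =
      {v \<in> coinv (TP (Suc n) F) (cd F \<rho> (Suc n)). hopf_d k P F n v = \<zero>\<^bsub>TP (Suc (Suc n)) F\<^esub>}"
    unfolding ccs_int dd_int by (rule Collect_cong) (use c in \<open>auto simp del: dr.simps\<close>)
  show ?thesis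
    unfolding hopf_cohomology_def cohomology_def cocycles_def b[symmetric] h nat_int_Suc using z by simp
qed

end

lemma pms_ccs:
  assumes F: "comodule F \<rho>" and G: "comodule G \<sigma>" and g: "colin F \<rho> G \<sigma> g" and x: "x \<in> ccs F \<rho> i"
  shows "pms (Suc (nat i)) F G g x \<in> ccs G \<sigma> i"
proof (cases i rule: int_cases_neg)
  case neg
  then have "x = \<zero>\<^bsub>TP (Suc (nat i)) F\<^esub>" using x ccs_neg[of i F \<rho>] by blast
  then show ?thesis using lin_zero[OF pms_lin[OF colin_lin[OF g]]] sub_zero[OF ccs_sub[OF G]] by simp
next
  case (nonneg n)
  then show ?thesis using x colin_coinv[OF pms_colin[OF F G g], of x "Suc n"] by (simp add: ccs_int)
qed

lemma pms_cc_lin: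
  assumes F: "comodule F \<rho>" and G: "comodule G \<sigma>" and g: "colin F \<rho> G \<sigma> g"
  shows "lin (cc F \<rho> i) (cc G \<sigma> i) (pms (Suc (nat i)) F G g)"
  by (rule lin_corestrict[OF lin_restrict[OF pms_lin[OF colin_lin[OF g]] ccs_sub[OF F]] ccs_sub[OF G]])
    (simp add: pms_ccs[OF F G g])

text \<open>On a zero space the identity is the zero map, and both pass to the tensor power.\<close>

lemma TP_zero:
  assumes F: "VS F" "carrier F = {\<zero>\<^bsub>F\<^esub>}" and x: "x \<in> carrier (TP n F)"
  shows "x = \<zero>\<^bsub>TP n F\<^esub>"
proof -
  have "x = pms n F F (\<lambda>v. v) x" by (rule pm_id[OF PP F(1) x, symmetric])
  also have "\<dots> = pms n F F (\<lambda>v. \<zero>\<^bsub>F\<^esub>) x" by (rule pm_cong[OF PP lin_id[OF F(1)] _ x]) (simp add: F(2))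
  also have "\<dots> = \<zero>\<^bsub>TP n F\<^esub>" by (rule pm_zero[OF PP F(1) F(1) x])
  finally show ?thesis .
qed

end

section \<open>The double complex of a complex of Hopf modules\<close>

text \<open>\<open>d\<close> is required to be colinear, while the action is given degree by degree:
  on forms \<open>d\<close> obeys a Leibniz rule and is not linear over \<open>P\<close>. The rows
  are therefore contracted separately.\<close>

locale hopf_module_complex = hopf k P \<Delta> \<epsilon> S
  for k :: "('k, 'z) ring_scheme" and P :: "('k, 'p) module"
    and \<Delta> :: "'p \<Rightarrow> ('p list \<times> 'p \<Rightarrow> 'k) set" and \<epsilon> :: "'p \<Rightarrow> 'k" and S :: "'p \<Rightarrow> 'p" +
  fixes Om :: "int \<Rightarrow> ('k, 'f) module" and \<rho> :: "int \<Rightarrow> 'f \<Rightarrow> ('p list \<times> 'f \<Rightarrow> 'k) set"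
    and act :: "int \<Rightarrow> 'p \<Rightarrow> 'f \<Rightarrow> 'f" and d :: "int \<Rightarrow> 'f \<Rightarrow> 'f"
  assumes Om: "comodule (Om j) (\<rho> j)"
    and Om_neg: "j < 0 \<Longrightarrow> carrier (Om j) = {\<zero>\<^bsub>Om j\<^esub>}"
    and Om_module: "0 \<le> j \<Longrightarrow> hopf_module k P \<Delta> \<epsilon> S (Om j) (\<rho> j) (act j)"
    and d_colin: "colin (Om j) (\<rho> j) (Om (j + 1)) (\<rho> (j + 1)) (d j)"
    and d_d: "x \<in> carrier (Om j) \<Longrightarrow> d (j + 1) (d j x) = \<zero>\<^bsub>Om (j + 1 + 1)\<^esub>"
begin

lemma d_colin': "colin (Om (j - 1)) (\<rho> (j - 1)) (Om j) (\<rho> j) (d (j - 1))"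
  using d_colin[of "j - 1"] by simp

lemma d_d': "x \<in> carrier (Om (j - 1)) \<Longrightarrow> d j (d (j - 1) x) = \<zero>\<^bsub>Om (j + 1)\<^esub>"
  using d_d[of x "j - 1"] by simp

sublocale cx: comodule_complex k P \<Delta> \<epsilon> S "Om (j - 1)" "\<rho> (j - 1)" "d (j - 1)" "Om j" "\<rho> j" "Om (j + 1)" "\<rho> (j + 1)" "d j"
  for j
  by (intro comodule_complex.intro comodule_complex_axioms.intro hopf_axioms Om d_colin d_colin' d_d')

abbreviation C where "C i j \<equiv> cc (Om j) (\<rho> j) i"

text \<open>The sign (-1)^i of the column makes the differentials anticommute.\<close>

definition dv where
  "dv i j x = alt_sign k (nat i) \<odot>\<^bsub>TP (Suc (nat i)) (Om (j + 1))\<^esub> pms (Suc (nat i)) (Om j) (Om (j + 1)) (d j) x"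

abbreviation I where "I n \<equiv> (Om (int n))\<lparr>carrier := coinv (Om (int n)) (\<rho> (int n))\<rparr>"

text \<open>The augmentation: w goes to the tensor of 1 with w.\<close>

definition \<iota> where "\<iota> n w = dr (Om (int n)) 0 (nil (Om (int n)) w)"

lemma Om_VS: "VS (Om j)" by (rule F_VS[OF Om])

lemma TO_VS: "VS (TP n (Om j))" by (rule TP_VS'[OF Om_VS])

lemma dl: "lin (Om j) (Om (j + 1)) (d j)" by (rule colin_lin[OF d_colin])

lemma dv_lin: "lin (C i j) (C i (j + 1)) (dv i j)"
proof -
  have "lin (C i j) (C i (j + 1)) (\<lambda>x. alt_sign k (nat i) \<odot>\<^bsub>C i (j + 1)\<^esub> pms (Suc (nat i)) (Om j) (Om (j + 1)) (d j) x)"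
    by (rule lin_smultf[OF alt_sign_closed pms_cc_lin[OF Om Om d_colin]])
  then show ?thesis unfolding dv_def[abs_def] by simp
qed

lemma zero_ccs: "\<zero>\<^bsub>TP (Suc (nat i)) (Om j)\<^esub> \<in> ccs (Om j) (\<rho> j) i"
  by (rule sub_zero[OF ccs_sub[OF Om]])

lemma dv_zero: "dv i j \<zero>\<^bsub>TP (Suc (nat i)) (Om j)\<^esub> = \<zero>\<^bsub>TP (Suc (nat i)) (Om (j + 1))\<^esub>"
proof -
  have "dv i j \<zero>\<^bsub>C i j\<^esub> = \<zero>\<^bsub>C i (j + 1)\<^esub>" by (rule lin_zero[OF dv_lin])
  then show ?thesis by simp
qed

lemma dd_zero: "dd (Om j) i \<zero>\<^bsub>TP (Suc (nat i)) (Om j)\<^esub> = \<zero>\<^bsub>TP (Suc (nat (i + 1))) (Om j)\<^esub>"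
proof -
  have "dd (Om j) i \<zero>\<^bsub>C i j\<^esub> = \<zero>\<^bsub>C (i + 1) j\<^esub>" by (rule lin_zero[OF dd_lin[OF Om]])
  then show ?thesis by simp
qed

lemma dv_zero_iff:
  assumes x: "x \<in> ccs (Om j) (\<rho> j) i"
  shows "dv i j x = \<zero>\<^bsub>TP (Suc (nat i)) (Om (j + 1))\<^esub> \<longleftrightarrow>
    pms (Suc (nat i)) (Om j) (Om (j + 1)) (d j) x = \<zero>\<^bsub>TP (Suc (nat i)) (Om (j + 1))\<^esub>"
  unfolding dv_def by (rule sign_zero_iff[OF TO_VS lin_closed[OF pms_lin[OF dl] ccs_carrier[OF Om x]]])

lemma dv_dv:
  assumes x: "x \<in> ccs (Om j) (\<rho> j) i"
  shows "dv i (j + 1) (dv i j x) = \<zero>\<^bsub>TP (Suc (nat i)) (Om (j + 1 + 1))\<^esub>"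
proof -
  let ?n = "Suc (nat i)"
  have xc: "x \<in> carrier (TP ?n (Om j))" by (rule ccs_carrier[OF Om x])
  have "pms ?n (Om (j + 1)) (Om (j + 1 + 1)) (d (j + 1)) (pms ?n (Om j) (Om (j + 1)) (d j) x) =
    pms ?n (Om j) (Om (j + 1 + 1)) (\<lambda>x. d (j + 1) (d j x)) x" by (rule pm_comp[OF PP dl dl xc])
  also have "\<dots> = pms ?n (Om j) (Om (j + 1 + 1)) (\<lambda>x. \<zero>\<^bsub>Om (j + 1 + 1)\<^esub>) x"
    by (rule pm_cong[OF PP lin_comp[OF dl dl] d_d xc])
  also have "\<dots> = \<zero>\<^bsub>TP ?n (Om (j + 1 + 1))\<^esub>" by (rule pm_zero[OF PP Om_VS Om_VS xc])
  finally have "pms ?n (Om (j + 1)) (Om (j + 1 + 1)) (d (j + 1)) (pms ?n (Om j) (Om (j + 1)) (d j) x) = \<zero>\<^bsub>TP ?n (Om (j + 1 + 1))\<^esub>" .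
  then show ?thesis
    unfolding dv_def lin_smult[OF pms_lin[OF dl] alt_sign_closed lin_closed[OF pms_lin[OF dl] xc]]
    by (simp only: vs_smult_zero(1)[OF TO_VS alt_sign_closed])
qed

lemma anticommute:
  assumes x: "x \<in> ccs (Om j) (\<rho> j) i"
  shows "dd (Om (j + 1)) i (dv i j x) \<oplus>\<^bsub>TP (Suc (nat (i + 1))) (Om (j + 1))\<^esub> dv (i + 1) j (dd (Om j) i x) =
    \<zero>\<^bsub>TP (Suc (nat (i + 1))) (Om (j + 1))\<^esub>"
proof (cases i rule: int_cases_neg)
  case neg
  then have x0: "x = \<zero>\<^bsub>TP (Suc (nat i)) (Om j)\<^esub>" using x ccs_neg by fastforce
  show ?thesis unfolding x0 dv_zero dd_zero by (rule vs_add_zero(1)[OF TO_VS vs_zero[OF TO_VS]])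
next
  case (nonneg n)
  let ?y = "dr (Om (j + 1)) (Suc n) (pms (Suc n) (Om j) (Om (j + 1)) (d j) x)"
  have xc: "x \<in> carrier (TP (Suc n) (Om j))" using ccs_carrier[OF Om x] nonneg by simp
  have px: "pms (Suc n) (Om j) (Om (j + 1)) (d j) x \<in> carrier (TP (Suc n) (Om (j + 1)))" by (rule lin_closed[OF pms_lin[OF dl] xc])
  have "dd (Om (j + 1)) i (dv i j x) = alt_sign k n \<odot>\<^bsub>TP (Suc (Suc n)) (Om (j + 1))\<^esub> ?y"
    unfolding nonneg dd_int dv_def nat_int by (rule lin_smult[OF dr_lin[OF Om_VS] alt_sign_closed px])
  moreover have "dv (i + 1) j (dd (Om j) i x) = alt_sign k (Suc n) \<odot>\<^bsub>TP (Suc (Suc n)) (Om (j + 1))\<^esub> ?y"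
    unfolding nonneg dd_int dv_def nat_int_Suc pms_dr[OF dl xc] ..
  ultimately show ?thesis
    unfolding nonneg nat_int_Suc using sign_Suc_cancel[OF TO_VS dr_closed[OF Om_VS px]] by (simp only:)
qed

lemma Om_zero: "j < 0 \<Longrightarrow> x \<in> carrier (TP n (Om j)) \<Longrightarrow> x = \<zero>\<^bsub>TP n (Om j)\<^esub>"
  by (rule TP_zero[OF Om_VS Om_neg])

lemma pr_ccs:
  assumes x: "x \<in> ccs (Om j) (\<rho> j) i" and dx: "dv i j x = \<zero>\<^bsub>TP (Suc (nat i)) (Om (j + 1))\<^esub>"
  shows "cx.pr j (nat i) x \<in> ccs (cx.H j) (cx.\<kappa> j) i"
proof (cases i rule: int_cases_neg)
  case neg
  then have "x = \<zero>\<^bsub>TP (Suc (nat i)) (Om j)\<^esub>" using x ccs_neg by fastforce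
  then show ?thesis using lin_zero[OF cx.pr_lin] sub_zero[OF ccs_sub[OF cx.H_comodule]] by simp
next
  case (nonneg n)
  have dx': "pms (Suc n) (Om j) (Om (j + 1)) (d j) x = \<zero>\<^bsub>TP (Suc n) (Om (j + 1))\<^esub>"
    using iffD1[OF dv_zero_iff[OF x] dx] unfolding nonneg nat_int .
  show ?thesis using cx.pr_coinv[OF _ dx'] x unfolding nonneg nat_int ccs_int .
qed

text \<open>Reduces to \<open>cx.pr_ker\<close>: the sign in \<open>dv\<close> squares to 1 and can
  be absorbed into w.\<close>

lemma pr_ker:
  assumes x: "x \<in> ccs (Om j) (\<rho> j) i" and dx: "dv i j x = \<zero>\<^bsub>TP (Suc (nat i)) (Om (j + 1))\<^esub>"
  shows "cx.pr j (nat i) x = \<zero>\<^bsub>TP (Suc (nat i)) (cx.H j)\<^esub> \<longleftrightarrow>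
    (\<exists>w\<in>ccs (Om (j - 1)) (\<rho> (j - 1)) i. x = dv i (j - 1) w)"
proof (cases i rule: int_cases_neg)
  case neg
  then have x0: "x = \<zero>\<^bsub>TP (Suc (nat i)) (Om j)\<^esub>" using x ccs_neg by fastforce
  have "cx.pr j (nat i) x = \<zero>\<^bsub>TP (Suc (nat i)) (cx.H j)\<^esub>" unfolding x0 by (rule lin_zero[OF cx.pr_lin])
  moreover have "x = dv i (j - 1) \<zero>\<^bsub>TP (Suc (nat i)) (Om (j - 1))\<^esub>" unfolding x0 using dv_zero[of i "j - 1"] by simp
  ultimately show ?thesis using zero_ccs by blast
next
  case (nonneg n)
  let ?D = "pms (Suc n) (Om (j - 1)) (Om j) (d (j - 1))"
  let ?s = "\<lambda>w. alt_sign k n \<odot>\<^bsub>TP (Suc n) (Om (j - 1))\<^esub> w"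
  note dl' = colin_lin[OF d_colin']
  have dx': "pms (Suc n) (Om j) (Om (j + 1)) (d j) x = \<zero>\<^bsub>TP (Suc n) (Om (j + 1))\<^esub>"
    using iffD1[OF dv_zero_iff[OF x] dx] unfolding nonneg nat_int .
  have xc: "x \<in> coinv (TP (Suc n) (Om j)) (cd (Om j) (\<rho> j) (Suc n))" using x unfolding nonneg ccs_int .
  have sub: "sub (ccs (Om (j - 1)) (\<rho> (j - 1)) (int n)) (TP (Suc n) (Om (j - 1)))" 
    by (rule ccs_sub[OF Om, of _ "int n", unfolded nat_int])
  have D: "dv (int n) (j - 1) w = ?D (?s w)" if w: "w \<in> ccs (Om (j - 1)) (\<rho> (j - 1)) (int n)" for w
    using lin_smult[OF pms_lin[OF dl'] alt_sign_closed sub_carrier[OF sub w], of n] by (simp add: dv_def)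
  have "(\<exists>w\<in>ccs (Om (j - 1)) (\<rho> (j - 1)) (int n). x = ?D w) \<longleftrightarrow> (\<exists>w\<in>ccs (Om (j - 1)) (\<rho> (j - 1)) (int n). x = dv (int n) (j - 1) w)"
  proof
    assume "\<exists>w\<in>ccs (Om (j - 1)) (\<rho> (j - 1)) (int n). x = ?D w"
    then obtain w where w: "w \<in> ccs (Om (j - 1)) (\<rho> (j - 1)) (int n)" "x = ?D w" by blast
    have "x = dv (int n) (j - 1) (?s w)"
      unfolding D[OF sub_smult[OF sub alt_sign_closed w(1)]] sign_sign[OF TO_VS sub_carrier[OF sub w(1)]] by (rule w(2))
    then show "\<exists>w\<in>ccs (Om (j - 1)) (\<rho> (j - 1)) (int n). x = dv (int n) (j - 1) w"
      using sub_smult[OF sub alt_sign_closed w(1)] by blast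
  next
    assume "\<exists>w\<in>ccs (Om (j - 1)) (\<rho> (j - 1)) (int n). x = dv (int n) (j - 1) w"
    then obtain w where w: "w \<in> ccs (Om (j - 1)) (\<rho> (j - 1)) (int n)" "x = dv (int n) (j - 1) w" by blast
    then show "\<exists>w\<in>ccs (Om (j - 1)) (\<rho> (j - 1)) (int n). x = ?D w"
      using sub_smult[OF sub alt_sign_closed w(1)] D[OF w(1)] by metis
  qed
  then show ?thesis using cx.pr_ker[OF xc dx'] unfolding nonneg nat_int ccs_int by (simp only:)
qed

lemma pr_surj: "ccs (cx.H j) (cx.\<kappa> j) i \<subseteq>
    cx.pr j (nat i) ` {x \<in> ccs (Om j) (\<rho> j) i. dv i j x = \<zero>\<^bsub>TP (Suc (nat i)) (Om (j + 1))\<^esub>}"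
proof
  fix v assume v: "v \<in> ccs (cx.H j) (cx.\<kappa> j) i"
  have "\<exists>x\<in>ccs (Om j) (\<rho> j) i. dv i j x = \<zero>\<^bsub>TP (Suc (nat i)) (Om (j + 1))\<^esub> \<and> cx.pr j (nat i) x = v"
  proof (cases i rule: int_cases_neg)
    case neg
    then have "v = \<zero>\<^bsub>TP (Suc (nat i)) (cx.H j)\<^esub>" using v ccs_neg by fastforce
    moreover have "cx.pr j (nat i) \<zero>\<^bsub>TP (Suc (nat i)) (Om j)\<^esub> = \<zero>\<^bsub>TP (Suc (nat i)) (cx.H j)\<^esub>" by (rule lin_zero[OF cx.pr_lin])
    ultimately show ?thesis using dv_zero zero_ccs by blast
  next
    case (nonneg n)
    have vc: "v \<in> coinv (TP (Suc n) (cx.H j)) (cd (cx.H j) (cx.\<kappa> j) (Suc n))" using v unfolding nonneg ccs_int .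
    obtain x where x: "x \<in> coinv (TP (Suc n) (Om j)) (cd (Om j) (\<rho> j) (Suc n))"
      "pms (Suc n) (Om j) (Om (j + 1)) (d j) x = \<zero>\<^bsub>TP (Suc n) (Om (j + 1))\<^esub>" "cx.pr j n x = v"
      using cx.pr_surj[OF vc] by blast
    have xc: "x \<in> ccs (Om j) (\<rho> j) (int n)" using x(1) unfolding ccs_int .
    have "dv (int n) j x = \<zero>\<^bsub>TP (Suc n) (Om (j + 1))\<^esub>" using dv_zero_iff[OF xc] x(2) unfolding nat_int by blast
    then show ?thesis unfolding nonneg nat_int using xc x(3) by blast
  qed
  then show "v \<in> cx.pr j (nat i) ` {x \<in> ccs (Om j) (\<rho> j) i. dv i j x = \<zero>\<^bsub>TP (Suc (nat i)) (Om (j + 1))\<^esub>}" by blast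
qed

lemma pr_dd:
  assumes x: "x \<in> ccs (Om j) (\<rho> j) i"
  shows "cx.pr j (nat (i + 1)) (dd (Om j) i x) = dd (cx.H j) i (cx.pr j (nat i) x)"
proof (cases i rule: int_cases_neg)
  case neg
  then have "nat (i + 1) = 0" by simp
  moreover have "cx.pr j 0 \<zero>\<^bsub>TP (Suc 0) (Om j)\<^esub> = \<zero>\<^bsub>TP (Suc 0) (cx.H j)\<^esub>" by (rule lin_zero[OF cx.pr_lin])
  ultimately show ?thesis using neg by (simp add: dd_def)
next
  case (nonneg n)
  have xc: "x \<in> carrier (TP (Suc n) (Om j))" using ccs_carrier[OF Om x] nonneg by simp
  show ?thesis unfolding nonneg nat_int_Suc nat_int dd_int by (rule cx.pr_dr[OF xc])
qed

lemma exact: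
  assumes x: "x \<in> ccs (Om j) (\<rho> j) i" and i: "1 \<le> i" and dx: "dd (Om j) i x = \<zero>\<^bsub>TP (Suc (nat (i + 1))) (Om j)\<^esub>"
  shows "\<exists>y\<in>ccs (Om j) (\<rho> j) (i - 1). x = dd (Om j) (i - 1) y"
\<comment> \<open>In negative degrees everything is zero; the Hopf module structure is at hand from
  degree 0 on.\<close>
proof (cases "j < 0")
  case True
  have "x = \<zero>\<^bsub>TP (Suc (nat i)) (Om j)\<^esub>" by (rule Om_zero[OF True ccs_carrier[OF Om x]])
  moreover have "dd (Om j) (i - 1) \<zero>\<^bsub>TP (Suc (nat (i - 1))) (Om j)\<^esub> = \<zero>\<^bsub>TP (Suc (nat i)) (Om j)\<^esub>"
    using dd_zero[of j "i - 1"] by simp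
  ultimately show ?thesis using zero_ccs[of "i - 1" j] by (intro bexI[of _ "\<zero>\<^bsub>TP (Suc (nat (i - 1))) (Om j)\<^esub>"]) simp_all
next
  case False
  define n where "n = nat (i - 1)"
  have n: "i = int n + 1" "i - 1 = int n" using i by (simp_all add: n_def)
  interpret M: hopf_module k P \<Delta> \<epsilon> S "Om j" "\<rho> j" "act j" by (rule Om_module) (use False in simp)
  have "nat (int n + 1 + 1) = Suc (Suc n)" by simp
  then have "dr (Om j) (Suc (Suc n)) x = \<zero>\<^bsub>TP (Suc (Suc (Suc n))) (Om j)\<^esub>" using dx unfolding n(1) dd_int_Suc by (simp only:)
  moreover have "x \<in> coinv (TP (Suc (Suc n)) (Om j)) (cd (Om j) (\<rho> j) (Suc (Suc n)))" using x unfolding n(1) ccs_int_Suc .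
  ultimately show ?thesis unfolding n(2) ccs_int dd_int by (rule M.row_exact[rotated])
qed

lemma nl: "lin (Om j) (TP 0 (Om j)) (nil (Om j))" using nil_lin[OF Om_VS] by simp

lemma nil_coinv: "colin (Om j) (\<rho> j) (TP 0 (Om j)) (cd (Om j) (\<rho> j) 0) (nil (Om j))"
  using nil_colin[OF Om] by simp

lemma iota_coinv: "w \<in> coinv (Om (int n)) (\<rho> (int n)) \<Longrightarrow> \<iota> n w \<in> ccs (Om (int n)) (\<rho> (int n)) 0"
  unfolding \<iota>_def ccs_0 by (rule colin_coinv[OF dr_colin[OF Om] colin_coinv[OF nil_coinv]])

lemma I_sub: "sub (coinv (Om (int n)) (\<rho> (int n))) (Om (int n))" by (rule coinv_sub[OF rho_lin[OF Om]])

lemma iota_lin: "lin (I n) (C 0 (int n)) (\<iota> n)"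
proof -
  have sub: "sub (ccs (Om (int n)) (\<rho> (int n)) 0) (TP (Suc 0) (Om (int n)))" 
    by (rule ccs_sub[OF Om, of _ 0, simplified])
  have l: "lin (I n) (TP (Suc 0) (Om (int n))) (\<iota> n)"
    unfolding \<iota>_def[abs_def] by (rule lin_restrict[OF lin_comp[OF dr_lin[OF Om_VS] nl] I_sub])
  have "lin (I n) ((TP (Suc 0) (Om (int n)))\<lparr>carrier := ccs (Om (int n)) (\<rho> (int n)) 0\<rparr>) (\<iota> n)"
    by (rule lin_corestrict[OF l sub]) (use iota_coinv in simp)
  then show ?thesis by simp
qed

text \<open>The contraction \<open>hm 0\<close> undoes the augmentation, by the unit law of the
  action.\<close>

lemma iota_inj:
  assumes w: "w \<in> carrier (Om (int n))" and 0: "\<iota> n w = \<zero>\<^bsub>TP (Suc 0) (Om (int n))\<^esub>"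
  shows "w = \<zero>\<^bsub>Om (int n)\<^esub>"
proof -
  interpret M: hopf_module k P \<Delta> \<epsilon> S "Om (int n)" "\<rho> (int n)" "act (int n)" by (rule Om_module) simp
  have "M.hm 0 (\<iota> n w) = nil (Om (int n)) w"
    unfolding \<iota>_def dr.simps(1) M.hm_cns0[OF one_closed w] M.act_one[OF w] ..
  then have nz: "nil (Om (int n)) w = \<zero>\<^bsub>TP 0 (Om (int n))\<^esub>" unfolding 0 lin_zero[OF M.hm_lin] by (rule sym)
  show ?thesis
    using arg_cong[OF nz, of "unl (Om (int n))"] unfolding unl_nil[OF Om_VS w] lin_zero[OF M.unl0] .
qed

text \<open>Exactness of the augmented row in column zero. It yields a coinvariant of the zeroth
  tensor power; as \<open>nil\<close> is a split colinear map, the underlying form is coinvariant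
  too.\<close>

lemma iota_image:
  assumes x: "x \<in> ccs (Om (int n)) (\<rho> (int n)) 0"
  shows "dd (Om (int n)) 0 x = \<zero>\<^bsub>TP (Suc (Suc 0)) (Om (int n))\<^esub> \<longleftrightarrow> (\<exists>w\<in>coinv (Om (int n)) (\<rho> (int n)). x = \<iota> n w)"
proof -
  interpret M: hopf_module k P \<Delta> \<epsilon> S "Om (int n)" "\<rho> (int n)" "act (int n)" by (rule Om_module) simp
  have xc: "x \<in> coinv (TP (Suc 0) (Om (int n))) (cd (Om (int n)) (\<rho> (int n)) (Suc 0))" using x unfolding ccs_0 .
  show ?thesis
    unfolding dd_0
  proof
    assume 0: "dr (Om (int n)) (Suc 0) x = \<zero>\<^bsub>TP (Suc (Suc 0)) (Om (int n))\<^esub>"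
    obtain y where y: "y \<in> coinv (TP 0 (Om (int n))) (cd (Om (int n)) (\<rho> (int n)) 0)" "x = dr (Om (int n)) 0 y"
      using M.row_exact[OF xc 0] by blast
    have "y \<in> carrier (tensor k [] (Om (int n)))" using y(1) by (simp add: coinv_def)
    then obtain w where w: "w \<in> carrier (Om (int n))" "y = nil (Om (int n)) w" using nil_surj[OF Om_VS] by blast
    have "w \<in> coinv (Om (int n)) (\<rho> (int n))"
      by (rule coinv_inject[OF nil_coinv rho_lin[OF Om] M.unl0 unl_nil[OF Om_VS] w(1)]) (use y(1) w(2) in simp_all)
    then show "\<exists>w\<in>coinv (Om (int n)) (\<rho> (int n)). x = \<iota> n w" unfolding \<iota>_def y(2) w(2) by blast
  next
    assume "\<exists>w\<in>coinv (Om (int n)) (\<rho> (int n)). x = \<iota> n w"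
    then obtain w where w: "w \<in> coinv (Om (int n)) (\<rho> (int n))" "x = \<iota> n w" by blast
    have wc: "w \<in> carrier (Om (int n))" using w(1) by (simp add: coinv_def)
    show "dr (Om (int n)) (Suc 0) x = \<zero>\<^bsub>TP (Suc (Suc 0)) (Om (int n))\<^esub>"
      unfolding w(2) \<iota>_def by (rule dr_dr[OF Om_VS lin_closed[OF nl wc]])
  qed
qed

lemma iota_d:
  assumes w: "w \<in> carrier (Om (int n))"
  shows "dv 0 (int n) (\<iota> n w) = \<iota> (Suc n) (d (int n) w)"
proof -
  have n: "int (Suc n) = int n + 1" by simp
  have c: "nil (Om (int n)) w \<in> carrier (TP 0 (Om (int n)))" by (rule lin_closed[OF nl w])
  have pn: "pms 0 (Om (int n)) (Om (int n + 1)) (d (int n)) (nil (Om (int n)) w) = nil (Om (int n + 1)) (d (int n) w)"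
    using pm_nil[OF dl w] by simp
  have "nil (Om (int n + 1)) (d (int n) w) \<in> carrier (TP 0 (Om (int n + 1)))" by (rule lin_closed[OF nl lin_closed[OF dl w]])
  note e = vs_smult_one[OF TO_VS dr_closed[OF Om_VS this]]
  show ?thesis
    unfolding n \<iota>_def dv_def
    using pms_dr[OF dl c] e pn by (simp add: alt_sign_0 del: dr.simps)
qed

lemma double: "double_complex k C (\<lambda>i j. dd (Om j) i) dv (\<lambda>i j. cc (cx.H j) (cx.\<kappa> j) i) (\<lambda>i j. dd (cx.H j) i)
    (\<lambda>i j. cx.pr j (nat i)) I (\<lambda>n. d (int n)) \<iota>"
proof (intro double_complex.intro ground_field_axioms, rule double_complex_axioms.intro)
  fix i j
  show "lin (C i j) (C (i + 1) j) (dd (Om j) i)" by (rule dd_lin[OF Om])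
  show "lin (C i j) (C i (j + 1)) (dv i j)" by (rule dv_lin)
  show "carrier (C i j) = {\<zero>\<^bsub>C i j\<^esub>}" if n: "i < 0 \<or> j < 0"
  proof -
    have "ccs (Om j) (\<rho> j) i = {\<zero>\<^bsub>TP (Suc (nat i)) (Om j)\<^esub>}"
      using n
    proof
      assume "j < 0"
      from Om_zero[OF this ccs_carrier[OF Om]] sub_zero[OF ccs_sub[OF Om]] show ?thesis by blast
    qed (rule ccs_neg)
    then show ?thesis by simp
  qed
  show "lin (cc (cx.H j) (cx.\<kappa> j) i) (cc (cx.H j) (cx.\<kappa> j) (i + 1)) (dd (cx.H j) i)" by (rule dd_lin[OF cx.H_comodule])
  show "lin ((C i j)\<lparr>carrier := {x \<in> carrier (C i j). dv i j x = \<zero>\<^bsub>C i (j + 1)\<^esub>}\<rparr>) (cc (cx.H j) (cx.\<kappa> j) i) (cx.pr j (nat i))"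
    by (rule lin_corestrict[OF lin_comp[OF cx.pr_lin lin_restrict[OF cc_incl[OF Om] sub_kernel[OF dv_lin]]] ccs_sub[OF cx.H_comodule]])
      (use pr_ccs in simp)
  show "carrier (cc (cx.H j) (cx.\<kappa> j) i) \<subseteq> cx.pr j (nat i) ` {x \<in> carrier (C i j). dv i j x = \<zero>\<^bsub>C i (j + 1)\<^esub>}"
    using pr_surj by simp
  fix x assume "x \<in> carrier (C i j)"
  then have x: "x \<in> ccs (Om j) (\<rho> j) i" by simp
  show "dd (Om j) (i + 1) (dd (Om j) i x) = \<zero>\<^bsub>C (i + 1 + 1) j\<^esub>" using dd_dd[OF Om x] by simp
  show "dv i (j + 1) (dv i j x) = \<zero>\<^bsub>C i (j + 1 + 1)\<^esub>" using dv_dv[OF x] by simp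
  show "dd (Om (j + 1)) i (dv i j x) \<oplus>\<^bsub>C (i + 1) (j + 1)\<^esub> dv (i + 1) j (dd (Om j) i x) = \<zero>\<^bsub>C (i + 1) (j + 1)\<^esub>"
    using anticommute[OF x] by simp
  show "\<exists>y\<in>carrier (C (i - 1) j). x = dd (Om j) (i - 1) y" if "1 \<le> i" "dd (Om j) i x = \<zero>\<^bsub>C (i + 1) j\<^esub>"
    using exact[OF x that(1)] that(2) by simp
  assume "dv i j x = \<zero>\<^bsub>C i (j + 1)\<^esub>"
  then have dx: "dv i j x = \<zero>\<^bsub>TP (Suc (nat i)) (Om (j + 1))\<^esub>" by simp
  show "cx.pr j (nat i) x = \<zero>\<^bsub>cc (cx.H j) (cx.\<kappa> j) i\<^esub> \<longleftrightarrow> (\<exists>w\<in>carrier (C i (j - 1)). x = dv i (j - 1) w)"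
    using pr_ker[OF x dx] by simp
  show "cx.pr j (nat (i + 1)) (dd (Om j) i x) = dd (cx.H j) i (cx.pr j (nat i) x)" by (rule pr_dd[OF x])
next
  fix n
  show "lin (I n) (I (Suc n)) (d (int n))"
  proof -
    have "lin (I n) ((Om (int n + 1))\<lparr>carrier := coinv (Om (int n + 1)) (\<rho> (int n + 1))\<rparr>) (d (int n))"
      by (rule lin_corestrict[OF lin_restrict[OF dl I_sub] coinv_sub[OF rho_lin[OF Om]]])
        (use colin_coinv[OF d_colin] in simp)
    then show ?thesis by (simp add: add.commute)
  qed
  show "lin (I n) (C 0 (int n)) (\<iota> n)" by (rule iota_lin)
  show "w = \<zero>\<^bsub>I n\<^esub>" if "w \<in> carrier (I n)" "\<iota> n w = \<zero>\<^bsub>C 0 (int n)\<^esub>" for w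
    using iota_inj[of w n] that by (simp add: coinv_def)
  show "dd (Om (int n)) 0 x = \<zero>\<^bsub>C 1 (int n)\<^esub> \<longleftrightarrow> (\<exists>w\<in>carrier (I n). x = \<iota> n w)" if "x \<in> carrier (C 0 (int n))" for x
    using iota_image[of x n] that by simp
  show "dv 0 (int n) (\<iota> n w) = \<iota> (Suc n) (d (int n) w)" if "w \<in> carrier (I n)" for w
    by (rule iota_d) (use that in \<open>simp add: coinv_def\<close>)
qed

theorem spectral:
  "\<exists>E D. spectral_sequence k E D \<and>
    (\<forall>n m. E 2 (int n) m = hopf_cohomology k P \<Delta> (cx.H m) (cx.\<kappa> m) n) \<and>
    converges_to k E (cohomology I (\<lambda>n. d (int n)))"
proof -
  obtain E D where "spectral_sequence k E D"
    and 2: "\<And>i j. E 2 i j = quot_module ((cc (cx.H j) (cx.\<kappa> j) i)\<lparr>carrier := {v \<in> carrier (cc (cx.H j) (cx.\<kappa> j) i).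
        dd (cx.H j) i v = \<zero>\<^bsub>cc (cx.H j) (cx.\<kappa> j) (i + 1)\<^esub>}\<rparr>)
      (dd (cx.H j) (i - 1) ` carrier (cc (cx.H j) (cx.\<kappa> j) (i - 1)))"
    and "converges_to k E (cohomology I (\<lambda>n. d (int n)))"
    using double_complex.spectral[OF double] by (elim exE conjE) (rule that; simp only:)
  moreover have "E 2 (int n) m = hopf_cohomology k P \<Delta> (cx.H m) (cx.\<kappa> m) n" for n m
    unfolding 2 by (rule hopf_cohomology_eq[OF cx.H_comodule])
  ultimately show ?thesis by blast
qed

end

section \<open>The forms of a bicovariant calculus as Hopf modules\<close>

locale bicovariant_hopf = hopf k P \<Delta> \<epsilon> S + bicovariant_calculus k P \<Delta> \<epsilon> W \<Omega> d coL coR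
  for k :: "('k, 'z) ring_scheme" and P :: "('k, 'w) module"
    and \<Delta> :: "'w \<Rightarrow> ('w list \<times> 'w \<Rightarrow> 'k) set" and \<epsilon> :: "'w \<Rightarrow> 'k" and S :: "'w \<Rightarrow> 'w"
    and W :: "('k, 'w) module" and \<Omega> :: "nat \<Rightarrow> 'w set" and d :: "'w \<Rightarrow> 'w"
    and coL coR :: "nat \<Rightarrow> 'w \<Rightarrow> ('w list \<times> 'w \<Rightarrow> 'k) set"
begin

abbreviation Fm where "Fm n \<equiv> forms W \<Omega> n"

lemmas W_algebra = differential_calculus.algebra[OF calculus]

lemma W_VS: "VS W" by (rule k_algebra.vectorspace[OF W_algebra])

lemma O_sub: "sub (\<Omega> n) W" by (rule differential_calculus.subspace[OF calculus])

lemma O_VS: "VS (Fm n)" by (rule sub_VS[OF O_sub])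

text \<open>An equality of records, so \<open>P\<close> shares all operations with \<open>W\<close>
  and its product acts on forms directly.\<close>

lemma P_def: "P = Fm 0" by (rule differential_calculus.degree_zero[OF calculus, symmetric])

lemma P_simps: "carrier P = \<Omega> 0" "mult P = mult W" "one P = one W" "add P = add W" "smult P = smult W"
  by (subst P_def, simp)+

lemma d_lin: "lin (Fm n) (Fm (Suc n)) d"
  by (rule lin_corestrict[OF lin_restrict[OF differential_calculus.d_linear[OF calculus] O_sub] O_sub])
    (simp add: differential_calculus.d_degree[OF calculus])

lemma d_colin: "colin (Fm n) (coL n) (Fm (Suc n)) (coL (Suc n)) d"
  unfolding colin_def using d_lin left_d by simp

lemma mult_bilin': "bilin P (Fm n) (Fm n) (\<lambda>p w. p \<otimes>\<^bsub>W\<^esub> w)"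
proof -
  interpret ring W by (rule k_algebra.ring[OF W_algebra])
  have c: "p \<otimes>\<^bsub>W\<^esub> w \<in> \<Omega> n" if "p \<in> \<Omega> 0" "w \<in> \<Omega> n" for p w
    using differential_calculus.mult_degree[OF calculus that] by simp
  note W = sub_carrier[OF O_sub]
  show ?thesis
    by (rule bilinI[OF P_VS O_VS O_VS]; rule linI[OF _ O_VS])
      (simp_all add: P_VS O_VS P_simps c W l_distr r_distr
        k_algebra.smult_assoc_left[OF W_algebra] k_algebra.smult_assoc_right[OF W_algebra])
qed

text \<open>The compatibility of action and coaction is the multiplicativity of \<open>coL\<close>
  for a 0-form times an n-form, together with \<open>coL 0\<close> being
  \<open>\<Delta>\<close>.\<close>

lemma O_module: "hopf_module k P \<Delta> \<epsilon> S (Fm n) (coL n) (\<lambda>p w. p \<otimes>\<^bsub>W\<^esub> w)"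
proof (intro hopf_module.intro hopf_module_axioms.intro hopf_axioms left mult_bilin')
  interpret ring W by (rule k_algebra.ring[OF W_algebra])
  fix w assume "w \<in> carrier (Fm n)"
  then have w: "w \<in> \<Omega> n" by simp
  show "\<one>\<^bsub>P\<^esub> \<otimes>\<^bsub>W\<^esub> w = w" unfolding P_simps by (rule l_one[OF sub_carrier[OF O_sub w]])
  fix p assume p: "p \<in> carrier P"
  then have "p \<in> \<Omega> 0" by (simp add: P_simps)
  from left_mult[OF this w]
  show "coL n (p \<otimes>\<^bsub>W\<^esub> w) = bd P P (T2 P (Fm n))
      (\<lambda>a b. bd P (Fm n) (T2 P (Fm n)) (\<lambda>c v. tp P (Fm n) (a \<otimes>\<^bsub>P\<^esub> c) (b \<otimes>\<^bsub>W\<^esub> v)) (coL n w)) (\<Delta> p)"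
    unfolding tensor_mult_def Let_def bd_def tp_def add_0_left left_zero[OF p] P_def[symmetric] by simp
qed

text \<open>Extension by zero to negative degrees, as a subspace of \<open>W\<close> so that the
  type does not change.\<close>

definition Om :: "int \<Rightarrow> ('k, 'w) module" where
  "Om j = (if j < 0 then W\<lparr>carrier := {\<zero>\<^bsub>W\<^esub>}\<rparr> else Fm (nat j))"

definition co :: "int \<Rightarrow> 'w \<Rightarrow> ('w list \<times> 'w \<Rightarrow> 'k) set" where
  "co j = (if j < 0 then (\<lambda>_. \<zero>\<^bsub>T2 P (W\<lparr>carrier := {\<zero>\<^bsub>W\<^esub>}\<rparr>)\<^esub>) else coL (nat j))"

lemma Om_int: "Om (int n) = Fm n" "Om (int n + 1) = Fm (Suc n)"
  by (simp_all add: Om_def nat_int_Suc)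

lemma co_int: "co (int n) = coL n" "co (int n + 1) = coL (Suc n)"
  by (simp_all add: co_def nat_int_Suc)

abbreviation W0 where "W0 \<equiv> W\<lparr>carrier := {\<zero>\<^bsub>W\<^esub>}\<rparr>"

lemma W0_VS: "VS W0" by (rule sub_VS[OF sub_zero_space[OF W_VS]])

lemma co0_lin: "lin W0 (T2 P W0) (\<lambda>_. \<zero>\<^bsub>T2 P W0\<^esub>)"
  by (rule lin_const_zero[OF W0_VS T2_VS[OF P_VS W0_VS]])

lemma W0_lin: "VS V \<Longrightarrow> f \<zero>\<^bsub>W\<^esub> = \<zero>\<^bsub>V\<^esub> \<Longrightarrow> lin W0 V f"
  by (rule lin_cong[OF lin_const_zero[OF W0_VS]]) simp_all

lemma W0_colin: "comodule V \<sigma> \<Longrightarrow> f \<zero>\<^bsub>W\<^esub> = \<zero>\<^bsub>V\<^esub> \<Longrightarrow> colin W0 (\<lambda>_. \<zero>\<^bsub>T2 P W0\<^esub>) V \<sigma> f"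
  unfolding colin_def
  using W0_lin[OF F_VS, of V \<sigma> f] lin_zero[OF rho_lin, of V \<sigma>] lin_zero[OF id_tensor_lin[OF P_VS W0_lin[OF F_VS]], of V \<sigma> f]
  by simp

text \<open>The zero space is a linear retract of the 0-forms, and its inclusion is
  colinear.\<close>

lemma W0_comodule: "comodule W0 (\<lambda>_. \<zero>\<^bsub>T2 P W0\<^esub>)"
proof (rule comodule_sub[OF left co0_lin W0_colin[OF left]])
  show "(\<lambda>x. x) \<zero>\<^bsub>W\<^esub> = \<zero>\<^bsub>Fm 0\<^esub>" by simp
  show "lin (Fm 0) W0 (\<lambda>_. \<zero>\<^bsub>W0\<^esub>)" by (rule lin_const_zero[OF O_VS W0_VS])
qed simp

lemma d_zero: "d \<zero>\<^bsub>W\<^esub> = \<zero>\<^bsub>W\<^esub>" by (rule lin_zero[OF differential_calculus.d_linear[OF calculus]])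

lemma Om_comodule: "comodule (Om j) (co j)"
  unfolding Om_def co_def using W0_comodule left by simp

lemma Om_zero [simp]: "\<zero>\<^bsub>Om j\<^esub> = \<zero>\<^bsub>W\<^esub>" by (simp add: Om_def)

sublocale complex: hopf_module_complex k P \<Delta> \<epsilon> S Om co "\<lambda>_ p w. p \<otimes>\<^bsub>W\<^esub> w" "\<lambda>_. d"
proof (intro hopf_module_complex.intro hopf_module_complex_axioms.intro hopf_axioms Om_comodule)
  fix j
  show "carrier (Om j) = {\<zero>\<^bsub>Om j\<^esub>}" if "j < 0" using that by (simp add: Om_def)
  show "hopf_module k P \<Delta> \<epsilon> S (Om j) (co j) (\<lambda>p w. p \<otimes>\<^bsub>W\<^esub> w)" if "0 \<le> j"
    using O_module[of "nat j"] that by (simp add: Om_def co_def)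
  show "colin (Om j) (co j) (Om (j + 1)) (co (j + 1)) d"
  proof (cases j rule: int_cases_neg)
    case neg
    then have "Om j = W0" "co j = (\<lambda>_. \<zero>\<^bsub>T2 P W0\<^esub>)" by (simp_all add: Om_def co_def)
    then show ?thesis using W0_colin[OF Om_comodule, of d "j + 1"] d_zero by simp
  next
    case (nonneg n)
    show ?thesis unfolding nonneg Om_int co_int by (rule d_colin)
  qed
  fix x assume "x \<in> carrier (Om j)"
  then have "x \<in> carrier W" using sub_carrier[OF O_sub] vs_zero[OF W_VS] by (auto simp: Om_def split: if_splits)
  then show "d (d x) = \<zero>\<^bsub>Om (j + 1 + 1)\<^esub>" using differential_calculus.d_d[OF calculus] by simp
qed

text \<open>In degree 0 the zero space in degree -1 has image {0}, in agreement with the convention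
  for coboundaries.\<close>

lemma boundaries: "d ` carrier (Om (int m - 1)) = coboundaries Fm (\<lambda>_. d) m"
proof (cases m)
  case 0
  then show ?thesis by (simp add: Om_def coboundaries_def d_zero)
next
  case (Suc n)
  then show ?thesis using Om_int(1)[of n] by (simp add: coboundaries_def)
qed

lemma de_Rham_eq: "complex.cx.H (int m) = de_Rham W \<Omega> d m"
  unfolding de_Rham_def cohomology_def cocycles_def boundaries Om_int by simp

lemma de_Rham_coaction_eq: "complex.cx.\<kappa> (int m) = de_Rham_coaction k P W \<Omega> d coL m"
proof
  fix c
  show "complex.cx.\<kappa> (int m) c = de_Rham_coaction k P W \<Omega> d coL m c"
    unfolding complex.cx.\<kappa>_def
    unfolding de_Rham_coaction_def Let_def de_Rham_def cohomology_def cocycles_def boundaries Om_int co_int by simp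
qed

lemma invariant_complex: "complex.I = invariant_forms k P W \<Omega> coL"
  unfolding Om_int co_int invariant_forms_def coinvariants_eq ..

lemma invariant_forms_spectral_sequence:
  "\<exists>E D. spectral_sequence k E D \<and>
    (\<forall>n m. E 2 (int n) (int m) =
      hopf_cohomology k P \<Delta> (de_Rham W \<Omega> d m) (de_Rham_coaction k P W \<Omega> d coL m) n) \<and>
    converges_to k E (cohomology (invariant_forms k P W \<Omega> coL) (\<lambda>_. d))"
proof -
  obtain E D where "spectral_sequence k E D"
    and 2: "\<forall>n m. E 2 (int n) m = hopf_cohomology k P \<Delta> (complex.cx.H m) (complex.cx.\<kappa> m) n"
    and "converges_to k E (cohomology complex.I (\<lambda>_. d))"
    using complex.spectral by blast
  moreover have "E 2 (int n) (int m) = hopf_cohomology k P \<Delta> (de_Rham W \<Omega> d m) (de_Rham_coaction k P W \<Omega> d coL m) n" for n m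
    using 2 unfolding de_Rham_eq[symmetric] de_Rham_coaction_eq[symmetric] by blast
  ultimately show ?thesis unfolding invariant_complex by blast
qed

end

theorem corollary6p4:
  fixes k :: "('k, 'z) ring_scheme" and P W :: "('k, 'w) module"
    and \<Delta> :: "'w \<Rightarrow> ('w list \<times> 'w \<Rightarrow> 'k) set" and \<epsilon> :: "'w \<Rightarrow> 'k" and S :: "'w \<Rightarrow> 'w"
    and \<Omega> :: "nat \<Rightarrow> 'w set" and d :: "'w \<Rightarrow> 'w"
    and coL coR :: "nat \<Rightarrow> 'w \<Rightarrow> ('w list \<times> 'w \<Rightarrow> 'k) set"
  assumes "field k"
    and "hopf_algebra k P \<Delta> \<epsilon> S"
    and "bicovariant_calculus k P \<Delta> \<epsilon> W \<Omega> d coL coR"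
  shows "\<exists>(E :: nat \<Rightarrow> int \<Rightarrow> int \<Rightarrow> ('k, ('w list \<times> 'w set \<Rightarrow> 'k) set set) module) D.
    spectral_sequence k E D \<and>
    (\<forall>n m. E 2 (int n) (int m) =
      hopf_cohomology k P \<Delta> (de_Rham W \<Omega> d m) (de_Rham_coaction k P W \<Omega> d coL m) n) \<and>
    converges_to k E (cohomology (invariant_forms k P W \<Omega> coL) (\<lambda>_. d))"
  by (rule bicovariant_hopf.invariant_forms_spectral_sequence
      [OF bicovariant_hopf.intro[OF hopf.intro[OF ground_field.intro[OF assms(1)] assms(2)] assms(3)]])

end
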